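(* Let $\mathcal{C}\subset\mathbb{P}^2$ be a reduced curve with $\mathcal{C}=\mathcal{C}'\cup L$ for some line $L\subset\mathbb{P}^2$, $L\not\subset\mathcal{C}'$, and let $d_2,d_3$ be integers. The following are equivalent: 1. $\mathcal{C}$ is free with exponents $\{d_2,d_3\}$. 2. After possibly interchanging $d_2$ and $d_3$, $\mathcal{C}'$ is either (i) free with exponents $(d_2,d_3-1)$ and $|\mathcal{C}'\cap L|+\epsilon(\mathcal{C}',L)=d_2+1$, or (ii) plus-one generated with exponents $(d_2,d_3)$ and level $d=\deg(\mathcal{C})-1-|\mathcal{C}'\cap L|-\epsilon(\mathcal{C}',L)$.
   Context: $S=\mathbb{C}[x,y,z]$ with standard grading. A reduced curve $\mathcal{C}\subset\mathbb{P}^2$ is given by a reduced homogeneous $f_{\mathcal{C}}\in S$. A derivation $\theta=\sum f_i\partial_i$ is homogeneous of degree $k$ if all $f_i$ are homogeneous of degree $k$; $\theta_E=x\partial_x+y\partial_y+z\partial_z$. $D(\mathcal{C})=\{\theta\in\mathrm{Der}(S):\theta(f_{\mathcal{C}})\in Sf_{\mathcal{C}}\}$, $D_0(\mathcal{C})=\{\theta:\theta(f_{\mathcal{C}})=0\}$, and $D(\mathcal{C})=D_0(\mathcal{C})\oplus S\theta_E$. $\mathcal{C}$ is free if $D_0(\mathcal{C})$ is a free $S$-module (necessarily of rank 2); its exponents are the degrees of a homogeneous basis of $D_0(\mathcal{C})$ (an unordered pair). $\mathcal{C}$ is plus-one generated if $D(\mathcal{C})$ has a minimal set of homogeneous generators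 $\{\theta_E,\theta_2,\theta_3,\psi\}$ with a unique relation $f_1\theta_E+f_2\theta_2+f_3\theta_3+\alpha\psi=0$, $f_i\in S$, $\deg\alpha=1$; exponents $(\deg\theta_2,\deg\theta_3)$, level $\deg\psi$. $\mathcal{E}_{\mathcal{C}}$ is the sheafification of $D_0(\mathcal{C})$ (a rank 2 vector bundle on $\mathbb{P}^2$). $|\mathcal{C}'\cap L|$ is the number of distinct points of $\mathcal{C}'\cap L$. For a reduced curve $\mathcal{C}'$ and a line $L\not\subset\mathcal{C}'$, $\epsilon(\mathcal{C}',L)\in\mathbb{Z}$ is the integer defined by A. Dimca, which measures the failure of the singularities of $\mathcal{C}'\cup L$ on $L$ to be quasi-homogeneous (it is $0$ if all these singularities are quasi-homogeneous), and for which there is an exact sequence of vector bundles $0\to\mathcal{E}_{\mathcal{C}'}(-1)\xrightarrow{\alpha_L}\mathcal{E}_{\mathcal{C}'\cup L}\to\mathcal{O}_L(1-|\mathcal{C}'\cap L|-\epsilon(\mathcal{C}',L))\to0$, $\alpha_L$ being a linear form defining $L$. *)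

theory Defs
  imports "HOL-Analysis.Analysis" "HOL-Library.Poly_Mapping"
begin

type_synonym mono3 = "3 \<Rightarrow>\<^sub>0 nat"
type_synonym poly3 = "mono3 \<Rightarrow>\<^sub>0 complex"

definition Var :: "3 \<Rightarrow> poly3" where
  "Var i = Poly_Mapping.single (Poly_Mapping.single i 1) 1"

definition cst :: "complex \<Rightarrow> poly3" where
  "cst c = Poly_Mapping.single 0 c"

definition tdeg :: "mono3 \<Rightarrow> nat" where
  "tdeg m = (\<Sum>i\<in>UNIV. Poly_Mapping.lookup m i)"

text \<open>Homogeneous of degree d (the zero polynomial is homogeneous of every degree).\<close>
definition homog :: "poly3 \<Rightarrow> nat \<Rightarrow> bool" where
  "homog p d \<longleftrightarrow> (\<forall>m\<in>Poly_Mapping.keys p. tdeg m = d)"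

definition hdeg :: "poly3 \<Rightarrow> nat" where
  "hdeg p = Max (tdeg ` Poly_Mapping.keys p)"

definition eval3 :: "poly3 \<Rightarrow> complex^3 \<Rightarrow> complex" where
  "eval3 p x = (\<Sum>m\<in>Poly_Mapping.keys p.
       Poly_Mapping.lookup p m * (\<Prod>i\<in>UNIV. (x $ i) ^ Poly_Mapping.lookup m i))"

definition pd :: "3 \<Rightarrow> poly3 \<Rightarrow> poly3" where
  "pd i p = (\<Sum>m\<in>Poly_Mapping.keys p.
       Poly_Mapping.single (m - Poly_Mapping.single i 1)
         (of_nat (Poly_Mapping.lookup m i) * Poly_Mapping.lookup p m))"

definition reduced_curve :: "poly3 \<Rightarrow> bool" where
  "reduced_curve f \<longleftrightarrow> f \<noteq> 0 \<and> homog f (hdeg f) \<and> hdeg f \<ge> 1 \<and>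
     (\<forall>g. g * g dvd f \<longrightarrow> g dvd 1)"

definition is_line :: "poly3 \<Rightarrow> bool" where
  "is_line a \<longleftrightarrow> a \<noteq> 0 \<and> homog a 1"

type_synonym der = "3 \<Rightarrow> poly3"

definition der_apply :: "der \<Rightarrow> poly3 \<Rightarrow> poly3" where
  "der_apply \<theta> f = (\<Sum>i\<in>UNIV. \<theta> i * pd i f)"

definition euler :: der where
  "euler = (\<lambda>i. Var i)"

definition homog_der :: "der \<Rightarrow> nat \<Rightarrow> bool" where
  "homog_der \<theta> d \<longleftrightarrow> (\<exists>i. \<theta> i \<noteq> 0) \<and> (\<forall>i. homog (\<theta> i) d)"

definition D0 :: "poly3 \<Rightarrow> der set" where
  "D0 f = {\<theta>. der_apply \<theta> f = 0}"

definition Dmod :: "poly3 \<Rightarrow> der set" where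
  "Dmod f = {\<theta>. f dvd der_apply \<theta> f}"

definition free_exps :: "poly3 \<Rightarrow> int \<Rightarrow> int \<Rightarrow> bool" where
  "free_exps f d2 d3 \<longleftrightarrow> (\<exists>\<theta>1 \<theta>2 k1 k2.
     d2 = int k1 \<and> d3 = int k2 \<and> homog_der \<theta>1 k1 \<and> homog_der \<theta>2 k2 \<and>
     D0 f = {(\<lambda>i. a * \<theta>1 i + b * \<theta>2 i) | a b. True} \<and>
     (\<forall>a b. (\<lambda>i. a * \<theta>1 i + b * \<theta>2 i) = (\<lambda>_. 0) \<longrightarrow> a = 0 \<and> b = 0))"

definition comb4 :: "(nat \<Rightarrow> der) \<Rightarrow> (nat \<Rightarrow> poly3) \<Rightarrow> der" where
  "comb4 G g = (\<lambda>i. \<Sum>j<4. g j * G j i)"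

definition pog :: "poly3 \<Rightarrow> int \<Rightarrow> int \<Rightarrow> int \<Rightarrow> bool" where
  "pog f d2 d3 d \<longleftrightarrow> (\<exists>\<theta>2 \<theta>3 \<psi> k2 k3 k.
     d2 = int k2 \<and> d3 = int k3 \<and> d = int k \<and>
     homog_der \<theta>2 k2 \<and> homog_der \<theta>3 k3 \<and> homog_der \<psi> k \<and>
     (let G = (\<lambda>j. if j = 0 then euler else if j = 1 then \<theta>2
                     else if j = 2 then \<theta>3 else \<psi>) in
       Dmod f = {comb4 G g | g. True} \<and>
       (\<forall>j<4. G j \<notin> {comb4 G g | g. g j = 0}) \<and>
       (\<exists>r. comb4 G r = (\<lambda>_. 0) \<and> r 3 \<noteq> 0 \<and> homog (r 3) 1 \<and>
          (\<forall>g. comb4 G g = (\<lambda>_. 0) \<longrightarrow> (\<exists>h. \<forall>j<4. g j = h * r j)))))"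

definition proj_class :: "complex^3 \<Rightarrow> (complex^3) set" where
  "proj_class p = {(\<chi> i. c * p $ i) | c. c \<noteq> 0}"

definition common_pts :: "poly3 \<Rightarrow> poly3 \<Rightarrow> (complex^3) set set" where
  "common_pts f g = proj_class ` {p. p \<noteq> 0 \<and> eval3 f p = 0 \<and> eval3 g p = 0}"

definition chart :: "(complex^3) set \<Rightarrow> 3" where
  "chart P = (SOME i. \<exists>p\<in>P. p $ i \<noteq> 0)"

definition npt :: "(complex^3) set \<Rightarrow> complex^3" where
  "npt P = (THE q. q \<in> P \<and> q $ chart P = 1)"

definition ideal_gen :: "poly3 set \<Rightarrow> poly3 set" where
  "ideal_gen G = {(\<Sum>x\<in>F. h x * x) | F h. finite F \<and> F \<subseteq> G}"

text \<open>dim_C of (S localized at the maximal ideal of q) / (G).\<close>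
definition locdim :: "complex^3 \<Rightarrow> poly3 set \<Rightarrow> nat" where
  "locdim q G = Sup {n. \<exists>a :: nat \<Rightarrow> poly3. \<forall>c :: nat \<Rightarrow> complex.
      (\<exists>u. eval3 u q \<noteq> 0 \<and> u * (\<Sum>j<n. cst (c j) * a j) \<in> ideal_gen G)
        \<longrightarrow> (\<forall>j<n. c j = 0)}"

text \<open>Local Milnor and Tjurina numbers of the curve g = 0 at the point P, computed
  in the affine chart x_i = 1 (i = chart P) of P^2.\<close>
definition milnor :: "poly3 \<Rightarrow> (complex^3) set \<Rightarrow> nat" where
  "milnor g P = locdim (npt P)
     ({Var (chart P) - 1} \<union> {pd j g | j. j \<noteq> chart P})"

definition tjurina :: "poly3 \<Rightarrow> (complex^3) set \<Rightarrow> nat" where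
  "tjurina g P = locdim (npt P)
     (insert g ({Var (chart P) - 1} \<union> {pd j g | j. j \<noteq> chart P}))"

definition eps_loc :: "poly3 \<Rightarrow> (complex^3) set \<Rightarrow> int" where
  "eps_loc g P = int (milnor g P) - int (tjurina g P)"

definition dimca_eps :: "poly3 \<Rightarrow> poly3 \<Rightarrow> int" where
  "dimca_eps f a = (\<Sum>P\<in>common_pts f a. eps_loc (f * a) P - eps_loc f P)"

end

(*
For a logarithmic derivation \<theta> of C' consider the restriction to L of \<theta>(a), where a is an
equation of L. These restrictions form a principal ideal (g), and
|C' \<inter> L| + \<epsilon>(C', L) = deg C' - deg g. Indeed at a point P of C' \<inter> L, with n the intersection
number of C' and L and q the order of g,
  \<mu>(C' \<union> L) = \<mu>(C') + 2n - 1   and   \<tau>(C' \<union> L) = \<tau>(C') + n + q,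
so that 1 + \<epsilon>_P = n - q. The second formula comes from two exact sequences of finite length
modules, the first one in addition from computing lengths along the Puiseux roots of h_s, where
h(s, t) is a local equation of C' and L is t = 0.

If C is free, a basis of D_0(C) projects to B_2, B_3 in D_0(C') tangent to L, and a divides all
2x2 minors of (B_2, B_3). Hence some x B_2 + y B_3 = a \<psi> with x, y coprime on L, and D_0(C') is
generated by B_2, B_3, \<psi> with this single relation. If x or y is a unit then C' is free,
otherwise C' is plus-one generated; the degree of \<psi> is deg g.
Conversely, a generator \<psi> of degree deg g with \<psi>(a) not in (a) is used to correct the two other
generators to be tangent to L, and Saito's criterion applies to them.
*)
theory Submission
  imports Defs "HOL-Computational_Algebra.Computational_Algebra" "HOL-Computational_Algebra.Field_as_Ring"
begin

section \<open>Puiseux series\<close>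

unbundle no vec_syntax

text \<open>The number \<epsilon> is built from lengths over local rings, while freeness is about
  degrees of forms. Both meet in one polynomial in an affine coordinate of L: its orders at the
  roots are local, its degree is global. Nothing may be lost at infinity, so frames are chosen with
  the curve, and later a component of a derivation, nonzero at the point at infinity of L. A basis
  of D_0(C) does not lie in D_0(C'), since a derivation killing f a need not kill f. Subtracting
  multiples of the Euler derivation moves it there and changes neither the determinant with Euler
  nor tangency to L. In the Milnor number of t h, the summand n comes from the factor t in the first
  entry of the gradient, and n - 1 is the number of roots of h_s through the point, each making the
  second entry longer by one. In the definition of plus-one generated only the last coefficient of
  the relation has a prescribed degree. This already makes the relation homogeneous, and minimality
  keeps units out of it; these two facts drive the converse, where the generator not tangent to L
  need not be \<psi>.\<close>

definition ringhom :: "('a::comm_ring_1 \<Rightarrow> 'b::comm_ring_1) \<Rightarrow> bool" where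
  "ringhom h \<longleftrightarrow> h 1 = 1 \<and> (\<forall>x y. h (x + y) = h x + h y) \<and> (\<forall>x y. h (x * y) = h x * h y)"

lemma ringhomI:
  "h 1 = 1 \<Longrightarrow> (\<And>x y. h (x + y) = h x + h y) \<Longrightarrow> (\<And>x y. h (x * y) = h x * h y) \<Longrightarrow> ringhom h"
  by (simp add: ringhom_def)

context
  fixes h :: "'a::comm_ring_1 \<Rightarrow> 'b::comm_ring_1"
  assumes hom: "ringhom h"
begin

lemma rh_1: "h 1 = 1" and rh_add: "h (x + y) = h x + h y" and rh_mult: "h (x * y) = h x * h y"
  using hom by (auto simp: ringhom_def)

lemma rh_0: "h 0 = 0"
  using rh_add[of 0 0] by simp

lemma rh_minus: "h (- x) = - h x"
  using rh_add[of x "-x"] by (simp add: rh_0 add_eq_0_iff)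

lemma rh_diff: "h (x - y) = h x - h y"
  using rh_add[of x "-y"] by (simp add: rh_minus)

lemma rh_sum: "h (sum f A) = (\<Sum>x\<in>A. h (f x))"
  by (induction A rule: infinite_finite_induct) (auto simp: rh_0 rh_add)

lemma rh_power: "h (x ^ n) = h x ^ n"
  by (induction n) (auto simp: rh_1 rh_mult)

lemma rh_dvd: "x dvd y \<Longrightarrow> h x dvd h y"
  by (auto simp: dvd_def rh_mult)

lemma rh_prod_list: "h (prod_list (map f xs)) = prod_list (map (\<lambda>x. h (f x)) xs)"
  by (induction xs) (auto simp: rh_1 rh_mult)

lemma ringhom_map_poly: "ringhom (map_poly h)"
proof (rule ringhomI)
  show "map_poly h 1 = 1" by (simp add: map_poly_1' rh_1)
  show "map_poly h (x + y) = map_poly h x + map_poly h y" for x y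
    by (intro poly_eqI) (simp add: coeff_map_poly rh_0 rh_add)
  show "map_poly h (x * y) = map_poly h x * map_poly h y" for x y
    by (intro poly_eqI) (simp add: coeff_map_poly rh_0 coeff_mult rh_sum rh_mult)
qed

lemma map_poly_pCons_rh: "map_poly h (pCons c p) = pCons (h c) (map_poly h p)"
  by (intro poly_eqI) (auto simp: coeff_map_poly rh_0 coeff_pCons split: nat.splits)

lemma poly_map_poly_rh: "poly (map_poly h p) (h x) = h (poly p x)"
  by (induction p) (auto simp: map_poly_pCons_rh rh_0 rh_add rh_mult)

lemma map_poly_pcompose_rh: "map_poly h (pcompose p q) = pcompose (map_poly h p) (map_poly h q)"
proof (induction p)
  case (pCons c p)
  have "map_poly h (pcompose (pCons c p) q) = map_poly h [:c:] + map_poly h q * map_poly h (pcompose p q)"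
    using ringhom_map_poly by (simp add: pcompose_pCons ringhom_def)
  then show ?case
    by (simp add: pCons map_poly_pCons_rh pcompose_pCons)
qed auto

lemma ringhom_poly_map: "ringhom (\<lambda>p. poly (map_poly h p) y)"
  using ringhom_map_poly by (auto simp: ringhom_def)

end

lemma ringhom_comp: "ringhom f \<Longrightarrow> ringhom g \<Longrightarrow> ringhom (\<lambda>x. f (g x))"
  by (simp add: ringhom_def)

text \<open>F is regarded as a power series in the inner variable with polynomial coefficients;
  \<open>tc m F\<close> is the m-th of them, and \<open>tc 0\<close> is reduction modulo that
  variable.\<close>

definition tc :: "nat \<Rightarrow> complex fps poly \<Rightarrow> complex poly" where
  "tc m F = map_poly (\<lambda>c. c $ m) F"

lemma coeff_tc: "coeff (tc m F) k = coeff F k $ m"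
  by (simp add: tc_def coeff_map_poly)

lemma tc_eqI: "(\<And>m. tc m F = tc m G) \<Longrightarrow> F = G"
  by (intro poly_eqI fps_ext) (metis coeff_tc)

lemma degree_tc: "degree (tc m F) \<le> degree F"
  by (rule degree_le) (simp add: coeff_tc coeff_eq_0)

lemma tc_mult: "tc m (F * G) = (\<Sum>i\<le>m. tc i F * tc (m - i) G)"
proof (rule poly_eqI)
  fix k
  have "coeff (tc m (F * G)) k = (\<Sum>j\<le>k. \<Sum>i\<le>m. coeff F j $ i * coeff G (k - j) $ (m - i))"
    by (simp add: coeff_tc coeff_mult fps_sum_nth fps_mult_nth atMost_atLeast0)
  also have "\<dots> = (\<Sum>i\<le>m. \<Sum>j\<le>k. coeff F j $ i * coeff G (k - j) $ (m - i))"
    by (rule sum.swap)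
  finally show "coeff (tc m (F * G)) k = coeff (\<Sum>i\<le>m. tc i F * tc (m - i) G) k"
    by (simp add: coeff_sum coeff_mult coeff_tc)
qed

text \<open>The uniform degree bound is what makes the glued series a polynomial in the outer
  variable.\<close>

lemma tc_construct:
  assumes "\<And>m. degree (f m) \<le> D"
  obtains F :: "complex fps poly" where "\<And>m. tc m F = f m" "degree F \<le> D"
proof
  let ?F = "\<Sum>k\<le>D. monom (Abs_fps (\<lambda>m. coeff (f m) k)) k"
  have c: "coeff ?F k = (if k \<le> D then Abs_fps (\<lambda>m. coeff (f m) k) else 0)" for k
    by (simp add: coeff_sum coeff_monom if_distrib sum.delta cong: if_cong)
  show "degree ?F \<le> D" by (rule degree_le) (simp add: c)
  show "tc m ?F = f m" for m
    using assms[of m] by (intro poly_eqI) (auto simp: coeff_tc c coeff_eq_0)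
qed

text \<open>Comparing coefficients of the m-th power of the inner variable leaves the equation
  \<open>g * b + h * a = r\<close>, with r known, for the new coefficients a of G and b of H. A
  Bezout relation solves it. Taking a modulo g keeps all corrections of G below the degree of g, so
  G stays monic, and this in turn bounds the degree of b.\<close>

lemma hensel:
  fixes F :: "complex fps poly"
  assumes F0: "tc 0 F = g * h" and cop: "coprime g h" and mon: "lead_coeff g = 1"
    and dF: "degree h + degree g \<le> degree F"
  obtains G H where "F = G * H" "tc 0 G = g" "tc 0 H = h" "lead_coeff G = 1" "degree G = degree g"
proof -
  define d where "d = degree g"
  define D where "D = degree F - d"
  have dD: "degree F = d + D" "degree h \<le> D" using dF by (auto simp: D_def d_def)
  obtain u v where uv: "u * g + v * h = 1"
    using cop by (metis bezout_coefficients_fst_snd coprime_imp_gcd_eq_1)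
  have g0: "g \<noteq> 0" using mon by auto
  let ?R = "\<lambda>p m. tc m F - (\<Sum>i\<in>{0<..<m}. fst (p i) * snd (p (m - i)))"
  \<comment> \<open>The m-th choice is the pair of m-th coefficients of G and H; it depends on the
    pairs with smaller index only.\<close>
  define P where "P = (\<lambda>(p :: nat \<Rightarrow> complex poly \<times> complex poly) m r.
     degree (snd r) \<le> D \<and>
     (if m = 0 then r = (g, h) else (degree (fst r) < d \<or> fst r = 0) \<and> g * snd r + h * fst r = ?R p m))"
  have "\<exists>f. \<forall>m. P f m (f m)"
  proof (rule dependent_wf_choice[of less_than])
    show "P f x r = P g' x r" if "\<And>z. (z, x) \<in> less_than \<Longrightarrow> f z = g' z" for f g' x r
    proof -
      have "(\<Sum>i\<in>{0<..<x}. fst (f i) * snd (f (x - i))) = (\<Sum>i\<in>{0<..<x}. fst (g' i) * snd (g' (x - i)))"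
        by (rule sum.cong) (auto simp: that)
      then show ?thesis by (simp add: P_def)
    qed
  next
    fix m p assume IH: "\<And>y. (y, m) \<in> less_than \<Longrightarrow> P p y (p y)"
    show "\<exists>r. P p m r"
    proof (cases "m = 0")
      case True then show ?thesis using dD by (auto simp: P_def)
    next
      case False
      define r where "r = ?R p m"
      \<comment> \<open>As \<open>u * g + v * h = 1\<close>, the pair (v r, u r) solves the
        equation; the multiple of g removed from its first entry reappears in b.\<close>
      define a where "a = (v * r) mod g"
      define b where "b = u * r + h * ((v * r) div g)"
      have "h * (v * r) = h * (((v * r) div g) * g + a)" by (simp add: a_def)
      then have "g * b + h * a = (u * g + v * h) * r" by (simp add: b_def algebra_simps)
      then have eq: "g * b + h * a = r" by (simp add: uv)
      have da: "degree a < d \<or> a = 0"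
        unfolding a_def d_def using degree_mod_less[OF g0] by blast
      have "degree (fst (p i) * snd (p (m - i))) \<le> degree F" if "i \<in> {0<..<m}" for i
      proof -
        have "P p i (p i)" "P p (m - i) (p (m - i))" using IH that by auto
        then have "degree (fst (p i)) \<le> d" "degree (snd (p (m - i))) \<le> D"
          using that by (auto simp: P_def)
        then show ?thesis using degree_mult_le[of "fst (p i)" "snd (p (m-i))"] dD by linarith
      qed
      then have dr: "degree r \<le> degree F"
        unfolding r_def by (intro degree_diff_le degree_tc degree_sum_le) auto
      have "degree (h * a) \<le> degree F"
        using degree_mult_le[of h a] da dD by (cases "a = 0") auto
      then have "degree (g * b) \<le> degree F"
        using degree_diff_le[OF dr, of "h * a"] by (simp add: eq[symmetric])
      then have "degree b \<le> D"
        using g0 dD by (cases "b = 0") (auto simp: degree_mult_eq d_def)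
      then have "P p m (a, b)" using False eq da by (simp add: P_def r_def)
      then show ?thesis by blast
    qed
  qed simp
  then obtain p where p: "\<And>m. P p m (p m)" by blast
  have p0: "p 0 = (g, h)" using p[of 0] by (simp add: P_def)
  have dp1: "degree (fst (p m)) \<le> d" for m using p[of m] p0 by (cases "m = 0") (auto simp: P_def d_def)
  have dp2: "degree (snd (p m)) \<le> D" for m using p[of m] by (auto simp: P_def)
  obtain G where G: "\<And>m. tc m G = fst (p m)" "degree G \<le> d" by (rule tc_construct[of "\<lambda>m. fst (p m)", OF dp1]) blast
  obtain H where H: "\<And>m. tc m H = snd (p m)" "degree H \<le> D" by (rule tc_construct[of "\<lambda>m. snd (p m)", OF dp2]) blast
  have "F = G * H"
  proof (rule tc_eqI)
    fix m
    show "tc m F = tc m (G * H)"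
    proof (cases "m = 0")
      case True then show ?thesis using F0 p0 by (simp add: tc_mult G H)
    next
      case False
      have "{..m} = insert 0 (insert m {0<..<m})" using False by auto
      then have "tc m (G * H) = fst (p 0) * snd (p m) + (fst (p m) * snd (p 0) + (\<Sum>i\<in>{0<..<m}. fst (p i) * snd (p (m - i))))"
        using False by (simp add: tc_mult G H)
      also have "\<dots> = tc m F" using p[of m] False p0 by (simp add: P_def algebra_simps)
      finally show ?thesis ..
    qed
  qed
  moreover have lc: "coeff G d = 1"
  proof (rule fps_ext)
    fix m
    have "coeff (tc m G) d = (if m = 0 then 1 else 0)"
      using p[of m] p0 mon by (auto simp: G P_def d_def coeff_eq_0)
    then show "coeff G d $ m = 1 $ m" by (simp add: coeff_tc)
  qed
  moreover have "degree G = d" using lc G(2) by (intro antisym le_degree) auto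
  ultimately show ?thesis using that[of G H] G(1)[of 0] H(1)[of 0] p0 by (simp add: d_def)
qed

text \<open>Adjoins an N-th root of the variable: the new X is the N-th root of the old one.\<close>

definition sub :: "nat \<Rightarrow> complex fps \<Rightarrow> complex fps" where
  "sub N c = c oo fps_X ^ N"

lemma sub_nth: "N > 0 \<Longrightarrow> sub N c $ k = (if N dvd k then c $ (k div N) else 0)"
proof -
  assume N: "N > 0"
  have "sub N c $ k = (\<Sum>i\<in>{0..k}. if i * N = k then c $ i else 0)"
    by (auto simp: sub_def fps_compose_nth power_mult[symmetric] fps_X_power_nth mult.commute intro!: sum.cong)
  also have "\<dots> = (\<Sum>i\<in>{0..k}. if i = k div N \<and> N dvd k then c $ i else 0)"
    using N by (intro sum.cong) auto
  also have "\<dots> = (if N dvd k then c $ (k div N) else 0)"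
    by (auto simp: sum.delta)
  finally show ?thesis .
qed

lemma sub_one [simp]: "sub N 1 = 1"
  by (simp add: sub_def)

lemma ringhom_sub: "N > 0 \<Longrightarrow> ringhom (sub N)"
  by (rule ringhomI) (auto simp: sub_def fps_compose_add_distrib fps_compose_mult_distrib)

lemma sub_sub: "N > 0 \<Longrightarrow> M > 0 \<Longrightarrow> sub M (sub N c) = sub (N * M) c"
  by (rule fps_ext) (auto simp: sub_nth div_mult2_eq mult.commute dvd_div_iff_mult elim: dvd_mult_right
      dest: dvd_mult_left)

lemma sub_1 [simp]: "sub 1 c = c" "sub (Suc 0) c = c"
  by (simp_all add: sub_def)

lemma sub_X_power: "N > 0 \<Longrightarrow> sub N (fps_X ^ k) = fps_X ^ (N * k)"
  by (rule fps_ext) (auto simp: sub_nth fps_X_power_nth)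

section \<open>Factorizations over Puiseux series\<close>

lemma coeff_pcompose_scale: "coeff (pcompose p [:0, c:]) k = c ^ k * coeff (p :: 'a::comm_ring_1 poly) k"
proof (induction p arbitrary: k)
  case (pCons a p)
  then show ?case by (cases k) (auto simp: pcompose_pCons coeff_pCons algebra_simps)
qed auto

text \<open>A factorization over Puiseux series expressed by power series: once the variable has
  become an N-th power, the roots \<open>xs\<close> are ordinary power series.\<close>

definition splits :: "complex fps poly \<Rightarrow> nat \<Rightarrow> complex fps list \<Rightarrow> bool" where
  "splits F N xs \<longleftrightarrow> N > 0 \<and> map_poly (sub N) F = (\<Prod>z\<leftarrow>xs. [:- z, 1:])"

lemma splits_mono:
  assumes "splits F N xs" "M > 0"
  shows "splits F (N * M) (map (sub M) xs)"
proof -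
  have N: "N > 0" using assms by (simp add: splits_def)
  note r = ringhom_sub[OF assms(2)]
  have "map_poly (sub (N * M)) F = map_poly (sub M) (map_poly (sub N) F)"
    using N assms(2) rh_0[OF r] rh_0[OF ringhom_sub[OF N]]
    by (subst map_poly_map_poly) (auto simp: sub_sub o_def)
  also have "\<dots> = (\<Prod>z\<leftarrow>xs. map_poly (sub M) [:- z, 1:])"
    using assms by (simp add: splits_def rh_prod_list[OF ringhom_map_poly[OF r]])
  also have "\<dots> = (\<Prod>z\<leftarrow>map (sub M) xs. [:- z, 1:])"
    by (simp add: map_poly_pCons_rh[OF r] rh_minus[OF r] rh_1[OF r] o_def)
  finally show ?thesis using N assms by (simp add: splits_def)
qed

lemma splits_mult:
  assumes "splits F N xs" "splits G M ys"
  obtains K zs where "splits (F * G) K zs"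
proof -
  have "N > 0" "M > 0" using assms by (auto simp: splits_def)
  with splits_mono[OF assms(1), of M] splits_mono[OF assms(2), of N]
  have "splits (F * G) (N * M) (map (sub M) xs @ map (sub N) ys)"
    by (auto simp: splits_def rh_mult[OF ringhom_map_poly[OF ringhom_sub]] mult.commute)
  then show ?thesis using that by blast
qed

lemma prod_list_pcompose:
  "pcompose (\<Prod>z\<leftarrow>(xs :: 'a::comm_ring_1 list). [:- z, 1:]) q = (\<Prod>z\<leftarrow>xs. q - [:z:])"
proof (induction xs)
  case (Cons a xs)
  have "pcompose [:- a, 1:] q = q - [:a:]"
    by (intro poly_eqI) (simp add: pcompose_pCons coeff_pCons split: nat.split)
  with Cons show ?case by (simp add: pcompose_mult del: mult_pCons_left)
qed (simp add: pcompose_1)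

lemma smult_prod_list: "smult ((c :: 'a::comm_ring_1) ^ length xs) (\<Prod>z\<leftarrow>xs. f z) = (\<Prod>z\<leftarrow>xs. smult c (f z))"
  by (induction xs) (auto simp: mult.commute simp flip: mult_smult_right smult_smult)

lemma splits_shift:
  assumes "splits (pcompose F [:b, 1:]) N xs"
  obtains ys where "splits F N ys"
proof -
  have N: "N > 0" using assms by (simp add: splits_def)
  note r = ringhom_sub[OF N]
  have "map_poly (sub N) F = map_poly (sub N) (pcompose (pcompose F [:b, 1:]) [:-b, 1:])"
    by (simp add: pcompose_assoc[symmetric] pcompose_pCons)
  also have "\<dots> = (\<Prod>z\<leftarrow>xs. [:- sub N b, 1:] - [:z:])"
    using assms by (simp add: map_poly_pcompose_rh[OF r] splits_def prod_list_pcompose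
        map_poly_pCons_rh[OF r] rh_minus[OF r] rh_1[OF r])
  also have "\<dots> = (\<Prod>z\<leftarrow>map (\<lambda>z. z + sub N b) xs. [:- z, 1:])"
    by (simp add: o_def add_diff_eq minus_diff_commute)
  finally show ?thesis using that N unfolding splits_def by blast
qed

lemma degree_linear_prod: "degree (\<Prod>z\<leftarrow>(xs :: 'a::idom list). [:- z, 1:]) = length xs"
proof (induction xs)
  case (Cons a xs)
  let ?P = "\<Prod>z\<leftarrow>xs. [:- z, 1:]"
  have "0 \<notin> set (map (\<lambda>z. [:- z, 1 :: 'a:]) xs)" by auto
  then have "?P \<noteq> 0" by (simp add: prod_list_zero_iff)
  then have "degree ([:- a, 1:] * ?P) = Suc (length xs)"
    using Cons by (subst degree_mult_eq) auto
  then show ?case by (simp del: mult_pCons_left)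
qed simp

lemma splits_length:
  assumes "splits G N xs" shows "length xs = degree G"
proof -
  have N: "N > 0" using assms by (simp add: splits_def)
  have inj: "sub N c = 0 \<longleftrightarrow> c = 0" for c
    using N fps_compose_eq_0_iff[of "fps_X ^ N" c] by (auto simp: sub_def)
  have "degree G = degree (map_poly (sub N) G)"
    by (rule degree_map_poly[symmetric]) (simp add: inj)
  also have "\<dots> = length xs" using assms
    by (simp add: splits_def degree_linear_prod)
  finally show ?thesis ..
qed

text \<open>Scaling the outer variable by X^p divides the roots by X^p, so the roots of F are X^(N
  p) times those of G. The scaling can be undone coefficientwise because X is not a zero
  divisor.\<close>

lemma splits_scale:
  assumes xs: "splits G N xs" and q: "q > 0"
    and eq: "pcompose (map_poly (sub q) F) [:0, fps_X ^ p:] = smult (fps_X ^ (p * degree G)) G"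
  obtains ys where "splits F (q * N) ys"
proof -
  have N: "N > 0" using xs by (simp add: splits_def)
  note r = ringhom_sub[OF N]
  let ?c = "fps_X ^ (N * p) :: complex fps"
  have len: "length xs = degree G" by (rule splits_length[OF xs])
  have "pcompose (map_poly (sub (q * N)) F) [:0, ?c:] = map_poly (sub N) (pcompose (map_poly (sub q) F) [:0, fps_X ^ p:])"
    using N q rh_0[OF ringhom_sub[OF q]] rh_0[OF r]
    by (simp add: map_poly_pcompose_rh[OF r] map_poly_map_poly o_def sub_sub map_poly_pCons_rh[OF r] sub_X_power)
  also have "\<dots> = smult (sub N (fps_X ^ (p * degree G))) (map_poly (sub N) G)"
    unfolding eq using rh_0[OF r] rh_mult[OF r] by (intro poly_eqI) (simp add: coeff_map_poly)
  also have "\<dots> = smult (?c ^ length xs) (\<Prod>z\<leftarrow>xs. [:- z, 1:])"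
    using xs N by (simp add: splits_def sub_X_power len power_mult[symmetric] mult.assoc)
  also have "\<dots> = (\<Prod>z\<leftarrow>xs. smult ?c [:- z, 1:])"
    by (rule smult_prod_list)
  also have "\<dots> = pcompose (\<Prod>z\<leftarrow>map (\<lambda>z. ?c * z) xs. [:- z, 1:]) [:0, ?c:]"
    unfolding prod_list_pcompose by (simp add: o_def)
  finally have e: "pcompose (map_poly (sub (q * N)) F) [:0, ?c:] = pcompose (\<Prod>z\<leftarrow>map (\<lambda>z. ?c * z) xs. [:- z, 1:]) [:0, ?c:]" .
  have "map_poly (sub (q * N)) F = (\<Prod>z\<leftarrow>map (\<lambda>z. ?c * z) xs. [:- z, 1:])"
  proof (rule poly_eqI)
    fix k
    from arg_cong[OF e, of "\<lambda>P. coeff P k"]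
    show "coeff (map_poly (sub (q * N)) F) k = coeff (\<Prod>z\<leftarrow>map (\<lambda>z. ?c * z) xs. [:- z, 1:]) k"
      unfolding coeff_pcompose_scale by simp
  qed
  then show ?thesis using that N q unfolding splits_def by (metis nat_0_less_mult_iff)
qed

text \<open>If the reduction of F modulo X had a single root z, it would be (s - z)^d. Its
  coefficient in degree d - 1 is -d z, so z = 0 and all lower coefficients vanish, against
  \<open>k\<close>. Hence the factor at one root is coprime to its cofactor and Hensel lifting
  applies.\<close>

lemma monic_not_power_split:
  fixes F :: "complex fps poly"
  assumes mon: "lead_coeff F = 1" and d: "degree F \<ge> 1"
    and c1: "coeff F (degree F - 1) $ 0 = 0" and k: "k < degree F" "coeff F k $ 0 \<noteq> 0"
  obtains G H where "F = G * H" "lead_coeff G = 1" "lead_coeff H = 1"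
    "degree G < degree F" "degree H < degree F"
proof -
  define d where "d = degree F"
  define f where "f = tc 0 F"
  have cd: "coeff f d = 1" using mon by (simp add: f_def coeff_tc d_def)
  have df: "degree f = d" using cd degree_tc[of 0 F] by (intro antisym le_degree) (auto simp: f_def d_def)
  have f0: "f \<noteq> 0" using cd by auto
  obtain z where z: "poly f z = 0"
    using fundamental_theorem_of_algebra[of f] df d by (metis constant_degree d_def not_one_le_zero)
  define m where "m = order z f"
  have m0: "m \<noteq> 0" using z f0 by (simp add: m_def order_root)
  obtain h where h: "f = [:- z, 1:] ^ m * h" "\<not> [:- z, 1:] dvd h"
    using order_decomp[OF f0, of z] by (auto simp: m_def)
  have h0: "h \<noteq> 0" using f0 h by auto
  have lch: "lead_coeff h = 1"
    using cd df h by (metis lead_coeff_mult lead_coeff_power lead_coeff_pCons(1) lead_coeff_1 mult_1 one_poly_eq_simps(1) power_one pCons_eq_0_iff zero_neq_one)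
  have deg: "d = m + degree h"
    using h0 h(1) df by (simp add: degree_mult_eq degree_linear_power)
  have "m \<noteq> d"
  proof
    assume "m = d"
    with deg have "degree h = 0" by simp
    with lch have "h = 1" by (metis degree_eq_zeroE lead_coeff_pCons(2) coeff_pCons_0 one_pCons)
    then have fd: "f = [:- z, 1:] ^ d" using h \<open>m = d\<close> by simp
    have "coeff f (d - 1) = of_nat (d choose (d - 1)) * (- z)"
      using d unfolding fd by (subst coeff_linear_poly_power) (auto simp: d_def)
    then have "z = 0" using c1 d by (auto simp: f_def coeff_tc d_def binomial_eq_0_iff)
    then have "coeff f k = 0" using k unfolding fd by (subst coeff_linear_poly_power) (auto simp: d_def)
    then show False using k by (simp add: f_def coeff_tc)
  qed
  then have md: "m < d" using deg by simp
  have "coprime [:- z, 1:] h"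
    using h(2) by (intro prime_elem_imp_coprime) (auto intro: prime_elem_linear_field_poly)
  then have cop: "coprime ([:- z, 1:] ^ m) h" by simp
  have lz: "lead_coeff ([:- z, 1:] ^ m) = 1" by (simp add: lead_coeff_power)
  have le: "degree h + degree ([:- z, 1:] ^ m) \<le> degree F"
    using deg by (simp add: degree_linear_power d_def)
  obtain G H where GH: "F = G * H" "lead_coeff G = 1" "degree G = degree ([:- z, 1:] ^ m)"
    using hensel[OF h(1)[unfolded f_def] cop lz le] by metis
  have "lead_coeff H = 1" using mon GH by (simp add: lead_coeff_mult)
  moreover have "degree G = m" using GH by (simp add: degree_linear_power)
  moreover have "d = degree G + degree H"
    using GH mon by (metis d_def degree_mult_eq leading_coeff_0_iff mult_zero_left mult_zero_right zero_neq_one)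
  ultimately show ?thesis using that[OF GH(1)] GH m0 md by (simp add: d_def)
qed

text \<open>Only the two top terms of F contribute to degree d - 1 after the shift by b; they give d
  b + c, which determines b.\<close>

lemma tschirnhaus:
  fixes F :: "complex fps poly"
  assumes mon: "lead_coeff F = 1" and d: "degree F \<ge> 1"
  obtains b where "lead_coeff (pcompose F [:b, 1:]) = 1" "degree (pcompose F [:b, 1:]) = degree F"
    "coeff (pcompose F [:b, 1:]) (degree F - 1) = 0"
proof -
  define d where "d = degree F"
  define c where "c = coeff F (d - 1)"
  define b where "b = - (fps_const (1 / of_nat d) * c)"
  define R where "R = F - monom 1 d - monom c (d - 1)"
  have d1: "d \<ge> 1" using assms d_def by simp
  have R: "coeff R i = 0" if "i \<ge> d - 1" for i
    using that mon d1 by (cases "i = d - 1 \<or> i = d") (auto simp: R_def c_def d_def coeff_eq_0)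
  have dR: "coeff (pcompose R [:b, 1:]) (d - 1) = 0"
  proof (cases "d = 1")
    case True
    then have "R = 0" using R by (intro poly_eqI) simp
    then show ?thesis by simp
  next
    case False
    have "degree R < d - 1" using R[of "degree R"] False d1 by (cases "R = 0") (auto simp: not_le[symmetric])
    then show ?thesis by (intro coeff_eq_0) (simp add: degree_pcompose)
  qed
  have F: "F = monom 1 d + monom c (d - 1) + R" by (simp add: R_def)
  have e1: "pcompose (monom 1 d) [:b, 1:] = [:b, 1:] ^ d" for d
    by (induction d) (simp_all add: pcompose_1 monom_Suc pcompose_pCons del: mult_pCons_left)
  have e2: "pcompose (monom c n) [:b, 1:] = smult c ([:b, 1:] ^ n)" for n
    using e1[of n] by (metis mult.right_neutral pcompose_smult smult_monom)
  have "coeff (pcompose F [:b, 1:]) (d - 1) = of_nat d * b + c"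
    unfolding F pcompose_add coeff_add dR e1 e2
    using d1 binomial_symmetric[of 1 d] by (simp add: coeff_linear_poly_power)
  also have "of_nat d * b = - (fps_const (of_nat d * (1 / of_nat d)) * c)"
    by (simp only: b_def fps_of_nat[symmetric] fps_const_mult[symmetric] mult.assoc mult_minus_right)
  also have "\<dots> = - c" using d1 by simp
  finally have "coeff (pcompose F [:b, 1:]) (d - 1) = 0" by simp
  moreover have "degree (pcompose F [:b, 1:]) = degree F" by (simp add: degree_pcompose)
  moreover have "lead_coeff (pcompose F [:b, 1:]) = 1" using mon by (simp add: lead_coeff_comp)
  ultimately show ?thesis using that by (simp add: d_def)
qed

text \<open>The index k minimizes the order of the k-th coefficient divided by d - k; this minimum
  is p / q. After X has become X^q, minimality makes the j-th coefficient divisible by X^(p (d -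
  j)), which is what scaling s by X^p leaves to cancel. For j = k nothing remains, so that
  coefficient of G is a unit.\<close>

lemma newton_polygon_rescale:
  fixes F :: "complex fps poly"
  assumes mon: "lead_coeff F = 1" and d: "degree F = d"
    and ex: "k1 < d" "coeff F k1 \<noteq> 0" and c1: "coeff F (d - 1) = 0"
  obtains G p q k where "q > 0" "lead_coeff G = 1" "degree G = d" "coeff G (d - 1) = 0"
    "k < d" "coeff G k $ 0 \<noteq> 0"
    "pcompose (map_poly (sub q) F) [:0, fps_X ^ p:] = smult (fps_X ^ (p * d)) G"
proof -
  define K where "K = {k. k < d \<and> coeff F k \<noteq> 0}"
  have K: "finite K" "K \<noteq> {}" using ex by (auto simp: K_def)
  define w where "w k = real (subdegree (coeff F k)) / real (d - k)" for k
  obtain k where k: "k \<in> K" "\<And>j. j \<in> K \<Longrightarrow> w k \<le> w j"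
    using ex_min_if_finite[OF finite_imageI[OF K(1)], of w] K by (auto simp: not_less)
  define p where "p = subdegree (coeff F k)"
  define q where "q = d - k"
  have kd: "k < d" "coeff F k \<noteq> 0" using k by (auto simp: K_def)
  have q: "q > 0" using kd by (simp add: q_def)
  have ge: "p * (d - j) \<le> q * subdegree (coeff F j)" if "j < d" "coeff F j \<noteq> 0" for j
  proof -
    have "w k \<le> w j" using that k by (simp add: K_def)
    then have "real p * real (d - j) \<le> real (subdegree (coeff F j)) * real q"
      using kd that by (simp add: w_def p_def q_def field_simps)
    then have "real (p * (d - j)) \<le> real (q * subdegree (coeff F j))" by (simp add: mult.commute)
    then show ?thesis by (simp only: of_nat_le_iff)
  qed
  define g where "g j = fps_shift (p * (d - j)) (sub q (coeff F j))" for j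
  have g: "sub q (coeff F j) = fps_X ^ (p * (d - j)) * g j" if "j < d" for j
  proof -
    have "sub q (coeff F j) $ n = 0" if n: "n < p * (d - j)" for n
    proof (cases "coeff F j = 0")
      case False
      then have "n < q * subdegree (coeff F j)" using ge \<open>j < d\<close> n by fastforce
      then show ?thesis using q by (auto simp: sub_nth intro!: nth_less_subdegree_zero)
    qed (use q in \<open>simp add: sub_nth\<close>)
    then show ?thesis by (intro fps_ext) (auto simp: g_def fps_X_power_mult_nth)
  qed
  define G where "G = monom 1 d + (\<Sum>j<d. monom (g j) j)"
  have cG: "coeff G j = (if j < d then g j else if j = d then 1 else 0)" for j
    by (auto simp: G_def coeff_sum)
  have dG: "degree G = d"
    by (intro antisym degree_le le_degree) (auto simp: cG)
  have "coeff G k $ 0 = coeff F k $ p"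
    using kd q by (simp add: cG g_def sub_nth q_def)
  then have nz: "coeff G k $ 0 \<noteq> 0" using kd by (simp add: p_def)
  have c1': "coeff G (d - 1) = 0"
    using ex c1 by (simp add: cG g_def rh_0[OF ringhom_sub[OF q]])
  have "pcompose (map_poly (sub q) F) [:0, fps_X ^ p:] = smult (fps_X ^ (p * d)) G"
  proof (rule poly_eqI)
    fix j
    have "(fps_X ^ p) ^ j * sub q (coeff F j) = fps_X ^ (p * d) * coeff G j"
    proof (cases j d rule: linorder_cases)
      case less
      then have "p * j + p * (d - j) = p * d" by (simp add: add_mult_distrib2[symmetric])
      then show ?thesis using less g[OF less]
        by (simp add: cG power_mult[symmetric] mult.assoc[symmetric] power_add[symmetric])
    next
      case equal
      then show ?thesis using mon d by (simp add: cG power_mult)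
    next
      case greater
      then show ?thesis using d by (simp add: cG coeff_eq_0 rh_0[OF ringhom_sub[OF q]])
    qed
    then show "coeff (pcompose (map_poly (sub q) F) [:0, fps_X ^ p:]) j = coeff (smult (fps_X ^ (p * d)) G) j"
      by (simp add: coeff_pcompose_scale coeff_map_poly rh_0[OF ringhom_sub[OF q]])
  qed
  then show ?thesis using that[OF q _ dG c1' kd(1) nz] by (simp add: dG cG)
qed

text \<open>After removing the term of degree d - 1 and rescaling along the steepest edge of the Newton polygon,
  the reduction modulo X is not a d-th power, so Hensel lifts a factorization into smaller degrees.\<close>

theorem newton_puiseux:
  fixes F :: "complex fps poly"
  assumes "lead_coeff F = 1"
  obtains N xs where "splits F N xs"
proof -
  have "\<exists>N xs. splits F N xs" if "degree F = d" "lead_coeff F = 1" for d and F :: "complex fps poly"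
    using that
  proof (induction d arbitrary: F rule: less_induct)
    case (less d)
    consider "d = 0" | "d \<ge> 1" by linarith
    then show ?case
    proof cases
      case 1
      then have "F = 1" using less.prems by (metis degree_eq_zeroE lead_coeff_pCons(2) coeff_pCons_0 one_pCons)
      then have "splits F 1 []" by (simp add: splits_def)
      then show ?thesis by blast
    next
      case 2
      obtain b where b: "lead_coeff (pcompose F [:b, 1:]) = 1" "degree (pcompose F [:b, 1:]) = d"
        "coeff (pcompose F [:b, 1:]) (d - 1) = 0"
        using tschirnhaus[of F] less.prems 2 by metis
      define F' where "F' = pcompose F [:b, 1:]"
      note b = b[folded F'_def]
      have "\<exists>N xs. splits F' N xs"
      proof (cases "\<exists>k<d. coeff F' k \<noteq> 0")
        case False
        then have "F' = monom 1 d"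
          using b by (intro poly_eqI) (metis coeff_monom coeff_eq_0 linorder_neqE_nat)
        then have "F' = [:0, 1:] ^ d" by (simp add: monom_altdef)
        moreover have "map_poly (sub 1) F' = F'" by (rule map_poly_idI) simp
        ultimately have "splits F' 1 (replicate d 0)"
          by (simp add: splits_def)
        then show ?thesis by blast
      next
        case True
        then obtain G p q k where G: "q > 0" "lead_coeff G = 1" "degree G = d" "coeff G (d - 1) = 0"
          "k < d" "coeff G k $ 0 \<noteq> 0"
          "pcompose (map_poly (sub q) F') [:0, fps_X ^ p:] = smult (fps_X ^ (p * d)) G"
          using newton_polygon_rescale[of F' d] b by metis
        obtain G1 G2 where G12: "G = G1 * G2" "lead_coeff G1 = 1" "lead_coeff G2 = 1"
          "degree G1 < d" "degree G2 < d"
          by (rule monic_not_power_split[of G k]) (use G 2 in auto)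
        obtain N1 xs1 N2 xs2 where "splits G1 N1 xs1" "splits G2 N2 xs2"
          using less.IH[of _ G1] less.IH[of _ G2] G12 by metis
        then obtain N xs where "splits G N xs" using splits_mult G12(1) by metis
        then show ?thesis using splits_scale[of G N xs q F' p] G by metis
      qed
      then show ?thesis using splits_shift unfolding F'_def by metis
    qed
  qed
  then show ?thesis using that assms by blast
qed

section \<open>Codimension of ideals\<close>

definition ideal :: "'a::comm_ring_1 set \<Rightarrow> bool" where
  "ideal J \<longleftrightarrow> 0 \<in> J \<and> (\<forall>x\<in>J. \<forall>y\<in>J. x + y \<in> J) \<and> (\<forall>x\<in>J. \<forall>r. r * x \<in> J)"

definition idl :: "'a::comm_ring_1 set \<Rightarrow> 'a set" where
  "idl G = \<Inter>{J. ideal J \<and> G \<subseteq> J}"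

context
  fixes J :: "'a::comm_ring_1 set"
  assumes J: "ideal J"
begin
lemma ideal_0: "0 \<in> J" and ideal_add: "x \<in> J \<Longrightarrow> y \<in> J \<Longrightarrow> x + y \<in> J"
  and ideal_mult: "x \<in> J \<Longrightarrow> r * x \<in> J" and ideal_mult': "x \<in> J \<Longrightarrow> x * r \<in> J"
  using J by (auto simp: ideal_def mult.commute)

lemma ideal_minus: "x \<in> J \<Longrightarrow> - x \<in> J"
  using ideal_mult[of x "-1"] by simp

lemma ideal_diff: "x \<in> J \<Longrightarrow> y \<in> J \<Longrightarrow> x - y \<in> J"
  using ideal_add[of x "-y"] ideal_minus by simp

lemma ideal_cancel: "x - y \<in> J \<Longrightarrow> x \<in> J \<longleftrightarrow> y \<in> J"
  using ideal_add[of "x - y" y] ideal_diff[of x "x - y"] by auto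

lemma ideal_sum: "(\<And>i. i \<in> A \<Longrightarrow> f i \<in> J) \<Longrightarrow> sum f A \<in> J"
  by (induction A rule: infinite_finite_induct) (auto simp: ideal_0 ideal_add)
end

lemma ideal_idl: "ideal (idl G)"
  unfolding idl_def ideal_def by blast

lemma idl_superset: "x \<in> G \<Longrightarrow> x \<in> idl G"
  unfolding idl_def by blast

lemma idl_least: "ideal J \<Longrightarrow> G \<subseteq> J \<Longrightarrow> idl G \<subseteq> J"
  unfolding idl_def by blast

lemma idl_empty [simp]: "idl {} = {0}"
proof -
  have "ideal {0 :: 'a::comm_ring_1}" by (simp add: ideal_def)
  then show ?thesis using idl_least[of "{0::'a}" "{}"] ideal_0[OF ideal_idl, of "{}"] by blast
qed

lemma idl_insert: "p \<in> idl (insert a G) \<longleftrightarrow> (\<exists>x. p - x * a \<in> idl G)"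
proof
  let ?J = "{p. \<exists>x. p - x * a \<in> idl G}"
  note i = ideal_idl[of G]
  have "ideal ?J"
    unfolding ideal_def
  proof (intro conjI ballI allI)
    show "0 \<in> ?J" using ideal_0[OF i] by (auto intro: exI[of _ 0])
  next
    fix x y assume "x \<in> ?J" "y \<in> ?J"
    then obtain b c where "x - b * a \<in> idl G" "y - c * a \<in> idl G" by auto
    then have "x + y - (b + c) * a \<in> idl G"
      using ideal_add[OF i] by (fastforce simp: algebra_simps)
    then show "x + y \<in> ?J" by blast
  next
    fix x r assume "x \<in> ?J"
    then obtain b where "x - b * a \<in> idl G" by auto
    then have "r * x - (r * b) * a \<in> idl G"
      using ideal_mult[OF i, of _ r] by (fastforce simp: algebra_simps)
    then show "r * x \<in> ?J" by blast
  qed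
  moreover have "insert a G \<subseteq> ?J"
    using ideal_0[OF i] idl_superset[of _ G] by (auto intro: exI[of _ 0] exI[of _ 1])
  ultimately show "p \<in> idl (insert a G) \<Longrightarrow> \<exists>x. p - x * a \<in> idl G"
    using idl_least by blast
next
  assume "\<exists>x. p - x * a \<in> idl G"
  then obtain x where "p - x * a \<in> idl G" by blast
  then have "p - x * a \<in> idl (insert a G)"
    using idl_least[of "idl (insert a G)" G] ideal_idl idl_superset[of _ "insert a G"] by blast
  moreover have "x * a \<in> idl (insert a G)"
    by (intro ideal_mult ideal_idl idl_superset) auto
  ultimately show "p \<in> idl (insert a G)"
    using ideal_cancel[OF ideal_idl] by blast
qed

lemma idl_1: "p \<in> idl {a} \<longleftrightarrow> (\<exists>x. p = x * a)"
  by (auto simp: idl_insert)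

lemma idl_2: "p \<in> idl {a, b} \<longleftrightarrow> (\<exists>x y. p = x * a + y * b)"
  unfolding idl_insert[of p a] idl_1 by (simp only: diff_eq_eq add.commute)

lemma idl_3: "p \<in> idl {a, b, c} \<longleftrightarrow> (\<exists>x y z. p = x * a + y * b + z * c)"
  unfolding idl_insert[of p a] idl_2 by (simp only: diff_eq_eq ac_simps)

text \<open>Gaussian elimination: the last equation expresses the unknown \<open>i0\<close> through
  the others, which leaves one equation and one unknown less.\<close>

lemma homogeneous_system:
  fixes c :: "'i \<Rightarrow> nat \<Rightarrow> 'f::field"
  assumes "finite I" "card I > n"
  obtains d where "\<exists>i\<in>I. d i \<noteq> 0" "\<And>j. j < n \<Longrightarrow> (\<Sum>i\<in>I. d i * c i j) = 0"
proof -
  have "\<exists>d. (\<exists>i\<in>I. d i \<noteq> 0) \<and> (\<forall>j<n. (\<Sum>i\<in>I. d i * c i j) = 0)"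
    using assms
  proof (induction n arbitrary: I c)
    case 0
    then have "I \<noteq> {}" by auto
    then show ?case by (intro exI[of _ "\<lambda>_. 1"]) auto
  next
    case (Suc n)
    show ?case
    proof (cases "\<forall>i\<in>I. c i n = 0")
      case True
      obtain d where d: "\<exists>i\<in>I. d i \<noteq> 0" "\<And>j. j < n \<Longrightarrow> (\<Sum>i\<in>I. d i * c i j) = 0"
        using Suc.IH[of I c] Suc.prems by (meson Suc_lessD)
      then show ?thesis using True by (intro exI[of _ d]) (auto simp: less_Suc_eq)
    next
      case False
      then obtain i0 where i0: "i0 \<in> I" "c i0 n \<noteq> 0" by auto
      let ?I = "I - {i0}"
      define c' where "c' i j = c i j - c i n / c i0 n * c i0 j" for i j
      obtain d where d: "\<exists>i\<in>?I. d i \<noteq> 0" "\<And>j. j < n \<Longrightarrow> (\<Sum>i\<in>?I. d i * c' i j) = 0"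
      proof -
        have "n < card ?I" using Suc.prems i0 by (simp add: card_Diff_singleton)
        then show ?thesis using Suc.IH[of ?I c'] Suc.prems(1) that by (meson finite_Diff)
      qed
      define e where "e = d(i0 := - (\<Sum>i\<in>?I. d i * (c i n / c i0 n)))"
      have s: "(\<Sum>i\<in>I. e i * c i j) = (\<Sum>i\<in>?I. d i * c' i j)" for j
      proof -
        have "(\<Sum>i\<in>I. e i * c i j) = e i0 * c i0 j + (\<Sum>i\<in>?I. e i * c i j)"
          using Suc.prems i0 by (simp add: sum.remove)
        also have "(\<Sum>i\<in>?I. e i * c i j) = (\<Sum>i\<in>?I. d i * c i j)"
          by (rule sum.cong) (auto simp: e_def)
        finally show ?thesis
          by (simp add: e_def c'_def algebra_simps sum_subtractf sum_distrib_left sum_distrib_right)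
      qed
      have "(\<Sum>i\<in>I. e i * c i n) = 0" unfolding s using i0 by (simp add: c'_def)
      then have "\<forall>j<Suc n. (\<Sum>i\<in>I. e i * c i j) = 0"
        using s d by (auto simp: less_Suc_eq)
      moreover have "\<exists>i\<in>I. e i \<noteq> 0" using d by (auto simp: e_def)
      ultimately show ?thesis by blast
    qed
  qed
  then show ?thesis using that by blast
qed

text \<open>An algebra over the complex numbers given by its structure map, so that the linear
  algebra below serves both polynomials and polynomials over power series.\<close>

locale calg =
  fixes k :: "complex \<Rightarrow> 'a::comm_ring_1"
  assumes k: "ringhom k"
begin

definition lc :: "nat \<Rightarrow> (nat \<Rightarrow> complex) \<Rightarrow> (nat \<Rightarrow> 'a) \<Rightarrow> 'a" where
  "lc n c v = (\<Sum>j<n. k (c j) * v j)"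

definition indep :: "'a set \<Rightarrow> nat \<Rightarrow> (nat \<Rightarrow> 'a) \<Rightarrow> bool" where
  "indep J n v \<longleftrightarrow> (\<forall>c. lc n c v \<in> J \<longrightarrow> (\<forall>j<n. c j = 0))"

definition spans :: "'a set \<Rightarrow> nat \<Rightarrow> (nat \<Rightarrow> 'a) \<Rightarrow> bool" where
  "spans J n v \<longleftrightarrow> (\<forall>p. \<exists>c. p - lc n c v \<in> J)"

text \<open>The codimension as the size of a basis modulo J; as a relation it also records
  finiteness.\<close>

definition hascodim :: "'a set \<Rightarrow> nat \<Rightarrow> bool" where
  "hascodim J n \<longleftrightarrow> (\<exists>v. indep J n v \<and> spans J n v)"

lemma lc_cong: "(\<And>j. j < n \<Longrightarrow> c j = c' j) \<Longrightarrow> (\<And>j. j < n \<Longrightarrow> v j = v' j) \<Longrightarrow> lc n c v = lc n c' v'"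
  by (simp add: lc_def)

lemma lc_Suc: "lc (Suc n) c v = lc n c v + k (c n) * v n"
  by (simp add: lc_def)

lemma lc_mult: "lc n c (\<lambda>j. u * v j) = u * lc n c v"
  by (simp add: lc_def sum_distrib_left ac_simps)

lemma lc_scale: "lc n (\<lambda>j. a * c j) v = k a * lc n c v"
  by (simp add: lc_def sum_distrib_left rh_mult[OF k] ac_simps)

text \<open>Expressing a longer family w through v modulo J gives a homogeneous system with more
  unknowns than equations, hence a dependence of w.\<close>

lemma indep_le_spans:
  assumes J: "ideal J" and v: "spans J n v" and w: "indep J m w"
  shows "m \<le> n"
proof (rule ccontr)
  assume "\<not> m \<le> n"
  then have "card {..<m} > n" by simp
  obtain c where c: "\<And>i. w i - lc n (c i) v \<in> J" using choice[of "\<lambda>i c. w i - lc n c v \<in> J"] v unfolding spans_def by blast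
  obtain d where d: "\<exists>i<m. d i \<noteq> 0" "\<And>j. j < n \<Longrightarrow> (\<Sum>i<m. d i * c i j) = 0"
    by (rule homogeneous_system[OF _ \<open>card {..<m} > n\<close>, of c]) auto
  have "lc m d w - (\<Sum>i<m. k (d i) * lc n (c i) v) = (\<Sum>i<m. k (d i) * (w i - lc n (c i) v))"
    by (simp add: lc_def sum_subtractf algebra_simps)
  also have "\<dots> \<in> J" by (intro ideal_sum ideal_mult J c)
  also have "(\<Sum>i<m. k (d i) * lc n (c i) v) = (\<Sum>i<m. \<Sum>j<n. k (d i * c i j) * v j)"
    by (simp add: lc_def sum_distrib_left rh_mult[OF k] mult.assoc)
  also have "\<dots> = (\<Sum>j<n. k (\<Sum>i<m. d i * c i j) * v j)"
    by (subst sum.swap) (simp add: rh_sum[OF k] sum_distrib_right)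
  also have "\<dots> = 0" using d by (simp add: rh_0[OF k])
  finally have "lc m d w \<in> J" by simp
  then show False using w d unfolding indep_def by blast
qed

lemma hascodim_unique: "ideal J \<Longrightarrow> hascodim J n \<Longrightarrow> hascodim J m \<Longrightarrow> n = m"
  unfolding hascodim_def by (meson antisym indep_le_spans)

lemma indep_mono: "indep J n v \<Longrightarrow> m \<le> n \<Longrightarrow> indep J m v"
  unfolding indep_def
proof safe
  fix c j assume H: "\<forall>c. lc n c v \<in> J \<longrightarrow> (\<forall>j<n. c j = 0)" and "m \<le> n" "lc m c v \<in> J" "j < m"
  let ?c = "\<lambda>j. if j < m then c j else 0"
  have "lc n ?c v = lc m c v"
    unfolding lc_def using \<open>m \<le> n\<close> by (intro sum.mono_neutral_cong_right) (auto simp: rh_0[OF k])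
  then have "lc n ?c v \<in> J" using \<open>lc m c v \<in> J\<close> by simp
  then have "\<forall>i<n. ?c i = 0" by (rule mp[OF spec[OF H, of ?c]])
  then have "?c j = 0" using \<open>j < m\<close> \<open>m \<le> n\<close> less_le_trans by blast
  then show "c j = 0" using \<open>j < m\<close> by simp
qed

lemma indep_subset: "J \<subseteq> J' \<Longrightarrow> indep J' n v \<Longrightarrow> indep J n v"
  unfolding indep_def by blast

text \<open>Links the codimension to the supremum in which \<open>locdim\<close> is stated: the
  sizes of independent families fill the interval up to n.\<close>

lemma Sup_indep:
  assumes "ideal J" "hascodim J n"
  shows "Sup {n. \<exists>v. indep J n v} = n"
proof -
  obtain v where v: "indep J n v" "spans J n v" using assms by (auto simp: hascodim_def)
  then have "{n. \<exists>v. indep J n v} = {..n}"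
    using indep_le_spans[OF assms(1) v(2)] indep_mono[OF v(1)] by auto
  then show ?thesis by simp
qed

lemma indep_extend:
  assumes J: "ideal J" and v: "indep J n v" and p: "\<And>c. p - lc n c v \<notin> J"
  shows "indep J (Suc n) (v(n := p))"
  unfolding indep_def
proof safe
  fix c j assume l: "lc (Suc n) c (v(n := p)) \<in> J" and j: "j < Suc n"
  have e: "lc (Suc n) c (v(n := p)) = lc n c v + k (c n) * p"
    unfolding lc_Suc by (simp add: lc_def)
  have cn: "c n = 0"
  proof (rule ccontr)
    assume cn: "c n \<noteq> 0"
    have "p - lc n (\<lambda>j. - (1 / c n) * c j) v = k (1 / c n) * (lc n c v + k (c n) * p)"
      unfolding lc_scale using cn by (simp add: rh_minus[OF k] algebra_simps rh_mult[OF k, symmetric] mult.assoc[symmetric] rh_1[OF k])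
    also have "\<dots> \<in> J" using l e by (intro ideal_mult J) auto
    finally show False using p by blast
  qed
  then have "lc n c v \<in> J" using l e by (simp add: rh_0[OF k])
  then show "c j = 0" using v cn j unfolding indep_def by (auto simp: less_Suc_eq)
qed

text \<open>An independent family of maximal size spans, since otherwise it could be
  extended.\<close>

lemma hascodim_if_bounded:
  assumes J: "ideal J" and b: "\<And>m v. indep J m v \<Longrightarrow> m \<le> b"
  obtains n where "hascodim J n" "n \<le> b"
proof -
  have "indep J 0 (\<lambda>_. 0)" by (simp add: indep_def)
  then have ex: "\<exists>v. indep J 0 v" by blast
  obtain n where n: "\<exists>v. indep J n v" "\<And>m. \<exists>v. indep J m v \<Longrightarrow> m \<le> n"
    using ex_has_greatest_nat[of "\<lambda>m. \<exists>v. indep J m v" 0 "\<lambda>m. m" "Suc b", OF ex] b by (meson less_Suc_eq_le)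
  then obtain v where v: "indep J n v" by blast
  have "spans J n v"
    unfolding spans_def using indep_extend[OF J v] n(2)[of "Suc n"] by fastforce
  then show ?thesis using that[of n] v b unfolding hascodim_def by blast
qed

lemma hascodim_superset:
  assumes "ideal J" "ideal J'" "J \<subseteq> J'" "hascodim J n"
  obtains m where "hascodim J' m" "m \<le> n"
proof -
  obtain v where v: "spans J n v" using assms by (auto simp: hascodim_def)
  show ?thesis
    by (rule hascodim_if_bounded[OF assms(2)])
      (use indep_le_spans[OF assms(1) v] indep_subset[OF assms(3)] that in blast)+
qed

text \<open>An injective endomorphism of a finite-dimensional space is surjective: u times a basis
  is independent, and adding p to it would exceed the dimension.\<close>

lemma mult_surj_mod:
  assumes J: "ideal J" and n: "hascodim J n" and inj: "\<And>x. u * x \<in> J \<Longrightarrow> x \<in> J"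
  obtains x where "p - u * x \<in> J"
proof -
  obtain v where v: "indep J n v" "spans J n v" using n by (auto simp: hascodim_def)
  let ?w = "\<lambda>j. u * v j"
  have w: "indep J n ?w"
    using v(1) inj unfolding indep_def lc_mult by blast
  have "\<exists>c. p - lc n c ?w \<in> J"
  proof (rule ccontr)
    assume "\<nexists>c. p - lc n c ?w \<in> J"
    then have "indep J (Suc n) (?w(n := p))" by (intro indep_extend[OF J w]) auto
    then show False using indep_le_spans[OF J v(2)] by fastforce
  qed
  then show ?thesis using that by (auto simp: lc_mult)
qed

text \<open>Additivity of the length along the sequence R/(K : x), R/K, R/(K + (x)).\<close>

lemma hascodim_exact:
  assumes K: "ideal K" and K': "ideal K'" "K \<subseteq> K'" "x \<in> K'" and K'': "K'' = {c. c * x \<in> K}"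
    and n1: "hascodim K' n1" and n2: "hascodim K'' n2"
    and dec: "\<And>p. p \<in> K' \<Longrightarrow> \<exists>y. p - y * x \<in> K"
  shows "hascodim K (n1 + n2)"
proof -
  obtain v where v: "indep K' n1 v" "spans K' n1 v" using n1 by (auto simp: hascodim_def)
  obtain w where w: "indep K'' n2 w" "spans K'' n2 w" using n2 by (auto simp: hascodim_def)
  define z where "z j = (if j < n1 then v j else w (j - n1) * x)" for j
  have lz: "lc (n1 + n2) c z = lc n1 c v + lc n2 (\<lambda>j. c (n1 + j)) w * x" for c
  proof -
    have "lc (n1 + n2) c z = (\<Sum>j\<in>{..<n1}. k (c j) * z j) + (\<Sum>j\<in>{n1..<n1+n2}. k (c j) * z j)"
      unfolding lc_def by (metis atLeast0LessThan le_add1 sum.atLeastLessThan_concat zero_le)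
    also have "(\<Sum>j\<in>{n1..<n1+n2}. k (c j) * z j) = (\<Sum>j<n2. k (c (n1 + j)) * z (n1 + j))"
      using sum.shift_bounds_nat_ivl[of "\<lambda>j. k (c j) * z j" 0 n1 n2]
      by (simp add: add.commute atLeast0LessThan)
    finally show ?thesis by (simp add: lc_def z_def sum_distrib_right mult.assoc)
  qed
  have "indep K (n1 + n2) z"
    unfolding indep_def
  proof safe
    fix c j assume l: "lc (n1 + n2) c z \<in> K" and j: "j < n1 + n2"
    have "lc n2 (\<lambda>j. c (n1 + j)) w * x \<in> K'" by (intro ideal_mult K')
    then have "lc n1 c v \<in> K'"
      using l K'(2) unfolding lz using ideal_diff[OF K'(1)] by fastforce
    then have c1: "\<And>i. i < n1 \<Longrightarrow> c i = 0" using v(1) by (auto simp: indep_def)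
    then have "lc n1 c v = 0" by (simp add: lc_def rh_0[OF k])
    then have "lc n2 (\<lambda>j. c (n1 + j)) w \<in> K''" using l unfolding lz K'' by simp
    then have "\<And>i. i < n2 \<Longrightarrow> c (n1 + i) = 0" using w(1) by (auto simp: indep_def)
    then show "c j = 0" using c1[of j] j by (metis add_diff_inverse_nat nat_add_left_cancel_less)
  qed
  moreover have "spans K (n1 + n2) z"
    unfolding spans_def
  proof
    fix p
    obtain c where c: "p - lc n1 c v \<in> K'" using v(2) by (auto simp: spans_def)
    then obtain y where y: "p - lc n1 c v - y * x \<in> K" using dec by blast
    obtain d where "y - lc n2 d w \<in> K''" using w(2) by (auto simp: spans_def)
    then have d: "y * x - lc n2 d w * x \<in> K" by (simp add: K'' algebra_simps)
    define e where "e j = (if j < n1 then c j else d (j - n1))" for j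
    have "lc (n1 + n2) e z = lc n1 c v + lc n2 d w * x"
      unfolding lz by (simp add: e_def cong: lc_cong)
    then have "p - lc (n1 + n2) e z \<in> K" using ideal_add[OF K y d] by (simp add: algebra_simps)
    then show "\<exists>c. p - lc (n1 + n2) c z \<in> K" by blast
  qed
  ultimately show ?thesis unfolding hascodim_def by blast
qed

lemma hascodim_UNIV: "hascodim UNIV 0"
  by (auto simp: hascodim_def indep_def spans_def)

end

section \<open>Localization at a point\<close>

locale pointed_calg = calg +
  fixes ev :: "'a \<Rightarrow> complex"
  assumes ev: "ringhom ev"
begin

text \<open>The contraction of the extension of I to the localization at the point given by ev.\<close>

definition sat :: "'a set \<Rightarrow> 'a set" where
  "sat I = {p. \<exists>u. ev u \<noteq> 0 \<and> u * p \<in> I}"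

lemma sat_superset: "I \<subseteq> sat I"
  unfolding sat_def using rh_1[OF ev] by (auto intro!: exI[of _ 1])

lemma sat_mono: "I \<subseteq> I' \<Longrightarrow> sat I \<subseteq> sat I'"
  unfolding sat_def by blast

lemma ideal_sat:
  assumes I: "ideal I" shows "ideal (sat I)"
  unfolding ideal_def
proof (intro conjI ballI allI)
  show "0 \<in> sat I" using sat_superset ideal_0[OF I] by blast
next
  fix x y assume "x \<in> sat I" "y \<in> sat I"
  then obtain u v where u: "ev u \<noteq> 0" "u * x \<in> I" "ev v \<noteq> 0" "v * y \<in> I" by (auto simp: sat_def)
  then have "(u * v) * (x + y) \<in> I"
    using ideal_add[OF I ideal_mult[OF I u(2), of v] ideal_mult[OF I u(4), of u]]
    by (simp add: algebra_simps)
  then show "x + y \<in> sat I" using u by (auto simp: sat_def rh_mult[OF ev] intro!: exI[of _ "u * v"])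
next
  fix x r assume "x \<in> sat I"
  then obtain u where u: "ev u \<noteq> 0" "u * x \<in> I" by (auto simp: sat_def)
  then have "u * (r * x) \<in> I" using ideal_mult[OF I u(2), of r] by (simp add: ac_simps)
  then show "r * x \<in> sat I" using u by (auto simp: sat_def)
qed

lemma sat_unit:
  assumes "ev u \<noteq> 0" "u * x \<in> sat I" shows "x \<in> sat I"
proof -
  obtain v where "ev v \<noteq> 0" "v * (u * x) \<in> I" using assms(2) by (auto simp: sat_def)
  then have "ev (v * u) \<noteq> 0" "(v * u) * x \<in> I" using assms(1) by (auto simp: rh_mult[OF ev] mult.assoc)
  then show ?thesis unfolding sat_def by blast
qed

text \<open>Localization is exact. What needs an argument is that an element of
  \<open>sat I'\<close> is a multiple of x modulo \<open>sat I\<close> without a denominator: u acts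
  injectively on the quotient by the saturated colon ideal, whose finite dimension makes it
  surjective there.\<close>

lemma hascodim_sat_exact:
  assumes I: "ideal I" and I': "\<And>p. p \<in> I' \<longleftrightarrow> (\<exists>y. p - y * x \<in> I)"
    and I'': "I'' = {c. c * x \<in> I}"
    and n1: "hascodim (sat I') n1" and n2: "hascodim (sat I'') n2"
  shows "hascodim (sat I) (n1 + n2)"
proof -
  have "I' = idl (insert x I)"
    using I' idl_insert[of _ x I] idl_least[OF I, of I] idl_superset[of _ I] by blast
  then have iI': "ideal I'" by (simp add: ideal_idl)
  have sub: "I \<subseteq> I'" 
  proof
    fix p assume "p \<in> I"
    then have "p - 0 * x \<in> I" by simp
    then show "p \<in> I'" unfolding I' by blast
  qed
  have xI': "x \<in> I'" 
  proof -
    have "x - 1 * x \<in> I" using ideal_0[OF I] by simp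
    then show ?thesis unfolding I' by blast
  qed
  have s: "sat I'' = {c. c * x \<in> sat I}"
    unfolding I'' sat_def by (simp add: mult.assoc)
  have iI'': "ideal I''"
    unfolding I'' ideal_def using ideal_0[OF I] ideal_add[OF I] ideal_mult[OF I]
    by (auto simp: distrib_right mult.assoc)
  have "\<exists>y. p - y * x \<in> sat I" if p: "p \<in> sat I'" for p
  proof -
    obtain u where u: "ev u \<noteq> 0" "u * p \<in> I'" using p by (auto simp: sat_def)
    then obtain y where y: "u * p - y * x \<in> I" using I' by blast
    obtain y' where "y - u * y' \<in> sat I''"
      by (rule mult_surj_mod[OF ideal_sat[OF iI''] n2, of u y]) (use sat_unit[OF u(1)] in auto)
    then have "(y - u * y') * x \<in> sat I" using s by blast
    moreover have "u * p - y * x \<in> sat I" using y sat_superset by blast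
    ultimately have "u * (p - y' * x) \<in> sat I"
      using ideal_add[OF ideal_sat[OF I]] by (fastforce simp: algebra_simps)
    then show ?thesis using sat_unit[OF u(1)] by blast
  qed
  moreover have "x \<in> sat I'" using sat_superset xI' by blast
  ultimately show ?thesis
    using hascodim_exact[OF ideal_sat[OF I] ideal_sat[OF iI'] sat_mono[OF sub] _ s n1 n2] by blast
qed

end

section \<open>Intersection numbers\<close>

text \<open>Throughout, in a polynomial ring in two variables the outer variable is called s and the inner
  variable t, so that B stands for the ring of polynomials in s, t and Q for the polynomials in s
  over power series in t.\<close>

definition kB :: "complex \<Rightarrow> complex poly poly" where "kB c = [:[:c:]:]"
definition evB :: "complex poly poly \<Rightarrow> complex" where "evB p = poly (poly p 0) 0"
definition kQ :: "complex \<Rightarrow> complex fps poly" where "kQ c = [:fps_const c:]"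
definition XQ :: "complex fps poly" where "XQ = [:fps_X:]"

interpretation B: pointed_calg kB evB
  by unfold_locales (auto simp: ringhom_def kB_def evB_def one_pCons)

interpretation Q: calg kQ
  by unfold_locales (auto simp: ringhom_def kQ_def one_pCons fps_const_mult[symmetric] simp del: fps_const_mult)

lemma lcQ_poly: "poly (Q.lc n c v) z = (\<Sum>j<n. fps_const (c j) * poly (v j) z)"
  by (simp add: Q.lc_def poly_sum kQ_def)

lemma linear_dvd: "poly p z = 0 \<Longrightarrow> \<exists>q. (p :: complex fps poly) = q * [:- z, 1:]"
  by (metis dvdE mult.commute poly_eq_0_iff_dvd)

text \<open>Setting s = z identifies the quotient by s - z with the power series in one variable,
  where \<phi> generates the same ideal as a power of X.\<close>

lemma codim_linear:
  fixes \<phi> :: "complex fps poly"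
  assumes nz: "poly \<phi> z \<noteq> 0"
  shows "Q.hascodim (idl {[:- z, 1:], \<phi>}) (subdegree (poly \<phi> z))"
proof -
  define n where "n = subdegree (poly \<phi> z)"
  have mem: "p \<in> idl {[:- z, 1:], \<phi>} \<longleftrightarrow> (\<forall>j<n. poly p z $ j = 0)" for p
  proof
    assume "p \<in> idl {[:- z, 1:], \<phi>}"
    then obtain x y where "p = x * [:- z, 1:] + y * \<phi>" unfolding idl_2 by blast
    then have "poly p z = poly y z * poly \<phi> z" by simp
    then have "poly \<phi> z dvd poly p z" by simp
    then have "poly p z = 0 \<or> n \<le> subdegree (poly p z)"
      using dvd_imp_subdegree_le n_def by blast
    then show "\<forall>j<n. poly p z $ j = 0" by (auto intro: nth_less_subdegree_zero)
  next
    assume H: "\<forall>j<n. poly p z $ j = 0"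
    have "poly \<phi> z dvd poly p z"
    proof (cases "poly p z = 0")
      case False
      then have "n \<le> subdegree (poly p z)" using H by (intro subdegree_geI) auto
      then show ?thesis using nz False by (simp add: fps_dvd_iff n_def)
    qed simp
    then obtain y where "poly p z = y * poly \<phi> z" by (metis dvdE mult.commute)
    then have "poly (p - [:y:] * \<phi>) z = 0" by simp
    then obtain x where "p - [:y:] * \<phi> = x * [:- z, 1:]" using linear_dvd by blast
    then have "p = x * [:- z, 1:] + [:y:] * \<phi>" by (simp only: diff_eq_eq)
    then show "p \<in> idl {[:- z, 1:], \<phi>}" unfolding idl_2 by blast
  qed
  define v :: "nat \<Rightarrow> complex fps poly" where "v j = [:fps_X ^ j:]" for j
  have l: "poly (Q.lc n c v) z $ i = (if i < n then c i else 0)" for c i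
    by (simp add: lcQ_poly v_def fps_sum_nth fps_X_power_nth if_distrib sum.delta' cong: if_cong)
  have "Q.indep (idl {[:- z, 1:], \<phi>}) n v"
    unfolding Q.indep_def mem by (simp add: l)
  moreover have "Q.spans (idl {[:- z, 1:], \<phi>}) n v"
    unfolding Q.spans_def mem by (auto simp: l intro!: exI[of _ "\<lambda>j. poly p z $ j" for p])
  ultimately show ?thesis unfolding Q.hascodim_def n_def by blast
qed

text \<open>The factor x = s - z is peeled off by an exact sequence. The colon ideal of x is (P,
  \<phi>): since \<phi> does not vanish at z, the coefficient of \<phi> in a multiple of x is itself
  a multiple of x.\<close>

lemma codim_linear_prod:
  fixes \<phi> :: "complex fps poly"
  assumes "\<And>z. z \<in> set xs \<Longrightarrow> poly \<phi> z \<noteq> 0"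
  shows "Q.hascodim (idl {\<Prod>z\<leftarrow>xs. [:- z, 1:], \<phi>}) (\<Sum>z\<leftarrow>xs. subdegree (poly \<phi> z))"
  using assms
proof (induction xs)
  case Nil
  have "idl {1, \<phi>} = UNIV"
    using ideal_mult[OF ideal_idl, of 1 "{1, \<phi>}"] idl_superset[of 1 "{1, \<phi>}"] by auto
  then show ?case using Q.hascodim_UNIV by simp
next
  case (Cons z xs)
  define x where "x = [:- z, 1:]"
  define P where "P = (\<Prod>z\<leftarrow>xs. [:- z, 1:])"
  have nz: "poly \<phi> z \<noteq> 0" using Cons by simp
  have xz: "poly x z = 0" "x \<noteq> 0" by (simp_all add: x_def)
  have "Q.hascodim (idl {x * P, \<phi>}) (subdegree (poly \<phi> z) + (\<Sum>z\<leftarrow>xs. subdegree (poly \<phi> z)))"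
  proof (rule Q.hascodim_exact[where K' = "idl {x, \<phi>}" and K'' = "idl {P, \<phi>}" and x = x])
    show "idl {x * P, \<phi>} \<subseteq> idl {x, \<phi>}"
      by (rule idl_least[OF ideal_idl]) (auto intro: ideal_mult' ideal_idl idl_superset)
    show "idl {P, \<phi>} = {c. c * x \<in> idl {x * P, \<phi>}}"
    proof safe
      fix c assume "c \<in> idl {P, \<phi>}"
      then obtain a b where "c = a * P + b * \<phi>" unfolding idl_2 by blast
      then have "c * x = a * (x * P) + (b * x) * \<phi>" by (simp only: algebra_simps)
      then show "c * x \<in> idl {x * P, \<phi>}" unfolding idl_2 by blast
    next
      fix c assume "c * x \<in> idl {x * P, \<phi>}"
      then obtain a b where e: "c * x = a * (x * P) + b * \<phi>" unfolding idl_2 by blast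
      then have "poly (c * x) z = poly (a * (x * P) + b * \<phi>) z" by (rule arg_cong)
      then have "poly b z = 0" using nz xz by simp
      then obtain b' where "b = b' * x" using linear_dvd x_def by blast
      then have "x * c = x * (a * P + b' * \<phi>)" using e by (simp only: algebra_simps)
      then have "c = a * P + b' * \<phi>" using xz by simp
      then show "c \<in> idl {P, \<phi>}" unfolding idl_2 by blast
    qed
    show "Q.hascodim (idl {x, \<phi>}) (subdegree (poly \<phi> z))"
      unfolding x_def by (rule codim_linear[OF nz])
    show "Q.hascodim (idl {P, \<phi>}) (\<Sum>z\<leftarrow>xs. subdegree (poly \<phi> z))"
      unfolding P_def using Cons by simp
    fix p assume "p \<in> idl {x, \<phi>}"
    then obtain a b where "p - a * x = b * \<phi>" unfolding idl_2 by (auto simp: algebra_simps)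
    then have "p - a * x = 0 * (x * P) + b * \<phi>" by simp
    then show "\<exists>y. p - y * x \<in> idl {x * P, \<phi>}" unfolding idl_2 by blast
  qed (auto intro: ideal_idl idl_superset)
  then show ?case by (simp add: x_def P_def del: mult_pCons_left)
qed

text \<open>The components of c with respect to the basis 1, X, ..., X^(N-1) over the power series in X^N.\<close>

definition dec :: "nat \<Rightarrow> nat \<Rightarrow> complex fps \<Rightarrow> complex fps" where
  "dec N i c = Abs_fps (\<lambda>m. c $ (N * m + i))"

definition decp :: "nat \<Rightarrow> nat \<Rightarrow> complex fps poly \<Rightarrow> complex fps poly" where
  "decp N i = map_poly (dec N i)"

lemma dec_nth [simp]: "dec N i c $ m = c $ (N * m + i)"
  by (simp add: dec_def)

lemma dec_add: "dec N i (a + b) = dec N i a + dec N i b"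
  by (rule fps_ext) simp

lemma dec_0 [simp]: "dec N i 0 = 0"
  by (rule fps_ext) simp

lemma dec_sub_mult:
  assumes N: "N > 0" and i: "i < N"
  shows "dec N i (sub N a * b) = a * dec N i b"
proof (rule fps_ext)
  fix m
  have "dec N i (sub N a * b) $ m = (\<Sum>j\<in>{0..N * m + i}. sub N a $ j * b $ (N * m + i - j))"
    by (simp add: fps_mult_nth)
  also have "\<dots> = (\<Sum>j\<in>(\<lambda>l. N * l) ` {0..m}. sub N a $ j * b $ (N * m + i - j))"
  proof (rule sum.mono_neutral_right)
    show "(\<lambda>l. N * l) ` {0..m} \<subseteq> {0..N * m + i}" by (auto intro!: trans_le_add1)
    show "\<forall>j\<in>{0..N * m + i} - (\<lambda>l. N * l) ` {0..m}. sub N a $ j * b $ (N * m + i - j) = 0"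
    proof
      fix j assume j: "j \<in> {0..N * m + i} - (\<lambda>l. N * l) ` {0..m}"
      have "\<not> N dvd j"
      proof
        assume "N dvd j"
        then obtain l where l: "j = N * l" by auto
        with j have "N * l \<le> N * m + i" "l \<notin> {0..m}" by auto
        then have "l \<ge> Suc m" by auto
        then have "N * l \<ge> N * Suc m" by (rule mult_le_mono2)
        then show False using \<open>N * l \<le> N * m + i\<close> i by simp
      qed
      then show "sub N a $ j * b $ (N * m + i - j) = 0" using N by (simp add: sub_nth)
    qed
  qed simp
  also have "\<dots> = (\<Sum>l\<in>{0..m}. sub N a $ (N * l) * b $ (N * m + i - N * l))"
    using N by (subst sum.reindex) (auto simp: inj_on_def)
  also have "\<dots> = (\<Sum>l\<in>{0..m}. a $ l * b $ (N * (m - l) + i))"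
  proof (rule sum.cong)
    fix l assume "l \<in> {0..m}"
    then have "N * m + i - N * l = N * (m - l) + i" by (simp add: diff_mult_distrib2)
    then show "sub N a $ (N * l) * b $ (N * m + i - N * l) = a $ l * b $ (N * (m - l) + i)"
      using N by (simp add: sub_nth)
  qed simp
  finally show "dec N i (sub N a * b) $ m = (a * dec N i b) $ m"
    by (simp add: fps_mult_nth)
qed

lemma dec_decompose:
  assumes N: "N > 0"
  shows "c = (\<Sum>i<N. fps_X ^ i * sub N (dec N i c))"
proof (rule fps_ext)
  fix m
  have "(\<Sum>i<N. fps_X ^ i * sub N (dec N i c)) $ m = (\<Sum>i<N. if m mod N = i then c $ m else 0)"
    unfolding fps_sum_nth
  proof (rule sum.cong)
    fix i assume i: "i \<in> {..<N}"
    show "(fps_X ^ i * sub N (dec N i c)) $ m = (if m mod N = i then c $ m else 0)"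
    proof (cases "m mod N = i")
      case True
      then have "i \<le> m" "m - i = N * (m div N)" "N * (m div N) + i = m"
        by (auto simp: minus_mod_eq_mult_div)
      then show ?thesis using True N by (simp add: fps_X_power_mult_nth sub_nth)
    next
      case False
      have "\<not> (i \<le> m \<and> N dvd m - i)"
        using False i by (metis lessThan_iff mod_eq_dvd_iff_nat mod_less)
      then show ?thesis using False N by (auto simp: fps_X_power_mult_nth sub_nth)
    qed
  qed simp
  then show "c $ m = (\<Sum>i<N. fps_X ^ i * sub N (dec N i c)) $ m" using N by (simp add: sum.delta)
qed

lemma decp_add: "decp N i (a + b) = decp N i a + decp N i b"
  by (rule poly_eqI) (simp add: decp_def coeff_map_poly dec_add)

lemma decp_0 [simp]: "decp N i 0 = 0"
  by (simp add: decp_def)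

lemma decp_sum: "decp N i (sum f A) = (\<Sum>x\<in>A. decp N i (f x))"
  by (induction A rule: infinite_finite_induct) (auto simp: decp_add)

lemma dec_sum: "dec N i (sum f A) = (\<Sum>x\<in>A. dec N i (f x))"
  by (induction A rule: infinite_finite_induct) (auto simp: dec_add)

lemma decp_sub_mult:
  assumes N: "N > 0" and i: "i < N"
  shows "decp N i (map_poly (sub N) a * b) = a * decp N i b"
  by (rule poly_eqI) (simp add: decp_def coeff_map_poly coeff_mult dec_sum
      rh_0[OF ringhom_sub[OF N]] dec_sub_mult[OF assms])

lemma decp_decompose:
  assumes N: "N > 0"
  shows "p = (\<Sum>i<N. XQ ^ i * map_poly (sub N) (decp N i p))"
  by (rule poly_eqI) (subst dec_decompose[OF N], simp add: coeff_sum XQ_def decp_def coeff_map_poly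
      rh_0[OF ringhom_sub[OF N]] poly_const_pow)

lemma decp_X_power:
  assumes "i < N" "j < N"
  shows "decp N i (XQ ^ j) = (if i = j then 1 else 0)"
proof -
  have "N * m + i = j \<longleftrightarrow> m = 0 \<and> i = j" for m using assms by (cases m) auto
  then have "dec N i (fps_X ^ j) = (if i = j then 1 else 0)"
    by (intro fps_ext) (auto simp: fps_X_power_nth)
  then show ?thesis
    by (intro poly_eqI) (auto simp: decp_def coeff_map_poly XQ_def poly_const_pow coeff_pCons one_pCons split: nat.splits)
qed

text \<open>The ring is free over its image under X -> X^N with basis 1, ..., X^(N-1). An element
  lies in the extended ideal iff its N components lie in the original one, so the codimension is
  multiplied by N.\<close>

lemma codim_base_change:
  assumes N: "N > 0" and n': "Q.hascodim (idl {map_poly (sub N) G, map_poly (sub N) \<phi>}) n'"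
  obtains n where "Q.hascodim (idl {G, \<phi>}) n" "n' = n * N"
proof -
  define F where "F = map_poly (sub N)"
  have F: "ringhom F" unfolding F_def by (rule ringhom_map_poly[OF ringhom_sub[OF N]])
  let ?J = "idl {G, \<phi>}" and ?J' = "idl {F G, F \<phi>}"
  note iJ = ideal_idl[of "{G, \<phi>}"] and iJ' = ideal_idl[of "{F G, F \<phi>}"]
  have FJ: "F p \<in> ?J'" if p: "p \<in> ?J" for p
  proof -
    obtain x y where "p = x * G + y * \<phi>" using p unfolding idl_2 by blast
    then have "F p = F x * F G + F y * F \<phi>" by (simp add: rh_add[OF F] rh_mult[OF F])
    then show ?thesis unfolding idl_2 by blast
  qed
  have dm: "decp N i (F a * b) = a * decp N i b" if "i < N" for i a b
    unfolding F_def by (rule decp_sub_mult[OF N that])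
  have mem: "p \<in> ?J' \<longleftrightarrow> (\<forall>i<N. decp N i p \<in> ?J)" for p
  proof
    assume "p \<in> ?J'"
    then obtain x y where p: "p = x * F G + y * F \<phi>" unfolding idl_2 by blast
    have "decp N i p = decp N i x * G + decp N i y * \<phi>" if "i < N" for i
      using dm[OF that, of G x] dm[OF that, of \<phi> y] by (simp add: p decp_add mult.commute)
    then show "\<forall>i<N. decp N i p \<in> ?J" unfolding idl_2 by blast
  next
    assume "\<forall>i<N. decp N i p \<in> ?J"
    then have "(\<Sum>i<N. XQ ^ i * F (decp N i p)) \<in> ?J'"
      by (intro ideal_sum ideal_mult iJ' FJ) auto
    then show "p \<in> ?J'" using decp_decompose[OF N, of p] by (simp add: F_def)
  qed
  \<comment> \<open>Member number j N + r of the extended family is X^r times the image of the j-th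
    member of v.\<close>
  define w where "w v i = XQ ^ (i mod N) * F (v (i div N))" for v :: "nat \<Rightarrow> complex fps poly" and i
  have kF: "kQ c = F (kQ c)" for c
    by (simp add: F_def kQ_def map_poly_pCons_rh[OF ringhom_sub[OF N]] sub_def)
  have dl: "decp N i (Q.lc (n * N) c (w v)) = Q.lc n (\<lambda>j. c (j * N + i)) v" if i: "i < N" for i n c v
  proof -
    have "decp N i (Q.lc (n * N) c (w v)) = (\<Sum>l<n * N. decp N i (kQ (c l) * w v l))"
      by (simp add: Q.lc_def decp_sum)
    also have "\<dots> = (\<Sum>l<n * N. if i = l mod N then kQ (c l) * v (l div N) else 0)"
    proof (rule sum.cong)
      fix l
      have "kQ (c l) * w v l = F (kQ (c l) * v (l div N)) * XQ ^ (l mod N)"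
        using kF[of "c l"] by (simp add: w_def rh_mult[OF F] ac_simps)
      then show "decp N i (kQ (c l) * w v l) = (if i = l mod N then kQ (c l) * v (l div N) else 0)"
        using i N by (simp add: dm decp_X_power)
    qed simp
    also have "\<dots> = (\<Sum>j<n. \<Sum>l\<in>{j * N..<j * N + N}. if i = l mod N then kQ (c l) * v (l div N) else 0)"
      by (rule sum.nat_group[symmetric])
    also have "\<dots> = (\<Sum>j<n. kQ (c (j * N + i)) * v j)"
    proof (rule sum.cong)
      fix j
      have "(\<Sum>l\<in>{j * N..<j * N + N}. if i = l mod N then kQ (c l) * v (l div N) else 0)
          = (\<Sum>l\<in>{j * N..<j * N + N}. if l = j * N + i then kQ (c l) * v (l div N) else 0)"
      proof (rule sum.cong)
        fix l assume l: "l \<in> {j * N..<j * N + N}"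
        then obtain r where r: "l = j * N + r" "r < N"
          by (metis atLeastLessThan_iff le_add_diff_inverse nat_add_left_cancel_less)
        then have "l mod N = r" by simp
        with r show "(if i = l mod N then kQ (c l) * v (l div N) else 0) = (if l = j * N + i then kQ (c l) * v (l div N) else 0)"
          by auto
      qed simp
      also have "\<dots> = kQ (c (j * N + i)) * v ((j * N + i) div N)" using i by (simp add: sum.delta)
      also have "(j * N + i) div N = j" using i by simp
      finally show "(\<Sum>l\<in>{j * N..<j * N + N}. if i = l mod N then kQ (c l) * v (l div N) else 0) = kQ (c (j * N + i)) * v j" .
    qed simp
    finally show ?thesis by (simp add: Q.lc_def)
  qed
  have ind: "Q.indep ?J' (n * N) (w v)" if v: "Q.indep ?J n v" for n v
    unfolding Q.indep_def
  proof (intro allI impI)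
    fix c l assume "Q.lc (n * N) c (w v) \<in> ?J'" and l: "l < n * N"
    then have "\<forall>i<N. Q.lc n (\<lambda>j. c (j * N + i)) v \<in> ?J" unfolding mem by (simp add: dl)
    then have H: "\<And>i j. i < N \<Longrightarrow> j < n \<Longrightarrow> c (j * N + i) = 0" using v unfolding Q.indep_def by blast
    have "l div N < n" using l N by (simp add: less_mult_imp_div_less)
    then show "c l = 0" using H[of "l mod N" "l div N"] N by simp
  qed
  have n'J: "Q.hascodim ?J' n'" using n' by (simp add: F_def)
  then obtain v' where v': "Q.spans ?J' n' v'" by (auto simp: Q.hascodim_def)
  have "m \<le> n'" if "Q.indep ?J m v" for m v
    using Q.indep_le_spans[OF iJ' v' ind[OF that]] N by (metis dual_order.trans mult_le_mono2 nat_mult_1_right One_nat_def Suc_leI)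
  then obtain n where n: "Q.hascodim ?J n" using Q.hascodim_if_bounded[OF iJ] by metis
  then obtain v where v: "Q.indep ?J n v" "Q.spans ?J n v" by (auto simp: Q.hascodim_def)
  have "Q.spans ?J' (n * N) (w v)"
    unfolding Q.spans_def
  proof
    fix p
    have "\<forall>i. \<exists>c. decp N i p - Q.lc n c v \<in> ?J" using v(2) by (auto simp: Q.spans_def)
    then obtain c where c: "\<And>i. decp N i p - Q.lc n (c i) v \<in> ?J" by metis
    define e where "e l = c (l mod N) (l div N)" for l
    have "decp N i (p - Q.lc (n * N) e (w v)) = decp N i p - Q.lc n (c i) v" if "i < N" for i
    proof -
      have "decp N i (p - Q.lc (n * N) e (w v)) + decp N i (Q.lc (n * N) e (w v)) = decp N i p"
        by (simp add: decp_add[symmetric])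
      moreover have "decp N i (Q.lc (n * N) e (w v)) = Q.lc n (c i) v"
        unfolding dl[OF that] by (rule Q.lc_cong) (use that in \<open>auto simp: e_def\<close>)
      ultimately show ?thesis by (simp add: eq_diff_eq)
    qed
    then have "p - Q.lc (n * N) e (w v) \<in> ?J'" unfolding mem using c by simp
    then show "\<exists>c. p - Q.lc (n * N) c (w v) \<in> ?J'" by blast
  qed
  then have "Q.hascodim ?J' (n * N)" using ind[OF v(1)] by (auto simp: Q.hascodim_def)
  then have "n' = n * N" using Q.hascodim_unique[OF iJ' n'J] by simp
  then show ?thesis using that n by blast
qed

section \<open>Comparison of local lengths over polynomials and over power series\<close>

definition io :: "complex poly poly \<Rightarrow> complex fps poly" where
  "io = map_poly fps_of_poly"

lemma ringhom_fps_of_poly: "ringhom fps_of_poly"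
  by (simp add: ringhom_def fps_of_poly_add fps_of_poly_mult)

lemma ringhom_io: "ringhom io"
  unfolding io_def by (rule ringhom_map_poly[OF ringhom_fps_of_poly])

lemma io_pCons: "io (pCons c p) = pCons (fps_of_poly c) (io p)"
  unfolding io_def by (rule map_poly_pCons_rh[OF ringhom_fps_of_poly])

lemma coeff_io: "coeff (io p) j = fps_of_poly (coeff p j)"
  by (simp add: io_def coeff_map_poly)

lemma io_kB: "io (kB c) = kQ c"
  by (simp add: kB_def kQ_def io_pCons fps_of_poly_const rh_0[OF ringhom_io])

lemma io_lc: "io (B.lc n c v) = Q.lc n c (\<lambda>j. io (v j))"
  by (simp add: B.lc_def Q.lc_def rh_sum[OF ringhom_io] rh_mult[OF ringhom_io] io_kB)

lemma tc_io_0: "tc 0 (io p) = map_poly (\<lambda>c. poly c 0) p"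
  by (rule poly_eqI) (simp add: coeff_tc coeff_io coeff_map_poly poly_0_coeff_0)

definition evQ :: "complex fps poly \<Rightarrow> complex" where "evQ p = coeff p 0 $ 0"

lemma ringhom_evQ: "ringhom evQ"
  by (simp add: ringhom_def evQ_def coeff_mult_0)

lemma evB_evQ: "evB p = evQ (io p)"
  by (simp add: evB_def evQ_def coeff_io poly_0_coeff_0)

text \<open>Replaces power series coefficients by polynomials; the error is absorbed wherever a
  power of the inner variable lies in the ideal.\<close>

lemma truncate:
  obtains b q where "p = io b + XQ ^ K * q"
proof
  show "p = io (map_poly (\<lambda>c. Poly (map (fps_nth c) [0..<K])) p) + XQ ^ K * map_poly (fps_shift K) p"
  proof (rule poly_eqI)
    fix j
    have c0: "Poly (map (fps_nth (0 :: complex fps)) [0..<K]) = 0"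
      by (rule poly_eqI) (simp add: nth_default_def coeff_Poly_eq)
    have "coeff p j = fps_of_poly (Poly (map (fps_nth (coeff p j)) [0..<K])) + fps_X ^ K * fps_shift K (coeff p j)"
      by (rule fps_ext) (auto simp: fps_X_power_mult_nth nth_default_def coeff_Poly_eq)
    then show "coeff p j = coeff (io (map_poly (\<lambda>c. Poly (map (fps_nth c) [0..<K])) p) + XQ ^ K * map_poly (fps_shift K) p) j"
      using c0 by (simp add: coeff_io coeff_map_poly XQ_def poly_const_pow)
  qed
qed

text \<open>With f = - e w the product (u + e) w is 1 - f modulo J, and a finite geometric series
  inverts 1 - f because a power of f lies in J.\<close>

lemma nilpotent_unit:
  fixes J :: "'a::comm_ring_1 set"
  assumes J: "ideal J" and w: "u * w - 1 \<in> J" and e: "e ^ M \<in> J"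
  obtains w' where "(u + e) * w' - 1 \<in> J"
proof -
  define f where "f = - (e * w)"
  have f: "f ^ M \<in> J"
    using ideal_mult[OF J e, of "(-1) ^ M * w ^ M"]
    by (simp add: f_def power_mult_distrib[symmetric] mult.commute)
  obtain s where s: "1 - f ^ M = (1 - f) * s"
    using dvdE[of "1 - f" "1 ^ M - f ^ M"] by (metis power_one dvd_def power_diff_sumr2)
  have "(u + e) * (w * s) - 1 = (u * w - 1) * s + ((1 - f) * s - 1)"
    by (simp add: f_def algebra_simps)
  also have "\<dots> = (u * w - 1) * s - f ^ M" by (simp add: s[symmetric])
  also have "\<dots> \<in> J" by (intro ideal_diff J ideal_mult' w f)
  finally show ?thesis using that by blast
qed

text \<open>The first n + 1 powers of X are dependent modulo J, so J contains a nonzero power series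
  in X alone, which is a power of X times a unit.\<close>

lemma X_power_in_ideal:
  assumes J: "ideal J" and n: "Q.hascodim J n"
  obtains K where "XQ ^ K \<in> J"
proof -
  obtain v where v: "Q.spans J n v" using n by (auto simp: Q.hascodim_def)
  have "\<not> Q.indep J (Suc n) (\<lambda>j. XQ ^ j)" using Q.indep_le_spans[OF J v] by fastforce
  then obtain c i where c: "Q.lc (Suc n) c (\<lambda>j. XQ ^ j) \<in> J" and i: "i < Suc n" "c i \<noteq> 0"
    unfolding Q.indep_def by blast
  define a where "a = (\<Sum>j<Suc n. fps_const (c j) * fps_X ^ j)"
  have "Q.lc (Suc n) c (\<lambda>j. XQ ^ j) = [:a:]"
    by (rule poly_eqI) (simp add: a_def Q.lc_def kQ_def XQ_def poly_const_pow coeff_sum coeff_pCons mult.commute split: nat.splits)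
  then have aJ: "[:a:] \<in> J" using c by simp
  have "a $ i = c i" using i by (simp add: a_def fps_sum_nth fps_X_power_nth if_distrib sum.delta' cong: if_cong)
  then have "a \<noteq> 0" using i by auto
  then obtain b where "fps_X ^ subdegree a = a * b"
    using subdegree_decompose[of a] by (metis dvdE fps_dvd_iff fps_X_power_subdegree le_refl power_eq_0_iff fps_X_neq_zero)
  then have "XQ ^ subdegree a = [:a:] * [:b:]" by (simp add: XQ_def poly_const_pow)
  then have "XQ ^ subdegree a \<in> J" using ideal_mult'[OF J aJ, of "[:b:]"] by (simp only:)
  then show ?thesis using that by blast
qed

text \<open>Bezout's identity over the fraction field of the coefficients, with denominators
  cleared. Here d is a nonzero combination of least degree, so pseudo-division of any combination by
  d leaves no remainder.\<close>

lemma bezout_const: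
  fixes p q :: "'a::idom poly"
  assumes "p \<noteq> 0"
  obtains A B d c where "A * p + B * q = d" "d \<noteq> 0" "c \<noteq> 0" "d dvd smult c p" "d dvd smult c q"
proof -
  define P where "P d \<longleftrightarrow> d \<noteq> 0 \<and> (\<exists>A B. A * p + B * q = d)" for d
  have "P p" using assms unfolding P_def by (metis add.right_neutral mult_1 mult_zero_left)
  then obtain d where d: "P d" "\<And>e. P e \<Longrightarrow> degree d \<le> degree e"
    using ex_has_least_nat[of P p degree] by blast
  obtain A B where AB: "A * p + B * q = d" and d0: "d \<noteq> 0" using d(1) unfolding P_def by blast
  have *: "\<exists>c. c \<noteq> 0 \<and> d dvd smult c x" if xpq: "\<exists>A B. A * p + B * q = x" for x
  proof -
    obtain u v where pd: "pseudo_divmod x d = (u, v)" by fastforce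
    let ?c = "coeff d (degree d) ^ (Suc (degree x) - degree d)"
    from pseudo_divmod[OF d0 pd] have e: "smult ?c x = d * u + v" and v: "v = 0 \<or> degree v < degree d" by auto
    obtain A' B' where x: "A' * p + B' * q = x" using xpq by blast
    have "v = ([:?c:] * A' - u * A) * p + ([:?c:] * B' - u * B) * q"
    proof -
      have "v = [:?c:] * x - u * d" using e by simp
      then show ?thesis unfolding x[symmetric] AB[symmetric] by (simp only: algebra_simps)
    qed
    then have "v = 0" using v d(2)[of v] unfolding P_def by (metis leD)
    then have "d dvd smult ?c x" using e by simp
    moreover have "?c \<noteq> 0" using d0 by simp
    ultimately show ?thesis by blast
  qed
  obtain c1 where c1: "c1 \<noteq> 0" "d dvd smult c1 p" using *[of p] by (metis add.right_neutral mult_1 mult_zero_left)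
  obtain c2 where c2: "c2 \<noteq> 0" "d dvd smult c2 q" using *[of q] by (metis add.left_neutral mult_1 mult_zero_left)
  have "d dvd smult (c1 * c2) p" "d dvd smult (c1 * c2) q"
    using c1 c2 by (metis dvd_smult mult.commute smult_smult)+
  then show ?thesis using that[OF AB d0, of "c1 * c2"] c1 c2 by simp
qed

text \<open>After division by the gcd, the combination d of \<open>bezout_const\<close> divides a
  nonzero constant by coprimality, so d is constant in s.\<close>

lemma bezout_gcd:
  fixes g \<phi> :: "complex poly poly"
  assumes "g \<noteq> 0"
  obtains A B c where "c \<noteq> 0" "A * g + B * \<phi> = [:c:] * gcd g \<phi>"
proof -
  define e where "e = gcd g \<phi>"
  have e0: "e \<noteq> 0" using assms by (simp add: e_def)
  obtain g' \<phi>' where g': "g = g' * e" "\<phi> = \<phi>' * e" "coprime g' \<phi>'"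
    using gcd_coprime_exists[of g \<phi>] e0 unfolding e_def by blast
  have "g' \<noteq> 0" using assms g' by auto
  then obtain A B d c where d: "A * g' + B * \<phi>' = d" "d \<noteq> 0" "c \<noteq> 0" "d dvd smult c g'" "d dvd smult c \<phi>'"
    by (rule bezout_const)
  have "d dvd gcd ([:c:] * g') ([:c:] * \<phi>')" using d by simp
  also have "gcd ([:c:] * g') ([:c:] * \<phi>') = normalize ([:c:] * gcd g' \<phi>')" by (rule gcd_mult_left)
  finally have "d dvd [:c:]" using g'(3) by (simp add: coprime_iff_gcd_eq_1)
  then obtain b where "[:c:] = d * b" by blast
  then have "degree d = 0" using d(3) degree_mult_eq[of d b] by (metis add_is_0 degree_pCons_0 mult_eq_0_iff pCons_eq_0_iff)
  then obtain c' where c': "d = [:c':]" by (rule degree_eq_zeroE)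
  have "A * g + B * \<phi> = (A * g' + B * \<phi>') * e" by (simp add: g' algebra_simps)
  then have "A * g + B * \<phi> = [:c':] * gcd g \<phi>" using d(1) c' by (simp add: e_def)
  moreover have "c' \<noteq> 0" using c' d(2) by auto
  ultimately show ?thesis using that by blast
qed

lemma tc_0_mult: "tc 0 (p * q) = tc 0 p * tc 0 q"
  by (simp add: tc_mult)

lemma tc_0_add: "tc 0 (p + q) = tc 0 p + tc 0 q"
  by (rule poly_eqI) (simp add: coeff_tc)

lemma ringhom_tc: "ringhom (tc 0)"
  by (rule ringhomI) (simp_all add: tc_0_mult tc_0_add, simp add: tc_def one_pCons map_poly_pCons)

lemma tc_XQ [simp]: "tc 0 XQ = 0"
  by (simp add: tc_def XQ_def map_poly_pCons)

lemma tc_0_eq_0: "tc 0 p = 0 \<Longrightarrow> \<exists>q. p = XQ * q"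
proof
  assume "tc 0 p = 0"
  then have "coeff p j $ 0 = 0" for j by (metis coeff_tc coeff_0)
  then show "p = XQ * map_poly (fps_shift 1) p"
    by (intro poly_eqI fps_ext) (simp add: XQ_def coeff_map_poly)
qed

lemma XQ_power_dvd_cancel:
  assumes "XQ ^ K * H = D * y" "tc 0 D \<noteq> 0"
  shows "\<exists>y'. H = D * y'"
  using assms
proof (induction K arbitrary: y)
  case (Suc K)
  have "tc 0 (XQ ^ Suc K * H) = 0" by (simp add: tc_0_mult)
  then have "tc 0 (D * y) = 0" using Suc.prems(1) by simp
  then have "tc 0 y = 0" using Suc.prems(2) by (simp add: tc_0_mult)
  then obtain z where z: "y = XQ * z" using tc_0_eq_0 by blast
  have "XQ * (XQ ^ K * H) = XQ * (D * z)" using Suc.prems(1) z by (simp add: ac_simps)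
  moreover have "XQ \<noteq> 0" by (simp add: XQ_def)
  ultimately have "XQ ^ K * H = D * z" by (metis mult_left_cancel)
  then show ?case using Suc by blast
qed auto

lemma io_eq_XQ_power_mult:
  assumes "io x = XQ ^ M * q"
  obtains b where "x = [:[:0, 1:]:] ^ M * b"
proof
  show "x = [:[:0, 1:]:] ^ M * map_poly (poly_shift M) x"
  proof (rule poly_eqI)
    fix j
    have "fps_of_poly (coeff x j) = fps_X ^ M * coeff q j"
      using arg_cong[OF assms, of "\<lambda>p. coeff p j"] by (simp add: coeff_io XQ_def poly_const_pow)
    then have "coeff (coeff x j) i = (fps_X ^ M * coeff q j) $ i" for i by (metis fps_of_poly_nth)
    then have "i < M \<Longrightarrow> coeff (coeff x j) i = 0" for i by (simp add: fps_X_power_mult_nth)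
    then have "coeff x j = [:0, 1:] ^ M * poly_shift M (coeff x j)"
      by (intro poly_eqI) (auto simp: monom_altdef[of 1, simplified, symmetric] coeff_monom_mult coeff_poly_shift)
    then show "coeff x j = coeff ([:[:0, 1:]:] ^ M * map_poly (poly_shift M) x) j"
      by (simp add: poly_const_pow coeff_map_poly)
  qed
qed

text \<open>Modulo J both X and s are nilpotent, the latter because G differs from s^r by a multiple
  of X. An element with nonzero constant term is therefore a unit.\<close>

lemma local_ring_mod:
  assumes J: "ideal J" and G: "G \<in> J" "tc 0 G = [:0, 1:] ^ r" and X: "XQ ^ K \<in> J" and u: "evQ u \<noteq> 0"
  obtains w where "u * w - 1 \<in> J"
proof -
  define S :: "complex fps poly" where "S = [:0, 1:]"
  have tS: "tc 0 S = [:0, 1:]" by (simp add: S_def tc_def map_poly_pCons one_pCons)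
  have "tc 0 (G - S ^ r) = 0"
    using G(2) by (simp add: rh_diff[OF ringhom_tc] rh_power[OF ringhom_tc] tS)
  then obtain G1 where "G - S ^ r = XQ * G1" using tc_0_eq_0 by blast
  then have G1: "G = S ^ r - (- (XQ * G1))" by (simp add: algebra_simps)
  obtain a where a: "(S ^ r) ^ K - (- (XQ * G1)) ^ K = G * a"
    unfolding G1 by (metis power_diff_sumr2)
  have "(- (XQ * G1)) ^ K = XQ ^ K * (- G1) ^ K" by (simp add: power_mult_distrib[symmetric])
  then have "(- (XQ * G1)) ^ K \<in> J" using ideal_mult'[OF J X] by simp
  then have "(S ^ r) ^ K \<in> J" using a ideal_mult'[OF J G(1), of a] ideal_cancel[OF J] by metis
  then have SJ: "S ^ (r * K) \<in> J" by (simp add: power_mult)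
  obtain c p where u': "u = pCons c p" by (metis pCons_cases)
  have c: "c = fps_const (c $ 0) + fps_X * fps_shift 1 c"
    by (rule fps_ext) (simp add: fps_X_mult_nth)
  have "u = (kQ (evQ u) + S * p) + XQ * [:fps_shift 1 c:]"
    using c by (simp add: u' S_def XQ_def kQ_def evQ_def mult.commute)
  moreover have "kQ (evQ u) * kQ (1 / evQ u) - 1 \<in> J"
    using u ideal_0[OF J] by (simp add: kQ_def one_pCons)
  then obtain w1 where "(kQ (evQ u) + S * p) * w1 - 1 \<in> J"
    by (rule nilpotent_unit[OF J, of _ _ "S * p" "r * K"])
      (use SJ ideal_mult'[OF J] in \<open>auto simp: power_mult_distrib\<close>)
  then obtain w2 where "((kQ (evQ u) + S * p) + XQ * [:fps_shift 1 c:]) * w2 - 1 \<in> J"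
    by (rule nilpotent_unit[OF J, of _ _ "XQ * [:fps_shift 1 c:]" K])
      (use X ideal_mult'[OF J] in \<open>simp_all only: power_mult_distrib\<close>)
  ultimately show ?thesis using that by metis
qed

text \<open>The Weierstrass factor G of g defines the same germ at the origin, as H is a unit there.\<close>

lemma codim_transfer:
  fixes g \<phi> :: "complex poly poly"
  assumes GH: "io g = G * H" and G0: "tc 0 G = [:0, 1:] ^ r" and H0: "evQ H \<noteq> 0"
    and n: "Q.hascodim (idl {G, io \<phi>}) n"
  shows "B.hascodim (B.sat (idl {g, \<phi>})) n"
proof -
  let ?J = "idl {G, io \<phi>}" and ?I = "idl {g, \<phi>}" and ?t = "[:[:0, 1:]:] :: complex poly poly"
  note J = ideal_idl[of "{G, io \<phi>}"] and I = ideal_idl[of "{g, \<phi>}"]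
  have GJ: "G \<in> ?J" "io \<phi> \<in> ?J" by (auto intro: idl_superset)
  obtain K where K: "XQ ^ K \<in> ?J" using X_power_in_ideal[OF J n] .
  have tH: "tc 0 H \<noteq> 0" using H0 by (metis coeff_0 coeff_tc evQ_def)
  have tg: "tc 0 (io g) \<noteq> 0" using G0 tH by (simp add: GH tc_0_mult)
  have g0: "g \<noteq> 0" using tg by (auto simp: rh_0[OF ringhom_io] tc_def)
  \<comment> \<open>A power of t lies in the localized ideal. Bezout puts c d into the ideal, where
    c depends on t alone and d is the gcd of g and \<phi>. As a power of X lies in
    \<open>?J\<close>, d divides H and does not vanish at the origin; the only non-unit left in c d
    is a power of t.\<close>
  have tM: "\<exists>M. ?t ^ M \<in> B.sat ?I"
  proof -
    define d where "d = gcd g \<phi>"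
    obtain A B c where c: "c \<noteq> 0" "A * g + B * \<phi> = [:c:] * d"
      by (rule bezout_gcd[OF g0, of \<phi>, folded d_def]) (rule that; assumption)
    obtain g' \<phi>' where g': "g = d * g'" "\<phi> = d * \<phi>'" unfolding d_def by (meson dvdE gcd_dvd1 gcd_dvd2)
    have "tc 0 (io d) \<noteq> 0" using tg by (auto simp: g' rh_mult[OF ringhom_io] tc_0_mult)
    moreover obtain a b where "XQ ^ K = a * G + b * io \<phi>" using K unfolding idl_2 by blast
    then have "XQ ^ K * H = a * io g + b * H * io \<phi>" by (simp add: GH algebra_simps)
    then have "XQ ^ K * H = io d * (a * io g' + b * H * io \<phi>')"
      by (simp add: g' rh_mult[OF ringhom_io] algebra_simps)
    ultimately obtain y where "H = io d * y" using XQ_power_dvd_cancel by blast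
    then have ed: "evB d \<noteq> 0" using H0 by (auto simp: evB_evQ rh_mult[OF ringhom_evQ])
    obtain c' where c': "c = [:-0, 1:] ^ order 0 c * c'" "\<not> [:-0, 1:] dvd c'"
      using order_decomp[OF c(1), of 0] by blast
    have "evB ([:c':] * d) \<noteq> 0"
    proof -
      have "poly c' 0 \<noteq> 0" using c'(2) by (simp add: poly_eq_0_iff_dvd)
      then show ?thesis using ed unfolding rh_mult[OF B.ev] by (simp add: evB_def[of "[:c':]"])
    qed
    moreover have "([:c':] * d) * ?t ^ order 0 c = A * g + B * \<phi>"
      using c(2) c'(1) by (simp add: poly_const_pow ac_simps)
    then have "([:c':] * d) * ?t ^ order 0 c \<in> ?I" unfolding idl_2 by blast
    ultimately show ?thesis unfolding B.sat_def by blast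
  qed
  \<comment> \<open>The localized ideal is the contraction of \<open>?J\<close>, so both quotients
    have the same dimension once the basis is moved to polynomials.\<close>
  have sat: "p \<in> B.sat ?I \<longleftrightarrow> io p \<in> ?J" for p
  proof
    assume "p \<in> B.sat ?I"
    then obtain u x y where u: "evB u \<noteq> 0" "u * p = x * g + y * \<phi>" unfolding B.sat_def idl_2 by blast
    have "io u * io p = io (x * g + y * \<phi>)" by (simp add: u(2)[symmetric] rh_mult[OF ringhom_io])
    also have "\<dots> = (io x * H) * G + io y * io \<phi>"
      by (simp add: rh_mult[OF ringhom_io] rh_add[OF ringhom_io] GH)
    finally have "io u * io p = (io x * H) * G + io y * io \<phi>" .
    then have uJ: "io u * io p \<in> ?J" unfolding idl_2 by blast
    obtain w where w: "io u * w - 1 \<in> ?J"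
      by (rule local_ring_mod[OF J GJ(1) G0 K, of "io u"]) (use u in \<open>auto simp: evB_evQ\<close>)
    have "io p = (io u * io p) * w - io p * (io u * w - 1)" by (simp add: algebra_simps)
    also have "\<dots> \<in> ?J" by (intro ideal_diff J ideal_mult' uJ ideal_mult w)
    finally show "io p \<in> ?J" .
  next
    assume "io p \<in> ?J"
    then obtain a b where ab: "io p = a * G + b * io \<phi>" unfolding idl_2 by blast
    obtain M' where "?t ^ M' \<in> B.sat ?I" using tM by blast
    \<comment> \<open>The exponent is made positive so that truncating H at order M keeps its
      constant term.\<close>
    then have tM: "?t ^ Suc M' \<in> B.sat ?I"
      unfolding power_Suc by (rule ideal_mult[OF B.ideal_sat[OF I]])
    define M where "M = Suc M'"
    obtain h q1 where h: "H = io h + XQ ^ M * q1" by (rule truncate)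
    obtain a0 q2 where a0: "a = io a0 + XQ ^ M * q2" by (rule truncate)
    obtain b0 q3 where b0: "b * H = io b0 + XQ ^ M * q3" by (rule truncate)
    have "H * io p = a * io g + (b * H) * io \<phi>" by (simp add: ab GH algebra_simps)
    then have "io (h * p - a0 * g - b0 * \<phi>) = XQ ^ M * (q2 * io g + q3 * io \<phi> - q1 * io p)"
      unfolding h b0[unfolded h] a0 rh_diff[OF ringhom_io] rh_mult[OF ringhom_io]
      by (simp add: algebra_simps)
    then obtain z where "h * p - a0 * g - b0 * \<phi> = ?t ^ M * z" using io_eq_XQ_power_mult by blast
    then have "h * p - (a0 * g + b0 * \<phi>) \<in> B.sat ?I"
      using ideal_mult'[OF B.ideal_sat[OF I] tM[folded M_def]] by (simp add: diff_diff_eq)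
    moreover have "a0 * g + b0 * \<phi> \<in> B.sat ?I"
      using B.sat_superset unfolding idl_2 by (metis idl_2 subsetD)
    ultimately have "h * p \<in> B.sat ?I" using ideal_cancel[OF B.ideal_sat[OF I]] by blast
    moreover have "evB h \<noteq> 0"
      using H0 by (simp add: h evB_evQ rh_add[OF ringhom_evQ] rh_mult[OF ringhom_evQ] M_def) (simp add: evQ_def XQ_def)
    ultimately show "p \<in> B.sat ?I" using B.sat_unit by blast
  qed
  obtain v where v: "Q.indep ?J n v" "Q.spans ?J n v" using n by (auto simp: Q.hascodim_def)
  have "\<exists>b. v j - io b \<in> ?J" for j
  proof -
    obtain b q where "v j = io b + XQ ^ K * q" by (rule truncate)
    then have "v j - io b = XQ ^ K * q" by simp
    then show ?thesis using ideal_mult'[OF J K] by metis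
  qed
  then obtain b where b: "\<And>j. v j - io (b j) \<in> ?J" by metis
  have "Q.lc n c v - Q.lc n c (\<lambda>j. io (b j)) = (\<Sum>j<n. kQ (c j) * (v j - io (b j)))" for c
    by (simp add: Q.lc_def sum_subtractf algebra_simps)
  moreover have "(\<Sum>j<n. kQ (c j) * (v j - io (b j))) \<in> ?J" for c
    by (intro ideal_sum J ideal_mult b)
  ultimately have l: "Q.lc n c v - io (B.lc n c b) \<in> ?J" for c by (simp add: io_lc)
  have "B.indep (B.sat ?I) n b"
    using v(1) ideal_cancel[OF J l] unfolding B.indep_def Q.indep_def sat by blast
  moreover have "B.spans (B.sat ?I) n b"
    unfolding B.spans_def sat
  proof
    fix p
    obtain c where "io p - Q.lc n c v \<in> ?J" using v(2) unfolding Q.spans_def by blast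
    then have "io (p - B.lc n c b) \<in> ?J"
      using ideal_add[OF J _ l[of c]] by (fastforce simp: rh_diff[OF ringhom_io])
    then show "\<exists>c. io (p - B.lc n c b) \<in> ?J" by blast
  qed
  ultimately show ?thesis unfolding B.hascodim_def by blast
qed

text \<open>The value of p at the Puiseux point s = z(x), t = x^N.\<close>

definition evN :: "nat \<Rightarrow> complex fps \<Rightarrow> complex poly poly \<Rightarrow> complex fps" where
  "evN N z p = poly (map_poly (sub N) (io p)) z"

lemma ringhom_evN: "N > 0 \<Longrightarrow> ringhom (evN N z)"
  unfolding evN_def[abs_def]
  by (rule ringhom_comp[OF ringhom_poly_map[OF ringhom_sub] ringhom_io])

text \<open>Weierstrass preparation by Hensel lifting: modulo t, g is s^r times a factor nonzero at
  the origin, and the lift G of s^r carries all branches through the origin. Orders along its roots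
  are measured in x with t = x^N, hence the factor N.\<close>

theorem intersection_length:
  fixes g :: "complex poly poly"
  assumes g0: "map_poly (\<lambda>c. poly c 0) g \<noteq> 0"
  obtains N xs where "N > 0" "length xs = order 0 (map_poly (\<lambda>c. poly c 0) g)"
    "\<And>z. z \<in> set xs \<Longrightarrow> z $ 0 = 0" "\<And>z. z \<in> set xs \<Longrightarrow> evN N z g = 0"
    "\<And>\<phi>. (\<And>z. z \<in> set xs \<Longrightarrow> evN N z \<phi> \<noteq> 0) \<Longrightarrow>
       \<exists>n. B.hascodim (B.sat (idl {g, \<phi>})) n \<and> n * N = (\<Sum>z\<leftarrow>xs. subdegree (evN N z \<phi>))"
proof -
  define f where "f = map_poly (\<lambda>c. poly c 0) g"
  define r where "r = order 0 f"
  have f: "f = tc 0 (io g)" by (simp add: f_def tc_io_0)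
  obtain h where h: "f = [:-0, 1:] ^ r * h" "\<not> [:-0, 1:] dvd h"
    using order_decomp[of f 0] g0 by (auto simp: r_def f_def)
  have h0: "h \<noteq> 0" using h(2) by auto
  have "coprime [:-0, 1:] h"
    using h(2) by (intro prime_elem_imp_coprime) (auto intro: prime_elem_linear_field_poly)
  then have cop: "coprime ([:-0, 1:] ^ r) h" by simp
  have "degree f = degree h + degree ([:-0, 1 :: complex:] ^ r)" using h(1) h0 by (simp add: degree_mult_eq)
  then have dg: "degree h + degree ([:-0, 1 :: complex:] ^ r) \<le> degree (io g)"
    using degree_tc[of 0 "io g"] f by simp
  obtain G H where GH: "io g = G * H" "tc 0 G = [:-0, 1:] ^ r" "tc 0 H = h" "lead_coeff G = 1"
    "degree G = degree ([:-0, 1 :: complex:] ^ r)"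
    by (rule hensel[OF _ cop _ dg]) (use h f in \<open>auto simp: lead_coeff_power\<close>)
  have dG: "degree G = r" using GH(5) by (simp add: degree_linear_power)
  have H0: "evQ H \<noteq> 0"
  proof -
    have "poly h 0 \<noteq> 0" using h(2) by (simp add: poly_eq_0_iff_dvd)
    then show ?thesis using GH(3) by (auto simp: evQ_def poly_0_coeff_0 coeff_tc)
  qed
  obtain N xs where xs: "splits G N xs" using newton_puiseux[OF GH(4)] .
  then have N: "N > 0" and Gx: "map_poly (sub N) G = (\<Prod>z\<leftarrow>xs. [:- z, 1:])" by (auto simp: splits_def)
  have rootG: "poly (map_poly (sub N) G) z = 0" if "z \<in> set xs" for z
    using that unfolding Gx by (induction xs) auto
  have len: "length xs = r" using splits_length[OF xs] dG by simp
  have z0: "z $ 0 = 0" if "z \<in> set xs" for z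
  proof -
    have "tc 0 (map_poly (sub N) G) = [:0, 1:] ^ r"
      using GH(2) N by (simp add: tc_def map_poly_map_poly o_def sub_nth rh_0[OF ringhom_sub[OF N]])
    then have "poly (map_poly (\<lambda>c. c $ 0) (map_poly (sub N) G)) (z $ 0) = (z $ 0) ^ r" by (simp add: tc_def)
    moreover have "ringhom (\<lambda>c :: complex fps. c $ 0)" by (simp add: ringhom_def)
    then have "poly (map_poly (\<lambda>c. c $ 0) (map_poly (sub N) G)) (z $ 0) = 0"
      using poly_map_poly_rh rootG[OF that] by (metis fps_zero_nth)
    ultimately show ?thesis by simp
  qed
  have ioN: "evN N z g = 0" if "z \<in> set xs" for z
    using rootG[OF that] by (simp add: evN_def GH(1) rh_mult[OF ringhom_map_poly[OF ringhom_sub[OF N]]])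
  have "\<exists>n. B.hascodim (B.sat (idl {g, \<phi>})) n \<and> n * N = (\<Sum>z\<leftarrow>xs. subdegree (evN N z \<phi>))"
    if "\<And>z. z \<in> set xs \<Longrightarrow> evN N z \<phi> \<noteq> 0" for \<phi>
  proof -
    have "Q.hascodim (idl {map_poly (sub N) G, map_poly (sub N) (io \<phi>)}) (\<Sum>z\<leftarrow>xs. subdegree (evN N z \<phi>))"
      unfolding Gx evN_def by (rule codim_linear_prod) (use that in \<open>simp add: evN_def\<close>)
    then obtain n where n: "Q.hascodim (idl {G, io \<phi>}) n" "(\<Sum>z\<leftarrow>xs. subdegree (evN N z \<phi>)) = n * N"
      using codim_base_change[OF N] by blast
    have "B.hascodim (B.sat (idl {g, \<phi>})) n"
      by (rule codim_transfer[OF GH(1) _ H0 n(1)]) (use GH(2) in simp)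
    then show ?thesis using n by auto
  qed
  then show ?thesis using that[of N xs] N len z0 ioN by (simp add: r_def f_def)
qed

section \<open>A plane germ together with a line\<close>

definition map0 :: "complex poly poly \<Rightarrow> complex poly" where
  "map0 = map_poly (\<lambda>c. poly c 0)"

definition tB :: "complex poly poly" where "tB = [:[:0, 1:]:]"

abbreviation ds :: "complex poly poly \<Rightarrow> complex poly poly" where "ds \<equiv> pderiv"

definition dt :: "complex poly poly \<Rightarrow> complex poly poly" where "dt = map_poly pderiv"

lemma ringhom_map0: "ringhom map0"
  unfolding map0_def by (rule ringhom_map_poly) (simp add: ringhom_def)

lemma map0_tB [simp]: "map0 tB = 0"
  by (simp add: map0_def tB_def map_poly_pCons)

lemma evB_map0: "evB p = poly (map0 p) 0"
  by (simp add: evB_def map0_def poly_0_coeff_0 coeff_map_poly)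

lemma map0_eq_0:
  assumes "map0 x = 0" obtains y where "x = tB * y"
proof -
  have "tc 0 (io x) = 0" using assms by (simp add: tc_io_0 map0_def)
  then obtain q where "io x = XQ ^ 1 * q" using tc_0_eq_0 by auto
  then obtain b where "x = [:[:0, 1:]:] ^ 1 * b" by (rule io_eq_XQ_power_mult)
  then show ?thesis using that by (simp add: tB_def)
qed

lemma tB_nonzero [simp]: "tB \<noteq> 0"
  by (simp add: tB_def)

lemma tB_cancel: "tB * x = tB * y \<Longrightarrow> x = y"
  by simp

text \<open>t is prime and does not divide h.\<close>

lemma tB_dvd_cancel:
  assumes "x * h = tB * y" "map0 h \<noteq> 0"
  obtains x' where "x = tB * x'" "x' * h = y"
proof -
  have "map0 (x * h) = 0" by (simp add: assms rh_mult[OF ringhom_map0])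
  then have "map0 x = 0" using assms(2) by (simp add: rh_mult[OF ringhom_map0])
  then obtain x' where x': "x = tB * x'" by (rule map0_eq_0)
  then have "tB * (x' * h) = tB * y" using assms(1) by (simp add: mult.assoc)
  then show ?thesis using that x' tB_cancel by blast
qed

definition lift0 :: "complex poly \<Rightarrow> complex poly poly" where "lift0 = map_poly (\<lambda>c. [:c:])"

lemma map0_lift0 [simp]: "map0 (lift0 p) = p"
  by (simp add: map0_def lift0_def map_poly_map_poly o_def)

lemma coeff_map0: "coeff (map0 p) j = coeff (coeff p j) 0"
  by (simp add: map0_def coeff_map_poly poly_0_coeff_0)

lemma map0_lc: "coeff (map0 (B.lc n c (\<lambda>j. [:0, 1:] ^ j))) i = (if i < n then c i else 0)"
proof -
  have "map0 ([:0, 1:] ^ j) = [:0, 1:] ^ j" for j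
    by (simp add: rh_power[OF ringhom_map0]) (simp add: map0_def map_poly_pCons one_pCons)
  moreover have "map0 (kB a) = [:a:]" for a by (simp add: kB_def map0_def map_poly_pCons)
  ultimately have "map0 (B.lc n c (\<lambda>j. [:0, 1:] ^ j)) = (\<Sum>j<n. monom (c j) j)"
    by (simp add: B.lc_def rh_sum[OF ringhom_map0] rh_mult[OF ringhom_map0] monom_altdef)
  then show ?thesis by (simp add: coeff_sum)
qed

lemma X_power_dvd_iff: "[:0, 1:] ^ q dvd (p :: complex poly) \<longleftrightarrow> (\<forall>j<q. coeff p j = 0)"
proof
  assume "[:0, 1:] ^ q dvd p"
  then obtain y where "p = monom 1 q * y" by (auto simp: monom_altdef)
  then show "\<forall>j<q. coeff p j = 0" by (simp add: coeff_monom_mult)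
next
  assume H: "\<forall>j<q. coeff p j = 0"
  have "p = monom 1 q * poly_shift q p"
    using H by (intro poly_eqI) (auto simp: coeff_monom_mult coeff_poly_shift)
  then show "[:0, 1:] ^ q dvd p" by (metis dvd_triv_left monom_altdef smult_1_left)
qed

text \<open>Modulo t the ring is C[s], where an ideal localized at the origin is determined by the
  least order of its elements; \<gamma> attains this order and \<open>min\<close> bounds it from
  below.\<close>

lemma codim_contains_t:
  assumes I: "ideal I" and t: "tB \<in> I"
    and g: "\<gamma> \<in> I" "map0 \<gamma> \<noteq> 0" "order 0 (map0 \<gamma>) = q"
    and min: "\<And>p. p \<in> I \<Longrightarrow> [:0, 1:] ^ q dvd map0 p"
  shows "B.hascodim (B.sat I) q"
proof -
  have sat: "p \<in> B.sat I \<longleftrightarrow> (\<forall>j<q. coeff (map0 p) j = 0)" for p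
    unfolding X_power_dvd_iff[symmetric]
  proof
    assume "p \<in> B.sat I"
    then obtain u where u: "evB u \<noteq> 0" "u * p \<in> I" by (auto simp: B.sat_def)
    have "\<not> [:-0, 1:] dvd map0 u" using u(1) unfolding evB_map0 poly_eq_0_iff_dvd .
    then have "coprime [:0, 1:] (map0 u)"
      by (intro prime_elem_imp_coprime) (auto intro: prime_elem_linear_field_poly)
    then have "coprime ([:0, 1:] ^ q) (map0 u)" by simp
    moreover have "[:0, 1:] ^ q dvd map0 u * map0 p"
      using min[OF u(2)] by (simp add: rh_mult[OF ringhom_map0])
    ultimately show "[:0, 1:] ^ q dvd map0 p" by (simp add: coprime_dvd_mult_right_iff)
  next
    assume "[:0, 1:] ^ q dvd map0 p"
    then obtain f where f: "map0 p = [:0, 1:] ^ q * f" by blast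
    obtain e where e: "map0 \<gamma> = [:-0, 1:] ^ q * e" "\<not> [:-0, 1:] dvd e"
      using order_decomp[OF g(2), of 0] g(3) by blast
    have "map0 (lift0 e * p - lift0 f * \<gamma>) = 0"
      by (simp add: rh_diff[OF ringhom_map0] rh_mult[OF ringhom_map0] f e(1))
    then obtain y where "lift0 e * p - lift0 f * \<gamma> = tB * y" by (rule map0_eq_0)
    then have "lift0 e * p = tB * y + lift0 f * \<gamma>" by (simp add: diff_eq_eq)
    also have "\<dots> \<in> I" by (intro ideal_add ideal_mult ideal_mult' I t g)
    finally have "lift0 e * p \<in> I" .
    moreover have "evB (lift0 e) \<noteq> 0" using e(2) unfolding evB_map0 poly_eq_0_iff_dvd by simp
    ultimately show "p \<in> B.sat I" unfolding B.sat_def by blast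
  qed
  have "B.indep (B.sat I) q (\<lambda>j. [:0, 1:] ^ j)"
    unfolding B.indep_def sat map0_lc by simp
  moreover have "B.spans (B.sat I) q (\<lambda>j. [:0, 1:] ^ j)"
    unfolding B.spans_def sat rh_diff[OF ringhom_map0] coeff_diff map0_lc
    by (auto intro!: exI[of _ "\<lambda>j. coeff (map0 p) j" for p])
  ultimately show ?thesis unfolding B.hascodim_def by blast
qed

lemma evN_pCons:
  assumes N: "N > 0"
  shows "evN N z (pCons c p) = sub N (fps_of_poly c) + z * evN N z p"
  by (simp add: evN_def io_pCons map_poly_pCons_rh[OF ringhom_sub[OF N]])

lemma evN_0: "N > 0 \<Longrightarrow> evN N z 0 = 0"
  by (rule rh_0[OF ringhom_evN])

text \<open>Differentiation of p along s = z(x), t = x^N with respect to x; the last factor is the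
  derivative of t.\<close>

lemma evN_chain_rule:
  assumes N: "N > 0"
  shows "fps_deriv (evN N z p) = evN N z (ds p) * fps_deriv z + evN N z (dt p) * (of_nat N * fps_X ^ (N - 1))"
proof (induction p)
  case 0
  show ?case by (simp add: dt_def evN_0[OF N])
next
  case (pCons c p)
  have s: "fps_deriv (sub N (fps_of_poly c)) = sub N (fps_of_poly (pderiv c)) * (of_nat N * fps_X ^ (N - 1))"
    using N fps_compose_deriv[of "fps_X ^ N" "fps_of_poly c"]
    by (simp add: sub_def fps_of_poly_pderiv fps_deriv_power')
  have d1: "ds (pCons c p) = p + pCons 0 (ds p)" by (simp add: pderiv_pCons)
  have d2: "dt (pCons c p) = pCons (pderiv c) (dt p)" unfolding dt_def by (rule map_poly_pCons) simp
  have s0: "sub N (fps_of_poly 0) = 0" by (simp add: rh_0[OF ringhom_sub[OF N]])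
  show ?case
    unfolding d1 d2 evN_pCons[OF N] rh_add[OF ringhom_evN[OF N]] fps_deriv_add fps_deriv_mult s pCons.IH s0
    by (simp add: algebra_simps)
qed

lemma evN_tB: "N > 0 \<Longrightarrow> evN N z tB = fps_X ^ N"
  by (simp add: tB_def evN_pCons evN_0 fps_of_poly_pCons sub_def)

lemma evN_nth_0: "N > 0 \<Longrightarrow> z $ 0 = 0 \<Longrightarrow> evN N z p $ 0 = evB p"
  by (induction p) (simp_all add: evN_0 evN_pCons sub_nth evB_def poly_0_coeff_0)

lemma subdegree_X_deriv:
  fixes f :: "complex fps"
  assumes "f \<noteq> 0" "f $ 0 = 0"
  shows "fps_deriv f \<noteq> 0" "subdegree f = Suc (subdegree (fps_deriv f))"
proof -
  have k: "subdegree f > 0" using assms by (metis gr0I nth_subdegree_zero_iff)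
  have "fps_deriv f $ (subdegree f - 1) \<noteq> 0" using k assms(1) by simp
  moreover have "\<And>i. i < subdegree f - 1 \<Longrightarrow> fps_deriv f $ i = 0" by (auto simp: less_diff_conv intro: nth_less_subdegree_zero)
  ultimately have "subdegree (fps_deriv f) = subdegree f - 1" by (rule subdegreeI)
  moreover have "fps_deriv f \<noteq> 0"
    using \<open>fps_deriv f $ (subdegree f - 1) \<noteq> 0\<close> by (metis fps_zero_nth)
  ultimately show "fps_deriv f \<noteq> 0" "subdegree f = Suc (subdegree (fps_deriv f))" using k by auto
qed

text \<open>The line is t = 0. The assumption sqf, a form of squarefreeness, keeps h nonzero along the Puiseux roots of ds h.\<close>

locale plane_germ =
  fixes h :: "complex poly poly" and n :: nat
  assumes h0: "evB h = 0" and hn: "map0 h \<noteq> 0" "order 0 (map0 h) = n"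
    and sqf: "\<exists>A B c. c \<noteq> 0 \<and> A * h + B * ds h = [:c:]"
begin

lemma n_pos: "n > 0"
  using h0 hn by (metis evB_map0 gr0I order_root)

lemma map0_ds: "map0 (ds p) = pderiv (map0 p)"
  by (rule poly_eqI) (simp add: coeff_map0 coeff_pderiv of_nat_poly)

text \<open>Along a root s(x), t = x^N of ds h, the derivative of e(x) = h is N x^(N-1) dt h. Hence h + t * dt h
  has the order of e there, which exceeds that of dt h by N.\<close>

lemma polar_length:
  obtains \<mu> where "B.hascodim (B.sat (idl {ds h, dt h})) \<mu>"
    "B.hascodim (B.sat (idl {ds h, h + tB * dt h})) (\<mu> + n - 1)"
proof -
  have "map0 h \<noteq> [:c:]" for c
    using hn n_pos by (metis order_0I pCons_eq_0_iff poly_const_conv less_irrefl)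
  then have p0: "pderiv (map0 h) \<noteq> 0" by (metis degree_eq_zeroE pderiv_eq_0_iff)
  then have g0: "map_poly (\<lambda>c. poly c 0) (ds h) \<noteq> 0" using map0_ds by (simp add: map0_def)
  have "order 0 (map0 h) = Suc (order 0 (pderiv (map0 h)))"
    using order_pderiv[OF hn(1), of 0] h0 by (simp add: evB_map0)
  then have on: "order 0 (map_poly (\<lambda>c. poly c 0) (ds h)) = n - 1"
    using map0_ds[of h] hn by (simp add: map0_def)
  obtain N xs where N: "N > 0" and len: "length xs = n - 1"
    and z0: "\<And>z. z \<in> set xs \<Longrightarrow> z $ 0 = 0" and zg: "\<And>z. z \<in> set xs \<Longrightarrow> evN N z (ds h) = 0"
    and cod: "\<And>\<phi>. (\<And>z. z \<in> set xs \<Longrightarrow> evN N z \<phi> \<noteq> 0) \<Longrightarrow>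
       \<exists>n. B.hascodim (B.sat (idl {ds h, \<phi>})) n \<and> n * N = (\<Sum>z\<leftarrow>xs. subdegree (evN N z \<phi>))"
    using intersection_length[OF g0] on by metis
  note e = ringhom_evN[OF N]
  obtain A B c where c: "c \<noteq> 0" "A * h + B * ds h = [:c:]" using sqf by blast
  have key: "evN N z (dt h) \<noteq> 0 \<and> evN N z (h + tB * dt h) \<noteq> 0 \<and>
      subdegree (evN N z (h + tB * dt h)) = N + subdegree (evN N z (dt h))" if z: "z \<in> set xs" for z
  proof -
    define \<eta> where "\<eta> = evN N z h"
    define \<theta> where "\<theta> = evN N z (dt h)"
    have "evN N z A * \<eta> = evN N z [:c:]"
      using zg[OF z] by (simp add: c(2)[symmetric] rh_add[OF e] rh_mult[OF e] \<eta>_def)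
    moreover have "evN N z [:c:] \<noteq> 0"
      using c(1) N fps_compose_eq_0_iff[of "fps_X ^ N" "fps_of_poly c"]
      by (auto simp: evN_pCons evN_0 sub_def)
    ultimately have "\<eta> \<noteq> 0" by auto
    have "\<eta> $ 0 = 0" unfolding \<eta>_def using evN_nth_0[OF N z0[OF z]] h0 by simp
    note d = subdegree_X_deriv[OF \<open>\<eta> \<noteq> 0\<close> this]
    have cr: "fps_deriv \<eta> = \<theta> * (of_nat N * fps_X ^ (N - 1))"
      using evN_chain_rule[OF N, of z h] zg[OF z] by (simp add: \<eta>_def \<theta>_def)
    then have t0: "\<theta> \<noteq> 0" using d(1) by auto
    have "of_nat N * fps_X ^ (N - 1) = fps_const (of_nat N :: complex) * fps_X ^ (N - 1)"
      by (simp add: fps_of_nat)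
    then have "subdegree (of_nat N * fps_X ^ (N - 1) :: complex fps) = N - 1" "of_nat N * fps_X ^ (N - 1) \<noteq> (0 :: complex fps)"
      using N by (simp_all add: fps_X_power_subdegree)
    then have sub: "subdegree \<eta> = N + subdegree \<theta>"
      using d(2) cr t0 N by (simp add: subdegree_mult)
    have ev: "evN N z (h + tB * dt h) = \<eta> + fps_X ^ N * \<theta>"
      by (simp add: rh_add[OF e] rh_mult[OF e] evN_tB[OF N] \<eta>_def \<theta>_def)
    have xd: "of_nat N * (fps_X ^ N * \<theta>) = fps_X * fps_deriv \<eta>"
      unfolding cr using N by (cases N) (simp_all add: ac_simps)
    have ofn: "(of_nat N * f) $ i = of_nat N * f $ i" for f :: "complex fps" and i
      unfolding fps_of_nat[symmetric] by simp
    \<comment> \<open>As N X^N \<theta> is X times the derivative of \<eta>, the i-th coefficient of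
      N (\<eta> + X^N \<theta>) is N + i times that of \<eta>. The factors N + i never vanish, so
      the two series have equal order.\<close>
    have nth: "of_nat N * (\<eta> + fps_X ^ N * \<theta>) $ i = (of_nat N + of_nat i) * \<eta> $ i" for i
    proof -
      have "of_nat N * (\<eta> + fps_X ^ N * \<theta>) $ i = (of_nat N * (\<eta> + fps_X ^ N * \<theta>)) $ i"
        by (simp only: ofn)
      also have "of_nat N * (\<eta> + fps_X ^ N * \<theta>) = of_nat N * \<eta> + fps_X * fps_deriv \<eta>"
        using xd by (simp add: algebra_simps)
      also have "\<dots> $ i = (of_nat N + of_nat i) * \<eta> $ i"
        unfolding fps_add_nth ofn by (cases i) (simp_all add: algebra_simps)
      finally show ?thesis .
    qed
    have nz: "(\<eta> + fps_X ^ N * \<theta>) $ subdegree \<eta> \<noteq> 0"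
    proof
      assume "(\<eta> + fps_X ^ N * \<theta>) $ subdegree \<eta> = 0"
      then have "(of_nat N + of_nat (subdegree \<eta>)) * \<eta> $ subdegree \<eta> = 0" using nth[of "subdegree \<eta>"] by simp
      moreover have "(of_nat N + of_nat (subdegree \<eta>) :: complex) = of_nat (N + subdegree \<eta>)" by simp
      moreover have "(of_nat (N + subdegree \<eta>) :: complex) \<noteq> 0" using N by (simp only: of_nat_eq_0_iff)
      ultimately show False using nth_subdegree_nonzero[OF \<open>\<eta> \<noteq> 0\<close>] by (metis mult_eq_0_iff)
    qed
    have low: "(\<eta> + fps_X ^ N * \<theta>) $ i = 0" if i: "i < subdegree \<eta>" for i
    proof -
      have "of_nat N * (\<eta> + fps_X ^ N * \<theta>) $ i = 0"
        unfolding nth nth_less_subdegree_zero[OF i] by simp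
      moreover have "(of_nat N :: complex) \<noteq> 0" using N by simp
      ultimately show ?thesis by (metis mult_eq_0_iff)
    qed
    have "subdegree (\<eta> + fps_X ^ N * \<theta>) = subdegree \<eta>" by (rule subdegreeI[OF nz low])
    moreover have "\<eta> + fps_X ^ N * \<theta> \<noteq> 0" using nz by (metis fps_zero_nth)
    ultimately show ?thesis using t0 sub ev \<theta>_def by metis
  qed
  obtain \<mu> where mu: "B.hascodim (B.sat (idl {ds h, dt h})) \<mu>" "\<mu> * N = (\<Sum>z\<leftarrow>xs. subdegree (evN N z (dt h)))"
    using cod[of "dt h"] key by blast
  obtain m where m: "B.hascodim (B.sat (idl {ds h, h + tB * dt h})) m"
    "m * N = (\<Sum>z\<leftarrow>xs. subdegree (evN N z (h + tB * dt h)))"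
    using cod[of "h + tB * dt h"] key by blast
  have "(\<Sum>z\<leftarrow>xs. subdegree (evN N z (h + tB * dt h))) = (\<Sum>z\<leftarrow>xs. N + subdegree (evN N z (dt h)))"
    using key by (intro arg_cong[of _ _ sum_list] map_cong) auto
  also have "\<dots> = length xs * N + (\<Sum>z\<leftarrow>xs. subdegree (evN N z (dt h)))"
    by (simp add: sum_list_addf sum_list_triv)
  finally have "m * N = (\<mu> + (n - 1)) * N" using mu(2) m(2) len by (simp add: algebra_simps)
  then have "m = \<mu> + n - 1" using N n_pos by simp
  then show ?thesis using that mu(1) m(1) by blast
qed

lemma codim_h_t: "B.hascodim (B.sat (idl {tB, h})) n"
proof (rule codim_contains_t[where \<gamma> = h])
  fix p assume "p \<in> idl {tB, h}"
  then obtain x y where "p = x * tB + y * h" unfolding idl_2 by blast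
  then have "map0 p = map0 y * map0 h"
    by (simp add: rh_add[OF ringhom_map0] rh_mult[OF ringhom_map0])
  moreover have "[:0, 1:] ^ n dvd map0 h" using order_1[of 0 "map0 h"] hn by simp
  ultimately show "[:0, 1:] ^ n dvd map0 p" by simp
qed (use hn in \<open>auto intro: ideal_idl idl_superset\<close>)

text \<open>The ideal here is generated by the partial derivatives of t h. Adding t to it gives (t,
  h), of length n; its colon ideal of t is the one measured by \<open>polar_length\<close>.\<close>

theorem milnor_with_line:
  obtains \<mu> where "B.hascodim (B.sat (idl {ds h, dt h})) \<mu>"
    "B.hascodim (B.sat (idl {tB * ds h, h + tB * dt h})) (\<mu> + 2 * n - 1)"
proof -
  obtain \<mu> where mu: "B.hascodim (B.sat (idl {ds h, dt h})) \<mu>"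
    "B.hascodim (B.sat (idl {ds h, h + tB * dt h})) (\<mu> + n - 1)" by (rule polar_length)
  have "B.hascodim (B.sat (idl {tB * ds h, h + tB * dt h})) (n + (\<mu> + n - 1))"
  proof (rule B.hascodim_sat_exact[OF ideal_idl, where x = tB and I' = "idl {tB, h}"])
    show "p \<in> idl {tB, h} \<longleftrightarrow> (\<exists>y. p - y * tB \<in> idl {tB * ds h, h + tB * dt h})" for p
    proof
      assume "p \<in> idl {tB, h}"
      then obtain x y where "p = x * tB + y * h" unfolding idl_2 by blast
      then have "p - (x - y * dt h) * tB = 0 * (tB * ds h) + y * (h + tB * dt h)" by (simp add: algebra_simps)
      then show "\<exists>y. p - y * tB \<in> idl {tB * ds h, h + tB * dt h}" unfolding idl_2 by blast
    next
      assume "\<exists>y. p - y * tB \<in> idl {tB * ds h, h + tB * dt h}"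
      then obtain y a b where "p - y * tB = a * (tB * ds h) + b * (h + tB * dt h)" unfolding idl_2 by blast
      then have "p = (y + a * ds h + b * dt h) * tB + b * h" by (simp add: algebra_simps)
      then show "p \<in> idl {tB, h}" unfolding idl_2 by blast
    qed
    show "B.hascodim (B.sat (idl {ds h, h + tB * dt h})) (\<mu> + n - 1)" by (rule mu(2))
    show "idl {ds h, h + tB * dt h} = {c. c * tB \<in> idl {tB * ds h, h + tB * dt h}}"
    proof safe
      fix c assume "c \<in> idl {ds h, h + tB * dt h}"
      then obtain a b where "c = a * ds h + b * (h + tB * dt h)" unfolding idl_2 by blast
      then have "c * tB = a * (tB * ds h) + (b * tB) * (h + tB * dt h)" by (simp add: algebra_simps)
      then show "c * tB \<in> idl {tB * ds h, h + tB * dt h}" unfolding idl_2 by blast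
    next
      fix c assume "c * tB \<in> idl {tB * ds h, h + tB * dt h}"
      then obtain a b where e: "c * tB = a * (tB * ds h) + b * (h + tB * dt h)" unfolding idl_2 by blast
      then have "b * h = tB * (c - a * ds h - b * dt h)" by (simp add: algebra_simps)
      then obtain b' where b': "b = tB * b'" by (rule tB_dvd_cancel[OF _ hn(1)])
      have "tB * c = tB * (a * ds h + b' * (h + tB * dt h))"
        using e b' by (simp add: algebra_simps)
      then have "c = a * ds h + b' * (h + tB * dt h)" by (rule tB_cancel)
      then show "c \<in> idl {ds h, h + tB * dt h}" unfolding idl_2 by blast
    qed
  qed (rule codim_h_t)
  moreover have "n + (\<mu> + n - 1) = \<mu> + 2 * n - 1" using n_pos by simp
  ultimately show ?thesis using that mu(1) by simp
qed

text \<open>The order q is the minimal order on the line of the t-component of a logarithmic vector field of h.\<close>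

theorem tjurina_with_line:
  assumes \<tau>: "B.hascodim (B.sat (idl {h, ds h, dt h})) \<tau>"
    and \<gamma>: "\<beta> * ds h + \<gamma> * dt h = c * h" "map0 \<gamma> \<noteq> 0" "order 0 (map0 \<gamma>) = q"
    and min: "\<And>\<beta> \<gamma> c. \<beta> * ds h + \<gamma> * dt h = c * h \<Longrightarrow> [:0, 1:] ^ q dvd map0 \<gamma>"
  shows "B.hascodim (B.sat (idl {tB * h, tB * ds h, h + tB * dt h})) (\<tau> + n + q)"
proof -
  let ?I = "idl {h, tB * ds h, tB * dt h}" and ?I1 = "idl {tB * h, tB * ds h, h + tB * dt h}"
  \<comment> \<open>Adjoining h to the Tjurina ideal \<open>?I1\<close> of t h gives
    \<open>?I\<close>. Adding t to that gives (t, h), and its colon ideal of t is the Tjurina ideal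
    of h, whence the lengths n and \<tau>.\<close>
  have I: "B.hascodim (B.sat ?I) (n + \<tau>)"
  proof (rule B.hascodim_sat_exact[OF ideal_idl, where x = tB and I' = "idl {tB, h}"])
    show "p \<in> idl {tB, h} \<longleftrightarrow> (\<exists>y. p - y * tB \<in> ?I)" for p
    proof
      assume "p \<in> idl {tB, h}"
      then obtain x y where "p = x * tB + y * h" unfolding idl_2 by blast
      then have "p - x * tB = y * h + 0 * (tB * ds h) + 0 * (tB * dt h)" by (simp add: algebra_simps)
      then show "\<exists>y. p - y * tB \<in> ?I" unfolding idl_3 by blast
    next
      assume "\<exists>y. p - y * tB \<in> ?I"
      then obtain y a b c where "p - y * tB = a * h + b * (tB * ds h) + c * (tB * dt h)" unfolding idl_3 by blast
      then have "p = (y + b * ds h + c * dt h) * tB + a * h" by (simp add: algebra_simps)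
      then show "p \<in> idl {tB, h}" unfolding idl_2 by blast
    qed
    show "idl {h, ds h, dt h} = {c. c * tB \<in> ?I}"
    proof safe
      fix c assume "c \<in> idl {h, ds h, dt h}"
      then obtain x a b where "c = x * h + a * ds h + b * dt h" unfolding idl_3 by blast
      then have "c * tB = (x * tB) * h + a * (tB * ds h) + b * (tB * dt h)" by (simp add: algebra_simps)
      then show "c * tB \<in> ?I" unfolding idl_3 by blast
    next
      fix c assume "c * tB \<in> ?I"
      then obtain x a b where e: "c * tB = x * h + a * (tB * ds h) + b * (tB * dt h)" unfolding idl_3 by blast
      then have "x * h = tB * (c - a * ds h - b * dt h)" by (simp add: algebra_simps)
      then obtain x' where "x = tB * x'" by (rule tB_dvd_cancel[OF _ hn(1)])
      then have "tB * c = tB * (x' * h + a * ds h + b * dt h)"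
        using e by (simp add: algebra_simps)
      then have "c = x' * h + a * ds h + b * dt h" by (rule tB_cancel)
      then show "c \<in> idl {h, ds h, dt h}" unfolding idl_3 by blast
    qed
  qed (rule codim_h_t, rule \<tau>)
  \<comment> \<open>The passage from \<open>?I1\<close> to \<open>?I\<close> costs the length of the
    quotient by this colon ideal. It contains t. If p h is a combination in which h + t dt h has
    coefficient b, then p agrees with b on the line, and b is the t-component of a logarithmic
    field.\<close>
  let ?C = "{c. c * h \<in> ?I1}"
  have iC: "ideal ?C"
    unfolding ideal_def using ideal_0[OF ideal_idl] ideal_add[OF ideal_idl] ideal_mult[OF ideal_idl]
    by (auto simp: distrib_right mult.assoc)
  have C: "B.hascodim (B.sat ?C) q"
  proof (rule codim_contains_t[OF iC _ _ \<gamma>(2,3)])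
    show "tB \<in> ?C" by (auto intro: idl_superset)
    have "\<gamma> * h = (- c) * (tB * h) + \<beta> * (tB * ds h) + \<gamma> * (h + tB * dt h)"
    proof -
      have "\<beta> * (tB * ds h) + \<gamma> * (h + tB * dt h) = \<gamma> * h + tB * (\<beta> * ds h + \<gamma> * dt h)"
        by (simp add: algebra_simps)
      then show ?thesis unfolding \<gamma>(1) by (simp add: algebra_simps)
    qed
    then show "\<gamma> \<in> ?C" unfolding mem_Collect_eq idl_3 by blast
    fix p assume "p \<in> ?C"
    then obtain x a b where e: "p * h = x * (tB * h) + a * (tB * ds h) + b * (h + tB * dt h)"
      unfolding mem_Collect_eq idl_3 by blast
    then have "(p - b - x * tB) * h = tB * (a * ds h + b * dt h)" by (simp add: algebra_simps)
    then obtain c' where c': "p - b - x * tB = tB * c'" "c' * h = a * ds h + b * dt h"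
      by (rule tB_dvd_cancel[OF _ hn(1)])
    from c'(1) have "p = b + (x + c') * tB" by (simp add: algebra_simps)
    then have "map0 p = map0 b" by (simp add: rh_add[OF ringhom_map0] rh_mult[OF ringhom_map0])
    then show "[:0, 1:] ^ q dvd map0 p" using min[OF c'(2)[symmetric]] by simp
  qed
  have "B.hascodim (B.sat ?I1) ((n + \<tau>) + q)"
  proof (rule B.hascodim_sat_exact[OF ideal_idl _ refl I C])
    show "p \<in> ?I \<longleftrightarrow> (\<exists>y. p - y * h \<in> ?I1)" for p
    proof
      assume "p \<in> ?I"
      then obtain x a b where "p = x * h + a * (tB * ds h) + b * (tB * dt h)" unfolding idl_3 by blast
      then have "p - (x - b) * h = 0 * (tB * h) + a * (tB * ds h) + b * (h + tB * dt h)" by (simp add: algebra_simps)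
      then show "\<exists>y. p - y * h \<in> ?I1" unfolding idl_3 by blast
    next
      assume "\<exists>y. p - y * h \<in> ?I1"
      then obtain y x a b where "p - y * h = x * (tB * h) + a * (tB * ds h) + b * (h + tB * dt h)" unfolding idl_3 by blast
      then have "p = (y + x * tB + b) * h + a * (tB * ds h) + b * (tB * dt h)" by (simp add: algebra_simps)
      then show "p \<in> ?I" unfolding idl_3 by blast
    qed
  qed
  then show ?thesis by (simp add: ac_simps)
qed

end

section \<open>Ternary polynomials\<close>

unbundle no fps_syntax
unbundle vec_syntax

abbreviation (input) sgl :: "'a \<Rightarrow> 'b \<Rightarrow> 'a \<Rightarrow>\<^sub>0 'b::zero" where "sgl \<equiv> Poly_Mapping.single"
abbreviation (input) lkp where "lkp \<equiv> Poly_Mapping.lookup"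

lemma sum_singles: "p = (\<Sum>m\<in>Poly_Mapping.keys p. sgl m (lkp p m))"
  by (rule poly_mapping_eqI)
    (simp add: lookup_sum lookup_single when_def sum.delta' in_keys_iff if_distrib cong: if_cong)

text \<open>The substitution homomorphism sending the variables to x; \<open>eval3\<close>,
  \<open>hpol\<close>, \<open>to3\<close>, \<open>rho\<close>, \<open>tau\<close> and
  \<open>Phi\<close> are all instances.\<close>

definition ins :: "(complex \<Rightarrow> 'a::comm_ring_1) \<Rightarrow> (3 \<Rightarrow> 'a) \<Rightarrow> poly3 \<Rightarrow> 'a" where
  "ins k x p = (\<Sum>m\<in>Poly_Mapping.keys p. k (lkp p m) * (\<Prod>i\<in>UNIV. x i ^ lkp m i))"

context
  fixes k :: "complex \<Rightarrow> 'a::comm_ring_1" and x :: "3 \<Rightarrow> 'a"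
  assumes k: "ringhom k"
begin

lemma ins_superset:
  assumes "finite A" "Poly_Mapping.keys p \<subseteq> A"
  shows "ins k x p = (\<Sum>m\<in>A. k (lkp p m) * (\<Prod>i\<in>UNIV. x i ^ lkp m i))"
  unfolding ins_def using assms by (intro sum.mono_neutral_left) (auto simp: in_keys_iff rh_0[OF k])

lemma ins_add: "ins k x (p + q) = ins k x p + ins k x q"
proof -
  let ?A = "Poly_Mapping.keys p \<union> Poly_Mapping.keys q"
  have "ins k x r = (\<Sum>m\<in>?A. k (lkp r m) * (\<Prod>i\<in>UNIV. x i ^ lkp m i))"
    if "r \<in> {p, q, p + q}" for r
    using that keys_add[of p q] by (intro ins_superset) auto
  then show ?thesis by (simp add: lookup_add rh_add[OF k] distrib_right sum.distrib)
qed

lemma ins_0: "ins k x 0 = 0"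
  by (simp add: ins_def)

lemma ins_single: "ins k x (sgl m c) = k c * (\<Prod>i\<in>UNIV. x i ^ lkp m i)"
  using ins_superset[of "{m}" "sgl m c"] by simp

lemma ins_sum: "ins k x (sum f A) = (\<Sum>a\<in>A. ins k x (f a))"
  by (induction A rule: infinite_finite_induct) (auto simp: ins_0 ins_add)

lemma ins_mult: "ins k x (p * q) = ins k x p * ins k x q"
proof -
  let ?P = "Poly_Mapping.keys p" and ?Q = "Poly_Mapping.keys q"
  have "p * q = (\<Sum>m\<in>?P. \<Sum>n\<in>?Q. sgl (m + n) (lkp p m * lkp q n))"
    by (subst (1) sum_singles[of p], subst (1) sum_singles[of q]) (simp add: sum_product mult_single)
  then have "ins k x (p * q) = (\<Sum>m\<in>?P. \<Sum>n\<in>?Q. ins k x (sgl (m + n) (lkp p m * lkp q n)))"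
    by (simp add: ins_sum)
  also have "\<dots> = ins k x p * ins k x q"
    unfolding ins_single ins_def[of k x p] ins_def[of k x q] sum_product
    by (simp add: rh_mult[OF k] lookup_add power_add prod.distrib ac_simps)
  finally show ?thesis .
qed

lemma ringhom_ins: "ringhom (ins k x)"
proof (rule ringhomI)
  show "ins k x 1 = 1" unfolding single_one[symmetric] ins_single by (simp add: rh_1[OF k])
qed (auto simp: ins_add ins_mult)

lemma ins_cst [simp]: "ins k x (cst c) = k c"
  by (simp add: cst_def ins_single)

lemma ins_Var [simp]: "ins k x (Var i) = x i"
proof -
  have "(\<Prod>j\<in>UNIV. x j ^ lkp (sgl i 1) j) = (\<Prod>j\<in>UNIV. if j = i then x j else 1)"
    by (rule prod.cong) (auto simp: lookup_single when_def)
  then show ?thesis by (simp add: Var_def ins_single rh_1[OF k] prod.delta)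
qed

end

lemma ringhom_cst: "ringhom cst"
  by (rule ringhomI) (simp_all add: cst_def single_add mult_single)

lemma Var_power: "Var i ^ n = sgl (sgl i n) 1"
  by (induction n) (simp_all add: Var_def mult_single single_add[symmetric])

lemma prod_3: "(\<Prod>i\<in>UNIV. f i) = f 1 * f 2 * f (3::3)"
  unfolding UNIV_3 by (simp add: ac_simps)

lemma single_eq_prod: "sgl m c = cst c * (\<Prod>i\<in>UNIV. Var i ^ lkp m i)"
proof -
  have m: "m = sgl 1 (lkp m 1) + sgl 2 (lkp m 2) + sgl 3 (lkp m 3)"
  proof (rule poly_mapping_eqI)
    fix j :: 3
    show "lkp m j = lkp (sgl 1 (lkp m 1) + sgl 2 (lkp m 2) + sgl 3 (lkp m 3)) j"
      using exhaust_3[of j] by (auto simp: lookup_add lookup_single when_def)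
  qed
  have "(\<Prod>i\<in>UNIV. Var i ^ lkp m i) = sgl m 1"
    unfolding prod_3 Var_power mult_single m[symmetric] by simp
  then show ?thesis by (simp add: cst_def mult_single)
qed

lemma poly3_induct [case_names cst Var add mult]:
  assumes cst: "\<And>c. P (cst c)" and Var: "\<And>i. P (Var i)"
    and add: "\<And>p q. P p \<Longrightarrow> P q \<Longrightarrow> P (p + q)" and mult: "\<And>p q. P p \<Longrightarrow> P q \<Longrightarrow> P (p * q)"
  shows "P p"
proof -
  have P0: "P 0" and P1: "P 1" using cst[of 0] cst[of 1] by (simp_all add: cst_def)
  have pow: "P (q ^ n)" if "P q" for q n by (induction n) (auto simp: P1 mult that)
  have prd: "P (prod f A)" if "\<And>i. P (f i)" for f :: "3 \<Rightarrow> poly3" and A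
    by (induction A rule: infinite_finite_induct) (auto simp: P1 mult that)
  have "P (sgl m c)" for m c
    unfolding single_eq_prod by (intro mult cst prd pow Var)
  then have "P (\<Sum>m\<in>A. sgl m (lkp p m))" for A
    by (induction A rule: infinite_finite_induct) (auto simp: P0 add)
  then show ?thesis using sum_singles[of p] by metis
qed

lemma poly3_hom_eq:
  assumes "ringhom f" "ringhom g" "\<And>c. f (cst c) = g (cst c)" "\<And>i. f (Var i) = g (Var i)"
  shows "f p = g p"
  by (induction p rule: poly3_induct)
    (auto simp: assms rh_add[OF assms(1)] rh_add[OF assms(2)] rh_mult[OF assms(1)] rh_mult[OF assms(2)])

lemma eval3_ins: "eval3 p v = ins (\<lambda>c. c) (\<lambda>i. v $ i) p"
  by (simp add: eval3_def ins_def)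

lemma ringhom_eval3: "ringhom (\<lambda>p. eval3 p v)"
  unfolding eval3_ins by (rule ringhom_ins) (simp add: ringhom_def)

lemma eval3_Var [simp]: "eval3 (Var i) v = v $ i" and eval3_cst [simp]: "eval3 (cst c) v = c"
  unfolding eval3_ins by (simp_all add: ringhom_def)

section \<open>Formal partial derivatives\<close>

lemma pd_superset:
  assumes "finite A" "Poly_Mapping.keys p \<subseteq> A"
  shows "pd i p = (\<Sum>m\<in>A. sgl (m - sgl i 1) (of_nat (lkp m i) * lkp p m))"
  unfolding pd_def using assms by (intro sum.mono_neutral_left) (auto simp: in_keys_iff)

lemma pd_add: "pd i (p + q) = pd i p + pd i q"
proof -
  let ?A = "Poly_Mapping.keys p \<union> Poly_Mapping.keys q"
  have "pd i r = (\<Sum>m\<in>?A. sgl (m - sgl i 1) (of_nat (lkp m i) * lkp r m))"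
    if "r \<in> {p, q, p + q}" for r
    using that keys_add[of p q] by (intro pd_superset) auto
  then show ?thesis by (simp add: lookup_add distrib_left single_add sum.distrib)
qed

lemma pd_0 [simp]: "pd i 0 = 0"
  by (simp add: pd_def)

lemma pd_sum: "pd i (sum f A) = (\<Sum>a\<in>A. pd i (f a))"
  by (induction A rule: infinite_finite_induct) (auto simp: pd_add)

lemma pd_single: "pd i (sgl m c) = sgl (m - sgl i 1) (of_nat (lkp m i) * c)"
  using pd_superset[of "{m}" "sgl m c" i] by simp

lemma pd_mult_single:
  "pd i (sgl m c * sgl m' c') = pd i (sgl m c) * sgl m' c' + sgl m c * pd i (sgl m' c')"
proof -
  have s: "sgl (m - sgl i 1 + m') (of_nat (lkp m i) * d) = sgl (m + m' - sgl i 1) (of_nat (lkp m i) * d)"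
    for m m' :: mono3 and d :: complex
  proof (cases "lkp m i = 0")
    case False
    have "m - sgl i 1 + m' = m + m' - sgl i 1"
      by (rule poly_mapping_eqI) (use False in \<open>auto simp: lookup_add lookup_minus lookup_single when_def\<close>)
    then show ?thesis by simp
  qed simp
  have "pd i (sgl m c * sgl m' c') = sgl (m + m' - sgl i 1) (of_nat (lkp m i) * (c * c')) + sgl (m' + m - sgl i 1) (of_nat (lkp m' i) * (c * c'))"
    by (simp add: mult_single pd_single lookup_add distrib_right single_add add.commute)
  also have "\<dots> = pd i (sgl m c) * sgl m' c' + sgl m c * pd i (sgl m' c')"
    unfolding s[symmetric] by (simp add: mult_single pd_single ac_simps)
  finally show ?thesis .
qed

lemma pd_mult: "pd i (p * q) = pd i p * q + p * pd i q"
proof -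
  let ?P = "Poly_Mapping.keys p" and ?Q = "Poly_Mapping.keys q"
  let ?p = "\<Sum>m\<in>?P. sgl m (lkp p m)" and ?q = "\<Sum>n\<in>?Q. sgl n (lkp q n)"
  have "pd i (?p * ?q) = pd i ?p * ?q + ?p * pd i ?q"
    unfolding sum_product pd_sum pd_mult_single sum.distrib by simp
  then show ?thesis using sum_singles[of p] sum_singles[of q] by metis
qed

lemma pd_cst [simp]: "pd i (cst c) = 0"
  by (simp add: cst_def pd_single)

lemma pd_Var: "pd i (Var j) = (if i = j then 1 else 0)"
  by (auto simp: Var_def pd_single lookup_single when_def)

lemma chain_rule3:
  fixes D :: "'a::comm_ring_1 \<Rightarrow> 'a"
  assumes k: "ringhom k" and Dk: "\<And>c. D (k c) = 0" and Da: "\<And>x y. D (x + y) = D x + D y"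
    and Dm: "\<And>x y. D (x * y) = D x * y + x * D y"
  shows "D (ins k x p) = (\<Sum>i\<in>UNIV. ins k x (pd i p) * D (x i))"
proof (induction p rule: poly3_induct)
  case (cst c)
  then show ?case by (simp add: k Dk ins_0[OF k])
next
  case (Var j)
  have "(\<Sum>i\<in>UNIV. ins k x (pd i (Var j)) * D (x i)) = (\<Sum>i\<in>UNIV. if i = j then D (x i) else 0)"
    by (rule sum.cong) (auto simp: pd_Var ins_0[OF k] rh_1[OF ringhom_ins[OF k]])
  then show ?case by (simp add: k)
next
  case (add p q)
  then show ?case by (simp add: ins_add[OF k] pd_add Da distrib_right sum.distrib)
next
  case (mult p q)
  then show ?case
    by (simp add: ins_mult[OF k] ins_add[OF k] pd_mult Dm sum_distrib_left sum_distrib_right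
        sum.distrib algebra_simps)
qed

section \<open>Homogeneous components\<close>

lemma tdeg_add: "tdeg (m + n) = tdeg m + tdeg n"
  by (simp add: tdeg_def lookup_add sum.distrib)

lemma tdeg_0_iff: "tdeg m = 0 \<longleftrightarrow> m = 0"
  by (auto simp: tdeg_def intro: poly_mapping_eqI)

text \<open>The substitution of x T, y T, z T for x, y, z, which separates the homogeneous components hc.\<close>

definition hpol :: "poly3 \<Rightarrow> poly3 poly" where
  "hpol = ins (\<lambda>c. [:cst c:]) (\<lambda>i. [:0, Var i:])"

lemma ringhom_Cst: "ringhom (\<lambda>c. [:cst c:])"
  using ringhom_cst by (simp add: ringhom_def one_pCons)

lemma ringhom_hpol: "ringhom hpol"
  unfolding hpol_def by (rule ringhom_ins[OF ringhom_Cst])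

lemma hpol_single: "hpol (sgl m c) = monom (sgl m c) (tdeg m)"
proof -
  have "[:0, Var i:] ^ n = monom (Var i ^ n) n" for i n
    by (induction n) (simp_all add: monom_Suc mult_monom one_pCons monom_0 smult_monom)
  then have "(\<Prod>i\<in>UNIV. [:0, Var i:] ^ lkp m i) = monom (\<Prod>i\<in>UNIV. Var i ^ lkp m i) (tdeg m)"
    by (simp add: prod_3 mult_monom tdeg_def sum_3)
  then show ?thesis
    unfolding hpol_def ins_single[OF ringhom_Cst] by (simp add: single_eq_prod smult_monom)
qed

definition hc :: "nat \<Rightarrow> poly3 \<Rightarrow> poly3" where "hc d p = coeff (hpol p) d"

lemma lookup_hc: "lkp (hc d p) m = (if tdeg m = d then lkp p m else 0)"
proof -
  have "hpol p = (\<Sum>m\<in>Poly_Mapping.keys p. monom (sgl m (lkp p m)) (tdeg m))"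
    by (subst sum_singles[of p]) (simp add: rh_sum[OF ringhom_hpol] hpol_single)
  then have "lkp (hc d p) m = (\<Sum>n\<in>Poly_Mapping.keys p. if n = m \<and> tdeg n = d then lkp p n else 0)"
    by (auto simp: hc_def coeff_sum lookup_sum lookup_single when_def intro!: sum.cong)
  also have "\<dots> = (if tdeg m = d then lkp p m else 0)"
    by (cases "tdeg m = d") (auto simp: in_keys_iff sum.delta' cong: conj_cong intro!: sum.neutral)
  finally show ?thesis .
qed

lemma homog_hc: "homog (hc d p) d"
  unfolding homog_def by (auto simp: in_keys_iff lookup_hc split: if_splits)

lemma homog_iff_hc: "homog p d \<longleftrightarrow> hc d p = p"
  by (auto simp: homog_def in_keys_iff poly_mapping_eq_iff fun_eq_iff lookup_hc)

lemma homog_iff_hpol: "homog p d \<longleftrightarrow> hpol p = monom p d"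
proof
  assume h: "homog p d"
  show "hpol p = monom p d"
  proof (rule poly_eqI)
    fix j
    show "coeff (hpol p) j = coeff (monom p d) j"
      unfolding hc_def[symmetric] using h
      by (intro poly_mapping_eqI) (auto simp: lookup_hc homog_def in_keys_iff)
  qed
next
  assume "hpol p = monom p d"
  then show "homog p d" by (simp add: homog_iff_hc hc_def)
qed

lemma hc_add: "hc d (p + q) = hc d p + hc d q"
  by (simp add: hc_def rh_add[OF ringhom_hpol])

lemma hc_diff: "hc d (p - q) = hc d p - hc d q"
  by (simp add: hc_def rh_diff[OF ringhom_hpol])

lemma hc_0 [simp]: "hc d 0 = 0"
  by (simp add: hc_def rh_0[OF ringhom_hpol])

lemma hc_sum: "hc d (sum f A) = (\<Sum>a\<in>A. hc d (f a))"
  by (induction A rule: infinite_finite_induct) (auto simp: hc_add)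

lemma hc_mult_homog: "homog p k \<Longrightarrow> hc d (p * q) = (if d < k then 0 else p * hc (d - k) q)"
  by (simp add: hc_def rh_mult[OF ringhom_hpol] homog_iff_hpol coeff_monom_mult)

lemma hc_homog: "homog p k \<Longrightarrow> hc d p = (if d = k then p else 0)"
  by (auto simp: hc_def homog_iff_hpol)

lemma sum_hc: "p = (\<Sum>d\<le>degree (hpol p). hc d p)"
proof -
  have "ringhom (\<lambda>p. poly (hpol p) 1)"
    using ringhom_hpol by (simp add: ringhom_def)
  then have "poly (hpol p) 1 = p"
    by (rule poly3_hom_eq[where g = "\<lambda>p. p"])
      (simp_all add: ringhom_def[of "\<lambda>p. p"] hpol_def ins_cst[OF ringhom_Cst] ins_Var[OF ringhom_Cst])
  then show ?thesis by (simp add: hc_def poly_altdef)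
qed

lemma hc_eq_0_imp: "(\<And>d. hc d p = 0) \<Longrightarrow> p = 0"
  using sum_hc[of p] by simp

lemma hpol_inject: "hpol p = hpol q \<longleftrightarrow> p = q"
  using sum_hc unfolding hc_def by metis

lemma homog_0 [simp]: "homog 0 d"
  by (simp add: homog_def)

lemma homog_add: "homog p d \<Longrightarrow> homog q d \<Longrightarrow> homog (p + q) d"
  by (simp add: homog_iff_hc hc_add)

lemma homog_sum: "(\<And>a. a \<in> A \<Longrightarrow> homog (f a) d) \<Longrightarrow> homog (sum f A) d"
  by (simp add: homog_iff_hc hc_sum)

lemma homog_mult: "homog p d \<Longrightarrow> homog q e \<Longrightarrow> homog (p * q) (d + e)"
  by (simp add: homog_iff_hpol rh_mult[OF ringhom_hpol] mult_monom)

lemma homog_minus: "homog p d \<Longrightarrow> homog (- p) d"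
  by (simp add: homog_def)

lemma homog_diff: "homog p d \<Longrightarrow> homog q d \<Longrightarrow> homog (p - q) d"
  using homog_add[of p d "-q"] homog_minus by simp

lemma homog_cst: "homog (cst c) 0"
  by (simp add: homog_def cst_def tdeg_0_iff)

lemma homog_Var: "homog (Var i) 1"
  by (simp add: homog_iff_hpol) (simp add: hpol_def ringhom_Cst monom_altdef)

lemma homog_cst_mult: "homog p d \<Longrightarrow> homog (cst c * p) d"
  using homog_mult[OF homog_cst] by fastforce

lemma homog_power: "homog p d \<Longrightarrow> homog (p ^ n) (n * d)"
  by (simp add: homog_iff_hpol rh_power[OF ringhom_hpol] monom_power mult.commute)

lemma homog_unique: "homog p d \<Longrightarrow> homog p e \<Longrightarrow> p \<noteq> 0 \<Longrightarrow> d = e"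
  by (metis hc_homog homog_iff_hc)

lemma homog_hdeg: "homog p d \<Longrightarrow> p \<noteq> 0 \<Longrightarrow> hdeg p = d"
proof -
  assume h: "homog p d" "p \<noteq> 0"
  obtain m where "m \<in> Poly_Mapping.keys p"
    using h(2) by (metis in_keys_iff lookup_zero poly_mapping_eqI)
  then have "tdeg ` Poly_Mapping.keys p = {d}" using h(1) by (auto simp: homog_def image_iff)
  then show ?thesis by (simp add: hdeg_def)
qed

lemma homog_0_cst: "homog p 0 \<Longrightarrow> \<exists>c. p = cst c"
proof -
  assume "homog p 0"
  then have "p = cst (lkp p 0)"
    unfolding cst_def
    by (intro poly_mapping_eqI) (auto simp: homog_def in_keys_iff tdeg_0_iff lookup_single when_def)
  then show ?thesis by blast
qed

lemma cst_eq_0_iff [simp]: "cst c = 0 \<longleftrightarrow> c = 0"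
  by (metis cst_def lookup_single_eq lookup_zero single_zero)

lemma cst_inverse: "c \<noteq> 0 \<Longrightarrow> cst c * cst (1 / c) = 1"
  by (simp add: cst_def mult_single)

text \<open>Degrees in the auxiliary variable of \<open>hpol\<close> add up under multiplication, so
  a unit lives in degree 0.\<close>

lemma unit_imp_cst: "(p :: poly3) dvd 1 \<Longrightarrow> \<exists>c. c \<noteq> 0 \<and> p = cst c"
proof -
  assume "p dvd 1"
  then obtain q where q: "1 = p * q" by blast
  then have nz: "p \<noteq> 0" "q \<noteq> 0" by auto
  have "hpol p \<noteq> 0" "hpol q \<noteq> 0" using nz hpol_inject[of _ 0] by (auto simp: rh_0[OF ringhom_hpol])
  moreover have "hpol p * hpol q = 1"
    using q by (metis rh_mult[OF ringhom_hpol] rh_1[OF ringhom_hpol])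
  ultimately have "degree (hpol p) = 0" by (metis add_is_0 degree_1 degree_mult_eq)
  then have "p = hc 0 p" using sum_hc[of p] by simp
  then have "homog p 0" using homog_iff_hc by metis
  then show ?thesis using homog_0_cst nz(1) by fastforce
qed

lemma cst_unit: "c \<noteq> 0 \<Longrightarrow> cst c dvd 1"
  using cst_inverse by (metis dvd_triv_left)

lemma of_nat_cst: "of_nat n = cst (of_nat n)"
  by (simp add: cst_def)

lemma tdeg_minus_single: "lkp m i \<noteq> 0 \<Longrightarrow> Suc (tdeg (m - sgl i 1)) = tdeg m"
proof -
  assume "lkp m i \<noteq> 0"
  then have "m = (m - sgl i 1) + sgl i 1"
    by (intro poly_mapping_eqI) (auto simp: lookup_add lookup_minus lookup_single when_def)
  then have "tdeg m = tdeg (m - sgl i 1) + tdeg (sgl i 1)" by (metis tdeg_add)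
  moreover have "tdeg (sgl i 1) = 1" using homog_Var[of i] by (simp add: homog_def Var_def)
  ultimately show ?thesis by simp
qed

lemma euler_formula: "homog p d \<Longrightarrow> (\<Sum>i\<in>UNIV. Var i * pd i p) = of_nat d * p"
proof -
  assume h: "homog p d"
  have s: "(\<Sum>i\<in>UNIV. Var i * pd i (sgl m c)) = of_nat (tdeg m) * sgl m c" for m c
  proof -
    have "Var i * pd i (sgl m c) = sgl m (of_nat (lkp m i) * c)" for i
    proof (cases "lkp m i = 0")
      case False
      then have "sgl i 1 + (m - sgl i 1) = m"
        by (intro poly_mapping_eqI) (auto simp: lookup_add lookup_minus lookup_single when_def)
      then show ?thesis by (simp add: Var_def pd_single mult_single)
    qed (simp add: pd_single)
    then have "(\<Sum>i\<in>UNIV. Var i * pd i (sgl m c)) = sgl m (\<Sum>i\<in>UNIV. of_nat (lkp m i) * c)"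
      by (simp add: sum_3 single_add)
    also have "(\<Sum>i\<in>UNIV. of_nat (lkp m i) * c) = of_nat (tdeg m) * c"
      by (simp add: tdeg_def sum_distrib_right)
    finally show ?thesis unfolding of_nat_cst cst_def mult_single by simp
  qed
  have "(\<Sum>i\<in>UNIV. Var i * pd i p) = (\<Sum>m\<in>Poly_Mapping.keys p. \<Sum>i\<in>UNIV. Var i * pd i (sgl m (lkp p m)))"
  proof -
    have "(\<Sum>i\<in>UNIV. Var i * pd i p) = (\<Sum>i\<in>UNIV. \<Sum>m\<in>Poly_Mapping.keys p. Var i * pd i (sgl m (lkp p m)))"
      by (rule sum.cong) (simp, subst (1) sum_singles[of p], simp add: pd_sum sum_distrib_left)
    also have "\<dots> = (\<Sum>m\<in>Poly_Mapping.keys p. \<Sum>i\<in>UNIV. Var i * pd i (sgl m (lkp p m)))"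
      by (rule sum.swap)
    finally show ?thesis .
  qed
  also have "\<dots> = (\<Sum>m\<in>Poly_Mapping.keys p. of_nat d * sgl m (lkp p m))"
    unfolding s using h by (intro sum.cong) (auto simp: homog_def)
  also have "\<dots> = of_nat d * p" by (subst (2) sum_singles[of p]) (simp add: sum_distrib_left)
  finally show ?thesis .
qed

lemma homog_pd: "homog p (Suc d) \<Longrightarrow> homog (pd i p) d"
  unfolding pd_def
proof (rule homog_sum)
  fix m assume "homog p (Suc d)" "m \<in> Poly_Mapping.keys p"
  then have "tdeg m = Suc d" by (simp add: homog_def)
  then have "lkp m i \<noteq> 0 \<Longrightarrow> tdeg (m - sgl i 1) = d" using tdeg_minus_single[of m i] by simp
  then show "homog (sgl (m - sgl i 1) (of_nat (lkp m i) * lkp p m)) d"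
    by (cases "lkp m i = 0") (auto simp: homog_def simp del: One_nat_def)
qed

lemma homog_pd_0: "homog p 0 \<Longrightarrow> pd i p = 0"
  using homog_0_cst pd_cst by metis

lemma hc_pd: "hc d (pd i p) = pd i (hc (Suc d) p)"
proof -
  have "hc d (pd i (hc j p)) = (if j = Suc d then pd i (hc j p) else 0)" for j
  proof (cases j)
    case 0
    then show ?thesis using homog_pd_0[OF homog_hc[of 0 p]] by simp
  next
    case (Suc k)
    have "homog (pd i (hc j p)) k" using homog_pd homog_hc Suc by metis
    then show ?thesis using Suc by (auto simp: hc_homog)
  qed
  note * = this
  have "hc d (pd i p) = (\<Sum>j\<le>degree (hpol p). hc d (pd i (hc j p)))"
    by (subst sum_hc[of p]) (simp add: pd_sum hc_sum)
  also have "\<dots> = (if Suc d \<le> degree (hpol p) then pd i (hc (Suc d) p) else 0)"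
    unfolding * by (simp add: sum.delta')
  also have "\<dots> = pd i (hc (Suc d) p)"
    by (simp add: hc_def[of "Suc d"] coeff_eq_0)
  finally show ?thesis .
qed

text \<open>Euler's formula multiplies the component of degree d + 1 by d + 1, which is
  invertible.\<close>

lemma all_pd_0_imp_cst:
  assumes "\<And>i. pd i p = 0" shows "\<exists>c. p = cst c"
proof -
  have "hc (Suc d) p = 0" for d
  proof -
    have "of_nat (Suc d) * hc (Suc d) p = (\<Sum>i\<in>UNIV. Var i * pd i (hc (Suc d) p))"
      using euler_formula[OF homog_hc] by metis
    also have "\<dots> = 0" using assms by (simp add: hc_pd[symmetric])
    finally show ?thesis unfolding of_nat_cst by (metis cst_eq_0_iff mult_eq_0_iff of_nat_neq_0)
  qed
  then have "hc d p = hc d (hc 0 p)" for d using hc_homog[OF homog_hc[of 0 p]] by (cases d) auto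
  then have "hc d (p - hc 0 p) = 0" for d
    by (metis diff_self hc_diff)
  then have "p - hc 0 p = 0" by (rule hc_eq_0_imp)
  then have "p = hc 0 p" by simp
  then show ?thesis using homog_0_cst homog_hc by metis
qed

text \<open>Differentiation lowers the top degree, so a multiple of p can arise only as 0.\<close>

lemma dvd_pd_imp_0:
  assumes "p dvd pd i p" shows "pd i p = 0"
proof (rule ccontr)
  assume nz: "pd i p \<noteq> 0"
  obtain q where q: "pd i p = p * q" using assms by blast
  then have "hpol (pd i p) = hpol p * hpol q" by (simp add: rh_mult[OF ringhom_hpol])
  moreover have "hpol (pd i p) \<noteq> 0" using nz hpol_inject[of _ 0] by (auto simp: rh_0[OF ringhom_hpol])
  ultimately have le: "degree (hpol p) \<le> degree (hpol (pd i p))"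
    by (metis degree_mult_eq le_add1 mult_eq_0_iff)
  have "coeff (hpol (pd i p)) (degree (hpol p)) = pd i (coeff (hpol p) (Suc (degree (hpol p))))"
    using hc_pd by (simp add: hc_def)
  then have "coeff (hpol (pd i p)) d = 0" if "d \<ge> degree (hpol p)" for d
    using hc_pd[of d i p] that by (simp add: hc_def coeff_eq_0)
  then show False using le \<open>hpol (pd i p) \<noteq> 0\<close> by (metis leading_coeff_0_iff)
qed

text \<open>Unique factorization is transported from iterated univariate polynomials.\<close>

definition to3 :: "poly3 \<Rightarrow> complex poly poly poly" where
  "to3 = ins (\<lambda>c. [:[:[:c:]:]:]) (\<lambda>i. if i = 1 then [:[:[:0, 1:]:]:] else if i = 2 then [:[:0, 1:]:] else [:0, 1:])"

definition from3 :: "complex poly poly poly \<Rightarrow> poly3" where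
  "from3 p = poly (map_poly (\<lambda>q. poly (map_poly (\<lambda>r. poly (map_poly cst r) (Var 1)) q) (Var 2)) p) (Var 3)"

lemma ringhom_kkk: "ringhom (\<lambda>c :: complex. [:[:[:c:]:]:])"
  by (simp add: ringhom_def one_pCons)

lemma ringhom_to3: "ringhom to3"
  unfolding to3_def by (rule ringhom_ins[OF ringhom_kkk])

lemma ringhom_from3_1: "ringhom (\<lambda>r. poly (map_poly cst r) (Var 1))"
  by (rule ringhom_poly_map[OF ringhom_cst])

lemma ringhom_from3_2: "ringhom (\<lambda>q. poly (map_poly (\<lambda>r. poly (map_poly cst r) (Var 1)) q) (Var 2))"
  by (rule ringhom_poly_map[OF ringhom_from3_1])

lemma ringhom_from3: "ringhom from3"
  unfolding from3_def[abs_def] by (rule ringhom_poly_map[OF ringhom_from3_2])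

lemma poly_hom_eq:
  assumes f: "ringhom f" and g: "ringhom g" and c: "\<And>c. f [:c:] = g [:c:]" and X: "f [:0, 1:] = g [:0, 1:]"
  shows "f p = g p"
proof (induction p)
  case (pCons a p)
  have "pCons a p = [:a:] + [:0, 1:] * p" by simp
  then show ?case using pCons c X by (metis rh_add[OF f] rh_add[OF g] rh_mult[OF f] rh_mult[OF g])
qed (simp add: rh_0[OF f] rh_0[OF g])

lemma from3_pCons: "from3 [:q:] = poly (map_poly (\<lambda>r. poly (map_poly cst r) (Var 1)) q) (Var 2)"
  using map_poly_pCons_rh[OF ringhom_from3_2, of q 0] by (simp add: from3_def)

lemma from3_pCons2: "from3 [:[:r:]:] = poly (map_poly cst r) (Var 1)"
  unfolding from3_pCons using map_poly_pCons_rh[OF ringhom_from3_1, of r 0] by simp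

lemma from3_pCons3: "from3 [:[:[:c:]:]:] = cst c"
  unfolding from3_pCons2 using map_poly_pCons_rh[OF ringhom_cst, of c 0] by simp

lemma from3_Var: "from3 [:[:[:0, 1:]:]:] = Var 1" "from3 [:[:0, 1:]:] = Var 2" "from3 [:0, 1:] = Var 3"
proof -
  show "from3 [:[:[:0, 1:]:]:] = Var 1"
    unfolding from3_pCons2
    by (simp add: map_poly_pCons_rh[OF ringhom_cst] rh_0[OF ringhom_cst] rh_1[OF ringhom_cst])
  show "from3 [:[:0, 1:]:] = Var 2"
    unfolding from3_pCons using rh_0[OF ringhom_from3_1] rh_1[OF ringhom_from3_1]
    by (simp add: map_poly_pCons_rh[OF ringhom_from3_1])
  show "from3 [:0, 1:] = Var 3"
    unfolding from3_def using rh_0[OF ringhom_from3_2] rh_1[OF ringhom_from3_2]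
    by (simp add: map_poly_pCons_rh[OF ringhom_from3_2])
qed

lemma from3_to3: "from3 (to3 p) = p"
proof (rule poly3_hom_eq[where f = "\<lambda>p. from3 (to3 p)" and g = "\<lambda>p. p"])
  show "ringhom (\<lambda>p. from3 (to3 p))" by (rule ringhom_comp[OF ringhom_from3 ringhom_to3])
  show "from3 (to3 (Var i)) = Var i" for i
    using exhaust_3[of i] by (auto simp: to3_def ins_Var[OF ringhom_kkk] from3_Var)
qed (simp_all add: ringhom_def[of "\<lambda>p. p"] to3_def ins_cst[OF ringhom_kkk] from3_pCons3)

lemma to3_from3: "to3 (from3 p) = p"
proof -
  note h = ringhom_comp[OF ringhom_to3 ringhom_from3]
  have i: "ringhom (\<lambda>x. x)" by (simp add: ringhom_def)
  have k: "ringhom (\<lambda>c :: 'a::comm_ring_1. [:c:])" by (simp add: ringhom_def one_pCons)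
  note h2 = ringhom_comp[OF h k] and k2 = ringhom_comp[OF k k]
  have 3: "to3 (from3 [:[:r:]:]) = [:[:r:]:]" for r
    by (rule poly_hom_eq[OF ringhom_comp[OF h k2] k2])
      (simp_all add: from3_pCons3 from3_Var, simp_all add: to3_def ins_cst[OF ringhom_kkk] ins_Var[OF ringhom_kkk])
  have 2: "to3 (from3 [:q:]) = [:q:]" for q
    by (rule poly_hom_eq[OF h2 k])
      (simp_all add: 3 from3_Var, simp_all add: to3_def ins_Var[OF ringhom_kkk])
  show ?thesis
    by (rule poly_hom_eq[OF h i])
      (simp_all add: 2 from3_Var, simp_all add: to3_def ins_Var[OF ringhom_kkk])
qed

lemma to3_dvd_iff: "to3 p dvd to3 q \<longleftrightarrow> p dvd q"
  using rh_dvd[OF ringhom_to3] rh_dvd[OF ringhom_from3] from3_to3 by metis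

text \<open>The two cancellation rules say that the cofactors are coprime, in the form in which this
  is applied.\<close>

lemma poly3_gcd:
  fixes p q :: poly3
  assumes "p \<noteq> 0 \<or> q \<noteq> 0"
  obtains d p' q' where "p = p' * d" "q = q' * d" "\<And>x. p' dvd q' * x \<Longrightarrow> p' dvd x" "\<And>x. q' dvd p' * x \<Longrightarrow> q' dvd x"
proof -
  let ?P = "to3 p" and ?Q = "to3 q"
  have "?P \<noteq> 0 \<or> ?Q \<noteq> 0" using assms from3_to3 rh_0[OF ringhom_from3] by metis
  then have "gcd ?P ?Q \<noteq> 0" by simp
  then obtain P' Q' where PQ: "?P = P' * gcd ?P ?Q" "?Q = Q' * gcd ?P ?Q" "coprime P' Q'"
    using gcd_coprime_exists by blast
  define d where "d = from3 (gcd ?P ?Q)"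
  have t: "to3 (from3 P' * x) = P' * to3 x" "to3 (from3 Q' * x) = Q' * to3 x" for x
    by (simp_all add: rh_mult[OF ringhom_to3] to3_from3)
  have "p = from3 P' * d" "q = from3 Q' * d"
    using PQ unfolding d_def by (metis from3_to3 rh_mult[OF ringhom_from3])+
  moreover have "from3 P' dvd from3 Q' * x \<Longrightarrow> from3 P' dvd x" for x
    using PQ(3) unfolding to3_dvd_iff[symmetric] t by (simp add: to3_from3 coprime_dvd_mult_right_iff)
  moreover have "from3 Q' dvd from3 P' * x \<Longrightarrow> from3 Q' dvd x" for x
    using PQ(3) unfolding to3_dvd_iff[symmetric] t
    by (simp add: to3_from3 coprime_commute coprime_dvd_mult_right_iff)
  ultimately show ?thesis using that by blast
qed

lemma poly3_prime_divisor:
  fixes p :: poly3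
  assumes "p \<noteq> 0" "\<not> p dvd 1"
  obtains \<pi> where "\<pi> dvd p" "prime_elem \<pi>"
proof -
  have 1: "to3 1 = 1" by (rule rh_1[OF ringhom_to3])
  have "to3 p \<noteq> 0" using assms from3_to3 rh_0[OF ringhom_from3] by metis
  moreover have "\<not> to3 p dvd 1" using assms(2) to3_dvd_iff[of p 1] 1 by simp
  ultimately obtain P where P: "prime P" "P dvd to3 p" using prime_divisor_exists by blast
  have PP: "P = to3 (from3 P)" by (simp add: to3_from3)
  have "from3 P dvd p" using P(2) PP to3_dvd_iff by metis
  moreover have "prime_elem (from3 P)"
  proof (rule prime_elemI)
    show "from3 P \<noteq> 0" using P(1) PP rh_0[OF ringhom_to3] by (metis not_prime_0)
    show "\<not> from3 P dvd 1" using P(1) PP to3_dvd_iff[of "from3 P" 1] 1 by (metis not_prime_unit)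
    show "from3 P dvd a \<or> from3 P dvd b" if "from3 P dvd a * b" for a b
      using that P(1) PP unfolding to3_dvd_iff[symmetric]
      by (metis prime_dvd_mult_iff rh_mult[OF ringhom_to3])
  qed
  ultimately show ?thesis using that by blast
qed

text \<open>With f = \<pi> u, each partial derivative of f is that of \<pi> times u, modulo \<pi>.
  As \<pi> does not divide u, it would divide all its own partial derivatives and thus be
  constant.\<close>

lemma reduced_prime_not_dvd_pd:
  assumes r: "\<And>g. g * g dvd f \<Longrightarrow> g dvd 1" and \<pi>: "prime_elem \<pi>" "\<pi> dvd f"
  obtains i where "\<not> \<pi> dvd pd i f"
proof -
  obtain u where u: "f = \<pi> * u" using \<pi>(2) by blast
  have nu: "\<not> \<pi> dvd u"
  proof
    assume "\<pi> dvd u"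
    then have "\<pi> * \<pi> dvd f" unfolding u by (rule mult_dvd_mono[OF dvd_refl])
    then show False using r \<pi>(1) by (metis prime_elem_not_unit)
  qed
  have "\<exists>i. \<not> \<pi> dvd pd i f"
  proof (rule ccontr)
    assume "\<nexists>i. \<not> \<pi> dvd pd i f"
    then have "\<pi> dvd pd i \<pi> * u + \<pi> * pd i u" for i by (simp add: u pd_mult)
    then have "\<pi> dvd pd i \<pi> * u" for i by (metis dvd_add_left_iff dvd_triv_left)
    then have "\<pi> dvd pd i \<pi>" for i using \<pi>(1) nu prime_elem_dvd_mult_iff by blast
    then have "pd i \<pi> = 0" for i by (rule dvd_pd_imp_0)
    then obtain c where "\<pi> = cst c" using all_pd_0_imp_cst by blast
    then show False using \<pi>(1) cst_unit by (metis cst_eq_0_iff prime_elem_def)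
  qed
  then show ?thesis using that by blast
qed

text \<open>What remains of f after division by the gcd of f and d divides all partial derivatives
  of f; a prime factor of it would contradict reducedness.\<close>

lemma reduced_dvd_cancel:
  assumes r: "\<And>g. g * g dvd f \<Longrightarrow> g dvd 1" and f0: "f \<noteq> 0" and d: "\<And>i. f dvd d * pd i f"
  shows "f dvd d"
proof -
  obtain g f1 d1 where g: "f = f1 * g" "d = d1 * g" "\<And>x. f1 dvd d1 * x \<Longrightarrow> f1 dvd x"
    using poly3_gcd[of f d] f0 by metis
  have "g \<noteq> 0" "f1 \<noteq> 0" using f0 g(1) by auto
  have "f1 dvd pd i f" for i
  proof -
    have "d * pd i f = (d1 * pd i f) * g" unfolding g(2) by (simp only: ac_simps)
    then have "f1 * g dvd (d1 * pd i f) * g" using d[of i] g(1) by metis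
    then have "f1 dvd d1 * pd i f" using \<open>g \<noteq> 0\<close> by (simp add: dvd_mult_cancel_right)
    then show ?thesis by (rule g(3))
  qed
  note * = this
  have "f1 dvd 1"
  proof (rule ccontr)
    assume "\<not> f1 dvd 1"
    then obtain \<pi> where "\<pi> dvd f1" "prime_elem \<pi>" using poly3_prime_divisor \<open>f1 \<noteq> 0\<close> by blast
    moreover from this have "\<pi> dvd f" using g(1) by (simp add: dvd_mult2)
    ultimately show False using reduced_prime_not_dvd_pd[OF r] * by (metis dvd_trans)
  qed
  then have "f1 * g dvd 1 * g" by (intro mult_dvd_mono) auto
  then show ?thesis using g by (metis dvd_mult mult_1)
qed

text \<open>By Euler's formula a common divisor of the partial derivatives also divides f.\<close>

lemma reduced_common_pd_unit:
  assumes r: "\<And>g. g * g dvd f \<Longrightarrow> g dvd 1" and f0: "f \<noteq> 0" and h: "homog f e" "e > 0"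
    and d: "\<And>i. \<kappa> dvd pd i f"
  shows "\<kappa> dvd 1"
proof (rule ccontr)
  assume nu: "\<not> \<kappa> dvd 1"
  have "\<kappa> dvd (\<Sum>i\<in>UNIV. Var i * pd i f)" using d by (intro dvd_sum) auto
  then have "\<kappa> dvd of_nat e * f" using euler_formula[OF h(1)] by simp
  then have "\<kappa> dvd (cst (1 / of_nat e) * cst (of_nat e)) * f"
    unfolding of_nat_cst by (simp add: mult.assoc)
  then have kf: "\<kappa> dvd f" using h(2) cst_inverse[of "of_nat e"] by (simp add: mult.commute)
  then have "\<kappa> \<noteq> 0" using f0 by auto
  then obtain \<pi> where "\<pi> dvd \<kappa>" "prime_elem \<pi>" using poly3_prime_divisor nu by blast
  then show False using reduced_prime_not_dvd_pd[OF r] kf d by (metis dvd_trans)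
qed

section \<open>Logarithmic derivations\<close>

lemma der_apply_add: "der_apply (\<lambda>i. \<theta> i + \<eta> i) f = der_apply \<theta> f + der_apply \<eta> f"
  by (simp add: der_apply_def distrib_right sum.distrib)

lemma der_apply_diff: "der_apply (\<lambda>i. \<theta> i - \<eta> i) f = der_apply \<theta> f - der_apply \<eta> f"
  by (simp add: der_apply_def left_diff_distrib sum_subtractf)

lemma der_apply_scale: "der_apply (\<lambda>i. c * \<theta> i) f = c * der_apply \<theta> f"
  by (simp add: der_apply_def sum_distrib_left mult.assoc)

lemma der_apply_mult: "der_apply \<theta> (f * g) = der_apply \<theta> f * g + f * der_apply \<theta> g"
  by (simp add: der_apply_def pd_mult sum_distrib_left sum_distrib_right sum.distrib algebra_simps)

lemma der_apply_euler: "homog f d \<Longrightarrow> der_apply euler f = of_nat d * f"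
  using euler_formula by (simp add: der_apply_def euler_def)

lemma der_apply_lin: "der_apply \<theta> f = 0 \<Longrightarrow> der_apply \<eta> f = 0 \<Longrightarrow> der_apply (\<lambda>i. a * \<theta> i + b * \<eta> i) f = 0"
  by (simp add: der_apply_add der_apply_scale)

lemma homog_der_apply:
  assumes "\<And>i. homog (\<theta> i) p" "homog f (Suc d)"
  shows "homog (der_apply \<theta> f) (p + d)"
  unfolding der_apply_def by (intro homog_sum homog_mult assms homog_pd)

lemma homog_quotient:
  assumes f: "homog f d" "f \<noteq> 0" and fg: "homog (f * g) k" "f * g \<noteq> 0"
  shows "d \<le> k" "homog g (k - d)"
proof -
  have e: "f * hc j g = (if d + j = k then f * g else 0)" for j
    using hc_mult_homog[OF f(1), of "d + j" g] hc_homog[OF fg(1), of "d + j"] by simp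
  have "\<exists>j. hc j g \<noteq> 0" using fg(2) hc_eq_0_imp[of g] by fastforce
  then obtain j where "hc j g \<noteq> 0" by blast
  then have "d + j = k" using e[of j] f(2) by (metis mult_eq_0_iff)
  then show "d \<le> k" by simp
  have "f * hc (k - d) g = f * g" using e[of "k - d"] \<open>d \<le> k\<close> by simp
  then show "homog g (k - d)" using f(2) by (simp add: homog_iff_hc)
qed

section \<open>Determinants of derivations\<close>

definition det3 :: "(3 \<Rightarrow> 'a::comm_ring_1) \<Rightarrow> (3 \<Rightarrow> 'a) \<Rightarrow> (3 \<Rightarrow> 'a) \<Rightarrow> 'a" where
  "det3 u v w = u 1 * (v 2 * w 3 - v 3 * w 2) - u 2 * (v 1 * w 3 - v 3 * w 1) + u 3 * (v 1 * w 2 - v 2 * w 1)"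

lemma det3_cramer: "det3 u v w * x i = det3 x v w * u i + det3 u x w * v i + det3 u v x * w i"
proof -
  have "det3 u v w * x 1 = det3 x v w * u 1 + det3 u x w * v 1 + det3 u v x * w 1"
    "det3 u v w * x 2 = det3 x v w * u 2 + det3 u x w * v 2 + det3 u v x * w 2"
    "det3 u v w * x 3 = det3 x v w * u 3 + det3 u x w * v 3 + det3 u v x * w 3"
    by (simp_all add: det3_def algebra_simps)
  then show ?thesis using exhaust_3[of i] by blast
qed

lemma det3_add2: "det3 u (\<lambda>i. v i + w i) x = det3 u v x + det3 u w x"
  and det3_add3: "det3 u x (\<lambda>i. v i + w i) = det3 u x v + det3 u x w"
  and det3_diff2: "det3 u (\<lambda>i. v i - w i) x = det3 u v x - det3 u w x"
  and det3_diff3: "det3 u x (\<lambda>i. v i - w i) = det3 u x v - det3 u x w"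
  and det3_scale2: "det3 u (\<lambda>i. c * v i) x = c * det3 u v x"
  and det3_scale3: "det3 u x (\<lambda>i. c * v i) = c * det3 u x v"
  by (simp_all add: det3_def algebra_simps)

lemma det3_self [simp]: "det3 u u x = 0" "det3 u x u = 0" "det3 u x x = 0"
  by (simp_all add: det3_def algebra_simps)

lemma det3_zero2: "(\<And>i. v i = 0) \<Longrightarrow> det3 u v w = 0"
  and det3_zero3: "(\<And>i. w i = 0) \<Longrightarrow> det3 u v w = 0"
  by (simp_all add: det3_def)

lemma det3_swap: "det3 u w v = - det3 u v w"
  by (simp add: det3_def algebra_simps)

lemma det3_cofactor:
  fixes g :: "3 \<Rightarrow> 'a::comm_ring_1"
  shows "\<exists>a b c. det3 u v w * g i = a * (\<Sum>i\<in>UNIV. u i * g i) + b * (\<Sum>i\<in>UNIV. v i * g i) + c * (\<Sum>i\<in>UNIV. w i * g i)"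
proof -
  have "det3 u v w * g 1 = (v 2 * w 3 - v 3 * w 2) * (\<Sum>i\<in>UNIV. u i * g i)
      + (u 3 * w 2 - u 2 * w 3) * (\<Sum>i\<in>UNIV. v i * g i) + (u 2 * v 3 - u 3 * v 2) * (\<Sum>i\<in>UNIV. w i * g i)"
    "det3 u v w * g 2 = (v 3 * w 1 - v 1 * w 3) * (\<Sum>i\<in>UNIV. u i * g i)
      + (u 1 * w 3 - u 3 * w 1) * (\<Sum>i\<in>UNIV. v i * g i) + (u 3 * v 1 - u 1 * v 3) * (\<Sum>i\<in>UNIV. w i * g i)"
    "det3 u v w * g 3 = (v 1 * w 2 - v 2 * w 1) * (\<Sum>i\<in>UNIV. u i * g i)
      + (u 2 * w 1 - u 1 * w 2) * (\<Sum>i\<in>UNIV. v i * g i) + (u 1 * v 2 - u 2 * v 1) * (\<Sum>i\<in>UNIV. w i * g i)"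
    by (simp_all add: det3_def sum_3 algebra_simps)
  then show ?thesis using exhaust_3[of i] by blast
qed

lemma homog_det3:
  assumes "\<And>i. homog (u i) a" "\<And>i. homog (v i) b" "\<And>i. homog (w i) c"
  shows "homog (det3 u v w) (a + b + c)"
proof -
  have "homog (u i * (v j * w k - v k * w j)) (a + b + c)" for i j k
    using homog_mult[OF assms(1) homog_diff[OF homog_mult[OF assms(2) assms(3)] homog_mult[OF assms(2) assms(3)]]]
    by (simp add: add.assoc)
  then show ?thesis unfolding det3_def by (intro homog_add homog_diff)
qed

locale curve =
  fixes f :: poly3 and e :: nat
  assumes red: "reduced_curve f" and e: "e = hdeg f"
begin

lemma f0: "f \<noteq> 0" and hf: "homog f e" and e1: "e \<ge> 1" and sq: "g * g dvd f \<Longrightarrow> g dvd 1"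
  using red unfolding reduced_curve_def e by blast+

lemma he: "der_apply euler f = of_nat e * f"
  by (rule der_apply_euler[OF hf])

lemma euler_cancel:
  assumes "\<kappa> * der_apply euler f = 0" shows "\<kappa> = 0"
proof -
  have "of_nat e \<noteq> (0 :: poly3)" using e1 by (simp add: of_nat_cst)
  then show ?thesis using assms f0 by (simp add: he)
qed

lemma D0_iff: "\<theta> \<in> D0 f \<longleftrightarrow> der_apply \<theta> f = 0"
  by (simp add: D0_def)

lemma D0_subset: "\<theta> \<in> D0 f \<Longrightarrow> \<theta> \<in> Dmod f"
  by (simp add: D0_def Dmod_def)

text \<open>If \<theta>(f) = c f, then c / e times the Euler derivation has the same value on f. The
  degree of c is forced by that of \<theta>, so homogeneity survives the subtraction.\<close>

lemma D0_proj:
  assumes "\<theta> \<in> Dmod f"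
  shows "\<exists>\<kappa>. (\<lambda>i. \<theta> i - \<kappa> * Var i) \<in> D0 f \<and>
    (\<forall>p. (\<forall>i. homog (\<theta> i) p) \<longrightarrow> (\<forall>i. homog (\<theta> i - \<kappa> * Var i) p))"
proof -
  obtain c where c: "der_apply \<theta> f = f * c" using assms by (auto simp: Dmod_def)
  define \<kappa> where "\<kappa> = cst (1 / of_nat e) * c"
  have ee: "cst (1 / of_nat e) * of_nat e = (1 :: poly3)"
    using e1 cst_inverse[of "of_nat e"] by (simp add: of_nat_cst mult.commute)
  have "der_apply (\<lambda>i. \<theta> i - \<kappa> * Var i) f = f * c - \<kappa> * der_apply euler f"
    by (simp add: der_apply_diff der_apply_scale c euler_def)
  also have "\<kappa> * der_apply euler f = (cst (1 / of_nat e) * of_nat e) * (f * c)"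
    by (simp add: he \<kappa>_def ac_simps)
  finally have "der_apply (\<lambda>i. \<theta> i - \<kappa> * Var i) f = 0" by (simp add: ee)
  then have 1: "(\<lambda>i. \<theta> i - \<kappa> * Var i) \<in> D0 f" unfolding D0_iff .
  have 2: "homog (\<theta> i - \<kappa> * Var i) p" if h: "\<And>i. homog (\<theta> i) p" for i p
  proof (cases "c = 0")
    case True
    then show ?thesis using h by (simp add: \<kappa>_def)
  next
    case False
    have "homog (der_apply \<theta> f) (p + (e - 1))" by (rule homog_der_apply[OF h]) (use hf e1 in simp)
    then have "homog (f * c) (p + (e - 1))" by (simp add: c)
    then have q: "e \<le> p + (e - 1)" "homog c (p + (e - 1) - e)"
      using homog_quotient[OF hf f0] False f0 by auto
    then have "homog (\<kappa> * Var i) (p + (e - 1) - e + 1)"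
      unfolding \<kappa>_def by (intro homog_mult homog_cst_mult homog_Var)
    then show ?thesis using h q(1) e1 by (intro homog_diff) auto
  qed
  then show ?thesis using 1 by blast
qed

text \<open>The adjugate matrix expresses the determinant times each partial derivative of f through
  the values of the three derivations on f, which are multiples of f; reducedness cancels the
  partial derivatives.\<close>

lemma saito_dvd:
  assumes "\<theta> \<in> Dmod f" "\<eta> \<in> Dmod f"
  shows "f dvd det3 euler \<theta> \<eta>"
proof (rule reduced_dvd_cancel[OF sq f0])
  fix i
  obtain a b c where "det3 euler \<theta> \<eta> * pd i f =
      a * der_apply euler f + b * der_apply \<theta> f + c * der_apply \<eta> f"
    using det3_cofactor[of euler \<theta> \<eta> "\<lambda>i. pd i f" i] unfolding der_apply_def by blast
  moreover have "f dvd der_apply euler f" by (simp add: he)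
  ultimately show "f dvd det3 euler \<theta> \<eta> * pd i f"
    using assms by (simp add: Dmod_def)
qed

text \<open>\<open>D0 f\<close> has rank 2: when Cramer's rule for A is applied to f, only the Euler
  term survives, and its coefficient is the determinant of A, B, C.\<close>

lemma det3_D0_zero:
  assumes "A \<in> D0 f" "B \<in> D0 f" "C \<in> D0 f" shows "det3 A B C = 0"
proof -
  have "(\<lambda>i. det3 euler B C * A i) = (\<lambda>i. det3 A B C * euler i + (det3 euler A C * B i + det3 euler B A * C i))"
    using det3_cramer[of euler B C A] by (intro ext) (simp add: add.assoc)
  from arg_cong[OF this, of "\<lambda>\<theta>. der_apply \<theta> f"]
  have "det3 A B C * der_apply euler f = 0"
    using assms by (simp add: der_apply_add der_apply_scale D0_iff)
  then show ?thesis by (rule euler_cancel)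
qed

text \<open>The vanishing determinants make A proportional to the Euler derivation E, so the i-th
  component of A times E(f) equals x_i A(f) = 0.\<close>

lemma D0_cross_zero:
  assumes A: "A \<in> D0 f" and x: "\<And>x. det3 euler A x = 0"
  shows "A i = 0"
proof -
  have c: "Var j * A i = Var i * A j" for i j
  proof -
    have "Var 1 * A 2 = Var 2 * A 1" using x[of "\<lambda>k. if k = 3 then 1 else 0"] by (simp add: det3_def euler_def)
    moreover have "Var 1 * A 3 = Var 3 * A 1" using x[of "\<lambda>k. if k = 2 then 1 else 0"] by (simp add: det3_def euler_def)
    moreover have "Var 2 * A 3 = Var 3 * A 2" using x[of "\<lambda>k. if k = 1 then 1 else 0"] by (simp add: det3_def euler_def)
    ultimately show ?thesis using exhaust_3[of i] exhaust_3[of j] by metis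
  qed
  have "A i * der_apply euler f = (\<Sum>j\<in>UNIV. (Var j * A i) * pd j f)"
    by (simp add: der_apply_def euler_def sum_distrib_left ac_simps)
  also have "\<dots> = (\<Sum>j\<in>UNIV. (Var i * A j) * pd j f)" by (simp only: c)
  also have "\<dots> = Var i * der_apply A f"
    by (simp add: der_apply_def sum_distrib_left ac_simps)
  also have "\<dots> = 0" using A by (simp add: D0_iff)
  finally show ?thesis by (rule euler_cancel)
qed

text \<open>Cramer's rule with an auxiliary vector x whose determinant with Euler and A is nonzero.
  Applying it to f removes the Euler term and leaves a relation between A and B; if there is no such
  x, then A is 0.\<close>

lemma det_zero_dependent:
  assumes A: "A \<in> D0 f" and B: "B \<in> D0 f" and d: "det3 euler A B = 0"
  obtains a b where "a \<noteq> 0 \<or> b \<noteq> 0" "\<And>i. a * A i + b * B i = 0"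
proof (cases "\<forall>x. det3 euler A x = 0")
  case True
  then have "1 * A i + 0 * B i = 0" for i using D0_cross_zero[OF A] by simp
  then show ?thesis using that[of 1 0] by simp
next
  case False
  then obtain x where x: "det3 euler A x \<noteq> 0" by blast
  have c: "det3 x A B * euler i + (det3 euler x B * A i + det3 euler A x * B i) = 0" for i
    using det3_cramer[of euler A B x i] d by (simp add: add.assoc)
  then have "(\<lambda>i. det3 x A B * euler i + (det3 euler x B * A i + det3 euler A x * B i)) = (\<lambda>i. 0)" by blast
  from arg_cong[OF this, of "\<lambda>\<theta>. der_apply \<theta> f"]
  have "det3 x A B * der_apply euler f = 0"
    using A B by (simp add: der_apply_add der_apply_scale D0_iff) (simp add: der_apply_def)
  then have "det3 x A B = 0" by (rule euler_cancel)
  then have "det3 euler x B * A i + det3 euler A x * B i = 0" for i using c[of i] by simp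
  then show ?thesis using that[of "det3 euler x B" "det3 euler A x"] x by blast
qed

text \<open>The Koszul derivations give the determinants e * f * pd i f, and the partial derivatives have no common factor.\<close>

lemma koszul_det_unit:
  assumes "\<And>A B. A \<in> D0 f \<Longrightarrow> B \<in> D0 f \<Longrightarrow> f * \<kappa> dvd det3 euler A B"
  shows "\<kappa> dvd 1"
proof (rule reduced_common_pd_unit[OF sq f0 hf])
  show "e > 0" using e1 by simp
  let ?g = "\<lambda>i. pd i f"
  let ?K12 = "\<lambda>i. if i = 1 then ?g 2 else if i = 2 then - ?g 1 else (0 :: poly3)"
  let ?K13 = "\<lambda>i. if i = 1 then ?g 3 else if i = 3 then - ?g 1 else (0 :: poly3)"
  let ?K23 = "\<lambda>i. if i = 2 then ?g 3 else if i = 3 then - ?g 2 else (0 :: poly3)"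
  have D: "?K12 \<in> D0 f" "?K13 \<in> D0 f" "?K23 \<in> D0 f"
    by (simp_all add: D0_iff der_apply_def sum_3)
  have E: "Var 1 * ?g 1 + Var 2 * ?g 2 + Var 3 * ?g 3 = of_nat e * f"
    using he by (simp add: der_apply_def euler_def sum_3)
  have "det3 euler ?K12 ?K13 = ?g 1 * (Var 1 * ?g 1 + Var 2 * ?g 2 + Var 3 * ?g 3)"
    "det3 euler ?K12 ?K23 = ?g 2 * (Var 1 * ?g 1 + Var 2 * ?g 2 + Var 3 * ?g 3)"
    "det3 euler ?K13 ?K23 = ?g 3 * (Var 1 * ?g 1 + Var 2 * ?g 2 + Var 3 * ?g 3)"
    by (simp_all add: det3_def euler_def algebra_simps)
  then have "f * \<kappa> dvd ?g 1 * (of_nat e * f)" "f * \<kappa> dvd ?g 2 * (of_nat e * f)" "f * \<kappa> dvd ?g 3 * (of_nat e * f)"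
    using assms[OF D(1) D(2)] assms[OF D(1) D(3)] assms[OF D(2) D(3)] by (simp_all only: E)
  then have d: "f * \<kappa> dvd f * (of_nat e * ?g i)" for i using exhaust_3[of i] by (auto simp: ac_simps)
  show "\<kappa> dvd pd i f" for i
  proof -
    have "\<kappa> dvd of_nat e * ?g i" using d[of i] f0 by simp
    then have "\<kappa> dvd cst (1 / of_nat e) * (of_nat e * ?g i)" by simp
    also have "cst (1 / of_nat e) * (of_nat e * ?g i) = ?g i"
      using e1 cst_inverse[of "of_nat e"] by (simp add: of_nat_cst mult.assoc[symmetric] mult.commute)
    finally show ?thesis .
  qed
qed

section \<open>Generators and relations of the module \<open>D0 f\<close>\<close>

definition gen2 :: "der \<Rightarrow> der \<Rightarrow> bool" where
  "gen2 A B \<longleftrightarrow> D0 f = {(\<lambda>i. a * A i + b * B i) | a b. True}"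

definition gen3 :: "der \<Rightarrow> der \<Rightarrow> der \<Rightarrow> bool" where
  "gen3 A B C \<longleftrightarrow> A \<in> D0 f \<and> B \<in> D0 f \<and> C \<in> D0 f \<and>
     (\<forall>\<theta>\<in>D0 f. \<exists>a b c. \<forall>i. \<theta> i = a * A i + b * B i + c * C i)"

text \<open>The unique relation from the definition of plus-one generated, transported to
  \<open>D0 f\<close>, where the Euler derivation no longer takes part.\<close>

definition rel3 :: "der \<Rightarrow> der \<Rightarrow> der \<Rightarrow> poly3 \<Rightarrow> poly3 \<Rightarrow> poly3 \<Rightarrow> bool" where
  "rel3 A B C r s t \<longleftrightarrow> (\<forall>i. r * A i + s * B i + t * C i = 0) \<and>
     (\<forall>a b c. (\<forall>i. a * A i + b * B i + c * C i = 0) \<longrightarrow> (\<exists>h. a = h * r \<and> b = h * s \<and> c = h * t))"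

lemma gen2_mem: "gen2 A B \<Longrightarrow> A \<in> D0 f" "gen2 A B \<Longrightarrow> B \<in> D0 f"
  "gen2 A B \<Longrightarrow> \<theta> \<in> D0 f \<Longrightarrow> \<exists>a b. \<forall>i. \<theta> i = a * A i + b * B i"
proof -
  assume g: "gen2 A B"
  have "A = (\<lambda>i. 1 * A i + 0 * B i)" "B = (\<lambda>i. 0 * A i + 1 * B i)" by auto
  then show "A \<in> D0 f" "B \<in> D0 f" using g unfolding gen2_def by blast+
  show "\<theta> \<in> D0 f \<Longrightarrow> \<exists>a b. \<forall>i. \<theta> i = a * A i + b * B i" using g unfolding gen2_def by auto
qed

lemma gen2I:
  assumes "A \<in> D0 f" "B \<in> D0 f" "\<And>\<theta>. \<theta> \<in> D0 f \<Longrightarrow> \<exists>a b. \<forall>i. \<theta> i = a * A i + b * B i"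
  shows "gen2 A B"
  unfolding gen2_def
proof safe
  fix \<theta> assume "\<theta> \<in> D0 f"
  then obtain a b where "\<forall>i. \<theta> i = a * A i + b * B i" using assms(3) by blast
  then have "\<theta> = (\<lambda>i. a * A i + b * B i)" by blast
  then show "\<exists>a b. \<theta> = (\<lambda>i. a * A i + b * B i) \<and> True" by blast
next
  fix a b show "(\<lambda>i. a * A i + b * B i) \<in> D0 f" using assms(1,2) der_apply_lin by (simp add: D0_iff)
qed

lemma det_nonzero_indep:
  assumes "det3 euler A B \<noteq> 0" "\<And>i. a * A i + b * B i = 0"
  shows "a = 0 \<and> b = 0"
proof -
  have "a * det3 euler A B = det3 euler (\<lambda>i. a * A i + b * B i) B"
    by (simp add: det3_add2 det3_scale2)
  moreover have "b * det3 euler A B = det3 euler A (\<lambda>i. a * A i + b * B i)"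
    by (simp add: det3_add3 det3_scale3)
  ultimately show ?thesis using assms by (auto simp: det3_def)
qed

lemma D0_proj_homog:
  assumes "\<theta> \<in> Dmod f" "\<And>i. homog (\<theta> i) p"
  shows "\<exists>\<kappa>. (\<lambda>i. \<theta> i - \<kappa> * Var i) \<in> D0 f \<and> (\<forall>i. homog (\<theta> i - \<kappa> * Var i) p)"
  using D0_proj[OF assms(1)] assms(2) by blast

text \<open>Saito's criterion. The determinant is f times some c, and \<open>p + q + 1 = e\<close>
  makes c constant. Cramer's rule then expands any \<theta> in \<open>D0 f\<close>: its numerators
  are multiples of f by \<open>saito_dvd\<close>, so only the constant c remains as
  denominator.\<close>

lemma saito_basis:
  assumes A: "A \<in> Dmod f" "\<And>i. homog (A i) p" and B: "B \<in> Dmod f" "\<And>i. homog (B i) q"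
    and d: "det3 euler A B \<noteq> 0" and deg: "p + q + 1 = e"
  shows "free_exps f (int p) (int q)"
proof -
  obtain \<kappa> where \<kappa>: "(\<lambda>i. A i - \<kappa> * Var i) \<in> D0 f" "\<And>i. homog (A i - \<kappa> * Var i) p"
    using D0_proj_homog[OF A] by blast
  obtain \<mu> where \<mu>: "(\<lambda>i. B i - \<mu> * Var i) \<in> D0 f" "\<And>i. homog (B i - \<mu> * Var i) q"
    using D0_proj_homog[OF B] by blast
  define A' where "A' = (\<lambda>i. A i - \<kappa> * euler i)"
  define B' where "B' = (\<lambda>i. B i - \<mu> * euler i)"
  have A': "A' \<in> D0 f" "\<And>i. homog (A' i) p" using \<kappa> by (auto simp: A'_def euler_def)
  have B': "B' \<in> D0 f" "\<And>i. homog (B' i) q" using \<mu> by (auto simp: B'_def euler_def)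
  have dd: "det3 euler A' B' = det3 euler A B"
    by (simp add: A'_def B'_def det3_diff2 det3_diff3 det3_scale2 det3_scale3)
  obtain c where c: "det3 euler A B = f * c" using saito_dvd[OF A(1) B(1)] by blast
  have "homog (euler i) 1" for i by (simp only: euler_def homog_Var)
  from homog_det3[of euler 1 A p B q, OF this A(2) B(2)] have "homog (f * c) e" using deg c by (simp add: add.commute)
  moreover have "f * c \<noteq> 0" using c d by simp
  ultimately have "homog c (e - e)" by (rule homog_quotient(2)[OF hf f0])
  then have "homog c 0" by simp
  then obtain c0 where c0: "c = cst c0" using homog_0_cst by blast
  have "c0 \<noteq> 0" using d c c0 by auto
  have "gen2 A' B'"
  proof (rule gen2I[OF A'(1) B'(1)])
    fix \<theta> assume \<theta>: "\<theta> \<in> D0 f"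
    obtain x where x: "det3 euler \<theta> B' = f * x" using saito_dvd[OF D0_subset[OF \<theta>] D0_subset[OF B'(1)]] by blast
    obtain y where y: "det3 euler A' \<theta> = f * y" using saito_dvd[OF D0_subset[OF A'(1)] D0_subset[OF \<theta>]] by blast
    have "f * (c * \<theta> i) = f * (x * A' i + y * B' i)" for i
      using det3_cramer[of euler A' B' \<theta> i] det3_D0_zero[OF \<theta> A'(1) B'(1)] x y
      by (simp add: dd c algebra_simps)
    then have "c * \<theta> i = x * A' i + y * B' i" for i using f0 by simp
    then have "cst (1 / c0) * (c * \<theta> i) = cst (1 / c0) * x * A' i + cst (1 / c0) * y * B' i" for i
      by (simp add: algebra_simps)
    moreover have "cst (1 / c0) * (c * \<theta> i) = \<theta> i" for i
      using cst_inverse[OF \<open>c0 \<noteq> 0\<close>] by (simp add: c0 mult.assoc[symmetric] mult.commute)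
    ultimately show "\<exists>a b. \<forall>i. \<theta> i = a * A' i + b * B' i" by metis
  qed
  moreover have nz: "det3 euler A' B' \<noteq> 0" using d dd by simp
  moreover have "\<exists>i. A' i \<noteq> 0" "\<exists>i. B' i \<noteq> 0"
    using nz det3_zero2[of A' euler B'] det3_zero3[of B' euler A'] by blast+
  moreover have "\<forall>a b. (\<lambda>i. a * A' i + b * B' i) = (\<lambda>_. 0) \<longrightarrow> a = 0 \<and> b = 0"
  proof (intro allI impI)
    fix a b assume "(\<lambda>i. a * A' i + b * B' i) = (\<lambda>_. 0)"
    then have "a * A' i + b * B' i = 0" for i by (rule fun_cong)
    then show "a = 0 \<and> b = 0" by (rule det_nonzero_indep[OF nz])
  qed
  ultimately show ?thesis
    unfolding free_exps_def gen2_def homog_der_def using A'(2) B'(2) by blast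
qed

text \<open>Converse of Saito's criterion: the determinant f \<kappa> of a basis divides that of any
  pair from \<open>D0 f\<close>, and the Koszul derivations force \<kappa> to be a unit.\<close>

lemma free_det:
  assumes g: "gen2 A B" and ind: "\<And>a b. (\<And>i. a * A i + b * B i = 0) \<Longrightarrow> a = 0 \<and> b = 0"
    and h: "\<And>i. homog (A i) p" "\<And>i. homog (B i) q"
  obtains c where "c \<noteq> 0" "det3 euler A B = cst c * f" "p + q + 1 = e"
proof -
  note AB = gen2_mem(1,2)[OF g]
  have nz: "det3 euler A B \<noteq> 0"
    using det_zero_dependent[OF AB] ind by metis
  obtain \<kappa> where \<kappa>: "det3 euler A B = f * \<kappa>"
    using saito_dvd[OF D0_subset[OF AB(1)] D0_subset[OF AB(2)]] by blast
  have "\<kappa> dvd 1"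
  proof (rule koszul_det_unit)
    fix K L assume "K \<in> D0 f" "L \<in> D0 f"
    then obtain a b a' b' where "\<forall>i. K i = a * A i + b * B i" "\<forall>i. L i = a' * A i + b' * B i"
      using gen2_mem(3)[OF g] by metis
    then have "K = (\<lambda>i. a * A i + b * B i)" "L = (\<lambda>i. a' * A i + b' * B i)" by auto
    then have "det3 euler K L = (a * b' - a' * b) * det3 euler A B"
      by (simp add: det3_add2 det3_add3 det3_scale2 det3_scale3 det3_swap[of euler B A] algebra_simps)
    then show "f * \<kappa> dvd det3 euler K L" by (simp add: \<kappa>)
  qed
  then obtain c where c: "c \<noteq> 0" "\<kappa> = cst c" using unit_imp_cst by blast
  have d: "det3 euler A B = cst c * f" by (simp add: \<kappa> c(2) mult.commute)
  have "homog (euler i) 1" for i by (simp only: euler_def homog_Var)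
  from homog_det3[of euler 1 A p B q, OF this h] have "homog (det3 euler A B) (1 + p + q)" .
  moreover have "homog (det3 euler A B) e" unfolding d by (rule homog_cst_mult[OF hf])
  ultimately have "1 + p + q = e" using homog_unique nz by blast
  then show ?thesis using that[OF c(1) d] by simp
qed

lemma hc_0_mult: "hc 0 (p * q) = hc 0 p * hc 0 q"
  by (simp add: hc_def rh_mult[OF ringhom_hpol] coeff_mult_0)

lemma hc_0_one [simp]: "hc 0 1 = 1"
  by (simp add: hc_def rh_1[OF ringhom_hpol])

text \<open>After division of \<rho> and \<sigma> by their gcd, A and B become multiples of one derivation in D0 f.
  Writing it in the generators puts 1 into the ideal (\<rho>, \<sigma>).\<close>

lemma relation_not_binary:
  assumes g: "gen3 A B C" and r: "rel3 A B C \<rho> \<sigma> 0" and nz: "\<rho> \<noteq> 0 \<or> \<sigma> \<noteq> 0"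
    and h: "hc 0 \<rho> = 0" "hc 0 \<sigma> = 0"
  shows False
proof -
  have rel: "\<rho> * A i + \<sigma> * B i = 0" for i using r by (simp add: rel3_def)
  have mult: "\<exists>h. a = h * \<rho> \<and> b = h * \<sigma> \<and> c = h * 0" if "\<And>i. a * A i + b * B i + c * C i = 0" for a b c
    using r that unfolding rel3_def by blast
  obtain d \<rho>' \<sigma>' where d: "\<rho> = \<rho>' * d" "\<sigma> = \<sigma>' * d" "\<And>x. \<rho>' dvd \<sigma>' * x \<Longrightarrow> \<rho>' dvd x"
    "\<And>x. \<sigma>' dvd \<rho>' * x \<Longrightarrow> \<sigma>' dvd x"
    using poly3_gcd[OF nz] by metis
  have d0: "d \<noteq> 0" using nz d by auto
  have "d * (\<rho>' * A i + \<sigma>' * B i) = 0" for i using rel[of i] d by (simp add: algebra_simps)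
  then have rel': "\<rho>' * A i + \<sigma>' * B i = 0" for i using d0 by simp
  then obtain u where u: "\<rho>' = u * \<rho>" "\<sigma>' = u * \<sigma>" using mult[of \<rho>' \<sigma>' 0] by auto
  have "\<exists>x. A i = \<sigma>' * x \<and> B i = - \<rho>' * x" for i
  proof (cases "\<sigma>' = 0")
    case True
    then have "\<rho>' \<noteq> 0" using nz d by auto
    have "\<rho>' dvd \<sigma>' * B i" using True by simp
    then have "\<rho>' dvd B i" for i using d(3) True by simp
    then obtain x where "B i = \<rho>' * x" by blast
    moreover have "A i = 0" using rel'[of i] True \<open>\<rho>' \<noteq> 0\<close> by simp
    ultimately show ?thesis using True by (intro exI[of _ "- x"]) simp
  next
    case False
    have "\<rho>' * A i = - \<sigma>' * B i" using rel'[of i] by (simp add: add_eq_0_iff)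
    then have "\<sigma>' dvd \<rho>' * A i" by simp
    then obtain x where x: "A i = \<sigma>' * x" using d(4) by blast
    then have "\<sigma>' * (\<rho>' * x + B i) = 0" using rel'[of i] by (simp add: algebra_simps)
    then have "B i = - \<rho>' * x" using False by (simp add: eq_neg_iff_add_eq_0 add.commute)
    then show ?thesis using x by blast
  qed
  then obtain \<eta> where \<eta>: "\<And>i. A i = \<sigma>' * \<eta> i" "\<And>i. B i = - \<rho>' * \<eta> i" by metis
  have nz': "\<rho>' \<noteq> 0 \<or> \<sigma>' \<noteq> 0" using nz d by auto
  have "A = (\<lambda>i. \<sigma>' * \<eta> i)" "B = (\<lambda>i. - \<rho>' * \<eta> i)" using \<eta> by auto
  then have "\<sigma>' * der_apply \<eta> f = 0" "- \<rho>' * der_apply \<eta> f = 0"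
    using g unfolding gen3_def D0_iff by (metis der_apply_scale)+
  then have "\<eta> \<in> D0 f" using nz' by (auto simp: D0_iff)
  then obtain x y z where xyz: "\<And>i. \<eta> i = x * A i + y * B i + z * C i" using g unfolding gen3_def by metis
  define w where "w = x * \<sigma>' - y * \<rho>' - 1"
  have wz: "w * \<eta> i + z * C i = 0" for i
  proof -
    have "x * A i + y * B i + z * C i = \<eta> i" using xyz[of i] by simp
    then show ?thesis unfolding \<eta> w_def by (simp add: algebra_simps)
  qed
  \<comment> \<open>Multiplying by \<sigma>' or \<rho>' gives a relation with a zero entry at a
    place where the generating relation has a nonzero one, hence its zero multiple.\<close>
  have "w = 0"
  proof (cases "\<sigma>' = 0")
    case False
    have "\<sigma>' * (w * \<eta> i + z * C i) = 0" for i by (simp only: wz mult_zero_right)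
    then have "w * A i + 0 * B i + (\<sigma>' * z) * C i = 0" for i unfolding \<eta>(1) by (simp add: algebra_simps)
    then obtain h where "w = h * \<rho>" "0 = h * \<sigma>" using mult[of w 0 "\<sigma>' * z"] by blast
    moreover have "\<sigma> \<noteq> 0" using False u by auto
    ultimately show ?thesis by auto
  next
    case True
    then have "\<rho>' \<noteq> 0" using nz' by simp
    have "- \<rho>' * (w * \<eta> i + z * C i) = 0" for i by (simp only: wz mult_zero_right)
    then have "0 * A i + w * B i + (- \<rho>' * z) * C i = 0" for i unfolding \<eta>(2) by (simp add: algebra_simps)
    then obtain h where "0 = h * \<rho>" "w = h * \<sigma>" using mult[of 0 w "- \<rho>' * z"] by blast
    moreover have "\<rho> \<noteq> 0" using \<open>\<rho>' \<noteq> 0\<close> u by auto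
    ultimately show ?thesis by auto
  qed
  then have "x * (u * \<sigma>) - y * (u * \<rho>) = 1" by (simp add: w_def u[symmetric])
  then have "hc 0 (x * (u * \<sigma>) - y * (u * \<rho>)) = 1" by simp
  then show False by (simp add: hc_diff hc_0_mult h)
qed

text \<open>A dependence between A and B is a multiple of the generating relation without C, so
  \<tau> = 0, which \<open>relation_not_binary\<close> excludes.\<close>

lemma rel3_det_nonzero:
  assumes g: "gen3 A B C" and r: "rel3 A B C \<rho> \<sigma> \<tau>" and h: "hc 0 \<rho> = 0" "hc 0 \<sigma> = 0"
  shows "det3 euler A B \<noteq> 0"
proof
  assume "det3 euler A B = 0"
  then obtain a b where ab: "a \<noteq> 0 \<or> b \<noteq> 0" "\<And>i. a * A i + b * B i = 0"
    using det_zero_dependent g unfolding gen3_def by metis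
  then have "\<forall>i. a * A i + b * B i + 0 * C i = 0" by simp
  then obtain u where u: "a = u * \<rho>" "b = u * \<sigma>" "0 = u * \<tau>" using r unfolding rel3_def by blast
  then have "\<rho> \<noteq> 0 \<or> \<sigma> \<noteq> 0" "\<tau> = 0" using ab(1) by auto
  then show False using relation_not_binary[OF g] r h by blast
qed

text \<open>A Hilbert-Burch argument: the determinants of the pairs with Euler form a relation,
  hence are u times (\<rho>, \<sigma>, \<tau>). It turns out that u is f up to a constant, and the
  determinant of A and B, a constant times f \<tau>, is compared in degree.\<close>

lemma rel3_degree_sum:
  assumes g: "gen3 A B C" and r: "rel3 A B C \<rho> \<sigma> \<tau>" and \<tau>: "\<tau> \<noteq> 0" "homog \<tau> 1"
    and h: "\<And>i. homog (A i) p" "\<And>i. homog (B i) q"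
  shows "p + q = e"
proof -
  have D: "A \<in> D0 f" "B \<in> D0 f" "C \<in> D0 f" using g by (auto simp: gen3_def)
  have "det3 euler B C * A i + det3 euler C A * B i + det3 euler A B * C i = 0" for i
    using det3_cramer[of euler B C A i] det3_D0_zero[OF D]
    by (simp add: det3_swap[of euler C A] det3_swap[of euler B A])
  then obtain u where u: "det3 euler B C = u * \<rho>" "det3 euler C A = u * \<sigma>" "det3 euler A B = u * \<tau>"
    using r unfolding rel3_def by blast
  note M = D[THEN D0_subset]
  have fu: "f dvd u * \<rho>" "f dvd u * \<sigma>" "f dvd u * \<tau>"
    using saito_dvd[OF M(2,3)] saito_dvd[OF M(3,1)] saito_dvd[OF M(1,2)] u by auto
  \<comment> \<open>The part f1 of f that is prime to u divides \<rho>, \<sigma> and \<tau>.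
    Dividing the generating relation by it gives a relation again, so f1 is a unit and f divides
    u.\<close>
  obtain w f1 u1 where w: "f = f1 * w" "u = u1 * w" "\<And>x. f1 dvd u1 * x \<Longrightarrow> f1 dvd x"
    using poly3_gcd[of f u] f0 by metis
  have w0: "w \<noteq> 0" using f0 w(1) by auto
  have "f1 dvd x" if "f dvd u * x" for x
  proof -
    have "f1 * w dvd (u1 * x) * w" using that w(2) unfolding w(1)[symmetric] by (simp add: ac_simps)
    then have "f1 dvd u1 * x" using w0 by (simp add: dvd_mult_cancel_right)
    then show ?thesis by (rule w(3))
  qed
  then obtain \<rho>' \<sigma>' \<tau>' where s: "\<rho> = f1 * \<rho>'" "\<sigma> = f1 * \<sigma>'" "\<tau> = f1 * \<tau>'" using fu by (meson dvdE)
  have f10: "f1 \<noteq> 0" using w(1) f0 by auto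
  have "f1 * (\<rho>' * A i + \<sigma>' * B i + \<tau>' * C i) = 0" for i
    using r unfolding rel3_def s by (simp add: algebra_simps)
  then have "\<rho>' * A i + \<sigma>' * B i + \<tau>' * C i = 0" for i using f10 by simp
  then obtain v where v: "\<tau>' = v * \<tau>" using r unfolding rel3_def by blast
  have "1 * \<tau> = (f1 * v) * \<tau>" using s(3) v by simp
  then have "1 = f1 * v" using \<tau>(1) by (metis mult_right_cancel)
  moreover have "f * v = (f1 * v) * w" by (subst w(1)) (simp only: ac_simps)
  ultimately have wf: "f * v = w" by (metis mult_1)
  have uf: "u = f * (u1 * v)" by (subst w(2), subst wf[symmetric]) (simp only: ac_simps)
  \<comment> \<open>All determinants of pairs from \<open>D0 f\<close> are multiples of u, and the
    Koszul ones leave no factor beyond f.\<close>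
  have "u1 * v dvd 1"
  proof (rule koszul_det_unit)
    fix K L assume "K \<in> D0 f" "L \<in> D0 f"
    then obtain a b c a' b' c' where "\<forall>i. K i = a * A i + b * B i + c * C i" "\<forall>i. L i = a' * A i + b' * B i + c' * C i"
      using g unfolding gen3_def by metis
    then have "K = (\<lambda>i. a * A i + b * B i + c * C i)" "L = (\<lambda>i. a' * A i + b' * B i + c' * C i)" by auto
    then have "det3 euler K L = (b * c' - b' * c) * det3 euler B C + (c * a' - c' * a) * det3 euler C A + (a * b' - a' * b) * det3 euler A B"
      by (simp add: det3_add2 det3_add3 det3_scale2 det3_scale3 det3_swap[of euler B A] det3_swap[of euler C B]
          det3_swap[of euler C A] algebra_simps)
    then have "det3 euler K L = u * ((b * c' - b' * c) * \<rho> + (c * a' - c' * a) * \<sigma> + (a * b' - a' * b) * \<tau>)"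
      by (simp add: u algebra_simps)
    then show "f * (u1 * v) dvd det3 euler K L" using uf by simp
  qed
  then obtain c where c: "c \<noteq> 0" "u1 * v = cst c" using unit_imp_cst by blast
  have "u = f * cst c" using uf c(2) by metis
  then have d: "det3 euler A B = cst c * (f * \<tau>)" unfolding u(3) by (simp only: ac_simps)
  have nz: "det3 euler A B \<noteq> 0" using d c(1) f0 \<tau>(1) by simp
  have "homog (euler i) 1" for i by (simp only: euler_def homog_Var)
  from homog_det3[of euler 1 A p B q, OF this h] have "homog (det3 euler A B) (1 + p + q)" .
  moreover have "homog (det3 euler A B) (e + 1)" unfolding d by (intro homog_cst_mult homog_mult hf \<tau>)
  ultimately have "1 + p + q = e + 1" using homog_unique nz by blast
  then show ?thesis by simp
qed

end

section \<open>Restriction to a line\<close>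

lemma cst_0 [simp]: "cst 0 = 0" and cst_1 [simp]: "cst 1 = 1"
  using rh_1[OF ringhom_cst] by (simp_all add: cst_def)

lemma homog_1_expand: "homog p 1 \<Longrightarrow> \<exists>c. \<forall>i. pd i p = cst (c i)"
proof -
  assume "homog p 1"
  then have "\<forall>i. \<exists>c. pd i p = cst c" using homog_pd[of p 0] homog_0_cst by fastforce
  then show ?thesis by metis
qed

lemma eval3_homog_scale:
  assumes "homog p d" shows "eval3 p (\<chi> i. c * v $ i) = c ^ d * eval3 p v"
proof -
  have "(\<Prod>i\<in>UNIV. (c * v $ i) ^ lkp m i) = c ^ tdeg m * (\<Prod>i\<in>UNIV. (v $ i) ^ lkp m i)" for m
    by (simp add: power_mult_distrib prod.distrib tdeg_def power_sum)
  then have "eval3 p (\<chi> i. c * v $ i) = (\<Sum>m\<in>Poly_Mapping.keys p. c ^ d * (lkp p m * (\<Prod>i\<in>UNIV. (v $ i) ^ lkp m i)))"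
    using assms unfolding eval3_def homog_def by (intro sum.cong) auto
  then show ?thesis by (simp add: eval3_def sum_distrib_left)
qed

lemma eval3_linear:
  assumes "homog l 1" shows "eval3 l (\<chi> i. x * v $ i + y * w $ i) = x * eval3 l v + y * eval3 l w"
proof -
  obtain c where c: "\<forall>i. pd i l = cst (c i)" using homog_1_expand[OF assms] by blast
  have l: "l = (\<Sum>i\<in>UNIV. Var i * cst (c i))" using euler_formula[OF assms] c by simp
  have e: "eval3 l v = (\<Sum>i\<in>UNIV. v $ i * c i)" for v
    by (subst l) (simp add: rh_mult[OF ringhom_eval3] rh_sum[OF ringhom_eval3])
  show ?thesis by (simp add: e sum.distrib sum_distrib_left algebra_simps)
qed

lemma ringhom_const: "ringhom (\<lambda>c :: 'a::comm_ring_1. [:c:])"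
  by (simp add: ringhom_def one_pCons)

lemma order_linear: "order z [:- z, 1 :: complex:] = 1"
  using order_power_n_n[of z 1] by simp

lemma sum_order_eq_degree:
  fixes p :: "complex poly"
  assumes "p \<noteq> 0" "finite R" "{x. poly p x = 0} \<subseteq> R"
  shows "(\<Sum>x\<in>R. order x p) = degree p"
  using assms
proof (induction "degree p" arbitrary: p)
  case 0
  then obtain c where "p = [:c:]" "c \<noteq> 0" by (metis degree_eq_zeroE pCons_0_0)
  then show ?case using 0 by (simp add: order_0I)
next
  case (Suc n)
  then obtain z where z: "poly p z = 0"
    using fundamental_theorem_of_algebra[of p] by (metis constant_degree Zero_not_Suc)
  then obtain q where q: "p = [:- z, 1:] * q" by (metis dvdE poly_eq_0_iff_dvd)
  have q0: "q \<noteq> 0" using Suc.prems(1) q by auto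
  have dq: "degree p = Suc (degree q)" using q0 unfolding q by (subst degree_mult_eq) auto
  have zR: "z \<in> R" using z Suc.prems(3) by blast
  have "(\<Sum>x\<in>R. order x p) = (\<Sum>x\<in>R. order x [:- z, 1:] + order x q)"
    using Suc.prems(1) unfolding q by (intro sum.cong refl order_mult) auto
  also have "\<dots> = (\<Sum>x\<in>R. if x = z then 1 else 0) + (\<Sum>x\<in>R. order x q)"
    unfolding sum.distrib by (intro arg_cong2[of _ _ _ _ "(+)"] sum.cong refl) (auto simp: order_0I order_linear)
  also have "\<dots> = 1 + degree q"
  proof -
    have "{x. poly q x = 0} \<subseteq> R" using Suc.prems(3) unfolding q by auto
    then have "(\<Sum>x\<in>R. order x q) = degree q" using Suc.hyps(1)[of q] Suc.hyps(2) dq q0 Suc.prems(2) by simp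
    then show ?thesis using zR Suc.prems(2) by (simp add: sum.delta)
  qed
  finally show ?case using dq by simp
qed

text \<open>The linear forms l0, l1, a are coordinates with dual basis b0, b1, b2. The line a = 0 is parametrized by
  pt u = b0 + u b1, with b1 as its point at infinity, and rho restricts polynomials to it.\<close>

locale line_frame =
  fixes a l0 l1 :: poly3 and b0 b1 b2 :: "complex^3"
  assumes ha: "homog a 1" and hl0: "homog l0 1" and hl1: "homog l1 1"
    and ev_a: "eval3 a b0 = 0" "eval3 a b1 = 0" "eval3 a b2 = 1"
    and ev_l0: "eval3 l0 b0 = 1" "eval3 l0 b1 = 0" "eval3 l0 b2 = 0"
    and ev_l1: "eval3 l1 b0 = 0" "eval3 l1 b1 = 1" "eval3 l1 b2 = 0"
    and frame: "\<And>i. Var i = cst (b0 $ i) * l0 + cst (b1 $ i) * l1 + cst (b2 $ i) * a"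
begin

definition rho :: "poly3 \<Rightarrow> complex poly" where
  "rho = ins (\<lambda>c. [:c:]) (\<lambda>i. [:b0 $ i, b1 $ i:])"

definition pt :: "complex \<Rightarrow> complex^3" where "pt u = (\<chi> i. b0 $ i + u * b1 $ i)"

lemma ringhom_rho: "ringhom rho"
  unfolding rho_def by (rule ringhom_ins[OF ringhom_const])

lemma rho_cst [simp]: "rho (cst c) = [:c:]" and rho_Var: "rho (Var i) = [:b0 $ i, b1 $ i:]"
  by (simp_all add: rho_def ins_cst[OF ringhom_const] ins_Var[OF ringhom_const])

lemma poly_rho: "poly (rho p) u = eval3 p (pt u)"
proof (rule poly3_hom_eq[where f = "\<lambda>p. poly (rho p) u" and g = "\<lambda>p. eval3 p (pt u)"])
  show "ringhom (\<lambda>p. poly (rho p) u)" using ringhom_rho by (simp add: ringhom_def)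
qed (simp_all add: ringhom_eval3 rho_Var pt_def)

lemma rho_linear:
  assumes "homog l 1" shows "rho l = [:eval3 l b0, eval3 l b1:]"
proof -
  have "poly (rho l) u = poly [:eval3 l b0, eval3 l b1:] u" for u
    unfolding poly_rho pt_def using eval3_linear[OF assms, of 1 b0 u b1] by simp
  then have "poly (rho l) = poly [:eval3 l b0, eval3 l b1:]" by blast
  then show ?thesis by (simp only: poly_eq_poly_eq_iff)
qed

lemma rho_a [simp]: "rho a = 0" and rho_l0 [simp]: "rho l0 = 1" and rho_l1 [simp]: "rho l1 = [:0, 1:]"
  unfolding rho_linear[OF ha] rho_linear[OF hl0] rho_linear[OF hl1] by (simp_all add: ev_a ev_l0 ev_l1 one_pCons)

lemma rho_dvd_a: "a dvd p \<Longrightarrow> rho p = 0"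
  by (auto simp: rh_mult[OF ringhom_rho])

text \<open>Homogenization in degree d with respect to l0 and l1; a section of \<open>rho\<close> on
  polynomials of degree at most d.\<close>

definition lift :: "nat \<Rightarrow> complex poly \<Rightarrow> poly3" where
  "lift d P = (\<Sum>j\<le>d. cst (coeff P j) * l0 ^ (d - j) * l1 ^ j)"

lemma homog_lift: "homog (lift d P) d"
  unfolding lift_def
proof (rule homog_sum)
  fix j assume "j \<in> {..d}"
  moreover have "homog (cst (coeff P j) * l0 ^ (d - j) * l1 ^ j) ((d - j) * 1 + j * 1)"
    by (intro homog_mult homog_cst_mult homog_power hl0 hl1)
  ultimately show "homog (cst (coeff P j) * l0 ^ (d - j) * l1 ^ j) d" by simp
qed

lemma rho_lift: "degree P \<le> d \<Longrightarrow> rho (lift d P) = P"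
proof -
  assume d: "degree P \<le> d"
  have "rho (lift d P) = (\<Sum>j\<le>d. monom (coeff P j) j)"
    by (simp add: lift_def rh_sum[OF ringhom_rho] rh_mult[OF ringhom_rho] rh_power[OF ringhom_rho] monom_altdef)
  also have "\<dots> = P"
    by (rule poly_eqI) (use d in \<open>auto simp: coeff_sum coeff_eq_0\<close>)
  finally show ?thesis .
qed

lemma lift_add: "lift d (P + Q) = lift d P + lift d Q"
  by (simp add: lift_def rh_add[OF ringhom_cst] distrib_right sum.distrib)

lemma lift_0 [simp]: "lift d 0 = 0"
  by (simp add: lift_def)

lemma lift_sum: "lift d (sum f A) = (\<Sum>x\<in>A. lift d (f x))"
  by (induction A rule: infinite_finite_induct) (auto simp: lift_add)

lemma lift_monom: "k \<le> d \<Longrightarrow> lift d (monom c k) = cst c * l0 ^ (d - k) * l1 ^ k"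
proof -
  assume k: "k \<le> d"
  have "lift d (monom c k) = (\<Sum>j\<le>d. if j = k then cst c * l0 ^ (d - k) * l1 ^ k else 0)"
    unfolding lift_def by (rule sum.cong) auto
  then show ?thesis using k by (simp add: sum.delta)
qed

lemma lift_mult:
  assumes "degree P \<le> d" "degree Q \<le> e"
  shows "lift (d + e) (P * Q) = lift d P * lift e Q"
proof -
  have P: "P = (\<Sum>i\<le>d. monom (coeff P i) i)" and Q: "Q = (\<Sum>j\<le>e. monom (coeff Q j) j)"
    by (rule poly_eqI, use assms in \<open>auto simp: coeff_sum coeff_eq_0\<close>)+
  have "P * Q = (\<Sum>i\<le>d. \<Sum>j\<le>e. monom (coeff P i * coeff Q j) (i + j))"
    by (subst (1) P, subst (1) Q) (simp add: sum_product mult_monom)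
  then have "lift (d + e) (P * Q) = (\<Sum>i\<le>d. \<Sum>j\<le>e. cst (coeff P i * coeff Q j) * l0 ^ (d + e - (i + j)) * l1 ^ (i + j))"
    by (simp add: lift_sum lift_monom add_mono)
  also have "\<dots> = (\<Sum>i\<le>d. \<Sum>j\<le>e. (cst (coeff P i) * l0 ^ (d - i) * l1 ^ i) * (cst (coeff Q j) * l0 ^ (e - j) * l1 ^ j))"
  proof (intro sum.cong refl)
    fix i j assume "i \<in> {..d}" "j \<in> {..e}"
    then have "d + e - (i + j) = (d - i) + (e - j)" by auto
    then show "cst (coeff P i * coeff Q j) * l0 ^ (d + e - (i + j)) * l1 ^ (i + j) =
        (cst (coeff P i) * l0 ^ (d - i) * l1 ^ i) * (cst (coeff Q j) * l0 ^ (e - j) * l1 ^ j)"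
      by (simp add: rh_mult[OF ringhom_cst] power_add ac_simps)
  qed
  also have "\<dots> = lift d P * lift e Q" by (simp add: lift_def sum_product)
  finally show ?thesis .
qed

definition tau :: "poly3 \<Rightarrow> poly3" where
  "tau = ins cst (\<lambda>i. cst (b0 $ i) * l0 + cst (b1 $ i) * l1)"

lemma ringhom_tau: "ringhom tau"
  unfolding tau_def by (rule ringhom_ins[OF ringhom_cst])

lemma tau_cst [simp]: "tau (cst c) = cst c" and tau_Var: "tau (Var i) = cst (b0 $ i) * l0 + cst (b1 $ i) * l1"
  by (simp_all add: tau_def ins_cst[OF ringhom_cst] ins_Var[OF ringhom_cst])

lemma tau_cong: "a dvd p - tau p"
proof (induction p rule: poly3_induct)
  case (Var i)
  have "Var i - tau (Var i) = cst (b2 $ i) * a" by (subst (1) frame) (simp add: tau_Var)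
  then show ?case by simp
next
  case (add p q)
  have "p + q - tau (p + q) = (p - tau p) + (q - tau q)" by (simp add: rh_add[OF ringhom_tau])
  then show ?case using dvd_add[OF add] by metis
next
  case (mult p q)
  have "p * q - tau (p * q) = (p - tau p) * q + tau p * (q - tau q)"
    by (simp add: rh_mult[OF ringhom_tau] algebra_simps)
  then show ?case using dvd_add[OF dvd_mult2[OF mult(1), of q] dvd_mult[OF mult(2), of "tau p"]] by metis
qed simp

text \<open>The two restrictions of p to the line, tau to a form in l0, l1 and rho to a polynomial, correspond by
  homogenization in degree d.\<close>

definition homprop :: "nat \<Rightarrow> poly3 \<Rightarrow> bool" where
  "homprop d p \<longleftrightarrow> degree (rho p) \<le> d \<and> tau p = lift d (rho p)"

lemma homprop_mult: "homprop d p \<Longrightarrow> homprop e q \<Longrightarrow> homprop (d + e) (p * q)"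
  unfolding homprop_def
  by (auto simp: rh_mult[OF ringhom_rho] rh_mult[OF ringhom_tau] lift_mult intro: order_trans[OF degree_mult_le add_mono])

lemma homprop_cst: "homprop 0 (cst c)"
  by (simp add: homprop_def lift_def)

lemma homprop_Var: "homprop 1 (Var i)"
  by (simp add: homprop_def lift_def rho_Var tau_Var)

lemma homprop_power: "homprop 1 p \<Longrightarrow> homprop n (p ^ n)"
proof (induction n)
  case 0
  show ?case using homprop_cst[of 1] by simp
next
  case (Suc n)
  then show ?case using homprop_mult[of 1 p n "p ^ n"] by simp
qed

lemma homprop_homog: "homog p d \<Longrightarrow> homprop d p"
proof -
  assume h: "homog p d"
  have s: "homprop (tdeg m) (sgl m c)" for m c
  proof -
    have "homprop (lkp m i) (Var i ^ lkp m i)" for i by (rule homprop_power[OF homprop_Var])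
    then have "homprop (lkp m 1 + lkp m 2 + lkp m 3) (Var 1 ^ lkp m 1 * Var 2 ^ lkp m 2 * Var 3 ^ lkp m 3)"
      by (intro homprop_mult)
    from homprop_mult[OF homprop_cst[of c] this] show ?thesis
      by (simp add: single_eq_prod prod_3 tdeg_def sum_3)
  qed
  have "homprop d (\<Sum>m\<in>A. sgl m (lkp p m))" if "A \<subseteq> Poly_Mapping.keys p" for A
    using that
  proof (induction A rule: infinite_finite_induct)
    case (insert m A)
    then have 1: "homprop d (sgl m (lkp p m))" using s[of m] h by (auto simp: homog_def)
    have 2: "homprop d (\<Sum>m\<in>A. sgl m (lkp p m))" using insert by simp
    from 1 2 insert.hyps show ?case
      by (simp add: homprop_def rh_add[OF ringhom_rho] rh_add[OF ringhom_tau] lift_add degree_add_le)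
  qed (simp_all add: homprop_def rh_0[OF ringhom_rho] rh_0[OF ringhom_tau])
  then show ?thesis using sum_singles[of p] by (metis order_refl)
qed

lemma degree_rho: "homog p d \<Longrightarrow> degree (rho p) \<le> d"
  using homprop_homog by (simp add: homprop_def)

lemma lift_rho: "homog p d \<Longrightarrow> a dvd p - lift d (rho p)"
  using homprop_homog tau_cong by (metis homprop_def)

lemma rho_eq_0: "homog p d \<Longrightarrow> rho p = 0 \<longleftrightarrow> a dvd p"
  using lift_rho[of p d] rho_dvd_a by auto

text \<open>A form keeps its full degree on the line exactly if it does not vanish at the point at
  infinity b1.\<close>

lemma coeff_rho_top: "homog p d \<Longrightarrow> coeff (rho p) d = eval3 p b1"
proof -
  assume h: "homog p d"
  obtain y where y: "p - lift d (rho p) = a * y" using lift_rho[OF h] by blast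
  note e = ringhom_eval3
  have "eval3 (p - lift d (rho p)) b1 = 0" by (simp add: y rh_mult[OF e] ev_a)
  then have "eval3 p b1 = eval3 (lift d (rho p)) b1" by (simp add: rh_diff[OF e])
  also have "\<dots> = (\<Sum>j\<le>d. coeff (rho p) j * 0 ^ (d - j))"
    by (simp add: lift_def rh_sum[OF e] rh_mult[OF e] rh_power[OF e] ev_l0 ev_l1)
  also have "\<dots> = (\<Sum>j\<le>d. if j = d then coeff (rho p) d else 0)"
    by (rule sum.cong) auto
  finally show ?thesis by (simp add: sum.delta)
qed

lemma tau_a [simp]: "tau a = 0"
proof -
  have "homprop 1 a" by (rule homprop_homog[OF ha])
  then show ?thesis by (simp add: homprop_def)
qed

lemma a_dvd_iff: "a dvd p \<longleftrightarrow> tau p = 0"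
proof
  assume "tau p = 0" then show "a dvd p" using tau_cong[of p] by simp
qed (auto simp: rh_mult[OF ringhom_tau])

lemma a_nonzero: "a \<noteq> 0"
  using ev_a rh_0[OF ringhom_eval3] by (metis zero_neq_one)

text \<open>\<open>tau\<close> has kernel (a) and maps into a domain.\<close>

lemma a_prime: "a dvd p * q \<Longrightarrow> a dvd p \<or> a dvd q"
  by (simp add: a_dvd_iff rh_mult[OF ringhom_tau])

lemma dvd_cancel_a:
  assumes "f dvd a * x" "\<not> a dvd f" shows "f dvd x"
proof -
  obtain y where y: "a * x = f * y" using assms(1) by blast
  then have "a dvd f * y" by (metis dvd_triv_left)
  then obtain y' where "y = a * y'" using a_prime assms(2) by blast
  then have "a * x = a * (f * y')" using y by (simp add: ac_simps)
  then show ?thesis using a_nonzero by simp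
qed

end

text \<open>The point b0 + u b1 becomes the point at infinity and b1 the origin of the affine
  coordinate; the linear forms are the dual coordinates.\<close>

lemma line_frame_change:
  assumes "line_frame a l0 l1 b0 b1 b2"
  shows "line_frame a (l1 - cst u * l0) l0 b1 (\<chi> i. b0 $ i + u * b1 $ i) b2"
proof -
  interpret line_frame a l0 l1 b0 b1 b2 by fact
  have l: "homog l 1 \<Longrightarrow> eval3 l (\<chi> i. b0 $ i + u * b1 $ i) = eval3 l b0 + u * eval3 l b1" for l
    using eval3_linear[of l 1 b0 u b1] by simp
  note e = ringhom_eval3
  show ?thesis
  proof
    show "homog (l1 - cst u * l0) 1" by (intro homog_diff homog_cst_mult hl0 hl1)
    fix i
    show "Var i = cst (b1 $ i) * (l1 - cst u * l0) + cst ((\<chi> i. b0 $ i + u * b1 $ i) $ i) * l0 + cst (b2 $ i) * a"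
      by (subst frame) (simp add: rh_add[OF ringhom_cst] rh_mult[OF ringhom_cst] algebra_simps)
  qed (simp_all add: ha hl0 hl1 l[OF ha] l[OF hl0] l[OF hl1] ev_a ev_l0 ev_l1 rh_diff[OF e] rh_mult[OF e] del: One_nat_def)
qed

text \<open>If x_k occurs in a, the other two variables complete a to linear coordinates, and the
  three vectors are the dual basis.\<close>

lemma line_frame_exists:
  assumes "is_line a"
  obtains l0 l1 b0 b1 b2 where "line_frame a l0 l1 b0 b1 b2"
proof -
  have a: "a \<noteq> 0" "homog a 1" using assms by (auto simp: is_line_def)
  obtain c where c: "\<And>i. pd i a = cst (c i)" using homog_1_expand[OF a(2)] by blast
  have ae: "a = (\<Sum>i\<in>UNIV. Var i * cst (c i))" using euler_formula[OF a(2)] c by simp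
  obtain k where k: "c k \<noteq> 0"
  proof (rule ccontr)
    assume "\<not> thesis"
    then have "c i = 0" for i using that by blast
    then show False using ae a(1) by simp
  qed
  obtain i j where ij: "i \<noteq> j" "i \<noteq> k" "j \<noteq> k" "UNIV = {i, j, k :: 3}"
  proof -
    consider "k = 1" | "k = 2" | "k = 3" using exhaust_3 by blast
    then show ?thesis
    proof cases
      case 1 show ?thesis using that[of 2 3] 1 UNIV_3 by auto
    next
      case 2 show ?thesis using that[of 1 3] 2 UNIV_3 by auto
    next
      case 3 show ?thesis using that[of 1 2] 3 UNIV_3 by auto
    qed
  qed
  have aa: "a = Var i * cst (c i) + Var j * cst (c j) + Var k * cst (c k)"
    by (subst ae) (simp add: ij ac_simps)
  have cc: "cst (c k) * cst (1 / c k) = 1" by (rule cst_inverse[OF k])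
  note e = ringhom_eval3
  have "line_frame a (Var i) (Var j) (\<chi> l. if l = i then 1 else if l = k then - c i / c k else 0)
    (\<chi> l. if l = j then 1 else if l = k then - c j / c k else 0) (\<chi> l. if l = k then 1 / c k else 0)"
  proof
    fix l
    have "Var k = cst (1 / c k) * a + cst (- c i / c k) * Var i + cst (- c j / c k) * Var j"
    proof -
      have d: "cst (- x / c k) = - (cst x * cst (1 / c k))" for x
        by (simp add: rh_mult[OF ringhom_cst, symmetric] rh_minus[OF ringhom_cst, symmetric])
      show ?thesis unfolding aa d using cc by (simp add: algebra_simps)
    qed
    moreover have "l = i \<or> l = j \<or> l = k" using ij(4) by blast
    ultimately show "Var l = cst ((\<chi> l. if l = i then 1 else if l = k then - c i / c k else 0) $ l) * Var i
        + cst ((\<chi> l. if l = j then 1 else if l = k then - c j / c k else 0) $ l) * Var j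
        + cst ((\<chi> l. if l = k then 1 / c k else 0) $ l) * a"
      using ij rh_1[OF ringhom_cst] by auto
  qed (use ij k a(2) in \<open>simp_all add: homog_Var[simplified] aa rh_add[OF e] rh_mult[OF e]\<close>)
  then show ?thesis using that by blast
qed

section \<open>Local invariants at the points of a line\<close>

lemma ideal_gen_eq_idl: "ideal_gen G = idl G"
proof
  show "ideal_gen G \<subseteq> idl G"
  proof
    fix x assume "x \<in> ideal_gen G"
    then obtain F h where "F \<subseteq> G" "x = (\<Sum>y\<in>F. h y * y)" unfolding ideal_gen_def by blast
    have "h y * y \<in> idl G" if "y \<in> F" for y
      using that \<open>F \<subseteq> G\<close> by (intro ideal_mult[OF ideal_idl] idl_superset) blast
    then show "x \<in> idl G" unfolding \<open>x = _\<close> by (rule ideal_sum[OF ideal_idl])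
  qed
  show "idl G \<subseteq> ideal_gen G"
  proof (rule idl_least)
    show "G \<subseteq> ideal_gen G"
    proof
      fix x assume "x \<in> G"
      then have "x = (\<Sum>y\<in>{x}. 1 * y)" "finite {x}" "{x} \<subseteq> G" by auto
      then show "x \<in> ideal_gen G" unfolding ideal_gen_def mem_Collect_eq
        by (intro exI[of _ "{x}"] exI[of _ "\<lambda>_. 1"]) simp
    qed
    show "ideal (ideal_gen G)"
      unfolding ideal_def
    proof (intro conjI ballI allI)
      show "0 \<in> ideal_gen G" unfolding ideal_gen_def mem_Collect_eq by (intro exI[of _ "{}"]) simp
    next
      fix x y assume "x \<in> ideal_gen G" "y \<in> ideal_gen G"
      then obtain F h F' h' where F: "finite F" "F \<subseteq> G" "x = (\<Sum>z\<in>F. h z * z)" "finite F'" "F' \<subseteq> G" "y = (\<Sum>z\<in>F'. h' z * z)"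
        unfolding ideal_gen_def by blast
      let ?k = "\<lambda>z. (if z \<in> F then h z else 0) + (if z \<in> F' then h' z else 0)"
      have "x = (\<Sum>z\<in>F \<union> F'. (if z \<in> F then h z else 0) * z)"
        unfolding F(3) using F by (intro sum.mono_neutral_cong_left) auto
      moreover have "y = (\<Sum>z\<in>F \<union> F'. (if z \<in> F' then h' z else 0) * z)"
        unfolding F(6) using F by (intro sum.mono_neutral_cong_left) auto
      ultimately have "x + y = (\<Sum>z\<in>F \<union> F'. ?k z * z)" by (simp add: distrib_right sum.distrib)
      moreover have "finite (F \<union> F')" "F \<union> F' \<subseteq> G" using F by auto
      ultimately show "x + y \<in> ideal_gen G" unfolding ideal_gen_def mem_Collect_eq
        by (intro exI[of _ "F \<union> F'"] exI[of _ ?k]) blast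
    next
      fix x r assume "x \<in> ideal_gen G"
      then obtain F h where F: "finite F" "F \<subseteq> G" "x = (\<Sum>z\<in>F. h z * z)" unfolding ideal_gen_def by blast
      then have "r * x = (\<Sum>z\<in>F. (r * h z) * z)" by (simp add: sum_distrib_left mult.assoc)
      then show "r * x \<in> ideal_gen G" unfolding ideal_gen_def mem_Collect_eq using F
        by (intro exI[of _ F] exI[of _ "\<lambda>z. r * h z"]) blast
    qed
  qed
qed

lemma pderiv_sum': "pderiv (sum f A) = (\<Sum>x\<in>A. pderiv (f x))"
  by (induction A rule: infinite_finite_induct) (auto simp: pderiv_add)

lemma ideal_vimage: "ringhom \<phi> \<Longrightarrow> ideal J \<Longrightarrow> ideal {p. \<phi> p \<in> J}"
  unfolding ideal_def by (simp add: rh_0 rh_add rh_mult)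

lemma dt_add: "dt (p + q) = dt p + dt q"
  by (rule poly_eqI) (simp add: dt_def coeff_map_poly pderiv_add)

lemma dt_mult: "dt (p * q) = dt p * q + p * dt q"
proof (rule poly_eqI)
  fix k
  have "coeff (dt (p * q)) k = (\<Sum>j\<le>k. pderiv (coeff p j) * coeff q (k - j) + coeff p j * pderiv (coeff q (k - j)))"
    by (simp add: dt_def coeff_map_poly coeff_mult pderiv_sum' pderiv_mult mult.commute add.commute)
  then show "coeff (dt (p * q)) k = coeff (dt p * q + p * dt q) k"
    by (simp add: dt_def coeff_map_poly coeff_mult sum.distrib)
qed

lemma ds_tB [simp]: "ds tB = 0" and dt_tB [simp]: "dt tB = 1"
  by (simp_all add: tB_def dt_def map_poly_pCons pderiv_pCons one_pCons)

lemma ringhom_kB: "ringhom kB"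
  by (rule B.k)

lemma linear_pd_sum: "homog l 1 \<Longrightarrow> (\<Sum>j\<in>UNIV. cst (v $ j) * pd j l) = cst (eval3 l v)"
proof -
  assume h: "homog l 1"
  obtain c where c: "\<forall>i. pd i l = cst (c i)" using homog_1_expand[OF h] by blast
  have l: "l = (\<Sum>i\<in>UNIV. Var i * cst (c i))" using euler_formula[OF h] c by simp
  have "eval3 l v = (\<Sum>i\<in>UNIV. v $ i * c i)"
    by (subst l) (simp add: rh_mult[OF ringhom_eval3] rh_sum[OF ringhom_eval3])
  then show ?thesis using c by (simp add: rh_sum[OF ringhom_cst] rh_mult[OF ringhom_cst])
qed

lemma Var_nonzero [simp]: "Var i \<noteq> 0"
proof -
  have "eval3 (Var i) (\<chi> i. 1) \<noteq> 0" by simp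
  then show ?thesis using rh_0[OF ringhom_eval3] by metis
qed

lemma Var_prime: "Var i dvd p * q \<Longrightarrow> Var i dvd p \<or> Var i dvd q"
proof -
  assume d: "Var i dvd p * q"
  have "is_line (Var i)" using homog_Var by (simp add: is_line_def del: One_nat_def)
  then obtain l0 l1 b0 b1 b2 where "line_frame (Var i) l0 l1 b0 b1 b2" by (rule line_frame_exists)
  then show ?thesis using d line_frame.a_prime by blast
qed

lemma split_Var_power:
  assumes "p \<noteq> 0" obtains k p' where "p = Var i ^ k * p'" "\<not> Var i dvd p'"
proof -
  have "\<exists>k p'. p = Var i ^ k * p' \<and> \<not> Var i dvd p'" using assms
  proof (induction "degree (hpol p)" arbitrary: p rule: less_induct)
    case less
    show ?case
    proof (cases "Var i dvd p")
      case False
      then show ?thesis by (intro exI[of _ 0] exI[of _ p]) simp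
    next
      case True
      then obtain y where y: "p = Var i * y" by blast
      then have y0: "y \<noteq> 0" "hpol y \<noteq> 0" using less.prems hpol_inject[of y 0] rh_0[OF ringhom_hpol] by auto
      have "hpol (Var i) = monom (Var i) 1" using homog_Var homog_iff_hpol by blast
      then have "degree (hpol p) = 1 + degree (hpol y)"
        using y0 by (simp add: y rh_mult[OF ringhom_hpol] degree_mult_eq degree_monom_eq)
      then obtain k p' where "y = Var i ^ k * p'" "\<not> Var i dvd p'" using less.hyps[of y] y0 by auto
      then show ?thesis using y by (intro exI[of _ "Suc k"] exI[of _ p']) (simp add: mult.assoc)
    qed
  qed
  then show ?thesis using that by blast
qed

lemma Var_power_cancel:
  assumes "p * y = Var i ^ k * f" "\<not> Var i dvd p" shows "p dvd f"
  using assms(1)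
proof (induction k arbitrary: y)
  case 0
  then show ?case by (metis dvd_triv_left mult_1 power_0)
next
  case (Suc k)
  then have "Var i dvd p * y" by simp
  then obtain y' where y': "y = Var i * y'" using Var_prime assms(2) by blast
  have "Var i * (p * y') = Var i * (Var i ^ k * f)" using Suc.prems y' by (simp add: ac_simps)
  then have "p * y' = Var i ^ k * f" using Var_nonzero[of i] by (metis mult_left_cancel)
  then show ?case by (rule Suc.IH)
qed

text \<open>Homogenization by the variable i, padded to degree D; for D large enough it has the same
  image as p in the chart x_i = 1.\<close>

definition hz :: "3 \<Rightarrow> nat \<Rightarrow> poly3 \<Rightarrow> poly3" where
  "hz i D p = (\<Sum>d\<le>D. hc d p * Var i ^ (D - d))"

lemma homog_hz: "homog (hz i D p) D"
  unfolding hz_def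
proof (rule homog_sum)
  fix d assume "d \<in> {..D}"
  moreover have "homog (hc d p * Var i ^ (D - d)) (d + (D - d) * 1)"
    by (intro homog_mult homog_hc homog_power homog_Var)
  ultimately show "homog (hc d p * Var i ^ (D - d)) D" by simp
qed

lemma sum_hc_le: "degree (hpol p) \<le> D \<Longrightarrow> p = (\<Sum>d\<le>D. hc d p)"
proof -
  assume d: "degree (hpol p) \<le> D"
  have "(\<Sum>d\<le>degree (hpol p). hc d p) = (\<Sum>d\<le>D. hc d p)"
    using d by (intro sum.mono_neutral_left) (auto simp: hc_def coeff_eq_0)
  then show ?thesis using sum_hc[of p] by simp
qed

text \<open>Through \<open>hpol\<close> the divisibility becomes T^d p = (x_i T - 1) Y. Since the
  first factor on the right has constant term -1, powers of T can be stripped from Y until d = 0,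
  where the degrees in T disagree.\<close>

lemma homog_dvd_Var_minus_1:
  assumes "homog p d" "Var i - 1 dvd p" shows "p = 0"
proof (rule ccontr)
  assume p0: "p \<noteq> 0"
  obtain y where y: "p = (Var i - 1) * y" using assms(2) by blast
  have hV: "hpol (Var i) = monom (Var i) 1" using homog_Var homog_iff_hpol by blast
  have L: "hpol (Var i - 1) = [:-1, Var i:]"
    by (simp add: rh_diff[OF ringhom_hpol] rh_1[OF ringhom_hpol] hV monom_Suc monom_0 one_pCons)
  have H: "monom p d = [:-1, Var i:] * hpol y"
    using y assms(1) L by (metis homog_iff_hpol rh_mult[OF ringhom_hpol])
  have "False" if "monom p d = [:-1, Var i:] * Y" for Y
    using that
  proof (induction d arbitrary: Y)
    case 0
    have "Y \<noteq> 0" using 0 p0 by auto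
    then have "degree ([:-1, Var i:] * Y) = 1 + degree Y" by (subst degree_mult_eq) auto
    then show False using 0 by (metis add_is_0 degree_monom_eq p0 zero_neq_one)
  next
    case (Suc d)
    have "coeff (monom p (Suc d)) 0 = coeff ([:-1, Var i:] * Y) 0" using Suc.prems by simp
    then have "coeff Y 0 = 0" by (simp add: coeff_mult)
    then obtain Y' where Y': "Y = [:0, 1:] * Y'"
      by (metis dvdE poly_0_coeff_0 poly_eq_0_iff_dvd minus_zero)
    have "[:0, 1:] * monom p d = [:0, 1:] * ([:-1, Var i:] * Y')"
      using Suc.prems unfolding Y' by (simp add: monom_Suc ac_simps)
    then have "monom p d = [:-1, Var i:] * Y'" by (metis mult_left_cancel pCons_eq_0_iff zero_neq_one)
    then show False by (rule Suc.IH)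
  qed
  then show False using H by blast
qed

lemma prime_factor_pos_degree:
  fixes D :: "complex poly poly"
  assumes "degree D > 0" obtains \<pi> where "prime_elem \<pi>" "\<pi> dvd D" "degree \<pi> > 0"
proof -
  have "\<exists>\<pi>. prime_elem \<pi> \<and> \<pi> dvd D \<and> degree \<pi> > 0" using assms
  proof (induction D rule: prime_divisors_induct)
    case (unit x)
    then show ?case by (metis degree_0 degree_1 degree_mult_eq dvdE gr_implies_not0 add_is_0 mult_eq_0_iff zero_neq_one)
  next
    case (factor p x)
    then have px: "p \<noteq> 0" "x \<noteq> 0" by auto
    show ?case
    proof (cases "degree p > 0")
      case True
      then show ?thesis using factor by auto
    next
      case False
      then have "degree x > 0" using factor.prems px by (simp add: degree_mult_eq)
      then show ?thesis using factor.IH by (meson dvd_mult)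
    qed
  qed simp
  then show ?thesis using that by blast
qed

text \<open>By inf every common point of the curve and the line is some pt u.\<close>

locale curve_line = curve f e + line_frame a l0 l1 b0 b1 b2
  for f e a l0 l1 b0 b1 b2 +
  assumes nd: "\<not> a dvd f" and inf: "eval3 f b1 \<noteq> 0"
begin

lemma rho_f: "rho f \<noteq> 0" "degree (rho f) = e"
proof -
  show "rho f \<noteq> 0" using rho_eq_0[OF hf] nd by blast
  show "degree (rho f) = e"
    using degree_rho[OF hf] coeff_rho_top[OF hf] inf by (metis antisym le_degree)
qed

end

locale curve_line_pt = curve_line +
  fixes u0 :: complex and i :: 3
  assumes root: "poly (rho f) u0 = 0" and ci: "pt u0 $ i \<noteq> 0"
begin

text \<open>In the affine chart x_i = 1 the point pt u0 becomes q. The local coordinates there are m1 (outer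
  variable) and a (inner variable); Phi is the passage to these coordinates, with section Lam.\<close>

definition q :: "complex^3" where "q = (\<chi> l. (1 / pt u0 $ i) * pt u0 $ l)"
text \<open>\<open>be\<close> and \<open>ga\<close> are b1 and b2 moved along q until their i-th
  coordinate is 0, so they are tangent to the chart; with q they form the basis dual to x_i, m1,
  a.\<close>

definition be :: "complex^3" where "be = (\<chi> l. b1 $ l - b1 $ i * q $ l)"
definition ga :: "complex^3" where "ga = (\<chi> l. b2 $ l - b2 $ i * q $ l)"
definition m1 :: poly3 where "m1 = l1 - cst u0 * l0"

lemma hm1: "homog m1 1"
  unfolding m1_def by (intro homog_diff homog_cst_mult hl0 hl1)

lemma at_i: "q $ i = 1" "be $ i = 0" "ga $ i = 0"
  using ci by (simp_all add: q_def be_def ga_def)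

lemma frame2: "Var l = cst (q $ l) * Var i + cst (be $ l) * m1 + cst (ga $ l) * a"
proof -
  have "b0 $ l = q $ l * b0 $ i - (b1 $ l - b1 $ i * q $ l) * u0"
  proof -
    have "q $ l * pt u0 $ i = pt u0 $ l" using ci by (simp add: q_def)
    then show ?thesis by (simp add: pt_def algebra_simps)
  qed
  then have b: "cst (b0 $ l) = cst (q $ l) * cst (b0 $ i) - (cst (b1 $ l) - cst (b1 $ i) * cst (q $ l)) * cst u0"
    by (simp only: rh_mult[OF ringhom_cst] rh_diff[OF ringhom_cst])
  have "cst (q $ l) * Var i + cst (be $ l) * m1 + cst (ga $ l) * a =
      cst (q $ l) * (cst (b0 $ i) * l0 + cst (b1 $ i) * l1 + cst (b2 $ i) * a)
      + (cst (b1 $ l) - cst (b1 $ i) * cst (q $ l)) * (l1 - cst u0 * l0) + (cst (b2 $ l) - cst (b2 $ i) * cst (q $ l)) * a"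
    by (subst frame[of i]) (simp add: be_def ga_def m1_def rh_mult[OF ringhom_cst] rh_diff[OF ringhom_cst])
  also have "\<dots> = cst (b0 $ l) * l0 + cst (b1 $ l) * l1 + cst (b2 $ l) * a"
    unfolding b by (simp add: algebra_simps)
  finally show ?thesis by (simp only: frame[symmetric])
qed

lemma eval_q: "homog p d \<Longrightarrow> eval3 p q = (1 / pt u0 $ i) ^ d * eval3 p (pt u0)"
  unfolding q_def by (rule eval3_homog_scale)

lemma eval_pt_linear: "homog l 1 \<Longrightarrow> eval3 l (pt u) = eval3 l b0 + u * eval3 l b1"
  unfolding pt_def using eval3_linear[of l 1 b0 u b1] by simp

lemma ev_q: "eval3 a q = 0" "eval3 m1 q = 0"
  unfolding eval_q[OF ha] eval_q[OF hm1] eval_pt_linear[OF ha] eval_pt_linear[OF hm1]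
  by (simp_all add: ev_a ev_l0 ev_l1 m1_def rh_diff[OF ringhom_eval3] rh_mult[OF ringhom_eval3])

lemma ev_m1: "eval3 m1 b1 = 1" "eval3 m1 b2 = 0"
  by (simp_all add: ev_l0 ev_l1 m1_def rh_diff[OF ringhom_eval3] rh_mult[OF ringhom_eval3])

lemma eval_be: "homog l 1 \<Longrightarrow> eval3 l be = eval3 l b1 - b1 $ i * eval3 l q"
  unfolding be_def using eval3_linear[of l 1 b1 "- b1 $ i" q] by simp

lemma eval_ga: "homog l 1 \<Longrightarrow> eval3 l ga = eval3 l b2 - b2 $ i * eval3 l q"
  unfolding ga_def using eval3_linear[of l 1 b2 "- b2 $ i" q] by simp

lemma ev_be: "eval3 a be = 0" "eval3 m1 be = 1"
  and ev_ga: "eval3 a ga = 1" "eval3 m1 ga = 0"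
  unfolding eval_be[OF ha] eval_be[OF hm1] eval_ga[OF ha] eval_ga[OF hm1]
  by (simp_all add: ev_q ev_a ev_m1)

definition Phi :: "poly3 \<Rightarrow> complex poly poly" where
  "Phi = ins kB (\<lambda>l. [:[:q $ l, ga $ l:], [:be $ l:]:])"

lemma ringhom_Phi: "ringhom Phi"
  unfolding Phi_def by (rule ringhom_ins[OF ringhom_kB])

lemma Phi_cst [simp]: "Phi (cst c) = kB c" and Phi_Var: "Phi (Var l) = [:[:q $ l, ga $ l:], [:be $ l:]:]"
  by (simp_all add: Phi_def ins_cst[OF ringhom_kB] ins_Var[OF ringhom_kB])

lemma Phi_linear:
  assumes "homog l 1" shows "Phi l = [:[:eval3 l q, eval3 l ga:], [:eval3 l be:]:]"
proof -
  obtain c where c: "\<forall>i. pd i l = cst (c i)" using homog_1_expand[OF assms] by blast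
  have l: "l = (\<Sum>i\<in>UNIV. Var i * cst (c i))" using euler_formula[OF assms] c by simp
  have ev: "eval3 l v = (\<Sum>i\<in>UNIV. v $ i * c i)" for v
    by (subst l) (simp add: rh_mult[OF ringhom_eval3] rh_sum[OF ringhom_eval3])
  have "Phi l = (\<Sum>i\<in>UNIV. [:[:q $ i, ga $ i:], [:be $ i:]:] * kB (c i))"
    by (subst l) (simp add: rh_mult[OF ringhom_Phi] rh_sum[OF ringhom_Phi] Phi_Var)
  then show ?thesis by (simp add: sum_3 ev kB_def mult.commute)
qed

lemma Phi_a [simp]: "Phi a = tB" and Phi_m1 [simp]: "Phi m1 = [:0, 1:]" and Phi_Var_i [simp]: "Phi (Var i) = 1"
  unfolding Phi_linear[OF ha] Phi_linear[OF hm1] Phi_Var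
  by (simp_all add: ev_q ev_be ev_ga at_i tB_def one_pCons)

lemma evB_Phi: "evB (Phi p) = eval3 p q"
proof (rule poly3_hom_eq[where f = "\<lambda>p. evB (Phi p)" and g = "\<lambda>p. eval3 p q"])
  show "ringhom (\<lambda>p. evB (Phi p))" by (rule ringhom_comp[OF B.ev ringhom_Phi])
qed (simp_all add: ringhom_eval3 Phi_Var evB_def kB_def)

definition Lam :: "complex poly poly \<Rightarrow> poly3" where
  "Lam p = poly (map_poly (\<lambda>r. poly (map_poly cst r) a) p) m1"

lemma ringhom_Lam0: "ringhom (\<lambda>r. poly (map_poly cst r) a)"
  by (rule ringhom_poly_map[OF ringhom_cst])

lemma ringhom_Lam: "ringhom Lam"
  unfolding Lam_def[abs_def] by (rule ringhom_poly_map[OF ringhom_Lam0])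

lemma Lam_const: "Lam [:r:] = poly (map_poly cst r) a"
  unfolding Lam_def using map_poly_pCons_rh[OF ringhom_Lam0, of r 0] by simp

lemma Lam_values [simp]: "Lam (kB c) = cst c" "Lam tB = a" "Lam [:0, 1:] = m1"
proof -
  show "Lam (kB c) = cst c"
    unfolding kB_def Lam_const using map_poly_pCons_rh[OF ringhom_cst, of c 0] by simp
  show "Lam tB = a"
    unfolding tB_def Lam_const by (simp add: map_poly_pCons_rh[OF ringhom_cst])
  show "Lam [:0, 1:] = m1"
    unfolding Lam_def using rh_0[OF ringhom_Lam0] rh_1[OF ringhom_Lam0]
    by (simp add: map_poly_pCons_rh[OF ringhom_Lam0])
qed

lemma Phi_Lam [simp]: "Phi (Lam p) = p"
proof -
  note h = ringhom_comp[OF ringhom_Phi ringhom_Lam]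
  have k: "ringhom (\<lambda>c :: complex poly. [:c:])" by (rule ringhom_const)
  have 1: "Phi (Lam [:r:]) = [:r:]" for r
    by (rule poly_hom_eq[OF ringhom_comp[OF h k] k])
      (simp_all add: Lam_values[unfolded kB_def tB_def], simp_all add: kB_def tB_def)
  show ?thesis
    by (rule poly_hom_eq[OF h]) (simp_all add: 1 ringhom_def)
qed

text \<open>With \<open>Phi_Lam\<close> this makes \<open>Phi\<close> the quotient map by x_i - 1,
  onto the coordinate ring of the chart.\<close>

lemma Lam_Phi: "Var i - 1 dvd p - Lam (Phi p)"
proof (induction p rule: poly3_induct)
  case (Var l)
  have P: "Phi (Var l) = kB (q $ l) + kB (ga $ l) * tB + kB (be $ l) * [:0, 1:]"
    by (simp add: Phi_Var kB_def tB_def)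
  have "Lam (Phi (Var l)) = cst (q $ l) + cst (ga $ l) * a + cst (be $ l) * m1"
    unfolding P rh_add[OF ringhom_Lam] rh_mult[OF ringhom_Lam] Lam_values ..
  then have "Var l - Lam (Phi (Var l)) = cst (q $ l) * (Var i - 1)"
    by (subst (1) frame2[of l]) (simp add: algebra_simps)
  then show ?case by simp
next
  case (add p q)
  have "p + q - Lam (Phi (p + q)) = (p - Lam (Phi p)) + (q - Lam (Phi q))"
    by (simp add: rh_add[OF ringhom_Phi] rh_add[OF ringhom_Lam])
  then show ?case using dvd_add[OF add] by metis
next
  case (mult p q)
  have "p * q - Lam (Phi (p * q)) = (p - Lam (Phi p)) * q + Lam (Phi p) * (q - Lam (Phi q))"
    by (simp add: rh_mult[OF ringhom_Phi] rh_mult[OF ringhom_Lam] algebra_simps)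
  then show ?case using dvd_add[OF dvd_mult2[OF mult(1), of q] dvd_mult[OF mult(2), of "Lam (Phi p)"]] by metis
qed simp

lemma ds_Phi: "ds (Phi p) = (\<Sum>l\<in>UNIV. Phi (pd l p) * kB (be $ l))"
  unfolding Phi_def
  by (subst chain_rule3[where D = pderiv, OF ringhom_kB])
    (simp_all add: kB_def pderiv_add pderiv_mult pderiv_pCons add.commute mult.commute)

lemma dt_Phi: "dt (Phi p) = (\<Sum>l\<in>UNIV. Phi (pd l p) * kB (ga $ l))"
proof -
  have "dt [:[:q $ l, ga $ l:], [:be $ l:]:] = kB (ga $ l)" for l
    by (simp add: dt_def map_poly_pCons pderiv_pCons kB_def)
  moreover have "dt (kB c) = 0" for c by (simp add: dt_def kB_def map_poly_pCons)
  ultimately show ?thesis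
    unfolding Phi_def by (subst chain_rule3[where D = dt, OF ringhom_kB]) (simp_all add: dt_add dt_mult)
qed

text \<open>A vector whose i-th coordinate vanishes in the chart has only components along
  \<open>be\<close> and \<open>ga\<close>; these are its values on the dual forms m1 and a.\<close>

lemma Phi_vector:
  assumes "Phi (\<theta> i) = 0"
  shows "Phi (\<theta> l) = kB (be $ l) * Phi (\<Sum>j\<in>UNIV. \<theta> j * pd j m1) + kB (ga $ l) * Phi (\<Sum>j\<in>UNIV. \<theta> j * pd j a)"
proof -
  have "pd j (Var l) = cst (q $ l) * pd j (Var i) + cst (be $ l) * pd j m1 + cst (ga $ l) * pd j a" for j
    by (subst (1) frame2[of l]) (simp add: pd_add pd_mult)
  then have "(\<Sum>j\<in>UNIV. \<theta> j * pd j (Var l)) = cst (q $ l) * (\<Sum>j\<in>UNIV. \<theta> j * pd j (Var i))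
      + cst (be $ l) * (\<Sum>j\<in>UNIV. \<theta> j * pd j m1) + cst (ga $ l) * (\<Sum>j\<in>UNIV. \<theta> j * pd j a)"
    by (simp add: distrib_left sum.distrib sum_distrib_left ac_simps)
  moreover have v: "(\<Sum>j\<in>UNIV. \<theta> j * pd j (Var l)) = \<theta> l" for l
  proof -
    have "(\<Sum>j\<in>UNIV. \<theta> j * pd j (Var l)) = (\<Sum>j\<in>UNIV. if j = l then \<theta> j else 0)"
      by (rule sum.cong) (auto simp: pd_Var)
    then show ?thesis by simp
  qed
  ultimately have "\<theta> l = cst (q $ l) * \<theta> i + cst (be $ l) * (\<Sum>j\<in>UNIV. \<theta> j * pd j m1) + cst (ga $ l) * (\<Sum>j\<in>UNIV. \<theta> j * pd j a)"
    by simp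
  then have "Phi (\<theta> l) = Phi (cst (q $ l) * \<theta> i + cst (be $ l) * (\<Sum>j\<in>UNIV. \<theta> j * pd j m1) + cst (ga $ l) * (\<Sum>j\<in>UNIV. \<theta> j * pd j a))"
    by simp
  then show ?thesis using assms by (simp only: rh_add[OF ringhom_Phi] rh_mult[OF ringhom_Phi] Phi_cst mult_zero_right add_0)
qed

section \<open>Milnor and Tjurina numbers in local coordinates\<close>

lemma Phi_idl:
  assumes G: "Var i - 1 \<in> G" shows "p \<in> idl G \<longleftrightarrow> Phi p \<in> idl (Phi ` G)"
proof
  have "ideal {p. Phi p \<in> idl (Phi ` G)}"
    by (rule ideal_vimage[OF ringhom_Phi ideal_idl])
  then have "idl G \<subseteq> {p. Phi p \<in> idl (Phi ` G)}" by (rule idl_least) (auto intro: idl_superset)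
  then show "p \<in> idl G \<Longrightarrow> Phi p \<in> idl (Phi ` G)" by blast
next
  have d: "p - Lam (Phi p) \<in> idl G" for p
  proof -
    obtain y where "p - Lam (Phi p) = (Var i - 1) * y" using Lam_Phi by blast
    then show ?thesis using ideal_mult'[OF ideal_idl idl_superset[OF G]] by simp
  qed
  have "ideal {b. Lam b \<in> idl G}"
    by (rule ideal_vimage[OF ringhom_Lam ideal_idl])
  moreover have "Phi ` G \<subseteq> {b. Lam b \<in> idl G}"
    using d ideal_cancel[OF ideal_idl d] idl_superset by blast
  ultimately have "idl (Phi ` G) \<subseteq> {b. Lam b \<in> idl G}" by (rule idl_least)
  then show "Phi p \<in> idl (Phi ` G) \<Longrightarrow> p \<in> idl G" using ideal_cancel[OF ideal_idl d] by blast
qed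

text \<open>\<open>Phi\<close> turns ideals containing x_i - 1 into ideals of the two-variable ring
  and values at q into values at the origin.\<close>

lemma locdim_eq:
  assumes G: "Var i - 1 \<in> G" and n: "B.hascodim (B.sat (idl (Phi ` G))) n"
  shows "locdim q G = n"
proof -
  let ?J = "idl (Phi ` G)"
  have s: "(\<exists>u. eval3 u q \<noteq> 0 \<and> u * p \<in> ideal_gen G) \<longleftrightarrow> Phi p \<in> B.sat ?J" for p
  proof
    assume "\<exists>u. eval3 u q \<noteq> 0 \<and> u * p \<in> ideal_gen G"
    then obtain u where "evB (Phi u) \<noteq> 0" "Phi u * Phi p \<in> ?J"
      unfolding ideal_gen_eq_idl Phi_idl[OF G] evB_Phi rh_mult[OF ringhom_Phi] by blast
    then show "Phi p \<in> B.sat ?J" unfolding B.sat_def by blast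
  next
    assume "Phi p \<in> B.sat ?J"
    then obtain u where "evB u \<noteq> 0" "u * Phi p \<in> ?J" unfolding B.sat_def by blast
    then have "evB (Phi (Lam u)) \<noteq> 0" "Phi (Lam u * p) \<in> ?J" by (simp_all add: rh_mult[OF ringhom_Phi])
    then show "\<exists>u. eval3 u q \<noteq> 0 \<and> u * p \<in> ideal_gen G"
      unfolding ideal_gen_eq_idl Phi_idl[OF G] evB_Phi by blast
  qed
  have l: "Phi (\<Sum>j<m. cst (c j) * v j) = B.lc m c (\<lambda>j. Phi (v j))" for m c v
    by (simp add: B.lc_def rh_sum[OF ringhom_Phi] rh_mult[OF ringhom_Phi])
  have "{m. \<exists>v. \<forall>c. (\<exists>u. eval3 u q \<noteq> 0 \<and> u * (\<Sum>j<m. cst (c j) * v j) \<in> ideal_gen G) \<longrightarrow> (\<forall>j<m. c j = 0)}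
      = {m. \<exists>v. B.indep (B.sat ?J) m (\<lambda>j. Phi (v j))}"
    unfolding s l B.indep_def ..
  also have "\<dots> = {m. \<exists>v. B.indep (B.sat ?J) m v}"
  proof -
    have "\<exists>w. B.indep (B.sat ?J) m (\<lambda>j. Phi (w j))" if "B.indep (B.sat ?J) m v" for m v
      using that by (intro exI[of _ "\<lambda>j. Lam (v j)"]) simp
    then show ?thesis by blast
  qed
  finally show ?thesis
    unfolding locdim_def using B.Sup_indep[OF B.ideal_sat[OF ideal_idl] n] by simp
qed

text \<open>The derivatives along x_j with j different from i are derivatives along vectors with
  i-th coordinate 0, and \<open>be\<close> and \<open>ga\<close> span these vectors.\<close>

lemma idl_gradient:
  "idl (Phi ` (H \<union> ({Var i - 1} \<union> {pd j g | j. j \<noteq> i}))) = idl (Phi ` H \<union> {ds (Phi g), dt (Phi g)})"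
proof
  let ?G = "Phi ` (H \<union> ({Var i - 1} \<union> {pd j g | j. j \<noteq> i}))" and ?K = "Phi ` H \<union> {ds (Phi g), dt (Phi g)}"
  have "Phi (pd j g) \<in> idl ?K" if j: "j \<noteq> i" for j
  proof -
    define \<theta> where "\<theta> l = (if l = j then 1 else 0 :: poly3)" for l
    have "\<theta> i = 0" using j by (simp add: \<theta>_def)
    then have "Phi (\<theta> i) = 0" by (simp add: rh_0[OF ringhom_Phi])
    define X where "X = Phi (\<Sum>j\<in>UNIV. \<theta> j * pd j m1)"
    define Y where "Y = Phi (\<Sum>j\<in>UNIV. \<theta> j * pd j a)"
    have P: "Phi (\<theta> l) = kB (be $ l) * X + kB (ga $ l) * Y" for l
      unfolding X_def Y_def by (rule Phi_vector[where \<theta> = \<theta>, OF \<open>Phi (\<theta> i) = 0\<close>])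
    have "(\<Sum>l\<in>UNIV. \<theta> l * pd l g) = (\<Sum>l\<in>UNIV. if l = j then pd l g else 0)"
      by (rule sum.cong) (auto simp: \<theta>_def)
    then have "Phi (pd j g) = (\<Sum>l\<in>UNIV. Phi (\<theta> l) * Phi (pd l g))"
      by (simp add: rh_sum[OF ringhom_Phi, symmetric] rh_mult[OF ringhom_Phi, symmetric])
    also have "\<dots> = X * ds (Phi g) + Y * dt (Phi g)"
      unfolding P ds_Phi dt_Phi by (simp add: sum_3 algebra_simps)
    also have "\<dots> \<in> idl ?K" by (intro ideal_add ideal_mult ideal_idl idl_superset) auto
    finally show ?thesis .
  qed
  moreover have "Phi (Var i - 1) = 0" by (simp add: rh_diff[OF ringhom_Phi] rh_1[OF ringhom_Phi])
  then have "Phi (Var i - 1) \<in> idl ?K" by (simp add: ideal_0[OF ideal_idl])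
  ultimately have "?G \<subseteq> idl ?K" by (auto intro: idl_superset)
  then show "idl ?G \<subseteq> idl ?K" by (rule idl_least[OF ideal_idl])
  have t: "Phi (pd l g) * kB (v $ l) \<in> idl ?G" if "v $ i = 0" for l and v :: "complex^3"
  proof (cases "l = i")
    case True
    then show ?thesis using that ideal_0[OF ideal_idl] by (simp add: kB_def)
  next
    case False
    then show ?thesis by (intro ideal_mult' ideal_idl idl_superset) blast
  qed
  have "ds (Phi g) \<in> idl ?G" unfolding ds_Phi by (intro ideal_sum ideal_idl t at_i)
  moreover have "dt (Phi g) \<in> idl ?G" unfolding dt_Phi by (intro ideal_sum ideal_idl t at_i)
  ultimately have "?K \<subseteq> idl ?G" by (auto intro: idl_superset)
  then show "idl ?K \<subseteq> idl ?G" by (rule idl_least[OF ideal_idl])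
qed

text \<open>On the line F is (u - u0)^k E' with E' nonzero at u0. Lifting the factors gives F = m1^k
  E modulo a, where m1 is the local coordinate and E does not vanish at q.\<close>

lemma order_Phi_rho:
  assumes F: "homog F d" "rho F \<noteq> 0"
  shows "map0 (Phi F) \<noteq> 0" "order 0 (map0 (Phi F)) = order u0 (rho F)"
proof -
  define k where "k = order u0 (rho F)"
  obtain E' where E': "rho F = [:- u0, 1:] ^ k * E'" "\<not> [:- u0, 1:] dvd E'"
    using order_decomp[OF F(2), of u0] k_def by blast
  have E0: "E' \<noteq> 0" using E'(2) by auto
  have "degree (rho F) = k + degree E'"
    unfolding E'(1) using E0 by (simp add: degree_mult_eq degree_linear_power)
  then have kd: "k \<le> d" "degree E' \<le> d - k" using degree_rho[OF F(1)] by auto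
  define E where "E = lift (d - k) E'"
  have rm: "rho m1 = [:- u0, 1:]" by (simp add: m1_def rh_diff[OF ringhom_rho] rh_mult[OF ringhom_rho])
  have hE: "homog E (d - k)" unfolding E_def by (rule homog_lift)
  have "homog (m1 ^ k * E) (k * 1 + (d - k))" by (intro homog_mult homog_power hm1 hE)
  then have h: "homog (F - m1 ^ k * E) d" using kd F(1) by (intro homog_diff) auto
  have "rho (F - m1 ^ k * E) = 0"
    using kd rho_lift[of E' "d - k"] E'(1)
    by (simp add: rh_diff[OF ringhom_rho] rh_mult[OF ringhom_rho] rh_power[OF ringhom_rho] rm E_def)
  then obtain y where "F - m1 ^ k * E = a * y" using rho_eq_0[OF h] by blast
  then have "F = m1 ^ k * E + a * y" by (simp add: diff_eq_eq add.commute)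
  then have "map0 (Phi F) = map0 (Phi m1) ^ k * map0 (Phi E)"
    by (simp add: rh_add[OF ringhom_Phi] rh_mult[OF ringhom_Phi] rh_power[OF ringhom_Phi]
        rh_add[OF ringhom_map0] rh_mult[OF ringhom_map0] rh_power[OF ringhom_map0] del: Phi_m1)
  also have "map0 (Phi m1) = [:-0, 1:]" by (simp add: map0_def map_poly_pCons one_pCons)
  finally have mF: "map0 (Phi F) = [:-0, 1:] ^ k * map0 (Phi E)" .
  have "poly (map0 (Phi E)) 0 = eval3 E q" by (simp add: evB_map0[symmetric] evB_Phi)
  also have "\<dots> = (1 / pt u0 $ i) ^ (d - k) * poly E' u0"
    using eval_q[OF hE] poly_rho[of E u0] rho_lift[OF kd(2)] by (simp add: E_def)
  also have "\<dots> \<noteq> 0" using ci E'(2) by (simp add: poly_eq_0_iff_dvd)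
  finally have nz: "poly (map0 (Phi E)) 0 \<noteq> 0" .
  then have "map0 (Phi E) \<noteq> 0" by auto
  then show n0: "map0 (Phi F) \<noteq> 0" unfolding mF by simp
  have "order 0 (map0 (Phi F)) = order 0 ([:-0, 1 :: complex:] ^ k) + order 0 (map0 (Phi E))"
    using n0 unfolding mF by (rule order_mult)
  also have "\<dots> = k" using order_power_n_n[of "0::complex" k] order_0I[OF nz] by simp
  finally show "order 0 (map0 (Phi F)) = order u0 (rho F)" by (simp add: k_def)
qed

lemma Phi_hz: "degree (hpol p) \<le> D \<Longrightarrow> Phi (hz i D p) = Phi p"
  using sum_hc_le[of p D]
  by (simp add: hz_def rh_sum[OF ringhom_Phi] rh_mult[OF ringhom_Phi] rh_power[OF ringhom_Phi])
    (metis rh_sum[OF ringhom_Phi])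

text \<open>Dehomogenization loses only powers of x_i: after the degrees are made equal, the
  difference is homogeneous and divisible by x_i - 1.\<close>

lemma homog_Phi_eq:
  assumes "homog p d" "homog p' d'" "Phi p = Phi p'" "d \<le> d'"
  shows "Var i ^ (d' - d) * p = p'"
proof -
  have "homog (Var i ^ (d' - d) * p) ((d' - d) * 1 + d)" by (intro homog_mult homog_power homog_Var assms)
  then have h: "homog (Var i ^ (d' - d) * p - p') d'" using assms by (intro homog_diff) auto
  have "Phi (Var i ^ (d' - d) * p - p') = 0"
    using assms by (simp add: rh_diff[OF ringhom_Phi] rh_mult[OF ringhom_Phi] rh_power[OF ringhom_Phi])
  then have "Var i - 1 dvd Var i ^ (d' - d) * p - p'"
    using Lam_Phi[of "Var i ^ (d' - d) * p - p'"] by (simp add: rh_0[OF ringhom_Lam])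
  then show ?thesis using homog_dvd_Var_minus_1[OF h] by simp
qed

abbreviation (input) h where "h \<equiv> Phi f"

text \<open>By \<open>bezout_gcd\<close> it suffices that the gcd of h and ds h is constant in s. A
  prime factor \<pi> of positive s-degree cannot divide ds \<pi>, so it would divide h twice;
  homogenizing this and splitting off powers of x_i gives a square dividing f.\<close>

lemma germ_squarefree: "\<exists>A B c. c \<noteq> 0 \<and> A * h + B * ds h = [:c:]"
proof -
  have h0: "h \<noteq> 0" using order_Phi_rho(1)[OF hf rho_f(1)] rh_0[OF ringhom_map0] by auto
  obtain A B c where c: "c \<noteq> 0" "A * h + B * ds h = [:c:] * gcd h (ds h)" by (rule bezout_gcd[OF h0])
  define D where "D = gcd h (ds h)"
  have D0: "D \<noteq> 0" using h0 by (simp add: D_def)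
  have "degree D = 0"
  proof (rule ccontr)
    assume "degree D \<noteq> 0"
    then obtain \<pi> where \<pi>: "prime_elem \<pi>" "\<pi> dvd D" "degree \<pi> > 0" using prime_factor_pos_degree[of D] by auto
    have "\<pi> dvd h" "\<pi> dvd ds h" using \<pi>(2) by (auto simp: D_def)
    then obtain w where w: "h = \<pi> * w" by blast
    have "\<pi> dvd \<pi> * ds w + w * ds \<pi>" using \<open>\<pi> dvd ds h\<close> unfolding w pderiv_mult .
    then have "\<pi> dvd w * ds \<pi>" by (simp add: dvd_add_right_iff)
    moreover have "\<not> \<pi> dvd ds \<pi>"
    proof
      assume "\<pi> dvd ds \<pi>"
      moreover have "ds \<pi> \<noteq> 0" using \<pi>(3) by (metis pderiv_eq_0_iff less_irrefl)
      ultimately have "degree \<pi> \<le> degree (ds \<pi>)" by (rule dvd_imp_degree_le)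
      then show False using \<pi>(3) by (simp add: degree_pderiv)
    qed
    ultimately have "\<pi> dvd w" using \<pi>(1) prime_elem_dvd_mult_iff by blast
    then obtain w' where w': "h = \<pi> * \<pi> * w'" using w by (auto simp: mult.assoc)
    define D1 where "D1 = degree (hpol (Lam \<pi>))"
    \<comment> \<open>The summand e makes the product at least as large in degree as f, so that the
      power of x_i multiplies f.\<close>
    define D2 where "D2 = degree (hpol (Lam w')) + e"
    let ?P = "hz i D1 (Lam \<pi>)" and ?W = "hz i D2 (Lam w')"
    have P: "Phi ?P = \<pi>" "Phi ?W = w'" by (simp_all add: Phi_hz D1_def D2_def)
    have "homog (?P * ?P * ?W) (D1 + D1 + D2)" by (intro homog_mult homog_hz)
    moreover have "Phi f = Phi (?P * ?P * ?W)" using w' by (simp add: rh_mult[OF ringhom_Phi] P)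
    moreover have "e \<le> D1 + D1 + D2" by (simp add: D2_def)
    ultimately obtain k where k: "Var i ^ k * f = ?P * ?P * ?W" using homog_Phi_eq[OF hf] by metis
    have "?P \<noteq> 0" using P(1) \<pi>(3) by (auto simp: rh_0[OF ringhom_Phi])
    then obtain k' P' where P': "?P = Var i ^ k' * P'" "\<not> Var i dvd P'" by (rule split_Var_power)
    have "(P' * P') * (Var i ^ k' * Var i ^ k' * ?W) = Var i ^ k * f"
      unfolding k by (subst (1 2) P'(1)) (simp add: ac_simps)
    moreover have "\<not> Var i dvd P' * P'" using Var_prime P'(2) by blast
    ultimately have "P' * P' dvd f" by (rule Var_power_cancel)
    then have "P' dvd 1" by (rule sq)
    then have "Phi P' dvd 1" using rh_dvd[OF ringhom_Phi] rh_1[OF ringhom_Phi] by metis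
    moreover have "Phi P' = \<pi>"
      using P(1) unfolding P'(1) by (simp add: rh_mult[OF ringhom_Phi] rh_power[OF ringhom_Phi])
    ultimately show False using \<pi>(1) by (simp add: prime_elem_def)
  qed
  then obtain d where d: "D = [:d:]" by (rule degree_eq_zeroE)
  have "A * h + B * ds h = [:c * d:]" using c(2) d by (simp add: D_def)
  moreover have "c * d \<noteq> 0" using c(1) D0 d by auto
  ultimately show ?thesis by blast
qed

lemma germ: "plane_germ h (order u0 (rho f))"
proof
  show "evB h = 0" using root eval_q[OF hf] by (simp add: evB_Phi poly_rho)
qed (use order_Phi_rho[OF hf rho_f(1)] germ_squarefree in auto)

text \<open>In the difference of the two local terms \<mu> and \<tau> cancel, leaving 1 + (2 n - 1)
  - (n + r) = n - r.\<close>

lemma eps_formula_codim: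
  assumes \<gamma>: "\<beta> * ds h + \<gamma> * dt h = c * h" "map0 \<gamma> \<noteq> 0" "order 0 (map0 \<gamma>) = r"
    and min: "\<And>\<beta> \<gamma> c. \<beta> * ds h + \<gamma> * dt h = c * h \<Longrightarrow> [:0, 1:] ^ r dvd map0 \<gamma>"
    and P: "chart P = i" "npt P = q"
  shows "1 + (eps_loc (f * a) P - eps_loc f P) = int (order u0 (rho f)) - int r"
proof -
  define n where "n = order u0 (rho f)"
  interpret plane_germ h n unfolding n_def by (rule germ)
  obtain \<mu> where mu: "B.hascodim (B.sat (idl {ds h, dt h})) \<mu>"
    "B.hascodim (B.sat (idl {tB * ds h, h + tB * dt h})) (\<mu> + 2 * n - 1)" by (rule milnor_with_line)
  have "B.sat (idl {ds h, dt h}) \<subseteq> B.sat (idl {h, ds h, dt h})"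
    by (intro B.sat_mono idl_least ideal_idl) (auto intro: idl_superset)
  then obtain \<tau> where tau: "B.hascodim (B.sat (idl {h, ds h, dt h})) \<tau>"
    using B.hascodim_superset[OF B.ideal_sat[OF ideal_idl] B.ideal_sat[OF ideal_idl] _ mu(1)] by metis
  have tau': "B.hascodim (B.sat (idl {tB * h, tB * ds h, h + tB * dt h})) (\<tau> + n + r)"
    by (rule tjurina_with_line[OF tau \<gamma> min])
  have Pf: "Phi (f * a) = tB * h" by (simp add: rh_mult[OF ringhom_Phi] mult.commute)
  have dsf: "ds (Phi (f * a)) = tB * ds h" unfolding Pf by (simp add: pderiv_mult)
  have dtf: "dt (Phi (f * a)) = h + tB * dt h" unfolding Pf by (simp add: dt_mult)
  have M: "idl (Phi ` ({Var i - 1} \<union> {pd j g | j. j \<noteq> i})) = idl {ds (Phi g), dt (Phi g)}" for g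
    using idl_gradient[of "{}" g] by simp
  have T: "idl (Phi ` (insert g ({Var i - 1} \<union> {pd j g | j. j \<noteq> i}))) = idl {Phi g, ds (Phi g), dt (Phi g)}" for g
    using idl_gradient[of "{g}" g] by (simp add: insert_commute)
  have "milnor f P = \<mu>"
    unfolding milnor_def P by (rule locdim_eq) (use mu(1) M[of f] in auto)
  moreover have "milnor (f * a) P = \<mu> + 2 * n - 1"
    unfolding milnor_def P by (rule locdim_eq) (use mu(2) M[of "f * a"] dsf dtf in auto)
  moreover have "tjurina f P = \<tau>"
    unfolding tjurina_def P by (rule locdim_eq) (use tau T[of f] in auto)
  moreover have "tjurina (f * a) P = \<tau> + n + r"
    unfolding tjurina_def P by (rule locdim_eq) (use tau' T[of "f * a"] dsf dtf Pf in auto)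
  ultimately show ?thesis using n_pos by (simp add: eps_loc_def n_def)
qed

lemma rho_der_proj:
  assumes "\<theta> \<in> Dmod f"
  obtains \<eta> where "\<eta> \<in> D0 f" "rho (der_apply \<eta> a) = rho (der_apply \<theta> a)"
proof -
  obtain \<kappa> where k: "(\<lambda>i. \<theta> i - \<kappa> * Var i) \<in> D0 f" using D0_proj[OF assms] by blast
  have "der_apply (\<lambda>i. \<theta> i - \<kappa> * Var i) a = der_apply \<theta> a - \<kappa> * a"
    using der_apply_euler[OF ha] by (simp add: der_apply_diff der_apply_scale euler_def)
  then have "rho (der_apply (\<lambda>i. \<theta> i - \<kappa> * Var i) a) = rho (der_apply \<theta> a)"
    by (simp add: rh_diff[OF ringhom_rho] rh_mult[OF ringhom_rho])
  then show ?thesis using that[OF k] by blast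
qed

text \<open>The coefficients are homogenized and used along the constant vectors \<open>be\<close>
  and \<open>ga\<close>. The logarithmic equation then holds up to a power of x_i, which multiplies
  the derivation and is invisible in the chart.\<close>

lemma local_to_global:
  assumes "\<beta> * ds h + \<gamma> * dt h = c * h"
  obtains \<eta> F d where "\<eta> \<in> D0 f" "rho (der_apply \<eta> a) = rho F" "homog F d" "Phi F = \<gamma>"
proof -
  define D where "D = max (degree (hpol (Lam \<beta>))) (degree (hpol (Lam \<gamma>)))"
  \<comment> \<open>D' is at least D, so the side of the equation containing c has the larger degree
    and the power of x_i falls on the derivation.\<close>
  define D' where "D' = max D (degree (hpol (Lam c)))"
  let ?B = "hz i D (Lam \<beta>)" and ?G = "hz i D (Lam \<gamma>)" and ?C = "hz i D' (Lam c)"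
  have P: "Phi ?B = \<beta>" "Phi ?G = \<gamma>" "Phi ?C = c"
    by (simp_all add: Phi_hz D_def D'_def)
  define \<theta> where "\<theta> l = cst (be $ l) * ?B + cst (ga $ l) * ?G" for l
  have "Phi (der_apply \<theta> f) = (\<Sum>l\<in>UNIV. (kB (be $ l) * \<beta> + kB (ga $ l) * \<gamma>) * Phi (pd l f))"
    by (simp add: der_apply_def \<theta>_def rh_sum[OF ringhom_Phi] rh_mult[OF ringhom_Phi] rh_add[OF ringhom_Phi] P)
  also have "\<dots> = \<beta> * ds h + \<gamma> * dt h"
    unfolding ds_Phi dt_Phi by (simp add: sum_3 algebra_simps)
  finally have e1': "Phi (der_apply \<theta> f) = Phi (?C * f)" using assms by (simp add: rh_mult[OF ringhom_Phi] P)
  have "homog (\<theta> l) D" for l unfolding \<theta>_def by (intro homog_add homog_cst_mult homog_hz)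
  then have h1: "homog (der_apply \<theta> f) (D + (e - 1))" by (rule homog_der_apply) (use hf e1 in simp)
  have h2: "homog (?C * f) (D' + e)" by (intro homog_mult homog_hz hf)
  have "D + (e - 1) \<le> D' + e" by (simp add: D'_def)
  then obtain k where k: "Var i ^ k * der_apply \<theta> f = ?C * f" using homog_Phi_eq[OF h1 h2 e1'] by blast
  have "(\<lambda>l. Var i ^ k * \<theta> l) \<in> Dmod f" unfolding Dmod_def using k by (simp add: der_apply_scale)
  then obtain \<eta> where \<eta>: "\<eta> \<in> D0 f" "rho (der_apply \<eta> a) = rho (der_apply (\<lambda>l. Var i ^ k * \<theta> l) a)"
    by (rule rho_der_proj)
  have "der_apply \<theta> a = ?B * (\<Sum>l\<in>UNIV. cst (be $ l) * pd l a) + ?G * (\<Sum>l\<in>UNIV. cst (ga $ l) * pd l a)"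
    by (simp add: der_apply_def \<theta>_def sum_3 algebra_simps)
  then have "der_apply \<theta> a = ?G" by (simp add: linear_pd_sum[OF ha] ev_be ev_ga)
  then have "rho (der_apply \<eta> a) = rho (Var i ^ k * ?G)" using \<eta>(2) by (simp add: der_apply_scale)
  moreover have "homog (Var i ^ k * ?G) (k * 1 + D)" by (intro homog_mult homog_power homog_Var homog_hz)
  moreover have "Phi (Var i ^ k * ?G) = \<gamma>" by (simp add: rh_mult[OF ringhom_Phi] rh_power[OF ringhom_Phi] P)
  ultimately show ?thesis using that \<eta>(1) by blast
qed

text \<open>The Euler derivation has i-th coordinate 1 in the chart, so subtracting a multiple of it
  makes \<theta> tangent to the chart; its value on a changes only by a multiple of a.\<close>

lemma global_to_local:
  assumes \<theta>: "\<theta> \<in> D0 f"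
  obtains \<beta> \<gamma> c where "\<beta> * ds h + \<gamma> * dt h = c * h" "map0 \<gamma> = map0 (Phi (der_apply \<theta> a))"
proof -
  define \<eta> where "\<eta> = (\<lambda>l. \<theta> l - \<theta> i * euler l)"
  have z: "Phi (\<eta> i) = 0" by (simp add: \<eta>_def euler_def rh_diff[OF ringhom_Phi] rh_mult[OF ringhom_Phi])
  define \<beta> where "\<beta> = Phi (\<Sum>j\<in>UNIV. \<eta> j * pd j m1)"
  define \<gamma> where "\<gamma> = Phi (\<Sum>j\<in>UNIV. \<eta> j * pd j a)"
  have P: "Phi (\<eta> l) = kB (be $ l) * \<beta> + kB (ga $ l) * \<gamma>" for l
    unfolding \<beta>_def \<gamma>_def by (rule Phi_vector[where \<theta> = \<eta>, OF z])
  have "\<beta> * ds h + \<gamma> * dt h = (\<Sum>l\<in>UNIV. Phi (\<eta> l) * Phi (pd l f))"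
    unfolding ds_Phi dt_Phi P by (simp add: sum_3 algebra_simps)
  also have "\<dots> = Phi (der_apply \<eta> f)"
    by (simp add: der_apply_def rh_sum[OF ringhom_Phi] rh_mult[OF ringhom_Phi])
  also have "der_apply \<eta> f = (- \<theta> i * of_nat e) * f"
    using \<theta> he unfolding \<eta>_def by (simp add: der_apply_diff der_apply_scale D0_iff)
  finally have "\<beta> * ds h + \<gamma> * dt h = Phi (- \<theta> i * of_nat e) * h" by (simp only: rh_mult[OF ringhom_Phi])
  moreover have "der_apply \<eta> a = der_apply \<theta> a - \<theta> i * a"
    using der_apply_euler[OF ha] by (simp add: \<eta>_def der_apply_diff der_apply_scale)
  then have "map0 \<gamma> = map0 (Phi (der_apply \<theta> a))"
    unfolding \<gamma>_def der_apply_def[symmetric]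
    by (simp add: rh_diff[OF ringhom_Phi] rh_mult[OF ringhom_Phi] rh_diff[OF ringhom_map0] rh_mult[OF ringhom_map0])
  ultimately show ?thesis using that by blast
qed

end

section \<open>From local orders to the degree of g\<close>

context curve_line
begin

lemma D0_hc:
  assumes "\<theta> \<in> D0 f" shows "(\<lambda>l. hc d (\<theta> l)) \<in> D0 f"
    and "der_apply (\<lambda>l. hc d (\<theta> l)) a = hc d (der_apply \<theta> a)"
proof -
  have 1: "homog (pd l f) (e - 1)" for l by (rule homog_pd) (use hf e1 in simp)
  have "der_apply (\<lambda>l. hc d (\<theta> l)) f = hc (e - 1 + d) (der_apply \<theta> f)"
    by (simp add: der_apply_def hc_sum hc_mult_homog[OF 1] mult.commute[of "\<theta> _"] mult.commute[of "hc _ _"])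
  then show "(\<lambda>l. hc d (\<theta> l)) \<in> D0 f" using assms by (simp add: D0_iff)
  have 2: "homog (pd l a) 0" for l by (rule homog_pd) (use ha in simp)
  show "der_apply (\<lambda>l. hc d (\<theta> l)) a = hc d (der_apply \<theta> a)"
    by (simp add: der_apply_def hc_sum hc_mult_homog[OF 2] mult.commute[of "\<theta> _"] mult.commute[of "hc _ _"])
qed

lemma homog_der_apply_a: "(\<And>l. homog (\<theta> l) d) \<Longrightarrow> homog (der_apply \<theta> a) d"
  using homog_der_apply[of \<theta> d a 0] ha by simp

end

locale tangency = curve_line +
  fixes g :: "complex poly"
  assumes g_dvd: "\<And>\<theta>. \<theta> \<in> D0 f \<Longrightarrow> g dvd rho (der_apply \<theta> a)"
    and g_mem: "\<exists>\<theta>\<in>D0 f. rho (der_apply \<theta> a) = g"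
begin

text \<open>f times the constant derivation along b2 is logarithmic and sends a to f.\<close>

lemma g_dvd_f: "g dvd rho f"
proof -
  define \<theta> where "\<theta> = (\<lambda>l. f * cst (b2 $ l))"
  have "\<theta> \<in> Dmod f" by (simp add: Dmod_def \<theta>_def der_apply_scale)
  then obtain \<kappa> where k: "(\<lambda>i. \<theta> i - \<kappa> * Var i) \<in> D0 f" using D0_proj by blast
  have "der_apply \<theta> a = f"
    using linear_pd_sum[OF ha, of b2] by (simp add: \<theta>_def der_apply_scale) (simp add: der_apply_def ev_a)
  moreover have "der_apply (\<lambda>i. \<theta> i - \<kappa> * Var i) a = der_apply \<theta> a - \<kappa> * a"
    using der_apply_euler[OF ha] by (simp add: der_apply_diff der_apply_scale euler_def)
  ultimately have "rho (der_apply (\<lambda>i. \<theta> i - \<kappa> * Var i) a) = rho f"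
    by (simp add: rh_diff[OF ringhom_rho] rh_mult[OF ringhom_rho])
  then show ?thesis using g_dvd[OF k] by simp
qed

lemma g_nonzero: "g \<noteq> 0"
  using g_dvd_f rho_f(1) by auto

text \<open>g itself need not come from a homogeneous derivation, while \<open>order_Phi_rho\<close>
  is about forms. If all homogeneous components had larger order at u, so would their sum g.\<close>

lemma attain_order:
  obtains \<theta> d where "\<theta> \<in> D0 f" "homog (der_apply \<theta> a) d" "rho (der_apply \<theta> a) \<noteq> 0"
    "order u (rho (der_apply \<theta> a)) = order u g"
proof -
  obtain \<theta> where \<theta>: "\<theta> \<in> D0 f" "rho (der_apply \<theta> a) = g" using g_mem by blast
  define w where "w = der_apply \<theta> a"
  have "\<exists>d. \<not> [:- u, 1:] ^ Suc (order u g) dvd rho (hc d w)"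
  proof (rule ccontr)
    assume "\<nexists>d. \<not> [:- u, 1:] ^ Suc (order u g) dvd rho (hc d w)"
    then have "[:- u, 1:] ^ Suc (order u g) dvd (\<Sum>d\<le>degree (hpol w). rho (hc d w))"
      by (intro dvd_sum) blast
    also have "(\<Sum>d\<le>degree (hpol w). rho (hc d w)) = g"
      using \<theta>(2) sum_hc[of w] rh_sum[OF ringhom_rho] by (metis w_def)
    finally show False using order_2[OF g_nonzero] by blast
  qed
  then obtain d where d: "\<not> [:- u, 1:] ^ Suc (order u g) dvd rho (hc d w)" by blast
  define \<eta> where "\<eta> = (\<lambda>l. hc d (\<theta> l))"
  have \<eta>: "\<eta> \<in> D0 f" "der_apply \<eta> a = hc d w"
    using D0_hc[OF \<theta>(1), of d] by (simp_all add: \<eta>_def w_def)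
  have nz: "rho (hc d w) \<noteq> 0" using d by auto
  have "g dvd rho (hc d w)" using g_dvd[OF \<eta>(1)] \<eta>(2) by simp
  then have "order u g \<le> order u (rho (hc d w))" by (rule dvd_imp_order_le[OF nz])
  moreover have "\<not> Suc (order u g) \<le> order u (rho (hc d w))"
    using d nz order_divides[of u "Suc (order u g)" "rho (hc d w)"] by blast
  ultimately have "order u (rho (der_apply \<eta> a)) = order u g" using \<eta>(2) by simp
  then show ?thesis using that[OF \<eta>(1)] homog_hc nz \<eta>(2) by metis
qed

definition cls :: "complex \<Rightarrow> (complex^3) set" where "cls u = proj_class (pt u)"

lemma pt_nonzero: "pt u \<noteq> 0"
proof
  assume "pt u = 0"
  have "eval3 l0 (pt u) = 1" unfolding pt_def using eval3_linear[OF hl0, of 1 b0 u b1] by (simp add: ev_l0)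
  moreover have "eval3 l0 (0 :: complex^3) = 0"
    using eval3_homog_scale[OF hl0, of 0 b0] by (simp add: zero_vec_def)
  ultimately show False using \<open>pt u = 0\<close> by simp
qed

text \<open>The minimal local order is that of g at u: a homogeneous derivation attaining it
  localizes, and every local field comes from a global one.\<close>

lemma eps_formula:
  assumes root: "poly (rho f) u = 0"
  shows "1 + (eps_loc (f * a) (cls u) - eps_loc f (cls u)) = int (order u (rho f)) - int (order u g)"
proof -
  define i where "i = chart (cls u)"
  have mem: "p \<in> cls u \<longleftrightarrow> (\<exists>c. c \<noteq> 0 \<and> p = (\<chi> i. c * pt u $ i))" for p
    by (auto simp: cls_def proj_class_def)
  obtain j where "pt u $ j \<noteq> 0" using pt_nonzero by (metis vec_eq_iff zero_index)
  moreover have "pt u \<in> cls u" unfolding mem by (intro exI[of _ 1]) (simp add: vec_eq_iff)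
  \<comment> \<open>\<open>chart\<close> picks a coordinate that is nonzero at some representative;
    all representatives are multiples of \<open>pt u\<close>, so it is nonzero there too.\<close>
  ultimately have "\<exists>p\<in>cls u. p $ i \<noteq> 0"
    unfolding i_def chart_def by (intro someI[of "\<lambda>i. \<exists>p\<in>cls u. p $ i \<noteq> 0" j]) blast
  then have ci: "pt u $ i \<noteq> 0" unfolding Bex_def mem by auto
  interpret curve_line_pt f e a l0 l1 b0 b1 b2 u i
    by unfold_locales (use root ci in auto)
  have npt: "npt (cls u) = q"
    unfolding npt_def i_def[symmetric]
  proof (rule the_equality)
    show "q \<in> cls u \<and> q $ i = 1"
      unfolding mem using ci at_i by (auto simp: q_def intro!: exI[of _ "1 / pt u $ i"])
  next
    fix p assume p: "p \<in> cls u \<and> p $ i = 1"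
    then obtain c where c: "p = (\<chi> i. c * pt u $ i)" unfolding mem by blast
    then have "c * pt u $ i = 1" using p by simp
    then have "c = 1 / pt u $ i" using ci by (simp add: field_simps)
    then show "p = q" using c by (simp add: q_def)
  qed
  obtain \<theta> d where \<theta>: "\<theta> \<in> D0 f" "homog (der_apply \<theta> a) d" "rho (der_apply \<theta> a) \<noteq> 0"
    "order u (rho (der_apply \<theta> a)) = order u g" by (rule attain_order)
  obtain \<beta> \<gamma> c where l: "\<beta> * ds (Phi f) + \<gamma> * dt (Phi f) = c * Phi f" "map0 \<gamma> = map0 (Phi (der_apply \<theta> a))"
    by (rule global_to_local[OF \<theta>(1)])
  show ?thesis
  proof (rule eps_formula_codim[OF l(1)])
    show "map0 \<gamma> \<noteq> 0" "order 0 (map0 \<gamma>) = order u g"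
      unfolding l(2) using order_Phi_rho[OF \<theta>(2,3)] \<theta>(4) by auto
    show "chart (cls u) = i" "npt (cls u) = q" using i_def npt by auto
    fix \<beta> \<gamma> c assume "\<beta> * ds (Phi f) + \<gamma> * dt (Phi f) = c * Phi f"
    then obtain \<eta> F d where F: "\<eta> \<in> D0 f" "rho (der_apply \<eta> a) = rho F" "homog F d" "Phi F = \<gamma>"
      by (rule local_to_global)
    show "[:0, 1:] ^ order u g dvd map0 \<gamma>"
    proof (cases "rho F = 0")
      case True
      then obtain y where "F = a * y" using rho_eq_0[OF F(3)] by blast
      then have "map0 \<gamma> = 0" using F(4) by (auto simp: rh_mult[OF ringhom_Phi] rh_mult[OF ringhom_map0])
      then show ?thesis by simp
    next
      case False
      have "order u g \<le> order u (rho F)" using g_dvd[OF F(1)] F(2) dvd_imp_order_le[OF False] by simp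
      then have "[:-0, 1:] ^ order u g dvd map0 \<gamma>"
        using order_Phi_rho(2)[OF F(3) False] F(4) order_divides[of 0 "order u g" "map0 \<gamma>"] by metis
      then show ?thesis by simp
    qed
  qed
qed

text \<open>By \<open>inf\<close> the common points correspond to the roots of \<open>rho f\<close>,
  and summing the local formula over them turns orders into degrees. The roots of g are among them
  because g divides \<open>rho f\<close>.\<close>

theorem points_and_epsilon:
  "int (card (common_pts f a)) + dimca_eps f a = int e - int (degree g)"
proof -
  define R where "R = {u. poly (rho f) u = 0}"
  have R: "finite R" unfolding R_def by (rule poly_roots_finite[OF rho_f(1)])
  have evl: "homog l 1 \<Longrightarrow> eval3 l (pt u) = eval3 l b0 + u * eval3 l b1" for l u
    unfolding pt_def using eval3_linear[of l 1 b0 u b1] by simp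
  have inj: "inj_on cls R"
  proof (rule inj_onI)
    fix u v assume "cls u = cls v"
    moreover have "pt u \<in> cls u" unfolding cls_def proj_class_def by (auto intro!: exI[of _ 1] simp: vec_eq_iff)
    ultimately obtain c where c: "pt u = (\<chi> i. c * pt v $ i)" unfolding cls_def proj_class_def by blast
    have "eval3 l0 (pt u) = c * eval3 l0 (pt v)" "eval3 l1 (pt u) = c * eval3 l1 (pt v)"
      unfolding c using eval3_homog_scale[OF hl0, of c "pt v"] eval3_homog_scale[OF hl1, of c "pt v"] by simp_all
    then show "u = v" by (simp add: evl[OF hl0] evl[OF hl1] ev_l0 ev_l1)
  qed
  have "common_pts f a = cls ` R"
  proof
    show "cls ` R \<subseteq> common_pts f a"
      unfolding common_pts_def cls_def R_def using pt_nonzero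
      by (auto simp: poly_rho evl[OF ha] ev_a)
    show "common_pts f a \<subseteq> cls ` R"
    proof
      fix P assume "P \<in> common_pts f a"
      then obtain p where p: "p \<noteq> 0" "eval3 f p = 0" "eval3 a p = 0" "P = proj_class p"
        unfolding common_pts_def by blast
      define x where "x = eval3 l0 p"
      define y where "y = eval3 l1 p"
      have pe: "p $ i = b0 $ i * x + b1 $ i * y" for i
        using arg_cong[OF frame[of i], of "\<lambda>l. eval3 l p"] p(3)
        by (simp add: rh_add[OF ringhom_eval3] rh_mult[OF ringhom_eval3] x_def y_def)
      have "x \<noteq> 0"
      proof
        assume "x = 0"
        then have pb: "p = (\<chi> i. y * b1 $ i)" using pe by (simp add: vec_eq_iff mult.commute)
        then have "y \<noteq> 0" using p(1) by (auto simp: vec_eq_iff)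
        moreover have "y ^ e * eval3 f b1 = 0" using p(2) eval3_homog_scale[OF hf, of y b1] pb by simp
        ultimately show False using inf by simp
      qed
      define u where "u = y / x"
      have pp: "p = (\<chi> i. x * pt u $ i)"
      proof -
        have "y = x * u" using \<open>x \<noteq> 0\<close> by (simp add: u_def)
        then show ?thesis using pe by (simp add: vec_eq_iff pt_def algebra_simps)
      qed
      have "x ^ e * eval3 f (pt u) = 0" using p(2) eval3_homog_scale[OF hf, of x "pt u"] pp by simp
      then have "u \<in> R" using \<open>x \<noteq> 0\<close> by (simp add: R_def poly_rho)
      moreover have "P = cls u"
      proof -
        have "proj_class p = proj_class (pt u)"
          unfolding proj_class_def
        proof safe
          fix c :: complex assume "c \<noteq> 0"
          then show "\<exists>d. (\<chi> i. c * p $ i) = (\<chi> i. d * pt u $ i) \<and> d \<noteq> 0"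
            using \<open>x \<noteq> 0\<close> by (intro exI[of _ "c * x"]) (simp add: pp mult.assoc)
        next
          fix c :: complex assume "c \<noteq> 0"
          then show "\<exists>d. (\<chi> i. c * pt u $ i) = (\<chi> i. d * p $ i) \<and> d \<noteq> 0"
            using \<open>x \<noteq> 0\<close> by (intro exI[of _ "c / x"]) (simp add: pp mult.assoc[symmetric])
        qed
        then show ?thesis by (simp add: p(4) cls_def)
      qed
      ultimately show "P \<in> cls ` R" by blast
    qed
  qed
  then have "int (card (common_pts f a)) + dimca_eps f a = (\<Sum>u\<in>R. 1 + (eps_loc (f * a) (cls u) - eps_loc f (cls u)))"
    unfolding dimca_eps_def sum.distrib by (simp add: card_image[OF inj] sum.reindex[OF inj])
  also have "\<dots> = (\<Sum>u\<in>R. int (order u (rho f)) - int (order u g))"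
    by (rule sum.cong[OF refl]) (simp add: eps_formula R_def)
  also have "\<dots> = int (\<Sum>u\<in>R. order u (rho f)) - int (\<Sum>u\<in>R. order u g)"
    by (simp add: sum_subtractf)
  also have "(\<Sum>u\<in>R. order u (rho f)) = e"
    using sum_order_eq_degree[OF rho_f(1) R] rho_f(2) by (simp add: R_def)
  also have "(\<Sum>u\<in>R. order u g) = degree g"
    using g_dvd_f by (intro sum_order_eq_degree g_nonzero R) (auto simp: R_def)
  finally show ?thesis .
qed

end

section \<open>Adding a line\<close>

lemma comb4_expand: "comb4 G g = (\<lambda>i. g 0 * G 0 i + g 1 * G 1 i + g 2 * G 2 i + g 3 * G 3 i)"
  by (simp add: comb4_def eval_nat_numeral add.assoc)

lemma free_exps_commute: "free_exps f x y \<Longrightarrow> free_exps f y x"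
proof -
  assume "free_exps f x y"
  then obtain A B p q where *: "x = int p" "y = int q" "homog_der A p" "homog_der B q"
    "D0 f = {(\<lambda>i. a * A i + b * B i) | a b. True}"
    "\<forall>a b. (\<lambda>i. a * A i + b * B i) = (\<lambda>_. 0) \<longrightarrow> a = 0 \<and> b = 0"
    unfolding free_exps_def by (elim exE conjE) (rule that; assumption)
  have "D0 f = {(\<lambda>i. a * B i + b * A i) | a b. True}" 
    unfolding *(5) by (subst add.commute) blast
  moreover have "\<forall>a b. (\<lambda>i. a * B i + b * A i) = (\<lambda>_. 0) \<longrightarrow> a = 0 \<and> b = 0"
    using *(6) by (subst add.commute) blast
  ultimately show ?thesis using * unfolding free_exps_def by blast
qed

section \<open>Freeness and plus-one generation in terms of \<open>D0 f\<close>\<close>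

context curve
begin

lemma free_exps_D0:
  assumes "free_exps f x y"
  obtains p q A B where "x = int p" "y = int q" "\<And>i. homog (A i) p" "\<And>i. homog (B i) q" "gen2 A B"
    "\<And>a b. (\<And>i. a * A i + b * B i = 0) \<Longrightarrow> a = 0 \<and> b = 0"
proof -
  obtain A B p q where *: "x = int p" "y = int q" "homog_der A p" "homog_der B q"
    "D0 f = {(\<lambda>i. a * A i + b * B i) | a b. True}"
    "\<forall>a b. (\<lambda>i. a * A i + b * B i) = (\<lambda>_. 0) \<longrightarrow> a = 0 \<and> b = 0"
    using assms unfolding free_exps_def by (elim exE conjE) (rule that; assumption)
  show ?thesis
  proof (rule that[of p q A B])
    show "gen2 A B" using *(5) by (simp add: gen2_def)
    show "a = 0 \<and> b = 0" if "\<And>i. a * A i + b * B i = 0" for a b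
      using *(6) that by blast
  qed (use *(1-4) in \<open>auto simp: homog_der_def\<close>)
qed

lemma gen3_perm: assumes "gen3 A B C" shows "gen3 B C A"
  unfolding gen3_def
proof (intro conjI ballI)
  fix \<theta> assume "\<theta> \<in> D0 f"
  then obtain a b c where "\<forall>i. \<theta> i = a * A i + b * B i + c * C i" using assms unfolding gen3_def by blast
  then have "\<forall>i. \<theta> i = b * B i + c * C i + a * A i" by (simp add: ac_simps)
  then show "\<exists>a b c. \<forall>i. \<theta> i = a * B i + b * C i + c * A i" by blast
qed (use assms in \<open>auto simp: gen3_def\<close>)

lemma gen3_swap: assumes "gen3 A B C" shows "gen3 B A C"
  unfolding gen3_def
proof (intro conjI ballI)
  fix \<theta> assume "\<theta> \<in> D0 f"
  then obtain a b c where "\<forall>i. \<theta> i = a * A i + b * B i + c * C i" using assms unfolding gen3_def by blast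
  then have "\<forall>i. \<theta> i = b * B i + a * A i + c * C i" by (simp add: ac_simps)
  then show "\<exists>a b c. \<forall>i. \<theta> i = a * B i + b * A i + c * C i" by blast
qed (use assms in \<open>auto simp: gen3_def\<close>)

lemma rel3_perm: assumes "rel3 A B C r s t" shows "rel3 B C A s t r"
  unfolding rel3_def
proof (intro conjI allI impI)
  fix i show "s * B i + t * C i + r * A i = 0"
    using assms unfolding rel3_def by (metis add.assoc add.commute)
next
  fix a b c assume "\<forall>i. a * B i + b * C i + c * A i = 0"
  then have "\<forall>i. c * A i + a * B i + b * C i = 0" by (simp add: ac_simps)
  then show "\<exists>h. a = h * s \<and> b = h * t \<and> c = h * r" using assms unfolding rel3_def by blast
qed

lemma rel3_swap: assumes "rel3 A B C r s t" shows "rel3 B A C s r t"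
  unfolding rel3_def
proof (intro conjI allI impI)
  fix i show "s * B i + r * A i + t * C i = 0"
    using assms unfolding rel3_def by (metis add.commute)
next
  fix a b c assume "\<forall>i. a * B i + b * A i + c * C i = 0"
  then have "\<forall>i. b * A i + a * B i + c * C i = 0" by (simp add: ac_simps)
  then show "\<exists>h. a = h * s \<and> b = h * r \<and> c = h * t" using assms unfolding rel3_def by blast
qed

lemma gen3_change:
  assumes g: "gen3 A B C" shows "gen3 (\<lambda>i. A i - x * C i) B C"
proof -
  have "(\<lambda>i. A i - x * C i) \<in> D0 f"
    using g by (simp add: gen3_def D0_iff der_apply_diff der_apply_scale)
  moreover have "\<exists>a b c. \<forall>i. \<theta> i = a * (A i - x * C i) + b * B i + c * C i" if \<theta>: "\<theta> \<in> D0 f" for \<theta>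
  proof -
    obtain a b c where "\<forall>i. \<theta> i = a * A i + b * B i + c * C i" using g \<theta> unfolding gen3_def by blast
    then have "\<forall>i. \<theta> i = a * (A i - x * C i) + b * B i + (c + a * x) * C i" by (simp add: algebra_simps)
    then show ?thesis by blast
  qed
  ultimately show ?thesis using g unfolding gen3_def by blast
qed

lemma rel3_change:
  assumes r: "rel3 A B C r s t" shows "rel3 (\<lambda>i. A i - x * C i) B C r s (t + r * x)"
  unfolding rel3_def
proof (intro conjI allI impI)
  fix i
  have "r * A i + s * B i + t * C i = 0" using r by (simp add: rel3_def)
  then show "r * (A i - x * C i) + s * B i + (t + r * x) * C i = 0" by (simp add: algebra_simps)
next
  fix a b c assume "\<forall>i. a * (A i - x * C i) + b * B i + c * C i = 0"
  then have "\<forall>i. a * A i + b * B i + (c - a * x) * C i = 0" by (simp add: algebra_simps)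
  then obtain h where h: "a = h * r" "b = h * s" "c - a * x = h * t" using r unfolding rel3_def by blast
  then have "c = h * (t + r * x)" by (simp add: algebra_simps)
  then show "\<exists>h. a = h * r \<and> b = h * s \<and> c = h * (t + r * x)" using h by blast
qed

lemma D0_components:
  assumes "\<And>d \<theta>. \<theta> \<in> D0 f \<Longrightarrow> (\<And>i. homog (\<theta> i) d) \<Longrightarrow> \<exists>x y z. \<forall>i. \<theta> i = x * A i + y * B i + z * C i"
    and \<theta>: "\<theta> \<in> D0 f"
  shows "\<exists>x y z. \<forall>i. \<theta> i = x * A i + y * B i + z * C i"
proof -
  have 1: "homog (pd l f) (e - 1)" for l by (rule homog_pd) (use hf e1 in simp)
  have D: "(\<lambda>l. hc d (\<theta> l)) \<in> D0 f" for d
  proof -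
    have "der_apply (\<lambda>l. hc d (\<theta> l)) f = hc (e - 1 + d) (der_apply \<theta> f)"
      by (simp add: der_apply_def hc_sum hc_mult_homog[OF 1] mult.commute[of "\<theta> _"] mult.commute[of "hc _ _"])
    then show ?thesis using \<theta> by (simp add: D0_iff)
  qed
  have "\<forall>d. \<exists>x y z. \<forall>i. hc d (\<theta> i) = x * A i + y * B i + z * C i"
  proof
    fix d show "\<exists>x y z. \<forall>i. hc d (\<theta> i) = x * A i + y * B i + z * C i"
      using assms(1)[OF D, of d d] homog_hc by blast
  qed
  then obtain x y z where xyz: "\<And>d i. hc d (\<theta> i) = x d * A i + y d * B i + z d * C i" by metis
  define M where "M = Max (range (\<lambda>i. degree (hpol (\<theta> i))))"
  have "\<theta> i = (\<Sum>d\<le>M. x d) * A i + (\<Sum>d\<le>M. y d) * B i + (\<Sum>d\<le>M. z d) * C i" for i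
  proof -
    have "degree (hpol (\<theta> i)) \<le> M" unfolding M_def by (intro Max_ge) auto
    then have "\<theta> i = (\<Sum>d\<le>M. hc d (\<theta> i))" by (rule sum_hc_le)
    then show ?thesis by (simp add: xyz sum.distrib sum_distrib_right)
  qed
  then show ?thesis by blast
qed

text \<open>The Euler entry of any relation is 0, as applying the relation to f shows. A redundant
  generator would give a relation with a unit in its place, but all entries of the generating
  relation have zero constant term.\<close>

lemma pogI:
  assumes g: "gen3 A B C" and r: "rel3 A B C r s t"
    and h: "homog_der A p" "homog_der B q" "homog_der C k"
    and t: "t \<noteq> 0" "homog t 1" and z: "hc 0 r = 0" "hc 0 s = 0"
  shows "pog f (int p) (int q) (int k)"
proof -
  define G where "G = (\<lambda>j::nat. if j = 0 then euler else if j = 1 then A else if j = 2 then B else C)"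
  have G: "G 0 = euler" "G 1 = A" "G (Suc 0) = A" "G 2 = B" "G 3 = C" by (auto simp: G_def)
  have D: "der_apply A f = 0" "der_apply B f = 0" "der_apply C f = 0" using g by (auto simp: gen3_def D0_iff)
  define \<rho> where "\<rho> = (\<lambda>j::nat. if j = 0 then 0 else if j = 1 then r else if j = 2 then s else t)"
  have ap: "der_apply (comb4 G c) f = c 0 * der_apply euler f" for c
    unfolding comb4_expand by (simp add: G der_apply_add der_apply_scale D)
  have rel: "\<exists>h. \<forall>j<4. c j = h * \<rho> j" if c: "comb4 G c = (\<lambda>_. 0)" for c
  proof -
    have "c 0 * der_apply euler f = 0" using ap[of c] c by (simp add: der_apply_def)
    then have c0: "c 0 = 0" by (rule euler_cancel)
    have "\<forall>i. c 1 * A i + c 2 * B i + c 3 * C i = 0"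
      using fun_cong[OF c[unfolded comb4_expand]] by (simp add: G c0)
    then obtain h where "c 1 = h * r" "c 2 = h * s" "c 3 = h * t" using r unfolding rel3_def by blast
    then have "\<forall>j<4. c j = h * \<rho> j" using c0 by (auto simp: \<rho>_def less_Suc_eq eval_nat_numeral)
    then show ?thesis by blast
  qed
  have z0: "hc 0 (\<rho> j) = 0" for j using z hc_homog[OF t(2), of 0] by (simp add: \<rho>_def)
  have "Dmod f = {comb4 G c | c. True}"
  proof safe
    fix \<theta> assume "\<theta> \<in> Dmod f"
    then obtain \<kappa> where k: "(\<lambda>i. \<theta> i - \<kappa> * Var i) \<in> D0 f" using D0_proj by blast
    have gg: "\<forall>\<theta>\<in>D0 f. \<exists>a b c. \<forall>i. \<theta> i = a * A i + b * B i + c * C i"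
      using g by (simp add: gen3_def)
    obtain x y z where xyz: "\<forall>i. \<theta> i - \<kappa> * Var i = x * A i + y * B i + z * C i"
      using bspec[OF gg k] by blast
    define c where "c = (\<lambda>j::nat. if j = 0 then \<kappa> else if j = 1 then x else if j = 2 then y else z)"
    have "\<theta> i = comb4 G c i" for i
    proof -
      have "\<theta> i = \<kappa> * Var i + (x * A i + y * B i + z * C i)" using xyz by (metis add.commute diff_add_cancel)
      then show ?thesis unfolding comb4_expand by (simp add: G c_def euler_def add.assoc)
    qed
    then show "\<exists>c. \<theta> = comb4 G c \<and> True" by blast
  next
    fix c show "comb4 G c \<in> Dmod f" by (simp add: Dmod_def ap he)
  qed
  moreover have "G j \<notin> {comb4 G c | c. c j = 0}" if j: "j < 4" for j
  proof
    assume "G j \<in> {comb4 G c | c. c j = 0}"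
    then obtain c where c: "G j = comb4 G c" "c j = 0" by blast
    define c' where "c' = c(j := - 1)"
    have "comb4 G c' i = comb4 G c i - G j i" for i
      using j c(2) unfolding comb4_expand c'_def by (auto simp: less_Suc_eq eval_nat_numeral)
    then have "comb4 G c' = (\<lambda>_. 0)" using c(1) by auto
    then obtain h where "c' j = h * \<rho> j" using rel j by blast
    then have "- 1 = h * \<rho> j" by (simp add: c'_def)
    then have "hc 0 (- 1) = 0" using hc_0_mult[of h "\<rho> j"] z0 by simp
    then have "hc 0 (0 - 1) = 0" by simp
    then show False unfolding hc_diff by simp
  qed
  moreover have "\<exists>r. comb4 G r = (\<lambda>_. 0) \<and> r 3 \<noteq> 0 \<and> homog (r 3) 1 \<and>
      (\<forall>c. comb4 G c = (\<lambda>_. 0) \<longrightarrow> (\<exists>h. \<forall>j<4. c j = h * r j))"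
  proof (intro exI[of _ \<rho>] conjI allI impI)
    show "comb4 G \<rho> = (\<lambda>_. 0)"
      using r unfolding comb4_expand rel3_def by (simp add: G \<rho>_def)
  qed (use t in \<open>simp_all add: \<rho>_def rel[unfolded \<rho>_def]\<close>)
  ultimately have *: "let G = (\<lambda>j. if j = 0 then euler else if j = 1 then A else if j = 2 then B else C) in
      Dmod f = {comb4 G c | c. True} \<and> (\<forall>j<4. G j \<notin> {comb4 G c | c. c j = 0}) \<and>
      (\<exists>r. comb4 G r = (\<lambda>_. 0) \<and> r 3 \<noteq> 0 \<and> homog (r 3) 1 \<and>
        (\<forall>c. comb4 G c = (\<lambda>_. 0) \<longrightarrow> (\<exists>h. \<forall>j<4. c j = h * r j)))"
    unfolding Let_def G_def[symmetric] by (intro conjI) simp_all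
  show ?thesis
    unfolding pog_def
    by (rule exI[of _ A], rule exI[of _ B], rule exI[of _ C], rule exI[of _ p], rule exI[of _ q], rule exI[of _ k])
      (intro conjI refl h *)
qed

text \<open>The component of degree k + 1 of the relation is a relation with the same last
  coefficient t, hence the relation itself.\<close>

lemma relation_homog:
  assumes r: "rel3 A B C r s t" and t: "t \<noteq> 0" "homog t 1"
    and h: "\<And>i. homog (A i) p" "\<And>i. homog (B i) q" "\<And>i. homog (C i) k"
  shows "r = (if p \<le> k + 1 then hc (k + 1 - p) r else 0)"
    and "s = (if q \<le> k + 1 then hc (k + 1 - q) s else 0)"
proof -
  have m: "homog x d \<Longrightarrow> hc (k + 1) (y * x) = (if d \<le> k + 1 then hc (k + 1 - d) y else 0) * x" for x y d
    using hc_mult_homog[of x d "k + 1" y] by (simp add: mult.commute)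
  let ?r = "if p \<le> k + 1 then hc (k + 1 - p) r else 0"
  let ?s = "if q \<le> k + 1 then hc (k + 1 - q) s else 0"
  have ht: "hc (Suc 0) t = t" using hc_homog[OF t(2), of 1] by simp
  have "?r * A i + ?s * B i + t * C i = 0" for i
  proof -
    have "hc (k + 1) (r * A i + s * B i + t * C i) = 0" using r by (simp add: rel3_def)
    then show ?thesis unfolding hc_add m[OF h(1)] m[OF h(2)] m[OF h(3)] by (simp add: ht)
  qed
  then obtain u where u: "?r = u * r" "?s = u * s" "t = u * t" using r unfolding rel3_def by blast
  have "u = 1" using u(3) t(1) by (metis mult_1 mult_right_cancel)
  then show "r = ?r" "s = ?s" using u by simp_all
qed

text \<open>The generators are projected along Euler into \<open>D0 f\<close>, which removes Euler
  from the relation. Minimality forbids nonzero constant coefficients, so by homogeneity nonzero r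
  and s have positive degree; this bounds p and q by k.\<close>

lemma pog_D0:
  assumes "pog f d2 d3 d"
  obtains p q k A B C r s t where "d2 = int p" "d3 = int q" "d = int k"
    "\<And>i. homog (A i) p" "\<And>i. homog (B i) q" "\<And>i. homog (C i) k"
    "gen3 A B C" "rel3 A B C r s t" "t \<noteq> 0" "homog t 1" "hc 0 r = 0" "hc 0 s = 0"
    "r \<noteq> 0 \<Longrightarrow> p \<le> k" "s \<noteq> 0 \<Longrightarrow> q \<le> k"
proof -
  obtain \<theta>2 \<theta>3 \<psi> p q k where d: "d2 = int p" "d3 = int q" "d = int k"
    "homog_der \<theta>2 p" "homog_der \<theta>3 q" "homog_der \<psi> k"
    and P: "let G = (\<lambda>j. if j = 0 then euler else if j = 1 then \<theta>2 else if j = 2 then \<theta>3 else \<psi>) in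
       Dmod f = {comb4 G g | g. True} \<and> (\<forall>j<4. G j \<notin> {comb4 G g | g. g j = 0}) \<and>
       (\<exists>r. comb4 G r = (\<lambda>_. 0) \<and> r 3 \<noteq> 0 \<and> homog (r 3) 1 \<and>
          (\<forall>g. comb4 G g = (\<lambda>_. 0) \<longrightarrow> (\<exists>h. \<forall>j<4. g j = h * r j)))"
    using assms unfolding pog_def by (elim exE conjE) (rule that; assumption)
  define G where "G = (\<lambda>j::nat. if j = 0 then euler else if j = 1 then \<theta>2 else if j = 2 then \<theta>3 else \<psi>)"
  have G: "G 0 = euler" "G 1 = \<theta>2" "G (Suc 0) = \<theta>2" "G 2 = \<theta>3" "G 3 = \<psi>" by (auto simp: G_def)
  obtain \<rho> where gen: "Dmod f = {comb4 G g | g. True}" and min: "\<forall>j<4. G j \<notin> {comb4 G g | g. g j = 0}"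
    and \<rho>: "comb4 G \<rho> = (\<lambda>_. 0)" "\<rho> 3 \<noteq> 0" "homog (\<rho> 3) 1"
    and mult: "\<And>g. comb4 G g = (\<lambda>_. 0) \<Longrightarrow> \<exists>h. \<forall>j<4. g j = h * \<rho> j"
    using P unfolding Let_def G_def[symmetric] by blast
  have GD: "G j \<in> Dmod f" if "j < 4" for j
  proof -
    have "G j = comb4 G (\<lambda>i. if i = j then 1 else 0)"
      using that unfolding comb4_expand by (auto simp: less_Suc_eq eval_nat_numeral)
    then show ?thesis using gen by blast
  qed
  have H: "\<And>i. homog (\<theta>2 i) p" "\<And>i. homog (\<theta>3 i) q" "\<And>i. homog (\<psi> i) k" using d by (auto simp: homog_der_def)
  have M: "\<theta>2 \<in> Dmod f" "\<theta>3 \<in> Dmod f" "\<psi> \<in> Dmod f" using GD[of 1] GD[of 2] GD[of 3] by (simp_all add: G)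
  obtain \<alpha> where \<alpha>: "(\<lambda>i. \<theta>2 i - \<alpha> * Var i) \<in> D0 f" "\<forall>i. homog (\<theta>2 i - \<alpha> * Var i) p"
    using D0_proj_homog[OF M(1) H(1)] by blast
  obtain \<beta> where \<beta>: "(\<lambda>i. \<theta>3 i - \<beta> * Var i) \<in> D0 f" "\<forall>i. homog (\<theta>3 i - \<beta> * Var i) q"
    using D0_proj_homog[OF M(2) H(2)] by blast
  obtain \<gamma> where \<gamma>: "(\<lambda>i. \<psi> i - \<gamma> * Var i) \<in> D0 f" "\<forall>i. homog (\<psi> i - \<gamma> * Var i) k"
    using D0_proj_homog[OF M(3) H(3)] by blast
  define A where "A = (\<lambda>i. \<theta>2 i - \<alpha> * euler i)"
  define B where "B = (\<lambda>i. \<theta>3 i - \<beta> * euler i)"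
  define C where "C = (\<lambda>i. \<psi> i - \<gamma> * euler i)"
  have AD: "A \<in> D0 f" "B \<in> D0 f" "C \<in> D0 f" using \<alpha> \<beta> \<gamma> by (simp_all add: A_def B_def C_def euler_def)
  have hA: "\<And>i. homog (A i) p" "\<And>i. homog (B i) q" "\<And>i. homog (C i) k"
    using \<alpha> \<beta> \<gamma> by (simp_all add: A_def B_def C_def euler_def)
  have conv: "comb4 G c = (\<lambda>i. (c 0 + c 1 * \<alpha> + c 2 * \<beta> + c 3 * \<gamma>) * euler i + (c 1 * A i + c 2 * B i + c 3 * C i))" for c
    unfolding comb4_expand by (simp add: G A_def B_def C_def algebra_simps)
  have ap: "der_apply (comb4 G c) f = (c 0 + c 1 * \<alpha> + c 2 * \<beta> + c 3 * \<gamma>) * der_apply euler f" for c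
    unfolding conv using AD by (simp add: der_apply_add der_apply_scale D0_iff)
  have g3: "gen3 A B C"
    unfolding gen3_def
  proof (intro conjI AD ballI)
    fix \<theta> assume \<theta>: "\<theta> \<in> D0 f"
    then obtain c where c: "\<theta> = comb4 G c" using D0_subset gen by blast
    then have "c 0 + c 1 * \<alpha> + c 2 * \<beta> + c 3 * \<gamma> = 0"
      using \<theta> ap[of c] euler_cancel unfolding D0_iff by metis
    then have "\<theta> i = c 1 * A i + c 2 * B i + c 3 * C i" for i unfolding c conv by simp
    then show "\<exists>a b c. \<forall>i. \<theta> i = a * A i + b * B i + c * C i" by blast
  qed
  have r3: "rel3 A B C (\<rho> 1) (\<rho> 2) (\<rho> 3)"
    unfolding rel3_def
  proof (intro conjI allI impI)
    fix i
    have "der_apply (comb4 G \<rho>) f = 0" by (simp add: \<rho>(1) der_apply_def)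
    then have "\<rho> 0 + \<rho> 1 * \<alpha> + \<rho> 2 * \<beta> + \<rho> 3 * \<gamma> = 0" unfolding ap by (rule euler_cancel)
    then show "\<rho> 1 * A i + \<rho> 2 * B i + \<rho> 3 * C i = 0" using fun_cong[OF \<rho>(1), of i] unfolding conv by simp
  next
    fix x y z assume xyz: "\<forall>i. x * A i + y * B i + z * C i = 0"
    define c where "c = (\<lambda>j::nat. if j = 0 then - (x * \<alpha> + y * \<beta> + z * \<gamma>) else if j = 1 then x else if j = 2 then y else z)"
    have "c 0 + c 1 * \<alpha> + c 2 * \<beta> + c 3 * \<gamma> = 0" by (simp add: c_def)
    then have "comb4 G c = (\<lambda>i. c 1 * A i + c 2 * B i + c 3 * C i)" unfolding conv by simp
    also have "\<dots> = (\<lambda>_. 0)" using xyz by (simp add: c_def)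
    finally obtain h where "\<forall>j<4. c j = h * \<rho> j" using mult by blast
    then have "c 1 = h * \<rho> 1" "c 2 = h * \<rho> 2" "c 3 = h * \<rho> 3" by auto
    then show "\<exists>h. x = h * \<rho> 1 \<and> y = h * \<rho> 2 \<and> z = h * \<rho> 3" by (intro exI[of _ h]) (simp add: c_def)
  qed
  \<comment> \<open>A nonzero constant entry would express generator j through the others.\<close>
  have noconst: "\<rho> j \<noteq> cst c" if j: "j < 4" and c: "c \<noteq> 0" for j c
  proof
    assume e: "\<rho> j = cst c"
    define g where "g = (\<lambda>i. if i = j then 0 else - cst (1 / c) * \<rho> i)"
    have cc: "cst (1 / c) * \<rho> j = 1" using cst_inverse[OF c] e by (simp add: mult.commute)
    have "comb4 G g i = G j i - cst (1 / c) * comb4 G \<rho> i" for i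
    proof -
      have "comb4 G g i + cst (1 / c) * comb4 G \<rho> i = (cst (1 / c) * \<rho> j) * G j i"
        using j unfolding comb4_expand g_def by (auto simp: less_Suc_eq eval_nat_numeral algebra_simps)
      then show ?thesis using cc by (simp add: eq_diff_eq)
    qed
    then have "G j = comb4 G g" using \<rho>(1) by auto
    moreover have "g j = 0" by (simp add: g_def)
    ultimately show False using min j by blast
  qed
  note rh = relation_homog[OF r3 \<rho>(2,3) hA]
  have key: "hc 0 x = 0 \<and> (x \<noteq> 0 \<longrightarrow> n \<le> k)"
    if x: "x = (if n \<le> k + 1 then hc (k + 1 - n) x else 0)" and nc: "\<And>c. c \<noteq> 0 \<Longrightarrow> x \<noteq> cst c" for x n
  proof (cases "x = 0")
    case False
    then have n: "n \<le> k + 1" "x = hc (k + 1 - n) x" using x by (auto split: if_splits)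
    then have hx: "homog x (k + 1 - n)" by (simp add: homog_iff_hc)
    have "k + 1 - n \<noteq> 0"
    proof
      assume "k + 1 - n = 0"
      then obtain c where "x = cst c" using hx homog_0_cst by auto
      then show False using nc False by (cases "c = 0") auto
    qed
    then show ?thesis using hc_homog[OF hx, of 0] n by simp
  qed simp
  have k1: "hc 0 (\<rho> 1) = 0 \<and> (\<rho> 1 \<noteq> 0 \<longrightarrow> p \<le> k)" by (rule key[OF rh(1)]) (rule noconst, simp)
  have k2: "hc 0 (\<rho> 2) = 0 \<and> (\<rho> 2 \<noteq> 0 \<longrightarrow> q \<le> k)" by (rule key[OF rh(2)]) (rule noconst, simp)
  show ?thesis
    by (rule that[OF d(1-3) hA g3 r3 \<rho>(2,3)]) (use k1 k2 in auto)
qed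

end

text \<open>F vanishes at finitely many points of the line only; any other point can be moved to
  infinity.\<close>

lemma frame_avoiding:
  assumes a: "is_line a" and F: "homog F d" "\<not> a dvd F"
  obtains l0 l1 b0 b1 b2 where "line_frame a l0 l1 b0 b1 b2" "eval3 F b1 \<noteq> 0"
proof -
  obtain l0 l1 b0 b1 b2 where fr: "line_frame a l0 l1 b0 b1 b2" by (rule line_frame_exists[OF a])
  interpret line_frame a l0 l1 b0 b1 b2 by (rule fr)
  have "rho F \<noteq> 0" using rho_eq_0[OF F(1)] F(2) by blast
  then have "finite {u. poly (rho F) u = 0}" by (rule poly_roots_finite)
  then obtain u where "u \<notin> {u. poly (rho F) u = 0}" using ex_new_if_finite[OF infinite_UNIV_char_0] by blast
  then have "eval3 F (pt u) \<noteq> 0" by (simp add: poly_rho)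
  then show ?thesis using that[OF line_frame_change[OF fr, of u]] by (simp add: pt_def)
qed

section \<open>From the curve without the line to the union\<close>

locale adding_line = curve_line +
  assumes red2: "reduced_curve (f * a)"
begin

lemma hfa: "hdeg (f * a) = e + 1"
  using homog_hdeg[OF homog_mult[OF hf ha]] red2 by (simp add: reduced_curve_def)

sublocale fa: curve "f * a" "e + 1"
  by unfold_locales (simp_all add: red2 hfa)

lemma tangent_Dmod:
  assumes "\<theta> \<in> D0 f" "a dvd der_apply \<theta> a" shows "\<theta> \<in> Dmod (f * a)"
  using assms by (auto simp: Dmod_def D0_iff der_apply_mult)

lemma der_apply_a_mod: "rho (der_apply (\<lambda>i. A i - x * C i) a) = rho (der_apply A a) - rho x * rho (der_apply C a)"
  by (simp add: der_apply_diff der_apply_scale rh_diff[OF ringhom_rho] rh_mult[OF ringhom_rho])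

text \<open>As A and B are tangent to the line, the restriction g of C(a) divides all the others.
  Its degree is at most k, and not less: the derivation sending a to f makes \<open>rho f\<close>,
  of full degree e, the product of g and a polynomial of degree at most e - k.\<close>

lemma full_degree:
  assumes g: "\<And>\<theta>. \<theta> \<in> D0 f \<Longrightarrow> \<exists>x y z. \<forall>i. \<theta> i = x * A i + y * B i + z * C i"
    and A: "a dvd der_apply A a" and B: "a dvd der_apply B a"
    and C: "C \<in> D0 f" "\<And>i. homog (C i) k"
  shows "int (card (common_pts f a)) + dimca_eps f a = int e - int k"
proof -
  define g where "g = rho (der_apply C a)"
  have ap: "der_apply \<theta> a = x * der_apply A a + y * der_apply B a + z * der_apply C a"
    if "\<forall>i. \<theta> i = x * A i + y * B i + z * C i" for \<theta> x y z
  proof -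
    have "\<theta> = (\<lambda>i. x * A i + y * B i + z * C i)" using that by blast
    then show ?thesis by (simp add: der_apply_add der_apply_scale)
  qed
  have gd: "g dvd rho (der_apply \<theta> a)" if th: "\<theta> \<in> D0 f" for \<theta>
  proof -
    obtain x y z where "\<forall>i. \<theta> i = x * A i + y * B i + z * C i" using assms(1)[OF th] by blast
    from ap[OF this] show ?thesis
      using rho_dvd_a[OF A] rho_dvd_a[OF B] by (simp add: rh_add[OF ringhom_rho] rh_mult[OF ringhom_rho] g_def)
  qed
  interpret tangency f e a l0 l1 b0 b1 b2 g
    by unfold_locales (use gd C(1) g_def in blast)+
  have hC: "homog (der_apply C a) k" using homog_der_apply_a C(2) by blast
  have le: "degree g \<le> k" unfolding g_def by (rule degree_rho[OF hC])
  have ge: "k \<le> degree g"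
  proof -
    define \<theta> where "\<theta> = (\<lambda>l. f * cst (b2 $ l))"
    have "\<theta> \<in> Dmod f" by (simp add: Dmod_def \<theta>_def der_apply_scale)
    then obtain \<kappa> where kp: "(\<lambda>i. \<theta> i - \<kappa> * Var i) \<in> D0 f" using D0_proj by blast
    have t: "der_apply \<theta> a = f"
      using linear_pd_sum[OF ha, of b2] by (simp add: \<theta>_def der_apply_scale) (simp add: der_apply_def ev_a)
    have "der_apply (\<lambda>i. \<theta> i - \<kappa> * Var i) a = f - \<kappa> * a"
      using der_apply_euler[OF ha] by (simp add: der_apply_diff der_apply_scale t euler_def)
    moreover obtain x y z where "\<forall>i. \<theta> i - \<kappa> * Var i = x * A i + y * B i + z * C i"
      using assms(1)[OF kp] by blast
    ultimately have eq: "f - \<kappa> * a = x * der_apply A a + y * der_apply B a + z * der_apply C a"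
      using ap[of "\<lambda>i. \<theta> i - \<kappa> * Var i" x y z] by simp
    obtain A' B' where AB: "der_apply A a = a * A'" "der_apply B a = a * B'" using A B by blast
    have "f = a * (\<kappa> + x * A' + y * B') + der_apply C a * z"
      using eq by (simp add: AB algebra_simps)
    then have "hc e f = hc e (a * (\<kappa> + x * A' + y * B')) + hc e (der_apply C a * z)"
      by (metis hc_add)
    then have "f = (if e < 1 then 0 else a * hc (e - 1) (\<kappa> + x * A' + y * B')) + (if e < k then 0 else der_apply C a * hc (e - k) z)"
      using hc_homog[OF hf, of e] by (simp add: hc_mult_homog[OF ha] hc_mult_homog[OF hC])
    then have "rho f = rho ((if e < 1 then 0 else a * hc (e - 1) (\<kappa> + x * A' + y * B')) + (if e < k then 0 else der_apply C a * hc (e - k) z))"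
      by simp
    then have rf: "rho f = (if e < k then 0 else g * rho (hc (e - k) z))"
      using e1 by (auto simp: rh_add[OF ringhom_rho] rh_mult[OF ringhom_rho] rh_0[OF ringhom_rho] g_def)
    then have ek: "\<not> e < k" and rf: "rho f = g * rho (hc (e - k) z)" using rho_f(1) by (auto split: if_splits)
    have "e = degree g + degree (rho (hc (e - k) z))"
      using rf rho_f by (metis degree_mult_eq mult_eq_0_iff)
    moreover have "degree (rho (hc (e - k) z)) \<le> e - k" by (rule degree_rho[OF homog_hc])
    ultimately show ?thesis using ek by simp
  qed
  show ?thesis using points_and_epsilon le ge by simp
qed

text \<open>On the line A(a) is a multiple of C(a); subtracting the lifted quotient times C makes A
  tangent. Because g has full degree k, the quotient fits into degree p - k.\<close>

lemma tangent_correction: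
  assumes hA: "\<And>i. homog (A i) p" and hC: "\<And>i. homog (C i) k"
    and wC: "rho (der_apply C a) = smult c g" "c \<noteq> 0" and gk: "degree g = k" and gA: "g dvd rho (der_apply A a)"
  obtains x where "\<And>i. homog (A i - x * C i) p" "a dvd der_apply (\<lambda>i. A i - x * C i) a"
proof (cases "rho (der_apply A a) = 0")
  case True
  have "a dvd der_apply A a" by (rule iffD1[OF rho_eq_0[OF homog_der_apply_a[of A, OF hA]] True])
  then show ?thesis using that[of 0] hA by simp
next
  case False
  obtain \<alpha> where \<alpha>: "rho (der_apply A a) = g * \<alpha>" using gA by blast
  have "degree (rho (der_apply A a)) = k + degree \<alpha>" using False \<alpha> gk by (auto simp: degree_mult_eq)
  then have d: "k \<le> p" "degree \<alpha> \<le> p - k" using degree_rho[OF homog_der_apply_a[of A, OF hA]] by auto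
  define x where "x = lift (p - k) (smult (1 / c) \<alpha>)"
  have rx: "rho x = smult (1 / c) \<alpha>" unfolding x_def using d wC(2) by (intro rho_lift) simp
  have "homog (x * C i) (p - k + k)" for i unfolding x_def by (intro homog_mult homog_lift hC)
  then have h: "homog (A i - x * C i) p" for i using d hA by (intro homog_diff) auto
  have "rho (der_apply (\<lambda>i. A i - x * C i) a) = 0"
    unfolding der_apply_a_mod \<alpha> rx wC(1) using wC(2) by simp
  then have "a dvd der_apply (\<lambda>i. A i - x * C i) a" by (rule iffD1[OF rho_eq_0[OF homog_der_apply_a[of "\<lambda>i. A i - x * C i", OF h]]])
  then show ?thesis using that h by blast
qed

text \<open>Since g has degree k, C(a) restricts to a constant multiple of g and corrects both A and
  B without changing their degrees. The relation keeps r and s under the correction, so the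
  determinant is nonzero, and \<open>p + q = e\<close> is Saito's degree condition for f a.\<close>

lemma pog_imp_free_aux:
  assumes g: "gen3 A B C" and r: "rel3 A B C r s t" and z: "hc 0 r = 0" "hc 0 s = 0"
    and hA: "\<And>i. homog (A i) p" and hB: "\<And>i. homog (B i) q" and hC: "\<And>i. homog (C i) k"
    and wC: "rho (der_apply C a) \<noteq> 0" and gk: "degree g = k"
    and gd: "\<And>\<theta>. \<theta> \<in> D0 f \<Longrightarrow> g dvd rho (der_apply \<theta> a)" and pq: "p + q = e"
  shows "free_exps (f * a) (int p) (int q)"
proof -
  have D: "A \<in> D0 f" "B \<in> D0 f" "C \<in> D0 f" using g by (auto simp: gen3_def)
  obtain \<gamma> where c: "rho (der_apply C a) = g * \<gamma>" using gd[OF D(3)] by blast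
  have "degree (rho (der_apply C a)) = k + degree \<gamma>" using wC c gk by (auto simp: degree_mult_eq)
  then have "degree \<gamma> = 0" using degree_rho[OF homog_der_apply_a[of C, OF hC]] by simp
  then obtain c0 where "\<gamma> = [:c0:]" by (rule degree_eq_zeroE)
  then have c0: "rho (der_apply C a) = smult c0 g" "c0 \<noteq> 0" using c wC by (auto simp: mult.commute)
  obtain x where x: "\<And>i. homog (A i - x * C i) p" "a dvd der_apply (\<lambda>i. A i - x * C i) a"
    by (rule tangent_correction[OF hA hC c0 gk gd[OF D(1)]]) blast
  obtain y where y: "\<And>i. homog (B i - y * C i) q" "a dvd der_apply (\<lambda>i. B i - y * C i) a"
    by (rule tangent_correction[OF hB hC c0 gk gd[OF D(2)]]) blast
  define A' where "A' = (\<lambda>i. A i - x * C i)"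
  define B' where "B' = (\<lambda>i. B i - y * C i)"
  have g1: "gen3 A' B C" unfolding A'_def by (rule gen3_change[OF g])
  have g2: "gen3 B' A' C" unfolding B'_def by (rule gen3_change[OF gen3_swap[OF g1]])
  have r1: "rel3 A' B C r s (t + r * x)" unfolding A'_def by (rule rel3_change[OF r])
  have r2: "rel3 B' A' C s r (t + r * x + s * y)" unfolding B'_def by (rule rel3_change[OF rel3_swap[OF r1]])
  have "det3 euler A' B' \<noteq> 0" by (rule rel3_det_nonzero[OF gen3_swap[OF g2] rel3_swap[OF r2] z])
  moreover have "A' \<in> D0 f" "B' \<in> D0 f" using g2 by (auto simp: gen3_def)
  then have "A' \<in> Dmod (f * a)" "B' \<in> Dmod (f * a)" using x(2) y(2) tangent_Dmod by (auto simp: A'_def B'_def)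
  ultimately show ?thesis
    using x(1) y(1) pq by (intro fa.saito_basis[of A' p B' q]) (auto simp: A'_def B'_def)
qed

text \<open>The Bezout coefficients are lifted in unrelated degrees, so the derivation attaining g
  is in general not homogeneous.\<close>

lemma tangency_gcd:
  assumes "gen3 A B C"
  defines "g \<equiv> gcd (rho (der_apply A a)) (gcd (rho (der_apply B a)) (rho (der_apply C a)))"
  shows "tangency f e a l0 l1 b0 b1 b2 g"
proof unfold_locales
  have ap: "der_apply (\<lambda>i. x * A i + y * B i + z * C i) a = x * der_apply A a + y * der_apply B a + z * der_apply C a" for x y z
    by (simp add: der_apply_add der_apply_scale)
  show "g dvd rho (der_apply \<theta> a)" if \<theta>: "\<theta> \<in> D0 f" for \<theta>
  proof -
    obtain x y z where "\<forall>i. \<theta> i = x * A i + y * B i + z * C i" using assms(1) \<theta> unfolding gen3_def by blast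
    then have "\<theta> = (\<lambda>i. x * A i + y * B i + z * C i)" by blast
    then have "rho (der_apply \<theta> a) = rho x * rho (der_apply A a) + rho y * rho (der_apply B a) + rho z * rho (der_apply C a)"
      by (simp add: ap rh_add[OF ringhom_rho] rh_mult[OF ringhom_rho])
    moreover have "g dvd rho (der_apply A a)" "g dvd rho (der_apply B a)" "g dvd rho (der_apply C a)"
      unfolding g_def by (auto intro: dvd_trans[OF gcd_dvd2])
    ultimately show ?thesis by (simp add: dvd_add)
  qed
  obtain u v where uv: "u * rho (der_apply B a) + v * rho (der_apply C a) = gcd (rho (der_apply B a)) (rho (der_apply C a))"
    using bezout_coefficients_fst_snd by blast
  obtain u' v' where uv': "u' * rho (der_apply A a) + v' * gcd (rho (der_apply B a)) (rho (der_apply C a)) = g"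
    using bezout_coefficients_fst_snd unfolding g_def by blast
  define L where "L P = lift (degree P) P" for P
  have L: "rho (L P) = P" for P unfolding L_def by (rule rho_lift) simp
  define \<theta> where "\<theta> = (\<lambda>i. L u' * A i + L (v' * u) * B i + L (v' * v) * C i)"
  have "\<theta> \<in> D0 f"
    using assms(1) by (simp add: gen3_def D0_iff \<theta>_def der_apply_add der_apply_scale)
  moreover have "rho (der_apply \<theta> a) = g"
    unfolding uv'[symmetric] uv[symmetric] \<theta>_def ap
    by (simp add: rh_add[OF ringhom_rho] rh_mult[OF ringhom_rho] L algebra_simps)
  ultimately show "\<exists>\<theta>\<in>D0 f. rho (der_apply \<theta> a) = g" by blast
qed

text \<open>The level k is the degree of g. If the generator of degree k is tangent to the line,
  some other generator is not; its degree is at least that of g, and at most k because its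
  coefficient in the relation is nonzero. It then takes over the role of the former.\<close>

lemma pog_imp_free:
  assumes "pog f d2 d3 (int e - int (card (common_pts f a)) - dimca_eps f a)"
  shows "free_exps (f * a) d2 d3"
proof -
  obtain A B C r s t p q k where d: "d2 = int p" "d3 = int q" "int e - int (card (common_pts f a)) - dimca_eps f a = int k"
    and h: "\<And>i. homog (A i) p" "\<And>i. homog (B i) q" "\<And>i. homog (C i) k"
    and g: "gen3 A B C" and r: "rel3 A B C r s t" and t: "t \<noteq> 0" "homog t 1"
    and z: "hc 0 r = 0" "hc 0 s = 0" and le: "r \<noteq> 0 \<Longrightarrow> p \<le> k" "s \<noteq> 0 \<Longrightarrow> q \<le> k"
    
  proof (rule pog_D0[OF assms], goal_cases)
    case prems: 1
    show ?case by (rule prems(1)[OF prems(2-)])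
  qed
  have zt: "hc 0 t = 0" using hc_homog[OF t(2), of 0] by simp
  define w where "w = gcd (rho (der_apply A a)) (gcd (rho (der_apply B a)) (rho (der_apply C a)))"
  interpret tangency f e a l0 l1 b0 b1 b2 w unfolding w_def by (rule tangency_gcd[OF g])
  have dw: "degree w = k" using points_and_epsilon d(3) by simp
  have pq: "p + q = e" by (rule rel3_degree_sum[OF g r t h(1,2)])
  have wle: "k \<le> n" if "rho (der_apply \<theta> a) \<noteq> 0" "\<And>i. homog (\<theta> i) n" "\<theta> \<in> D0 f" for \<theta> n
  proof -
    have "degree w \<le> degree (rho (der_apply \<theta> a))" by (rule dvd_imp_degree_le[OF g_dvd[OF that(3)] that(1)])
    also have "\<dots> \<le> n" by (rule degree_rho[OF homog_der_apply_a[of \<theta>, OF that(2)]])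
    finally show ?thesis using dw by simp
  qed
  have D: "A \<in> D0 f" "B \<in> D0 f" "C \<in> D0 f" using g by (auto simp: gen3_def)
  have gBCA: "gen3 B C A" and gCAB: "gen3 C A B" using gen3_perm g by blast+
  have rBCA: "rel3 B C A s t r" and rCAB: "rel3 C A B t r s" using rel3_perm r by blast+
  consider "rho (der_apply C a) \<noteq> 0" | "rho (der_apply A a) \<noteq> 0" | "rho (der_apply B a) \<noteq> 0"
    using g_nonzero by (auto simp: w_def)
  then have "free_exps (f * a) (int p) (int q)"
  proof cases
    case 1
    show ?thesis by (rule pog_imp_free_aux[OF g r z h 1 dw g_dvd pq])
  next
    case 2
    \<comment> \<open>Otherwise the relation would involve only B and C, which
      \<open>relation_not_binary\<close> rules out.\<close>
    have "r \<noteq> 0"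
    proof
      assume "r = 0"
      then show False using relation_not_binary[OF gBCA, of s t] rBCA t(1) z zt by simp
    qed
    then have "p = k" using le(1) wle[OF 2 h(1) D(1)] by simp
    then have "p + q = e" "k + q = e" using pq by auto
    have "free_exps (f * a) (int q) (int k)"
      by (rule pog_imp_free_aux[OF gBCA rBCA z(2) zt h(2) h(3) h(1) 2 _ g_dvd]) (use dw \<open>p = k\<close> pq in auto)
    then show ?thesis using free_exps_commute \<open>p = k\<close> by simp
  next
    case 3
    have "s \<noteq> 0"
    proof
      assume "s = 0"
      then show False using relation_not_binary[OF gCAB, of t r] rCAB t(1) z zt by simp
    qed
    then have "q = k" using le(2) wle[OF 3 h(2) D(2)] by simp
    have "free_exps (f * a) (int k) (int p)"
      by (rule pog_imp_free_aux[OF gCAB rCAB zt z(1) h(3) h(1) h(2) 3 _ g_dvd]) (use dw \<open>q = k\<close> pq in auto)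
    then show ?thesis using free_exps_commute \<open>q = k\<close> by simp
  qed
  then show ?thesis using d by simp
qed

text \<open>Here g has degree q. If B is not tangent to the line, it corrects A, and the corrected A
  together with a B satisfies Saito's criterion. If B is tangent, g comes from A, so p = q and the
  roles are exchanged.\<close>

lemma free_imp_free:
  assumes fr: "free_exps f d2 (d3 - 1)" and n: "int (card (common_pts f a)) + dimca_eps f a = d2 + 1"
  shows "free_exps (f * a) d2 d3"
proof -
  obtain A B p q where d: "d2 = int p" "d3 - 1 = int q" and h: "\<And>i. homog (A i) p" "\<And>i. homog (B i) q"
    and g: "gen2 A B" and ind: "\<And>a b. (\<And>i. a * A i + b * B i = 0) \<Longrightarrow> a = 0 \<and> b = 0"
    
  proof (rule free_exps_D0[OF fr], goal_cases)
    case prems: 1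
    show ?case by (rule prems(1)[OF prems(2-)])
  qed
  obtain c where c: "c \<noteq> 0" "det3 euler A B = cst c * f" "p + q + 1 = e" by (rule free_det[OF g ind h]) blast+
  have det: "det3 euler A B \<noteq> 0" using c f0 by simp
  note D = gen2_mem(1,2)[OF g]
  have d3: "d3 = int (q + 1)" using d(2) by simp
  \<comment> \<open>B is listed twice because \<open>tangency_gcd\<close> is stated for three
    generators.\<close>
  have g3: "gen3 A B B"
    unfolding gen3_def
  proof (intro conjI D ballI)
    fix \<theta> assume "\<theta> \<in> D0 f"
    then obtain x y where "\<forall>i. \<theta> i = x * A i + y * B i" using gen2_mem(3)[OF g] by blast
    then have "\<forall>i. \<theta> i = x * A i + y * B i + 0 * B i" by simp
    then show "\<exists>a b c. \<forall>i. \<theta> i = a * A i + b * B i + c * B i" by blast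
  qed
  define w where "w = gcd (rho (der_apply A a)) (gcd (rho (der_apply B a)) (rho (der_apply B a)))"
  interpret tangency f e a l0 l1 b0 b1 b2 w unfolding w_def by (rule tangency_gcd[OF g3])
  have dw: "degree w = q" using points_and_epsilon n d(1) c(3) by simp
  show ?thesis
  proof (cases "rho (der_apply B a) = 0")
    case False
    obtain \<gamma> where \<gamma>: "rho (der_apply B a) = w * \<gamma>" using g_dvd[OF D(2)] by blast
    have "degree (rho (der_apply B a)) = q + degree \<gamma>" using False \<gamma> dw by (auto simp: degree_mult_eq)
    then have "degree \<gamma> = 0" using degree_rho[OF homog_der_apply_a[of B, OF h(2)]] by simp
    then obtain c0 where "\<gamma> = [:c0:]" by (rule degree_eq_zeroE)
    then have c0: "rho (der_apply B a) = smult c0 w" "c0 \<noteq> 0" using \<gamma> False by (auto simp: mult.commute)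
    obtain x where x: "\<And>i. homog (A i - x * B i) p" "a dvd der_apply (\<lambda>i. A i - x * B i) a"
      by (rule tangent_correction[OF h c0 dw g_dvd[OF D(1)]]) blast
    have "(\<lambda>i. A i - x * B i) \<in> D0 f" using D by (simp add: D0_iff der_apply_diff der_apply_scale)
    then have 1: "(\<lambda>i. A i - x * B i) \<in> Dmod (f * a)" using x(2) tangent_Dmod by blast
    have 2: "(\<lambda>i. a * B i) \<in> Dmod (f * a)"
      using D by (intro tangent_Dmod) (simp_all add: D0_iff der_apply_scale)
    have "homog (a * B i) (1 + q)" for i by (intro homog_mult ha h)
    then have 3: "homog (a * B i) (q + 1)" for i by (simp add: add.commute)
    have "det3 euler (\<lambda>i. A i - x * B i) (\<lambda>i. a * B i) = a * det3 euler A B"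
      by (simp add: det3_diff2 det3_scale2 det3_scale3)
    then have "det3 euler (\<lambda>i. A i - x * B i) (\<lambda>i. a * B i) \<noteq> 0" using det a_nonzero by simp
    then have "free_exps (f * a) (int p) (int (q + 1))"
      using c(3) by (intro fa.saito_basis[OF 1 x(1) 2 3]) auto
    then show ?thesis using d d3 by simp
  next
    case True
    then have aB: "a dvd der_apply B a" by (rule iffD1[OF rho_eq_0[OF homog_der_apply_a[of B, OF h(2)]]])
    have "int (card (common_pts f a)) + dimca_eps f a = int e - int p"
    proof (rule full_degree[OF _ aB aB D(1) h(1)])
      fix \<theta> assume "\<theta> \<in> D0 f"
      then obtain x y where "\<forall>i. \<theta> i = x * A i + y * B i" using gen2_mem(3)[OF g] by blast
      then have "\<forall>i. \<theta> i = 0 * B i + y * B i + x * A i" by (simp add: add.commute)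
      then show "\<exists>x y z. \<forall>i. \<theta> i = x * B i + y * B i + z * A i" by blast
    qed
    then have pq: "p = q" using n d(1) c(3) by simp
    have 1: "B \<in> Dmod (f * a)" using D(2) aB tangent_Dmod by blast
    have 2: "(\<lambda>i. a * A i) \<in> Dmod (f * a)"
      using D by (intro tangent_Dmod) (simp_all add: D0_iff der_apply_scale)
    have "homog (a * A i) (1 + p)" for i by (intro homog_mult ha h)
    then have 3: "homog (a * A i) (p + 1)" for i by (simp add: add.commute)
    have "det3 euler B (\<lambda>i. a * A i) = - (a * det3 euler A B)"
      by (simp add: det3_scale3 det3_swap[of euler B A])
    then have "det3 euler B (\<lambda>i. a * A i) \<noteq> 0" using det a_nonzero by simp
    then have "free_exps (f * a) (int q) (int (p + 1))"
      using c(3) by (intro fa.saito_basis[OF 1 h(2) 2 3]) auto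
    then show ?thesis using d d3 pq by simp
  qed
qed

end

text \<open>Integer degrees, so that differences of degrees are not truncated.\<close>

definition ihomog :: "poly3 \<Rightarrow> int \<Rightarrow> bool" where
  "ihomog p k \<longleftrightarrow> p = 0 \<or> 0 \<le> k \<and> homog p (nat k)"

lemma ihomog_int: "homog p d \<Longrightarrow> ihomog p (int d)"
  by (simp add: ihomog_def)

lemma ihomog_diff: "ihomog p k \<Longrightarrow> ihomog q k \<Longrightarrow> ihomog (p - q) k"
  using homog_diff homog_minus by (auto simp: ihomog_def)

lemma ihomog_add: "ihomog p k \<Longrightarrow> ihomog q k \<Longrightarrow> ihomog (p + q) k"
  using homog_add by (auto simp: ihomog_def)

lemma ihomog_mult: "ihomog p j \<Longrightarrow> ihomog q k \<Longrightarrow> ihomog (p * q) (j + k)"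
  using homog_mult[of p "nat j" q "nat k"] by (auto simp: ihomog_def nat_add_distrib)

lemma hc_mult_ihomog:
  assumes "\<And>i. homog (A i) k"
  obtains u where "ihomog u (int d - int k)" "\<And>i. hc d (q * A i) = u * A i"
proof
  have "d \<ge> k \<Longrightarrow> nat (int d - int k) = d - k" by simp
  then show "ihomog (if d < k then 0 else hc (d - k) q) (int d - int k)"
    using homog_hc[of "d - k" q] by (auto simp: ihomog_def)
  show "hc d (q * A i) = (if d < k then 0 else hc (d - k) q) * A i" for i
    using hc_mult_homog[OF assms, of d i q] by (simp add: mult.commute)
qed

text \<open>Two vectors orthogonal to g have a cross product proportional to g; pairing with u gives
  the factor.\<close>

lemma grad_cofactor:
  fixes u v w g :: "3 \<Rightarrow> 'a::idom"
  assumes v: "v 1 * g 1 + v 2 * g 2 + v 3 * g 3 = 0" and w: "w 1 * g 1 + w 2 * g 2 + w 3 * g 3 = 0"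
  defines "s \<equiv> u 1 * g 1 + u 2 * g 2 + u 3 * g 3"
  shows "det3 u v w * g 1 = s * (v 2 * w 3 - v 3 * w 2)"
    and "det3 u v w * g 2 = s * (v 3 * w 1 - v 1 * w 3)"
    and "det3 u v w * g 3 = s * (v 1 * w 2 - v 2 * w 1)"
  using v w unfolding s_def det3_def by algebra+

section \<open>From the union to the curve without the line\<close>

context adding_line
begin

lemma ihomog_rho_0: "ihomog p k \<Longrightarrow> rho p = 0 \<Longrightarrow> a dvd p"
  using rho_eq_0 by (auto simp: ihomog_def)

lemma ihomog_degree: "ihomog p k \<Longrightarrow> rho p \<noteq> 0 \<Longrightarrow> int (degree (rho p)) \<le> k"
  using degree_rho[of p "nat k"] rh_0[OF ringhom_rho] by (auto simp: ihomog_def)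

lemma ihomog_lift:
  assumes "P \<noteq> 0 \<Longrightarrow> int (degree P) \<le> k"
  obtains x where "ihomog x k" "rho x = P"
proof (cases "P = 0")
  case True
  then show ?thesis using that[of 0] rh_0[OF ringhom_rho] by (simp add: ihomog_def)
next
  case False
  then have "int (degree P) \<le> k" by (rule assms)
  then show ?thesis using that[of "lift (nat k) P"] homog_lift rho_lift[of P "nat k"] by (simp add: ihomog_def)
qed

lemma ihomog_cancel_a: "ihomog (a * p) k \<Longrightarrow> p \<noteq> 0 \<Longrightarrow> 1 \<le> k \<and> homog p (nat (k - 1))"
  using homog_quotient[OF ha a_nonzero, of p "nat k"] a_nonzero
  by (auto simp: ihomog_def nat_diff_distrib)

text \<open>A basis of the derivations in \<open>D0 f\<close> tangent to the line; these correspond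
  to \<open>D0 (f * a)\<close> by subtraction of Euler multiples. No part of it refers to the
  frame.\<close>

definition tangent_basis :: "der \<Rightarrow> nat \<Rightarrow> der \<Rightarrow> nat \<Rightarrow> bool" where
  "tangent_basis A p B q \<longleftrightarrow> A \<in> D0 f \<and> B \<in> D0 f \<and> (\<forall>i. homog (A i) p) \<and> (\<forall>i. homog (B i) q) \<and>
     a dvd der_apply A a \<and> a dvd der_apply B a \<and> p + q = e \<and>
     (\<exists>c. c \<noteq> 0 \<and> det3 euler A B = cst c * (f * a)) \<and>
     (\<forall>\<theta>\<in>D0 f. a dvd der_apply \<theta> a \<longrightarrow> (\<exists>x y. \<forall>i. \<theta> i = x * A i + y * B i))"

lemma tangent_basis_swap: "tangent_basis A p B q \<Longrightarrow> tangent_basis B q A p"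
proof -
  assume t: "tangent_basis A p B q"
  then obtain c where c: "c \<noteq> 0" "det3 euler A B = cst c * (f * a)" unfolding tangent_basis_def by blast
  have "det3 euler B A = cst (- c) * (f * a)"
    using c(2) by (simp add: det3_swap[of euler B A] rh_minus[OF ringhom_cst])
  then have "\<exists>c. c \<noteq> 0 \<and> det3 euler B A = cst c * (f * a)" using c(1) by (intro exI[of _ "- c"]) simp
  moreover have "\<exists>x y. \<forall>i. \<theta> i = x * B i + y * A i" if \<theta>: "\<theta> \<in> D0 f" "a dvd der_apply \<theta> a" for \<theta>
  proof -
    obtain x y where "\<forall>i. \<theta> i = x * A i + y * B i" using t \<theta> unfolding tangent_basis_def by blast
    then have "\<forall>i. \<theta> i = y * B i + x * A i" by (simp add: add.commute)
    then show ?thesis by blast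
  qed
  ultimately show ?thesis using t by (simp add: tangent_basis_def)
qed

text \<open>From a \<theta>(f) + f \<theta>(a) = 0, where a is prime and does not divide f.\<close>

lemma D0_fa_imp:
  assumes "\<theta> \<in> D0 (f * a)" shows "\<theta> \<in> Dmod f" "a dvd der_apply \<theta> a"
proof -
  have eq: "a * der_apply \<theta> f = f * - der_apply \<theta> a"
    using assms unfolding fa.D0_iff der_apply_mult by (simp add: add_eq_0_iff2 mult.commute)
  then have "f dvd a * der_apply \<theta> f" by (metis dvd_triv_left)
  then have "f dvd der_apply \<theta> f" using nd by (rule dvd_cancel_a)
  then show "\<theta> \<in> Dmod f" by (simp add: Dmod_def)
  have "a dvd f * - der_apply \<theta> a" using eq by (metis dvd_triv_left)
  then have "a dvd - der_apply \<theta> a" using a_prime nd by blast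
  then show "a dvd der_apply \<theta> a" by simp
qed

text \<open>A basis of \<open>D0 (f * a)\<close> is projected along Euler into \<open>D0 f\<close>.
  A tangent \<theta> is expanded after the opposite projection; the Euler coefficient \<nu> that
  results vanishes because \<theta> kills f.\<close>

lemma tangent_basis_exists:
  assumes "free_exps (f * a) d2 d3"
  obtains p q A B where "d2 = int p" "d3 = int q" "tangent_basis A p B q"
proof -
  obtain A B p q where d: "d2 = int p" "d3 = int q" and h: "\<And>i. homog (A i) p" "\<And>i. homog (B i) q"
    and g: "fa.gen2 A B" and ind: "\<And>a b. (\<And>i. a * A i + b * B i = 0) \<Longrightarrow> a = 0 \<and> b = 0"
  proof (rule fa.free_exps_D0[OF assms], goal_cases)
    case prems: 1
    show ?case by (rule prems(1)[OF prems(2-)])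
  qed
  obtain c where c: "c \<noteq> 0" "det3 euler A B = cst c * (f * a)" "p + q + 1 = e + 1"
    by (rule fa.free_det[OF g ind h]) blast+
  note M = fa.gen2_mem(1,2)[OF g]
  obtain \<kappa> where \<kappa>: "(\<lambda>i. A i - \<kappa> * Var i) \<in> D0 f" "\<forall>i. homog (A i - \<kappa> * Var i) p"
    using D0_proj_homog[OF D0_fa_imp(1)[OF M(1)] h(1)] by blast
  obtain \<mu> where \<mu>: "(\<lambda>i. B i - \<mu> * Var i) \<in> D0 f" "\<forall>i. homog (B i - \<mu> * Var i) q"
    using D0_proj_homog[OF D0_fa_imp(1)[OF M(2)] h(2)] by blast
  define A' where "A' = (\<lambda>i. A i - \<kappa> * euler i)"
  define B' where "B' = (\<lambda>i. B i - \<mu> * euler i)"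
  have D: "A' \<in> D0 f" "B' \<in> D0 f" using \<kappa>(1) \<mu>(1) by (simp_all add: A'_def B'_def euler_def)
  have t: "a dvd der_apply A' a" "a dvd der_apply B' a"
    using D0_fa_imp(2)[OF M(1)] D0_fa_imp(2)[OF M(2)] der_apply_euler[OF ha]
    by (simp_all add: A'_def B'_def der_apply_diff der_apply_scale)
  have det: "det3 euler A' B' = cst c * (f * a)"
    using c(2) by (simp add: A'_def B'_def det3_diff2 det3_diff3 det3_scale2 det3_scale3)
  have gen: "\<exists>x y. \<forall>i. \<theta> i = x * A' i + y * B' i" if \<theta>: "\<theta> \<in> D0 f" "a dvd der_apply \<theta> a" for \<theta>
  proof -
    obtain \<tau> where \<tau>: "(\<lambda>i. \<theta> i - \<tau> * Var i) \<in> D0 (f * a)"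
      using fa.D0_proj[OF tangent_Dmod[OF \<theta>]] by blast
    obtain x y where xy: "\<forall>i. \<theta> i - \<tau> * Var i = x * A i + y * B i" using fa.gen2_mem(3)[OF g \<tau>] by blast
    define \<nu> where "\<nu> = \<tau> + x * \<kappa> + y * \<mu>"
    have th: "\<theta> i = \<nu> * euler i + (x * A' i + y * B' i)" for i
    proof -
      have "\<theta> i = x * A i + y * B i + \<tau> * Var i" using xy by (metis diff_add_cancel)
      then show ?thesis by (simp add: A'_def B'_def \<nu>_def euler_def algebra_simps)
    qed
    then have "\<theta> = (\<lambda>i. \<nu> * euler i + (x * A' i + y * B' i))" by blast
    then have "der_apply \<theta> f = \<nu> * der_apply euler f"
      using D by (simp add: der_apply_add der_apply_scale D0_iff)
    then have "\<nu> * der_apply euler f = 0" using \<theta>(1) by (simp add: D0_iff)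
    then have "\<nu> = 0" by (rule euler_cancel)
    then show ?thesis using th by auto
  qed
  have "tangent_basis A' p B' q"
    unfolding tangent_basis_def
    using D t det c(1,3) gen \<kappa>(2) \<mu>(2) by (auto simp: A'_def B'_def euler_def)
  then show ?thesis using that d by blast
qed

text \<open>The determinant times the gradient of f is E(f) times the vector of minors, where E is
  Euler. With determinant c f a and E(f) = e f, the minors are (c / e) a times the partial
  derivatives of f.\<close>

lemma tangent_cross:
  assumes "tangent_basis A p B q" shows "a dvd A i * B j - A j * B i"
proof -
  obtain c where c: "det3 euler A B = cst c * (f * a)" using assms unfolding tangent_basis_def by blast
  have D: "A \<in> D0 f" "B \<in> D0 f" using assms by (auto simp: tangent_basis_def)
  have key: "a dvd M" if M: "det3 euler A B * pd k f = der_apply euler f * M" for k M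
  proof -
    have "f * (a * (cst c * pd k f)) = f * (of_nat e * M)"
      using M unfolding c he by (simp add: ac_simps)
    then have "a * (cst c * pd k f) = of_nat e * M" using f0 by simp
    then have "a dvd of_nat e * M" by (metis dvd_triv_left)
    then have "a dvd cst (1 / of_nat e) * (of_nat e * M)" by simp
    also have "cst (1 / of_nat e) * (of_nat e * M) = (cst (of_nat e) * cst (1 / of_nat e)) * M"
      by (simp only: of_nat_cst ac_simps)
    also have "\<dots> = M" using e1 cst_inverse[of "of_nat e"] by simp
    finally show ?thesis .
  qed
  have "A 1 * pd 1 f + A 2 * pd 2 f + A 3 * pd 3 f = 0" "B 1 * pd 1 f + B 2 * pd 2 f + B 3 * pd 3 f = 0"
    using D by (simp_all add: D0_iff der_apply_def sum_3)
  note gc = grad_cofactor[OF this, of euler]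
  have 1: "a dvd A 2 * B 3 - A 3 * B 2" by (rule key[of 1]) (simp add: gc(1) der_apply_def sum_3)
  have 2: "a dvd A 3 * B 1 - A 1 * B 3" by (rule key[of 2]) (simp add: gc(2) der_apply_def sum_3)
  have 3: "a dvd A 1 * B 2 - A 2 * B 1" by (rule key[of 3]) (simp add: gc(3) der_apply_def sum_3)
  have "a dvd A 3 * B 2 - A 2 * B 3" "a dvd A 1 * B 3 - A 3 * B 1" "a dvd A 2 * B 1 - A 1 * B 2"
    by (metis 1 dvd_minus_iff minus_diff_eq, metis 2 dvd_minus_iff minus_diff_eq, metis 3 dvd_minus_iff minus_diff_eq)
  then show ?thesis
    using 1 2 3 exhaust_3[of i] exhaust_3[of j] by auto
qed

text \<open>Otherwise the square of a would divide the determinant c f a.\<close>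

lemma tangent_basis_not_dvd:
  assumes "tangent_basis A p B q" shows "\<exists>l. \<not> a dvd A l \<or> \<not> a dvd B l"
proof (rule ccontr)
  assume "\<not> ?thesis"
  then obtain A' B' where "\<And>l. A l = a * A' l" "\<And>l. B l = a * B' l" unfolding dvd_def by metis
  then have "A = (\<lambda>l. a * A' l)" "B = (\<lambda>l. a * B' l)" by auto
  then have d: "det3 euler A B = a * (a * det3 euler A' B')" by (simp add: det3_scale2 det3_scale3)
  obtain c where c: "c \<noteq> 0" "det3 euler A B = cst c * (f * a)" using assms unfolding tangent_basis_def by blast
  have "a * (a * det3 euler A' B') = a * (cst c * f)" using c d by (simp add: ac_simps)
  then have "cst c * f = a * det3 euler A' B'" using a_nonzero by simp
  then have "cst (1 / c) * (cst c * f) = a * (cst (1 / c) * det3 euler A' B')" by (simp add: ac_simps)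
  moreover have "cst (1 / c) * (cst c * f) = (cst c * cst (1 / c)) * f" by (simp only: ac_simps)
  ultimately have "f = a * (cst (1 / c) * det3 euler A' B')"
    using cst_inverse[OF c(1)] by simp
  then show False using nd by (metis dvd_triv_left)
qed

text \<open>On the line A and B are proportional, with coprime factors \<alpha> and \<beta> read off
  at component l; their lifts Y and X give the derivation \<psi>. The hypothesis on l gives \<alpha>
  the full degree p - deg w, so that quotients by \<alpha> lift in the right degree.\<close>

lemma free_cases:
  assumes tb: "tangent_basis A p B q" and l: "eval3 (A l) b1 \<noteq> 0"
  shows "free_exps f (int p) (int q - 1) \<and> int (card (common_pts f a)) + dimca_eps f a = int p + 1 \<or>
    free_exps f (int q) (int p - 1) \<and> int (card (common_pts f a)) + dimca_eps f a = int q + 1 \<or>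
    pog f (int p) (int q) (int e - int (card (common_pts f a)) - dimca_eps f a)"
proof -
  have D: "A \<in> D0 f" "B \<in> D0 f" and h: "\<And>i. homog (A i) p" "\<And>i. homog (B i) q"
    and t: "a dvd der_apply A a" "a dvd der_apply B a" and pq: "p + q = e"
    and T: "\<And>\<theta>. \<theta> \<in> D0 f \<Longrightarrow> a dvd der_apply \<theta> a \<Longrightarrow> \<exists>x y. \<forall>i. \<theta> i = x * A i + y * B i"
    using tb by (auto simp: tangent_basis_def)
  obtain c where c: "c \<noteq> 0" "det3 euler A B = cst c * (f * a)" using tb unfolding tangent_basis_def by blast
  have nz: "det3 euler A B \<noteq> 0" using c f0 a_nonzero by simp
  note hi = ihomog_int[OF h(1)] ihomog_int[OF h(2)]
  have dA: "degree (rho (A l)) = p" "rho (A l) \<noteq> 0"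
  proof -
    have "coeff (rho (A l)) p \<noteq> 0" using coeff_rho_top[OF h(1)] l by simp
    then show "degree (rho (A l)) = p" "rho (A l) \<noteq> 0" using degree_rho[OF h(1), of l] le_degree by fastforce+
  qed
  define w where "w = gcd (rho (A l)) (rho (B l))"
  have w0: "w \<noteq> 0" using dA by (simp add: w_def)
  obtain \<alpha> \<beta> where \<alpha>: "rho (A l) = w * \<alpha>" and \<beta>: "rho (B l) = w * \<beta>" and cop: "coprime \<alpha> \<beta>"
  proof -
    have "gcd (rho (A l)) (rho (B l)) \<noteq> 0" using w0 by (simp add: w_def)
    then obtain \<alpha> \<beta> where "rho (A l) = \<alpha> * w" "rho (B l) = \<beta> * w" "coprime \<alpha> \<beta>"
      using gcd_coprime_exists unfolding w_def by blast
    then show ?thesis using that[of \<alpha> \<beta>] by (simp add: mult.commute)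
  qed
  have \<alpha>0: "\<alpha> \<noteq> 0" using dA \<alpha> by auto
  have d\<alpha>: "p = degree w + degree \<alpha>" using dA \<alpha> w0 \<alpha>0 by (metis degree_mult_eq)
  have d\<beta>: "degree w + degree \<beta> \<le> q" if "\<beta> \<noteq> 0"
    using degree_rho[OF h(2), of l] that w0 by (simp add: \<beta> degree_mult_eq)
  obtain X where X: "ihomog X (int q - int (degree w))" "rho X = \<beta>"
    by (rule ihomog_lift[of \<beta> "int q - int (degree w)"]) (use d\<beta> in auto)
  obtain Y where Y: "ihomog Y (int p - int (degree w))" "rho Y = \<alpha>"
    by (rule ihomog_lift[of \<alpha> "int p - int (degree w)"]) (use d\<alpha> in auto)
  have nY: "\<not> a dvd Y" using rho_dvd_a Y(2) \<alpha>0 by blast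
  have Y0: "Y \<noteq> 0" using nY by auto
  define n where "n = int e - int (degree w)"
  have np: "int p - int (degree w) + int q = n" "int q - int (degree w) + int p = n"
    using pq by (simp_all add: n_def)
  have hn: "ihomog (Y * B i - X * A i) n" for i
  proof (rule ihomog_diff)
    show "ihomog (Y * B i) n" using ihomog_mult[OF Y(1) hi(2)] unfolding np .
    show "ihomog (X * A i) n" using ihomog_mult[OF X(1) hi(1)] unfolding np .
  qed
  \<comment> \<open>This is \<open>tangent_cross\<close> for the components l and i, with the common
    factor w cancelled on the line.\<close>
  have "a dvd Y * B i - X * A i" for i
  proof (rule ihomog_rho_0[OF hn])
    have "rho (A l * B i - A i * B l) = 0" using tangent_cross[OF tb] by (rule rho_dvd_a)
    then have "w * (\<alpha> * rho (B i) - \<beta> * rho (A i)) = 0"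
      by (simp add: rh_diff[OF ringhom_rho] rh_mult[OF ringhom_rho] \<alpha> \<beta> algebra_simps)
    then show "rho (Y * B i - X * A i) = 0"
      using w0 by (simp add: rh_diff[OF ringhom_rho] rh_mult[OF ringhom_rho] X(2) Y(2))
  qed
  then obtain \<psi> where \<psi>: "\<And>i. Y * B i - X * A i = a * \<psi> i" unfolding dvd_def by metis
  have fpsi: "(\<lambda>i. a * \<psi> i) = (\<lambda>i. Y * B i - X * A i)" using \<psi> by simp
  have "a * der_apply \<psi> f = 0"
    using arg_cong[OF fpsi, of "\<lambda>\<theta>. der_apply \<theta> f"] D by (simp add: der_apply_diff der_apply_scale D0_iff)
  then have D\<psi>: "\<psi> \<in> D0 f" using a_nonzero by (simp add: D0_iff)
  have detA: "a * det3 euler A \<psi> = Y * det3 euler A B"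
    using arg_cong[OF fpsi, of "det3 euler A"] by (simp add: det3_diff3 det3_scale3)
  have detB: "a * det3 euler B \<psi> = X * det3 euler A B"
    using arg_cong[OF fpsi, of "det3 euler B"] by (simp add: det3_diff3 det3_scale3 det3_swap[of euler B A])
  have "\<exists>i. \<psi> i \<noteq> 0"
  proof (rule ccontr)
    assume "\<not> ?thesis"
    then have "det3 euler A \<psi> = 0" by (simp add: det3_def)
    then show False using detA nz Y0 by simp
  qed
  then have n1: "1 \<le> n" using ihomog_cancel_a hn \<psi> by metis
  define k where "k = nat (n - 1)"
  have kn: "int k = n - 1" using n1 by (simp add: k_def)
  have h\<psi>: "homog (\<psi> i) k" for i
    using ihomog_cancel_a[of "\<psi> i" n] hn[of i] \<psi>[of i] by (cases "\<psi> i = 0") (auto simp: k_def)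
  \<comment> \<open>a \<theta> is tangent to the line, hence s A + t B. On the line the coefficients
    are a multiple \<zeta> of (-\<beta>, \<alpha>); removing the lifted multiple z of Y B - X A
    leaves coefficients divisible by a.\<close>
  have gen: "\<exists>x y z. \<forall>i. \<theta> i = x * A i + y * B i + z * \<psi> i" if \<theta>: "\<theta> \<in> D0 f" "\<And>i. homog (\<theta> i) d" for d \<theta>
  proof -
    have "(\<lambda>i. a * \<theta> i) \<in> D0 f" "a dvd der_apply (\<lambda>i. a * \<theta> i) a"
      using \<theta>(1) by (simp_all add: D0_iff der_apply_scale)
    then obtain s t where st: "\<forall>i. a * \<theta> i = s * A i + t * B i" using T by blast
    obtain s' where s': "ihomog s' (int (d + 1) - int p)" "\<And>i. hc (d + 1) (s * A i) = s' * A i"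
      by (rule hc_mult_ihomog[of A p "d + 1" s, OF h(1)]) blast
    obtain t' where t': "ihomog t' (int (d + 1) - int q)" "\<And>i. hc (d + 1) (t * B i) = t' * B i"
      by (rule hc_mult_ihomog[of B q "d + 1" t, OF h(2)]) blast
    have at: "a * \<theta> i = s' * A i + t' * B i" for i
    proof -
      have "homog (a * \<theta> i) (1 + d)" by (intro homog_mult ha \<theta>(2))
      then have "homog (a * \<theta> i) (d + 1)" by (simp add: add.commute)
      then have "a * \<theta> i = hc (d + 1) (a * \<theta> i)" unfolding homog_iff_hc by (rule sym)
      also have "\<dots> = hc (d + 1) (s * A i + t * B i)" using st by simp
      finally show ?thesis unfolding hc_add s'(2) t'(2) .
    qed
    have "rho (a * \<theta> l) = w * (rho s' * \<alpha> + rho t' * \<beta>)"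
      unfolding at by (simp add: rh_add[OF ringhom_rho] rh_mult[OF ringhom_rho] \<alpha> \<beta> algebra_simps)
    then have "w * (rho s' * \<alpha> + rho t' * \<beta>) = 0" by (simp add: rh_mult[OF ringhom_rho])
    then have z: "rho s' * \<alpha> + rho t' * \<beta> = 0" using w0 by simp
    then have "rho t' * \<beta> = \<alpha> * - rho s'" by (simp add: add_eq_0_iff2 mult.commute)
    then have "\<alpha> dvd rho t' * \<beta>" by (metis dvd_triv_left)
    then have "\<alpha> dvd rho t'" using cop by (simp add: coprime_dvd_mult_left_iff)
    then obtain \<zeta> where \<zeta>: "rho t' = \<alpha> * \<zeta>" by blast
    have "\<alpha> * (rho s' + \<zeta> * \<beta>) = 0" using z by (simp add: \<zeta> algebra_simps)
    then have rs: "rho s' + \<zeta> * \<beta> = 0" using \<alpha>0 by simp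
    \<comment> \<open>The degree in which z Y matches t' and z X matches s'; both rest on deg
      \<alpha> = p - deg w.\<close>
    define m where "m = int (d + 1) - int q - int (degree \<alpha>)"
    obtain z where z: "ihomog z m" "rho z = \<zeta>"
    proof (rule ihomog_lift[of \<zeta> m])
      assume z0: "\<zeta> \<noteq> 0"
      have "int (degree (rho t')) \<le> int (d + 1) - int q"
        by (rule ihomog_degree[OF t'(1)]) (use \<zeta> z0 \<alpha>0 in simp)
      then show "int (degree \<zeta>) \<le> m" using z0 \<alpha>0 by (simp add: \<zeta> degree_mult_eq m_def)
    qed
    have m: "m + (int p - int (degree w)) = int (d + 1) - int q" "m + (int q - int (degree w)) = int (d + 1) - int p"
      using d\<alpha> by (simp_all add: m_def)
    have "a dvd t' - z * Y"
    proof (rule ihomog_rho_0[OF ihomog_diff[OF t'(1)]])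
      show "ihomog (z * Y) (int (d + 1) - int q)" using ihomog_mult[OF z(1) Y(1)] unfolding m .
      show "rho (t' - z * Y) = 0" by (simp add: rh_diff[OF ringhom_rho] rh_mult[OF ringhom_rho] z(2) Y(2) \<zeta>)
    qed
    then obtain t'' where t'': "t' - z * Y = a * t''" by blast
    have "a dvd s' + z * X"
    proof (rule ihomog_rho_0[OF ihomog_add[OF s'(1)]])
      show "ihomog (z * X) (int (d + 1) - int p)" using ihomog_mult[OF z(1) X(1)] unfolding m .
      show "rho (s' + z * X) = 0" using rs by (simp add: rh_add[OF ringhom_rho] rh_mult[OF ringhom_rho] z(2) X(2))
    qed
    then obtain s'' where s'': "s' + z * X = a * s''" by blast
    have "\<theta> i = s'' * A i + t'' * B i + z * \<psi> i" for i
    proof -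
      have "a * (s'' * A i + t'' * B i + z * \<psi> i) = (a * s'') * A i + (a * t'') * B i + z * (a * \<psi> i)"
        by (simp add: algebra_simps)
      also have "\<dots> = s' * A i + t' * B i"
        unfolding s''[symmetric] t''[symmetric] \<psi>[symmetric] by (simp add: algebra_simps)
      also have "\<dots> = a * \<theta> i" by (rule at[symmetric])
      finally show ?thesis using a_nonzero by simp
    qed
    then show ?thesis by blast
  qed
  have gen': "\<exists>x y z. \<forall>i. \<theta> i = x * A i + y * B i + z * \<psi> i" if \<theta>: "\<theta> \<in> D0 f" for \<theta>
    by (rule D0_components[OF gen \<theta>])
  have g3: "gen3 A B \<psi>" using D D\<psi> gen' by (simp add: gen3_def)
  have cnt: "int (card (common_pts f a)) + dimca_eps f a = int e - int k"
    by (rule full_degree[OF gen' t D\<psi> h\<psi>])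
  \<comment> \<open>If w has degree p, then Y is a nonzero constant and B is redundant. If it has
    degree q and X is nonzero, then X is constant and A is redundant. Otherwise X and Y have zero
    constant term.\<close>
  consider (a) "int p = int (degree w)" | (b) "int q = int (degree w)" "X \<noteq> 0"
    | (c) "int p \<noteq> int (degree w)" "X = 0 \<or> int q \<noteq> int (degree w)" by blast
  then show ?thesis
  proof cases
    case a
    have "det3 euler A \<psi> \<noteq> 0" using detA nz Y0 by auto
    moreover have "p + k + 1 = e" using kn a by (simp add: n_def)
    ultimately have "free_exps f (int p) (int k)"
      by (intro saito_basis[of A p \<psi> k] D0_subset D D\<psi> h h\<psi>)
    moreover have "int k = int q - 1" "int e - int k = int p + 1" using kn a pq by (simp_all add: n_def)
    ultimately show ?thesis using cnt by simp
  next
    case b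
    have "det3 euler B \<psi> \<noteq> 0" using detB nz b(2) by auto
    moreover have "q + k + 1 = e" using kn b by (simp add: n_def)
    ultimately have "free_exps f (int q) (int k)"
      by (intro saito_basis[of B q \<psi> k] D0_subset D D\<psi> h h\<psi>)
    moreover have "int k = int p - 1" "int e - int k = int q + 1" using kn b pq by (simp_all add: n_def)
    ultimately show ?thesis using cnt by simp
  next
    case c
    have zY: "hc 0 (- Y) = 0"
      using Y(1) c(1) hc_homog[OF homog_minus, of Y "nat (int p - int (degree w))" 0] by (auto simp: ihomog_def)
    have zX: "hc 0 X = 0"
      using X(1) c(2) hc_homog[of X "nat (int q - int (degree w))" 0] by (auto simp: ihomog_def)
    have r3: "rel3 A B \<psi> X (- Y) a"
      unfolding rel3_def
    proof (intro conjI allI impI)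
      fix i show "X * A i + - Y * B i + a * \<psi> i = 0" by (simp flip: \<psi>)
    next
      fix x y z assume xyz: "\<forall>i. x * A i + y * B i + z * \<psi> i = 0"
      \<comment> \<open>Multiplying the relation by a eliminates \<psi> and leaves a relation
        between the independent A and B.\<close>
      have "(a * x - z * X) * A i + (a * y + z * Y) * B i = 0" for i
      proof -
        have "(a * x - z * X) * A i + (a * y + z * Y) * B i = a * (x * A i + y * B i) + z * (Y * B i - X * A i)"
          by (simp add: algebra_simps)
        also have "\<dots> = a * (x * A i + y * B i + z * \<psi> i)" unfolding \<psi> by (simp add: algebra_simps)
        finally show ?thesis using xyz by simp
      qed
      then have eq: "a * x - z * X = 0" "a * y + z * Y = 0" using det_nonzero_indep[OF nz] by blast+
      then have "z * Y = a * - y" by (simp add: add_eq_0_iff2)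
      then have "a dvd z" using a_prime nY by (metis dvd_triv_left)
      then obtain h where z: "z = a * h" by blast
      have "a * x = a * (h * X)" "a * y = a * (h * - Y)" using eq by (simp_all add: z algebra_simps add_eq_0_iff2)
      then have "x = h * X" "y = h * - Y" using a_nonzero mult_left_cancel by blast+
      then show "\<exists>h. x = h * X \<and> y = h * - Y \<and> z = h * a" using z by (simp add: mult.commute) blast
    qed
    have "A \<noteq> (\<lambda>_. 0)" "B \<noteq> (\<lambda>_. 0)" using nz by (auto simp: det3_def)
    then have "\<exists>i. A i \<noteq> 0" "\<exists>i. B i \<noteq> 0" by blast+
    then have "homog_der A p" "homog_der B q" "homog_der \<psi> k"
      using h h\<psi> \<open>\<exists>i. \<psi> i \<noteq> 0\<close> by (simp_all add: homog_der_def)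
    from pogI[OF g3 r3 this a_nonzero ha zX zY] have "pog f (int p) (int q) (int k)" .
    moreover have "int e - int (card (common_pts f a)) - dimca_eps f a = int k" using cnt by simp
    ultimately show ?thesis by simp
  qed
qed

end

theorem theorem3p5:
  fixes f' a :: poly3 and d2 d3 :: int
  assumes "reduced_curve (f' * a)"
    and "reduced_curve f'"
    and "is_line a"
    and "\<not> a dvd f'"
  shows "free_exps (f' * a) d2 d3 \<longleftrightarrow>
    (\<exists>e2 e3. (e2, e3) \<in> {(d2, d3), (d3, d2)} \<and>
      ((free_exps f' e2 (e3 - 1) \<and>
          int (card (common_pts f' a)) + dimca_eps f' a = e2 + 1)
       \<or> pog f' e2 e3 (int (hdeg (f' * a)) - 1 - int (card (common_pts f' a))
                        - dimca_eps f' a)))"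
proof -
  define e where "e = hdeg f'"
  have hf: "homog f' e" using assms(2) by (simp add: reduced_curve_def e_def)
  have line: "adding_line f' e a l0 l1 b0 b1 b2"
    if "line_frame a l0 l1 b0 b1 b2" "eval3 f' b1 \<noteq> 0" for l0 l1 b0 b1 b2
  proof -
    interpret line_frame a l0 l1 b0 b1 b2 by fact
    show ?thesis by unfold_locales (use assms(1,2,4) that(2) in \<open>simp_all add: e_def\<close>)
  qed
  obtain l0 l1 b0 b1 b2 where "line_frame a l0 l1 b0 b1 b2" "eval3 f' b1 \<noteq> 0"
    by (rule frame_avoiding[OF assms(3) hf assms(4)])
  then interpret L: adding_line f' e a l0 l1 b0 b1 b2 by (rule line)
  define N where "N = int (card (common_pts f' a)) + dimca_eps f' a"
  have lev: "int (hdeg (f' * a)) - 1 - int (card (common_pts f' a)) - dimca_eps f' a = int e - N"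
    "int e - int (card (common_pts f' a)) - dimca_eps f' a = int e - N"
    by (simp_all add: N_def L.hfa)
  have bwd: "free_exps (f' * a) x y"
    if "free_exps f' x (y - 1) \<and> N = x + 1 \<or> pog f' x y (int e - N)" for x y
    using that L.free_imp_free[of x y] L.pog_imp_free[of x y] unfolding lev N_def[symmetric] by blast
  have fwd: "(free_exps f' d2 (d3 - 1) \<and> N = d2 + 1 \<or> pog f' d2 d3 (int e - N)) \<or>
      (free_exps f' d3 (d2 - 1) \<and> N = d3 + 1 \<or> pog f' d3 d2 (int e - N))"
    if free: "free_exps (f' * a) d2 d3"
  proof -
    obtain p q A B where pq: "d2 = int p" "d3 = int q" and tb: "L.tangent_basis A p B q"
      by (rule L.tangent_basis_exists[OF free])
    \<comment> \<open>\<open>free_cases\<close> needs a point at infinity at which neither the curve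
      nor a component of A vanishes, so a new frame is taken once A is known;
      \<open>tangent_basis\<close> carries over unchanged.\<close>
    have main: "(free_exps f' (int p) (int q - 1) \<and> N = int p + 1) \<or>
        (free_exps f' (int q) (int p - 1) \<and> N = int q + 1) \<or> pog f' (int p) (int q) (int e - N)"
      if tb: "L.tangent_basis A p B q" and l: "\<not> a dvd A l" for A p B q l
    proof -
      have "homog (A l) p" using tb by (simp add: L.tangent_basis_def)
      then have h: "homog (f' * A l) (e + p)" by (rule homog_mult[OF hf])
      have "\<not> a dvd f' * A l" using L.a_prime assms(4) l by blast
      then obtain l0' l1' b0' b1' b2' where fr: "line_frame a l0' l1' b0' b1' b2'" "eval3 (f' * A l) b1' \<noteq> 0"
        using frame_avoiding[OF assms(3) h] by blast
      then have ev: "eval3 f' b1' \<noteq> 0" "eval3 (A l) b1' \<noteq> 0"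
        by (simp_all add: rh_mult[OF ringhom_eval3])
      interpret M: adding_line f' e a l0' l1' b0' b1' b2' by (rule line[OF fr(1) ev(1)])
      have "M.tangent_basis A p B q" using tb unfolding L.tangent_basis_def M.tangent_basis_def .
      from M.free_cases[OF this ev(2)] show ?thesis unfolding lev N_def[symmetric] .
    qed
    \<comment> \<open>If every component of A is divisible by a, the two basis elements are
      exchanged.\<close>
    obtain l where "\<not> a dvd A l \<or> \<not> a dvd B l" using L.tangent_basis_not_dvd[OF tb] by blast
    then show ?thesis
      using main[OF tb] main[OF L.tangent_basis_swap[OF tb]] unfolding pq by blast
  qed
  show ?thesis
    unfolding lev N_def[symmetric]
    using fwd bwd[of d2 d3] bwd[of d3 d2] free_exps_commute by auto
qed

end
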